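(* Let $G$ be a countable group which acts coarsely discontinuously by coarse equivalences on a discrete bounded geometry metric space $X$. Let $\alpha$ be the action of $G$ on $C^\ast_{\max}(X)/\mathcal{K}$ given by $g\cdot[T]=[M_gTM_g^\ast]$. Then there is a canonical $\ast$-isomorphism $$\left(C^\ast_{\max}(X)/\mathcal{K}\right)\rtimes_\alpha G\;\cong\; C^\ast_{\max}(X_G)/\mathcal{K},$$ where $\rtimes_\alpha$ denotes the full crossed product.
   Context: Large scale structures. For families of subsets of $X$, $\mathrm{st}(\mathcal{B},\mathcal{U})=\{\mathrm{st}(B,\mathcal{U})\mid B\in\mathcal{B}\}$, where $\mathrm{st}(B,\mathcal{U})$ is the union of the elements of $\mathcal{U}$ that intersect $B$. A large scale structure on a set $X$ is a nonempty set of families of subsets of $X$ (the uniformly bounded families) such that (1) if $\mathcal{B}_1$ is uniformly bounded and each element of $\mathcal{B}_2$ with more than one point is contained in some element of $\mathcal{B}_1$, then $\mathcal{B}_2$ is uniformly bounded; (2) $\mathrm{st}(\mathcal{B}_1,\mathcal{B}_2)$ is uniformly bounded whenever $\mathcal{B}_1,\mathcal{B}_2$ are. A metric $d$ induces the large scale structure whose uniformly bounded families are those $\mathcal{U}$ with $\sup_{U\in\mathcal{U}}\mathrm{diam}(U)<\infty$. Actions. A group $G$ acts on a metric space $X$ by coarse equivalences if it acts on the underlying set and for every $g\in G$ and $R>0$ there is $S>0$ with $d(x,y)\le R\Rightarrow d(gx,gy)\le S$. The action is coarsely discontinuous if for each $g\in G\setminus\{e\}$ and $R>0$ there is a bounded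 set $K$ such that $d(x,g\cdot x)\geq R$ for all $x\notin K$. $X_G$ denotes the set $X$ with the smallest large scale structure containing that of $X$ and all families $\{\{x,gx\}\mid x\in X\}$, $g\in G$. When $G$ is countable and $X$ is a discrete bounded geometry metric space, the large scale structure of $X_G$ is induced by a discrete metric, which has bounded geometry; fix any such metric on $X_G$ (the algebras below do not depend on the choice). A metric space has bounded geometry if for every $R>0$ there is an integer $N$ such that every $R$-ball has at most $N$ elements. Roe algebras. Fix a separable infinite-dimensional Hilbert space $H$. For a discrete bounded geometry metric space $Y$, operators $T$ on $\ell^2(Y)\otimes H$ are viewed as matrices $(T_{x,y})_{x,y\in Y}$ of operators on $H$. $C[Y]$ is the $\ast$-algebra of bounded operators $T$ on $\ell^2(Y)\otimes H$ such that every $T_{x,y}$ is compact and there is $R>0$ with $T_{x,y}=0$ whenever $d(x,y)\ge R$. The maximal Roe algebra $C^\ast_{\max}(Y)$ is the completion of $C[Y]$ in the norm $\|T\|=\sup_{(\phi,H_\phi)}\|\phi(T)\|_{B(H_\phi)}$, the supremum over all $\ast$-representations $\phi$ of $C[Y]$ on Hilbert spaces $H_\phi$ (this is finite). $C[Y]$ contains all the rank one operators $\delta_z\otimes u\mapsto\langle\delta_y\otimes w,\delta_z\otimes u\rangle\,\delta_x\otimes v$ ($x,y\in Y$, $v,w\in H$), and so $C^\ast_{\max}(Y)$ contains a closed two-sided ideal (the closed span of these) canonically isomorphic to the compact operators on $\ell^2(Y)\otimes H$; this ideal is denoted $\mathcal{K}$. For $g\in G$, $M_g$ is the operator on $\ell^2(X)\otimes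 H$ with matrix entries $(M_g)_{x,y}=1_H$ if $gy=x$ and $0$ otherwise. Conjugation $T\mapsto M_gTM_g^\ast$ defines an action of $G$ on $C[X]$, which extends to $C^\ast_{\max}(X)$, preserves $\mathcal{K}$, and so induces $\alpha$ on $C^\ast_{\max}(X)/\mathcal{K}$. *)

theory Defs
  imports "HOL-Analysis.Analysis" "HOL-Algebra.Module" "HOL-Algebra.QuotRing" "HOL-Algebra.Group_Action"
begin

section \<open>Complex Hilbert spaces and bounded operators\<close>

text \<open>The inner product is conjugate linear in the first argument.\<close>

class chilbert_space = banach +
  fixes scaleC :: "complex \<Rightarrow> 'a \<Rightarrow> 'a" (infixr "*\<^sub>C" 75)
    and cinner :: "'a \<Rightarrow> 'a \<Rightarrow> complex"
  assumes scaleC_add_right: "c *\<^sub>C (x + y) = c *\<^sub>C x + c *\<^sub>C y"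
    and scaleC_add_left: "(b + c) *\<^sub>C x = b *\<^sub>C x + c *\<^sub>C x"
    and scaleC_scaleC: "b *\<^sub>C (c *\<^sub>C x) = (b * c) *\<^sub>C x"
    and scaleR_scaleC: "r *\<^sub>R x = complex_of_real r *\<^sub>C x"
    and cinner_commute: "cinner x y = cnj (cinner y x)"
    and cinner_add_right: "cinner x (y + z) = cinner x y + cinner x z"
    and cinner_scaleC_right: "cinner x (c *\<^sub>C y) = c * cinner x y"
    and cinner_self: "cinner x x = complex_of_real ((norm x)\<^sup>2)"

lemma scaleC_one [simp]: "1 *\<^sub>C x = (x::'a::chilbert_space)"
  using scaleR_scaleC[of 1 x] by simp

global_interpretation cvs: vector_space "scaleC :: complex \<Rightarrow> 'a \<Rightarrow> 'a::chilbert_space"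
  by unfold_locales (simp_all add: scaleC_add_right scaleC_add_left scaleC_scaleC)

instantiation complex :: chilbert_space
begin
definition scaleC_complex :: "complex \<Rightarrow> complex \<Rightarrow> complex" where "scaleC_complex c x = c * x"
definition cinner_complex :: "complex \<Rightarrow> complex \<Rightarrow> complex" where "cinner_complex x y = cnj x * y"
instance
  by standard (auto simp: scaleC_complex_def cinner_complex_def algebra_simps scaleR_conv_of_real
      complex_norm_square simp del: of_real_power)
end

lemma norm_scaleC [simp]: "norm (c *\<^sub>C x) = cmod c * norm (x::'a::chilbert_space)"
proof -
  have "cinner (c *\<^sub>C x) (c *\<^sub>C x) = c * cinner (c *\<^sub>C x) x" by (simp add: cinner_scaleC_right)
  also have "cinner (c *\<^sub>C x) x = cnj c * cinner x x"
    by (subst cinner_commute) (simp add: cinner_scaleC_right cinner_commute[of x x, symmetric])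
  finally have "complex_of_real ((norm (c *\<^sub>C x))\<^sup>2) = complex_of_real ((cmod c)\<^sup>2 * (norm x)\<^sup>2)"
    by (simp add: cinner_self complex_norm_square del: of_real_power) 
  then have "(norm (c *\<^sub>C x))\<^sup>2 = (cmod c * norm x)\<^sup>2"
    unfolding of_real_eq_iff power_mult_distrib .
  then show ?thesis by (simp add: power2_eq_iff_nonneg)
qed

lemma cinner_add_left: "cinner (x + y) z = cinner x z + cinner y (z::'a::chilbert_space)"
  by (metis cinner_add_right cinner_commute complex_cnj_add)

lemma cinner_scaleC_left: "cinner (c *\<^sub>C x) y = cnj c * cinner x (y::'a::chilbert_space)"
  by (metis cinner_scaleC_right cinner_commute complex_cnj_mult)

lemma Cauchy_Schwarz_cinner: "cmod (cinner x y) \<le> norm x * norm (y::'a::chilbert_space)"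
proof (cases "x = 0")
  case True
  have "cinner 0 y = 0"
    by (metis add_cancel_right_left cinner_add_left)
  then show ?thesis using True by simp
next
  case False
  define a where "a = cinner x y"
  define n where "n = (norm x)\<^sup>2"
  have n: "n > 0" using False by (simp add: n_def)
  define z where "z = complex_of_real n *\<^sub>C y + (- a) *\<^sub>C x"
  have yx: "cinner y x = cnj a" unfolding a_def by (rule cinner_commute)
  have nC: "cinner (- a *\<^sub>C x) w = - cnj a * cinner x w" for w by (simp only: cinner_scaleC_left complex_cnj_minus)
  have nC': "cinner w (- a *\<^sub>C x) = - a * cinner w x" for w by (simp only: cinner_scaleC_right)
  have "cinner z z = complex_of_real n * (complex_of_real n * complex_of_real ((norm y)\<^sup>2)) 
      - a * cnj a * complex_of_real n"
    unfolding z_def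
    by (simp add: cinner_add_left cinner_add_right nC nC' cinner_scaleC_left cinner_scaleC_right
        cinner_self[of x] cinner_self[of y] a_def[symmetric] n_def[symmetric] yx algebra_simps
        del: of_real_power cvs.scale_minus_left)
  also have "\<dots> = complex_of_real (n * (n * (norm y)\<^sup>2 - (cmod a)\<^sup>2))"
    by (simp add: complex_norm_square[symmetric] algebra_simps)
  finally have "complex_of_real ((norm z)\<^sup>2) = complex_of_real (n * (n * (norm y)\<^sup>2 - (cmod a)\<^sup>2))"
    by (simp add: cinner_self)
  then have "(norm z)\<^sup>2 = n * (n * (norm y)\<^sup>2 - (cmod a)\<^sup>2)"
    unfolding of_real_eq_iff .
  then have "0 \<le> n * (norm y)\<^sup>2 - (cmod a)\<^sup>2"
    using n by (metis zero_le_power2 zero_le_mult_iff not_le order_less_imp_le)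
  then have "(cmod a)\<^sup>2 \<le> (norm x * norm y)\<^sup>2"
    by (simp add: n_def power_mult_distrib)
  then show ?thesis unfolding a_def
    by (meson norm_ge_zero power2_le_imp_le mult_nonneg_nonneg)
qed

lemma cinner_zero [simp]: "cinner 0 y = 0" "cinner y (0::'a::chilbert_space) = 0"
  using cinner_scaleC_left[of 0 y y] cinner_scaleC_right[of y 0 y] by simp_all

lemma cinner_minus_left: "cinner (- x) (z::'a::chilbert_space) = - cinner x z"
  using cinner_add_left[of x "- x" z] by (simp add: eq_neg_iff_add_eq_0 add.commute)

lemma cinner_minus_right: "cinner z (- x::'a::chilbert_space) = - cinner z x"
  using cinner_add_right[of z x "- x"] by (simp add: eq_neg_iff_add_eq_0 add.commute)

lemma cinner_diff_left: "cinner (x - y) (z::'a::chilbert_space) = cinner x z - cinner y z"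
  using cinner_add_left[of x "- y" z] by (simp add: cinner_minus_left)

lemma cinner_diff_right: "cinner z (x - y::'a::chilbert_space) = cinner z x - cinner z y"
  using cinner_add_right[of z x "- y"] by (simp add: cinner_minus_right)

lemma cinner_sum_left: "cinner (sum f F) (z::'a::chilbert_space) = (\<Sum>i\<in>F. cinner (f i) z)"
  by (induction F rule: infinite_finite_induct) (auto simp: cinner_add_left)

lemma cinner_sum_right: "cinner (z::'a::chilbert_space) (sum f F) = (\<Sum>i\<in>F. cinner z (f i))"
  by (induction F rule: infinite_finite_induct) (auto simp: cinner_add_right)

lemma cinner_eq_0_commute: "cinner x y = 0 \<longleftrightarrow> cinner y (x::'a::chilbert_space) = 0"
  by (metis cinner_commute complex_cnj_zero)

lemma cinner_self_eq_0: "cinner x x = 0 \<longleftrightarrow> (x::'a::chilbert_space) = 0"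
  by (simp add: cinner_self)

lemma cinner_ext: "(\<And>w. cinner x w = cinner y w) \<Longrightarrow> x = (y::'a::chilbert_space)"
  using cinner_self_eq_0[of "x - y"] by (simp add: cinner_diff_left)

lemma norm_add_sq:
  "(norm (x + y))\<^sup>2 = (norm x)\<^sup>2 + (norm y)\<^sup>2 + 2 * Re (cinner x (y::'a::chilbert_space))"
proof -
  have "complex_of_real ((norm (x + y))\<^sup>2) = cinner x x + cinner y y + (cinner x y + cnj (cinner x y))"
    unfolding cinner_self[symmetric] using cinner_commute[of y x]
    by (simp add: cinner_add_left cinner_add_right)
  also have "\<dots> = complex_of_real ((norm x)\<^sup>2 + (norm y)\<^sup>2 + 2 * Re (cinner x y))"
    by (simp add: cinner_self complex_add_cnj)
  finally show ?thesis unfolding of_real_eq_iff .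
qed

lemma norm_diff_sq:
  "(norm (x - y))\<^sup>2 = (norm x)\<^sup>2 + (norm y)\<^sup>2 - 2 * Re (cinner x (y::'a::chilbert_space))"
  using norm_add_sq[of x "- y"] by (simp add: cinner_minus_right)

lemma bounded_linear_scaleC: "bounded_linear (\<lambda>x::'a::chilbert_space. c *\<^sub>C x)"
  by (rule bounded_linear_intro[where K = "cmod c"])
    (simp_all add: scaleC_add_right scaleR_scaleC scaleC_scaleC mult.commute)

lemma bounded_linear_cinner: "bounded_linear (\<lambda>y::'a::chilbert_space. cinner x y)"
proof (rule bounded_linear_intro[where K = "norm x"])
  show "norm (cinner x y) \<le> norm y * norm x" for y
    using Cauchy_Schwarz_cinner[of x y] by (simp add: mult.commute)
qed (simp_all add: cinner_add_right scaleR_scaleC cinner_scaleC_right scaleC_complex_def)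

lemma subspace_closure:
  assumes "cvs.subspace (V::'a::chilbert_space set)"
  shows "cvs.subspace (closure V)"
proof (rule cvs.subspaceI)
  show "0 \<in> closure V" using cvs.subspace_0[OF assms] closure_subset by blast
  show "x + y \<in> closure V" if xy: "x \<in> closure V" "y \<in> closure V" for x y
  proof -
    obtain f g where "\<And>n. f n \<in> V" "f \<longlonglongrightarrow> x" "\<And>n. g n \<in> V" "g \<longlonglongrightarrow> y"
      using xy unfolding closure_sequential by metis
    then show ?thesis unfolding closure_sequential
      by (intro exI[of _ "\<lambda>n. f n + g n"]) (auto intro: tendsto_add cvs.subspace_add[OF assms])
  qed
  show "c *\<^sub>C x \<in> closure V" if x: "x \<in> closure V" for c x
  proof -
    obtain f where "\<And>n. f n \<in> V" "f \<longlonglongrightarrow> x"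
      using x unfolding closure_sequential by metis
    then show ?thesis unfolding closure_sequential
      by (intro exI[of _ "\<lambda>n. c *\<^sub>C f n"])
        (auto intro: bounded_linear.tendsto[OF bounded_linear_scaleC] cvs.subspace_scale[OF assms])
  qed
qed

lemma projection_exists:
  fixes V :: "'a::chilbert_space set"
  assumes V: "cvs.subspace V" and cl: "closed V"
  obtains p where "p \<in> V" "\<And>w. w \<in> V \<Longrightarrow> cinner w (v - p) = 0"
proof -
  have ne: "V \<noteq> {}" using cvs.subspace_0[OF V] by blast
  define D where "D = infdist v V"
  have D0: "0 \<le> D" by (simp add: D_def infdist_nonneg)
  have DV: "D \<le> norm (v - w)" if "w \<in> V" for w
    using infdist_le[OF that, of v] by (simp add: D_def dist_norm)
  have "\<exists>w\<in>V. norm (v - w) < D + e" if "e > 0" for e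
  proof (rule ccontr)
    assume "\<not> ?thesis"
    then have "D + e \<le> (INF w\<in>V. dist v w)"
      using ne by (intro cINF_greatest) (auto simp: dist_norm not_less)
    then show False using ne that by (simp add: D_def infdist_notempty)
  qed
  then have "\<exists>w\<in>V. norm (v - w) < D + 1 / Suc n" for n by simp
  then obtain s where sV: "\<And>n. s n \<in> V" and s: "\<And>n. norm (v - s n) < D + 1 / Suc n" by metis
  have lim: "(\<lambda>n. norm (v - s n)) \<longlonglongrightarrow> D"
  proof (rule tendsto_sandwich[where f = "\<lambda>_. D" and h = "\<lambda>n. D + 1 / real (Suc n)"])
    show "(\<lambda>n. D + 1 / real (Suc n)) \<longlonglongrightarrow> D"
      using tendsto_add[OF tendsto_const[of D] LIMSEQ_Suc[OF lim_1_over_n]] by simp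
    show "(\<lambda>n. D) \<longlonglongrightarrow> D" by simp
    show "\<forall>\<^sub>F n in sequentially. D \<le> norm (v - s n)"
      using DV[OF sV] by simp
    show "\<forall>\<^sub>F n in sequentially. norm (v - s n) \<le> D + 1 / real (Suc n)"
      using s by (intro always_eventually allI less_imp_le)
  qed
  have par: "(norm (s m - s n))\<^sup>2 \<le> 2 * (norm (v - s m))\<^sup>2 + 2 * (norm (v - s n))\<^sup>2 - 4 * D\<^sup>2" for m n
  proof -
    define x where "x = v - s m"
    define y where "y = v - s n"
    have "(1/2) *\<^sub>C (s m + s n) \<in> V"
      using sV by (intro cvs.subspace_scale[OF V] cvs.subspace_add[OF V])
    from DV[OF this] have "2 * D \<le> norm (2 *\<^sub>C (v - (1/2) *\<^sub>C (s m + s n)))" by simp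
    also have "2 *\<^sub>C (v - (1/2) *\<^sub>C (s m + s n)) = x + y"
    proof -
      have "2 *\<^sub>C v = v + v" using scaleC_add_left[of 1 1 v] by simp
      then show ?thesis by (simp add: x_def y_def cvs.scale_right_diff_distrib scaleC_scaleC)
    qed
    finally have "(2 * D)\<^sup>2 \<le> (norm (x + y))\<^sup>2"
      using D0 by (intro power_mono) auto
    moreover have "s m - s n = y - x" by (simp add: x_def y_def)
    moreover have "cinner x y = cnj (cinner y x)" by (rule cinner_commute)
    ultimately show ?thesis
      using norm_add_sq[of x y] norm_diff_sq[of y x]
      by (simp add: x_def[symmetric] y_def[symmetric] power_mult_distrib)
  qed
  have "Cauchy s"
  proof (rule CauchyI)
    fix e :: real assume e: "0 < e"
    have "(\<lambda>n. (norm (v - s n))\<^sup>2) \<longlonglongrightarrow> D\<^sup>2" by (intro tendsto_power lim)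
    from LIMSEQ_D[OF this, of "e\<^sup>2 / 4"] e obtain N
      where N: "\<And>n. n \<ge> N \<Longrightarrow> norm ((norm (v - s n))\<^sup>2 - D\<^sup>2) < e\<^sup>2 / 4" by auto
    have "norm (s m - s n) < e" if "m \<ge> N" "n \<ge> N" for m n
    proof -
      have "(norm (s m - s n))\<^sup>2 < e\<^sup>2"
        using par[of m n] N[OF that(1)] N[OF that(2)] unfolding real_norm_def by linarith
      then show ?thesis using e by (simp add: power2_less_imp_less)
    qed
    then show "\<exists>M. \<forall>m\<ge>M. \<forall>n\<ge>M. norm (s m - s n) < e" by blast
  qed
  then obtain p where p: "s \<longlonglongrightarrow> p" unfolding Cauchy_convergent_iff convergent_def by blast
  have pV: "p \<in> V" using closed_sequentially[OF cl _ p] sV by blast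
  have "(\<lambda>n. norm (v - s n)) \<longlonglongrightarrow> norm (v - p)" by (intro tendsto_intros p)
  then have normp: "norm (v - p) = D" using lim LIMSEQ_unique by blast
  have "cinner w (v - p) = 0" if w: "w \<in> V" for w
  proof (cases "w = 0")
    case False
    define u where "u = v - p"
    define t where "t = cinner w u / complex_of_real ((norm w)\<^sup>2)"
    have "p + t *\<^sub>C w \<in> V"
      using pV w by (intro cvs.subspace_add[OF V] cvs.subspace_scale[OF V])
    from DV[OF this] have "norm u \<le> norm (u - t *\<^sub>C w)"
      by (simp add: u_def normp diff_diff_eq)
    then have "(norm u)\<^sup>2 \<le> (norm (u - t *\<^sub>C w))\<^sup>2" by (intro power_mono) auto
    also have "\<dots> = (norm u)\<^sup>2 + (cmod t * norm w)\<^sup>2 - 2 * Re (t * cinner u w)"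
      by (simp add: norm_diff_sq cinner_scaleC_right)
    also have "t * cinner u w = complex_of_real ((cmod (cinner w u))\<^sup>2 / (norm w)\<^sup>2)"
      using cinner_commute[of u w] by (simp add: t_def complex_norm_square[symmetric] flip: of_real_power)
    also have "cmod t * norm w = cmod (cinner w u) / norm w"
      using False by (simp add: t_def norm_divide norm_mult power2_eq_square)
    finally have "(cmod (cinner w u))\<^sup>2 / (norm w)\<^sup>2 \<le> 0"
      by (simp add: power_divide)
    then have "(cmod (cinner w u))\<^sup>2 \<le> 0" using False by (simp add: divide_le_0_iff)
    then show ?thesis by (simp add: u_def)
  qed simp
  with pV show ?thesis by (rule that)
qed

definition bounded_clinear :: "('a::chilbert_space \<Rightarrow> 'b::chilbert_space) \<Rightarrow> bool" where
  "bounded_clinear T \<longleftrightarrow> bounded_linear T \<and> (\<forall>c v. T (c *\<^sub>C v) = c *\<^sub>C T v)"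

lemma bounded_clinearI:
  assumes "\<And>x y. T (x + y) = T x + T y" "\<And>c x. T (c *\<^sub>C x) = c *\<^sub>C T x" "\<And>x. norm (T x) \<le> norm x * K"
  shows "bounded_clinear T"
  unfolding bounded_clinear_def
  using assms by (auto intro!: bounded_linear_intro[where K = K] simp: scaleR_scaleC)

lemma bounded_clinear_compose:
  "bounded_clinear S \<Longrightarrow> bounded_clinear T \<Longrightarrow> bounded_clinear (\<lambda>x. S (T x))"
  unfolding bounded_clinear_def by (auto intro: bounded_linear_compose)

definition cadjoint :: "('a::chilbert_space \<Rightarrow> 'b::chilbert_space) \<Rightarrow> 'b \<Rightarrow> 'a" where
  "cadjoint T = (THE S. \<forall>v w. cinner (S v) w = cinner v (T w))"

lemma cadjoint_eqI:
  assumes "\<And>v w. cinner (S v) w = cinner v (T w)"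
  shows "cadjoint T = S"
  unfolding cadjoint_def
proof (rule the_equality)
  show "\<forall>v w. cinner (S v) w = cinner v (T w)" using assms by blast
  show "S' = S" if "\<forall>v w. cinner (S' v) w = cinner v (T w)" for S'
  proof
    show "S' v = S v" for v by (rule cinner_ext) (simp add: that assms)
  qed
qed

lemma cinner_cadjoint:
  fixes T :: "'a::chilbert_space \<Rightarrow> 'b::chilbert_space"
  assumes T: "bounded_clinear T"
  shows "cinner (cadjoint T v) w = cinner v (T w)"
proof -
  interpret T: bounded_linear T using T by (simp add: bounded_clinear_def)
  have TC: "T (c *\<^sub>C x) = c *\<^sub>C T x" for c x using T by (simp add: bounded_clinear_def)
  have "\<exists>u. \<forall>w. cinner u w = cinner v (T w)" for v
  proof (cases "\<forall>w. cinner v (T w) = 0")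
    case True
    then show ?thesis by (intro exI[of _ 0]) simp
  next
    case False
    define f where "f w = cinner v (T w)" for w
    have blf: "bounded_linear f"
      unfolding f_def by (intro bounded_linear_compose[OF bounded_linear_cinner] T.bounded_linear_axioms)
    interpret f: bounded_linear f by (rule blf)
    have fC: "f (c *\<^sub>C x) = c * f x" for c x by (simp add: f_def TC cinner_scaleC_right)
    obtain u where u: "f u \<noteq> 0" using False by (auto simp: f_def)
    define N where "N = {w. f w = 0}"
    have "closed N" unfolding N_def
      by (intro closed_Collect_eq continuous_intros linear_continuous_on blf)
    moreover have "cvs.subspace N"
      by (rule cvs.subspaceI) (auto simp: N_def f.add fC f.zero)
    ultimately obtain p where p: "p \<in> N" "\<And>w. w \<in> N \<Longrightarrow> cinner w (u - p) = 0"
      using projection_exists by metis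
    define z where "z = u - p"
    have fz: "f z \<noteq> 0" using u p(1) by (simp add: z_def f.diff N_def)
    then have z0: "z \<noteq> 0" by (auto simp: f.zero)
    have "cinner ((cnj (f z) / complex_of_real ((norm z)\<^sup>2)) *\<^sub>C z) w = f w" for w
    proof -
      have "w - (f w / f z) *\<^sub>C z \<in> N" using fz by (simp add: N_def f.diff fC)
      from p(2)[OF this] have "cinner (w - (f w / f z) *\<^sub>C z) z = 0" by (simp add: z_def)
      then have "cinner z (w - (f w / f z) *\<^sub>C z) = 0" by (simp add: cinner_eq_0_commute)
      then have "cinner z w = f w / f z * complex_of_real ((norm z)\<^sup>2)"
        by (simp add: cinner_diff_right cinner_scaleC_right cinner_self)
      then show ?thesis using fz z0 by (simp add: cinner_scaleC_left)
    qed
    then show ?thesis unfolding f_def by blast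
  qed
  then obtain S where S: "\<And>v w. cinner (S v) w = cinner v (T w)" by metis
  then show ?thesis using cadjoint_eqI[of S T] by simp
qed

lemma bounded_clinear_cadjoint:
  fixes T :: "'a::chilbert_space \<Rightarrow> 'b::chilbert_space"
  assumes T: "bounded_clinear T"
  shows "bounded_clinear (cadjoint T)"
proof -
  interpret T: bounded_linear T using T by (simp add: bounded_clinear_def)
  obtain K where K: "\<And>x. norm (T x) \<le> norm x * K" "0 < K" using T.pos_bounded by blast
  show ?thesis
  proof (rule bounded_clinearI)
    show "cadjoint T (x + y) = cadjoint T x + cadjoint T y" for x y
      by (rule cinner_ext) (simp add: cinner_add_left cinner_cadjoint[OF T])
    show "cadjoint T (c *\<^sub>C x) = c *\<^sub>C cadjoint T x" for c x
      by (rule cinner_ext) (simp add: cinner_scaleC_left cinner_cadjoint[OF T])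
    show "norm (cadjoint T x) \<le> norm x * K" for x
    proof (cases "cadjoint T x = 0")
      case True
      then show ?thesis using K(2) by simp
    next
      case False
      have "(norm (cadjoint T x))\<^sup>2 = cmod (cinner (cadjoint T x) (cadjoint T x))"
        by (simp add: cinner_self norm_power)
      also have "\<dots> \<le> norm x * norm (T (cadjoint T x))"
        by (simp add: cinner_cadjoint[OF T] Cauchy_Schwarz_cinner)
      also have "\<dots> \<le> norm x * (norm (cadjoint T x) * K)"
        by (intro mult_left_mono K) auto
      finally show ?thesis using False by (simp add: power2_eq_square mult.assoc mult.left_commute)
    qed
  qed
qed

definition compact_operator :: "('a::chilbert_space \<Rightarrow> 'b::chilbert_space) \<Rightarrow> bool" where
  "compact_operator T \<longleftrightarrow> bounded_clinear T \<and> compact (closure (T ` cball 0 1))"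

section \<open>The Hilbert space $\ell^2(I) \otimes H$\<close>

text \<open>$\ell^2(I) \otimes H$ is realised as the space of square summable functions from \<open>I\<close> to
  \<open>H\<close>, where \<open>I\<close> is the universe of the first type argument.\<close>

typedef (overloaded) ('i, 'h) ell2 = "{f :: 'i \<Rightarrow> 'h::chilbert_space. (\<lambda>i. (norm (f i))\<^sup>2) summable_on UNIV}"
  by (rule exI[of _ "\<lambda>_. 0"]) simp

setup_lifting type_definition_ell2

lemma square_summable_iff:
  "(\<lambda>i. (norm (f i))\<^sup>2) summable_on UNIV \<longleftrightarrow> (\<exists>C. \<forall>F. finite F \<longrightarrow> L2_set (\<lambda>i. norm (f i)) F \<le> C)"
proof
  assume s: "(\<lambda>i. (norm (f i))\<^sup>2) summable_on UNIV"
  have "(\<Sum>i\<in>F. (norm (f i))\<^sup>2) \<le> infsum (\<lambda>i. (norm (f i))\<^sup>2) UNIV" if "finite F" for F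
    using s that by (intro finite_sum_le_infsum) auto
  then show "\<exists>C. \<forall>F. finite F \<longrightarrow> L2_set (\<lambda>i. norm (f i)) F \<le> C"
    unfolding L2_set_def by (meson real_sqrt_le_mono)
next
  assume "\<exists>C. \<forall>F. finite F \<longrightarrow> L2_set (\<lambda>i. norm (f i)) F \<le> C"
  then obtain C where C: "\<And>F. finite F \<Longrightarrow> L2_set (\<lambda>i. norm (f i)) F \<le> C" by blast
  have "(\<Sum>i\<in>F. (norm (f i))\<^sup>2) \<le> C\<^sup>2" if "finite F" for F
    using C[OF that] unfolding L2_set_def by (rule sqrt_le_D)
  then show "(\<lambda>i. (norm (f i))\<^sup>2) summable_on UNIV"
    by (intro nonneg_bdd_above_summable_on bdd_aboveI2[where M = "C\<^sup>2"]) auto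
qed

lemma L2_set_le_sqrt_infsum:
  assumes "(\<lambda>i. (norm (f i))\<^sup>2) summable_on UNIV" "finite F"
  shows "L2_set (\<lambda>i. norm (f i)) F \<le> sqrt (\<Sum>\<^sub>\<infinity>i. (norm (f i))\<^sup>2)"
  unfolding L2_set_def using assms by (intro real_sqrt_le_mono finite_sum_le_infsum) auto

lemma sqrt_infsum_le:
  assumes C: "\<And>F. finite F \<Longrightarrow> L2_set (\<lambda>i. norm (f i)) F \<le> C"
  shows "sqrt (\<Sum>\<^sub>\<infinity>i. (norm (f i))\<^sup>2) \<le> C"
proof -
  have C0: "0 \<le> C" using C[of "{}"] by simp
  have "(\<Sum>\<^sub>\<infinity>i. (norm (f i))\<^sup>2) \<le> C\<^sup>2"
  proof (rule infsum_le_finite_sums)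
    show "(\<lambda>i. (norm (f i))\<^sup>2) summable_on UNIV"
      using C by (auto simp: square_summable_iff)
    show "(\<Sum>i\<in>F. (norm (f i))\<^sup>2) \<le> C\<^sup>2" if "finite F" for F
      using C[OF that] unfolding L2_set_def by (rule sqrt_le_D)
  qed
  then show ?thesis using C0 by (simp add: real_le_lsqrt)
qed

lemma L2_set_norm_add_le:
  "L2_set (\<lambda>i. norm (f i + g i)) F \<le> L2_set (\<lambda>i. norm (f i)) F + L2_set (\<lambda>i. norm (g i)) F"
  by (rule order_trans[OF L2_set_mono L2_set_triangle_ineq]) (auto intro: norm_triangle_ineq)

lemma square_summable_add:
  assumes "(\<lambda>i. (norm (f i))\<^sup>2) summable_on UNIV" "(\<lambda>i. (norm (g i))\<^sup>2) summable_on UNIV"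
  shows "(\<lambda>i. (norm (f i + g i))\<^sup>2) summable_on UNIV"
proof -
  obtain C D where C: "\<And>F. finite F \<Longrightarrow> L2_set (\<lambda>i. norm (f i)) F \<le> C"
    and D: "\<And>F. finite F \<Longrightarrow> L2_set (\<lambda>i. norm (g i)) F \<le> D"
    using assms unfolding square_summable_iff by blast
  have "L2_set (\<lambda>i. norm (f i + g i)) F \<le> C + D" if "finite F" for F
    using L2_set_norm_add_le[of f g F] C[OF that] D[OF that] by linarith
  then show ?thesis unfolding square_summable_iff by blast
qed

lemma square_summable_scaleC:
  assumes "(\<lambda>i. (norm (f i))\<^sup>2) summable_on UNIV"
  shows "(\<lambda>i. (norm (c *\<^sub>C f i))\<^sup>2) summable_on UNIV"
  using assms by (simp add: power_mult_distrib summable_on_cmult_right)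

lemma square_summable_cinner:
  assumes "(\<lambda>i. (norm (f i))\<^sup>2) summable_on UNIV" "(\<lambda>i. (norm (g i))\<^sup>2) summable_on UNIV"
  shows "(\<lambda>i. cinner (f i) (g i)) summable_on UNIV"
proof (rule abs_summable_summable[OF summable_on_comparison_test])
  show "(\<lambda>i. (norm (f i))\<^sup>2 + (norm (g i))\<^sup>2) summable_on UNIV"
    using assms by (rule summable_on_add)
  show "cmod (cinner (f i) (g i)) \<le> (norm (f i))\<^sup>2 + (norm (g i))\<^sup>2" for i
  proof -
    have "2 * (norm (f i) * norm (g i)) \<le> (norm (f i))\<^sup>2 + (norm (g i))\<^sup>2"
      using sum_squares_bound[of "norm (f i)" "norm (g i)"] by simp
    moreover have "0 \<le> norm (f i) * norm (g i)" by simp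
    ultimately show ?thesis using Cauchy_Schwarz_cinner[of "f i" "g i"] by linarith
  qed
qed auto

instantiation ell2 :: (type, chilbert_space) real_normed_vector
begin
lift_definition zero_ell2 :: "('a, 'b) ell2" is "\<lambda>_. 0" by simp
lift_definition plus_ell2 :: "('a, 'b) ell2 \<Rightarrow> ('a, 'b) ell2 \<Rightarrow> ('a, 'b) ell2"
  is "\<lambda>f g i. f i + g i" by (rule square_summable_add)
lift_definition uminus_ell2 :: "('a, 'b) ell2 \<Rightarrow> ('a, 'b) ell2" is "\<lambda>f i. - f i" by simp
lift_definition minus_ell2 :: "('a, 'b) ell2 \<Rightarrow> ('a, 'b) ell2 \<Rightarrow> ('a, 'b) ell2"
  is "\<lambda>f g i. f i - g i"
  using square_summable_add[of _ "\<lambda>i. - g i" for g] by fastforce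
lift_definition scaleR_ell2 :: "real \<Rightarrow> ('a, 'b) ell2 \<Rightarrow> ('a, 'b) ell2" is "\<lambda>r f i. r *\<^sub>R f i"
  by (simp add: power_mult_distrib summable_on_cmult_right)
lift_definition norm_ell2 :: "('a, 'b) ell2 \<Rightarrow> real" is "\<lambda>f. sqrt (\<Sum>\<^sub>\<infinity>i. (norm (f i))\<^sup>2)" .
definition dist_ell2 :: "('a, 'b) ell2 \<Rightarrow> ('a, 'b) ell2 \<Rightarrow> real" where "dist_ell2 f g = norm (f - g)"
definition sgn_ell2 :: "('a, 'b) ell2 \<Rightarrow> ('a, 'b) ell2" where "sgn_ell2 f = scaleR (inverse (norm f)) f"
definition uniformity_ell2 :: "(('a, 'b) ell2 \<times> ('a, 'b) ell2) filter" where
  "uniformity_ell2 = (INF e\<in>{0<..}. principal {(f, g). dist f g < e})"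
definition open_ell2 :: "('a, 'b) ell2 set \<Rightarrow> bool" where
  "open_ell2 U \<longleftrightarrow> (\<forall>x\<in>U. \<forall>\<^sub>F (x', y) in uniformity. x' = x \<longrightarrow> y \<in> U)"

instance
proof
  fix f g h :: "('a, 'b) ell2" and a b :: real
  show "f + g + h = f + (g + h)" by transfer (simp add: add.assoc)
  show "f + g = g + f" by transfer (simp add: add.commute)
  show "0 + f = f" by transfer simp
  show "- f + f = 0" by transfer simp
  show "f - g = f + - g" by transfer simp
  show "a *\<^sub>R (f + g) = a *\<^sub>R f + a *\<^sub>R g" by transfer (simp add: scaleR_add_right)
  show "(a + b) *\<^sub>R f = a *\<^sub>R f + b *\<^sub>R f" by transfer (simp add: scaleR_add_left)
  show "a *\<^sub>R b *\<^sub>R f = (a * b) *\<^sub>R f" by transfer simp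
  show "1 *\<^sub>R f = f" by transfer simp
  show "dist f g = norm (f - g)" by (rule dist_ell2_def)
  show "sgn f = scaleR (inverse (norm f)) f" unfolding sgn_ell2_def ..
  show "uniformity = (INF e\<in>{0<..}. principal {(x, y::('a, 'b) ell2). dist x y < e})"
    by (rule uniformity_ell2_def)
  show "open U \<longleftrightarrow> (\<forall>x\<in>U. \<forall>\<^sub>F (x', y) in uniformity. x' = x \<longrightarrow> y \<in> U)" for U :: "('a, 'b) ell2 set"
    by (rule open_ell2_def)
  show "norm f = 0 \<longleftrightarrow> f = 0"
  proof (transfer, rule iffI)
    fix f :: "'a \<Rightarrow> 'b"
    assume s: "(\<lambda>i. (norm (f i))\<^sup>2) summable_on UNIV" and z: "sqrt (\<Sum>\<^sub>\<infinity>i. (norm (f i))\<^sup>2) = 0"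
    have "norm (f i) \<le> 0" for i
      using L2_set_le_sqrt_infsum[OF s, of "{i}"] z by simp
    then show "f = (\<lambda>_. 0)" by auto
  qed simp
  show "norm (f + g) \<le> norm f + norm g"
  proof (transfer, rule sqrt_infsum_le)
    fix f g :: "'a \<Rightarrow> 'b" and F :: "'a set"
    assume "(\<lambda>i. (norm (f i))\<^sup>2) summable_on UNIV" "(\<lambda>i. (norm (g i))\<^sup>2) summable_on UNIV" "finite F"
    then show "L2_set (\<lambda>i. norm (f i + g i)) F
      \<le> sqrt (\<Sum>\<^sub>\<infinity>i. (norm (f i))\<^sup>2) + sqrt (\<Sum>\<^sub>\<infinity>i. (norm (g i))\<^sup>2)"
      by (intro order_trans[OF L2_set_norm_add_le] add_mono L2_set_le_sqrt_infsum)
  qed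
  show "norm (a *\<^sub>R f) = \<bar>a\<bar> * norm f"
    by transfer (simp add: power_mult_distrib infsum_cmult_right' real_sqrt_mult)
qed
end

instance ell2 :: (type, chilbert_space) banach
proof
  fix s :: "nat \<Rightarrow> ('a, 'b) ell2"
  assume s: "Cauchy s"
  define f where "f n = Rep_ell2 (s n)" for n
  have f: "(\<lambda>i. (norm (f n i))\<^sup>2) summable_on UNIV" for n
    using Rep_ell2[of "s n"] by (simp add: f_def)
  have diff: "L2_set (\<lambda>i. norm (f m i - f n i)) F \<le> norm (s m - s n)" if "finite F" for m n F
  proof -
    have "(\<lambda>i. (norm (f m i - f n i))\<^sup>2) summable_on UNIV"
      using Rep_ell2[of "s m - s n"] by (simp add: f_def minus_ell2.rep_eq)
    from L2_set_le_sqrt_infsum[OF this that] show ?thesis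
      by (simp add: norm_ell2.rep_eq minus_ell2.rep_eq f_def)
  qed
  have pt: "norm (f m i - f n i) \<le> norm (s m - s n)" for m n i
    using diff[of "{i}" m n] by simp
  have "Cauchy (\<lambda>n. f n i)" for i
  proof (rule CauchyI)
    fix e :: real assume "0 < e"
    then obtain M where "\<forall>m\<ge>M. \<forall>n\<ge>M. norm (s m - s n) < e" using CauchyD[OF s] by blast
    then show "\<exists>M. \<forall>m\<ge>M. \<forall>n\<ge>M. norm (f m i - f n i) < e"
      using pt by (meson le_less_trans)
  qed
  then have "convergent (\<lambda>n. f n i)" for i
    by (rule Cauchy_convergent)
  then have l: "(\<lambda>n. f n i) \<longlonglongrightarrow> lim (\<lambda>n. f n i)" for i
    unfolding convergent_LIMSEQ_iff .
  define l where "l i = lim (\<lambda>n. f n i)" for i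
  note l = l[folded l_def]
  have lim: "L2_set (\<lambda>i. norm (f n i - l i)) F \<le> e"
    if F: "finite F" and M: "\<forall>m\<ge>M. norm (s n - s m) < e" for n F M e
  proof (rule tendsto_upperbound)
    show "(\<lambda>m. L2_set (\<lambda>i. norm (f n i - f m i)) F) \<longlonglongrightarrow> L2_set (\<lambda>i. norm (f n i - l i)) F"
      unfolding L2_set_def by (intro tendsto_intros l)
    show "\<forall>\<^sub>F m in sequentially. L2_set (\<lambda>i. norm (f n i - f m i)) F \<le> e"
      unfolding eventually_sequentially
    proof (intro exI[of _ M] allI impI)
      fix m assume "M \<le> m"
      with M have "norm (s n - s m) < e" by blast
      with diff[OF F, of n m] show "L2_set (\<lambda>i. norm (f n i - f m i)) F \<le> e" by linarith
    qed
  qed simp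
  obtain M where M: "\<forall>m\<ge>M. \<forall>n\<ge>M. norm (s m - s n) < 1" using CauchyD[OF s, of 1] by auto
  have "(\<lambda>i. (norm (f M i - l i))\<^sup>2) summable_on UNIV"
    unfolding square_summable_iff using M by (intro exI[of _ 1] allI impI lim[of _ M M 1]) auto
  then have "(\<lambda>i. (norm (- (f M i - l i)))\<^sup>2) summable_on UNIV"
    by (simp only: norm_minus_cancel)
  from square_summable_add[OF f[of M] this]
  have ls: "(\<lambda>i. (norm (l i))\<^sup>2) summable_on UNIV" by simp
  define L where "L = Abs_ell2 l"
  have L: "Rep_ell2 L = l" unfolding L_def using ls by (simp add: Abs_ell2_inverse)
  have "s \<longlonglongrightarrow> L"
  proof (rule LIMSEQ_I)
    fix e :: real assume e: "0 < e"
    then obtain M where M: "\<forall>m\<ge>M. \<forall>n\<ge>M. norm (s m - s n) < e/2"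
      using CauchyD[OF s, of "e/2"] by auto
    have "norm (s n - L) < e" if "n \<ge> M" for n
    proof -
      have "norm (s n - L) \<le> e/2"
        unfolding norm_ell2.rep_eq minus_ell2.rep_eq L f_def[symmetric]
        using M that by (intro sqrt_infsum_le lim[of _ M n "e/2"]) auto
      then show ?thesis using e by linarith
    qed
    then show "\<exists>M. \<forall>n\<ge>M. norm (s n - L) < e" by blast
  qed
  then show "convergent s" by (rule convergentI)
qed

instantiation ell2 :: (type, chilbert_space) chilbert_space
begin
lift_definition scaleC_ell2 :: "complex \<Rightarrow> ('a, 'b) ell2 \<Rightarrow> ('a, 'b) ell2" is "\<lambda>c f i. c *\<^sub>C f i"
  by (rule square_summable_scaleC)
lift_definition cinner_ell2 :: "('a, 'b) ell2 \<Rightarrow> ('a, 'b) ell2 \<Rightarrow> complex"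
  is "\<lambda>f g. \<Sum>\<^sub>\<infinity>i. cinner (f i) (g i)" .
instance
proof
  fix f g h :: "('a, 'b) ell2" and a b :: complex and r :: real
  show "a *\<^sub>C (f + g) = a *\<^sub>C f + a *\<^sub>C g" by transfer (simp add: scaleC_add_right)
  show "(a + b) *\<^sub>C f = a *\<^sub>C f + b *\<^sub>C f" by transfer (simp add: scaleC_add_left)
  show "a *\<^sub>C b *\<^sub>C f = (a * b) *\<^sub>C f" by transfer (simp add: scaleC_scaleC)
  show "r *\<^sub>R f = complex_of_real r *\<^sub>C f" by transfer (simp add: scaleR_scaleC)
  show "cinner f g = cnj (cinner g f)"
    by transfer (simp add: infsum_cnj[symmetric] cinner_commute[symmetric])
  show "cinner f (g + h) = cinner f g + cinner f h"
    by transfer (simp add: cinner_add_right infsum_add square_summable_cinner)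
  show "cinner f (a *\<^sub>C g) = a * cinner f g"
    by transfer (simp add: cinner_scaleC_right infsum_cmult_right')
  show "cinner f f = complex_of_real ((norm f)\<^sup>2)"
  proof transfer
    fix f :: "'a \<Rightarrow> 'b"
    assume s: "(\<lambda>i. (norm (f i))\<^sup>2) summable_on UNIV"
    have "((\<lambda>i. complex_of_real ((norm (f i))\<^sup>2)) has_sum complex_of_real (\<Sum>\<^sub>\<infinity>i. (norm (f i))\<^sup>2)) UNIV"
      using has_sum_bounded_linear[OF bounded_linear_of_real has_sum_infsum[OF s]] .
    then show "(\<Sum>\<^sub>\<infinity>i. cinner (f i) (f i)) = complex_of_real ((sqrt (\<Sum>\<^sub>\<infinity>i. (norm (f i))\<^sup>2))\<^sup>2)"
      by (simp add: cinner_self infsumI infsum_nonneg)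
  qed
qed
end

lift_definition ell2_single :: "'i \<Rightarrow> 'h::chilbert_space \<Rightarrow> ('i, 'h) ell2"
  is "\<lambda>i v j. if j = i then v else 0"
  by (rule finite_nonzero_values_imp_summable_on) (auto intro: finite_subset[of _ "{_}"])

definition matrix_entry :: "(('x, 'h::chilbert_space) ell2 \<Rightarrow> ('x, 'h) ell2) \<Rightarrow> 'x \<Rightarrow> 'x \<Rightarrow> 'h \<Rightarrow> 'h" where
  "matrix_entry T x y = (\<lambda>v. Rep_ell2 (T (ell2_single y v)) x)"

section \<open>Star algebras, maximal completions, quotients and full crossed products\<close>

text \<open>Complex \<open>*\<close>-algebras are records with explicit carrier, so that constructions
  depending on parameters (a metric, an action) can be iterated. They are not assumed unital: the
  field \<^const>\<open>one\<close>, inherited from rings, carries no meaning and is never used.\<close>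

record 'a star_alg = "(complex, 'a) module" +
  involution :: "'a \<Rightarrow> 'a"

record 'a normed_star_alg = "'a star_alg" +
  alg_norm :: "'a \<Rightarrow> real"

definition star_hom :: "('a, 'm) star_alg_scheme \<Rightarrow> ('b, 'n) star_alg_scheme \<Rightarrow> ('a \<Rightarrow> 'b) \<Rightarrow> bool" where
  "star_hom A B f \<longleftrightarrow>
     f \<in> carrier A \<rightarrow> carrier B \<and>
     (\<forall>a\<in>carrier A. \<forall>b\<in>carrier A. f (a \<oplus>\<^bsub>A\<^esub> b) = f a \<oplus>\<^bsub>B\<^esub> f b) \<and>
     (\<forall>c. \<forall>a\<in>carrier A. f (c \<odot>\<^bsub>A\<^esub> a) = c \<odot>\<^bsub>B\<^esub> f a) \<and>
     (\<forall>a\<in>carrier A. \<forall>b\<in>carrier A. f (a \<otimes>\<^bsub>A\<^esub> b) = f a \<otimes>\<^bsub>B\<^esub> f b) \<and>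
     (\<forall>a\<in>carrier A. f (involution A a) = involution B (f a))"

text \<open>Between C*-algebras a bijective \<open>*\<close>-homomorphism is automatically isometric.\<close>

definition star_iso :: "('a, 'm) star_alg_scheme \<Rightarrow> ('b, 'n) star_alg_scheme \<Rightarrow> ('a \<Rightarrow> 'b) \<Rightarrow> bool" where
  "star_iso A B f \<longleftrightarrow> star_hom A B f \<and> bij_betw f (carrier A) (carrier B)"

definition bounded_ops :: "('k::chilbert_space \<Rightarrow> 'k) star_alg" where
  "bounded_ops =
     \<lparr>carrier = {T. bounded_clinear T}, mult = (\<lambda>S T. S \<circ> T), one = id,
      zero = (\<lambda>_. 0), add = (\<lambda>S T v. S v + T v), smult = (\<lambda>c T v. c *\<^sub>C T v),
      involution = cadjoint\<rparr>"

text \<open>Representations may be degenerate. The supremum over all \<open>*\<close>-representations on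
  Hilbert spaces can be taken over those on the single Hilbert space $\ell^2(A)$, where \<open>A\<close> is the
  element type: the norm of $\phi(a)$ is the supremum of its norms on the cyclic subspaces
  $\overline{\phi(A)\xi}$, a cyclic subspace has an orthonormal basis of cardinality at most that
  of \<open>A\<close>, hence embeds isometrically into $\ell^2(A)$, and the representation can be extended
  by 0 on the complement. Whenever the set of norms is unbounded the value is unspecified; for
  Roe algebras of bounded geometry spaces and for algebraic crossed products of C*-algebras by
  discrete groups it is bounded.\<close>

definition max_norm :: "('a, 'm) star_alg_scheme \<Rightarrow> 'a \<Rightarrow> real" where
  "max_norm A a =
     (SUP \<phi> \<in> {\<phi>. star_hom A (bounded_ops :: (('a, complex) ell2 \<Rightarrow> ('a, complex) ell2) star_alg) \<phi>}.
        onorm (\<phi> a))"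

lemma orthonormal_basis_exists:
  fixes W :: "'k::chilbert_space set"
  assumes W: "cvs.subspace W" and cl: "closed W"
  obtains B where "B \<subseteq> W" "\<And>b. b \<in> B \<Longrightarrow> norm b = 1"
    "\<And>b c. b \<in> B \<Longrightarrow> c \<in> B \<Longrightarrow> b \<noteq> c \<Longrightarrow> cinner b c = 0" "W = closure (cvs.span B)"
proof -
  define \<O> where "\<O> = {B. B \<subseteq> W \<and> (\<forall>b\<in>B. norm b = 1) \<and> (\<forall>b\<in>B. \<forall>c\<in>B. b \<noteq> c \<longrightarrow> cinner b c = 0)}"
  have "\<exists>M\<in>\<O>. \<forall>X\<in>\<O>. M \<subseteq> X \<longrightarrow> X = M"
  proof (rule subset_Zorn_nonempty)
    show "\<O> \<noteq> {}" by (auto simp: \<O>_def intro: exI[of _ "{}"])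
    fix C assume C: "C \<noteq> {}" "subset.chain \<O> C"
    have CO: "C \<subseteq> \<O>" and lin: "\<And>X Y. X \<in> C \<Longrightarrow> Y \<in> C \<Longrightarrow> X \<subseteq> Y \<or> Y \<subseteq> X"
      using C(2) by (auto simp: subset.chain_def)
    have "cinner b c = 0" if "b \<in> X" "X \<in> C" "c \<in> Y" "Y \<in> C" "b \<noteq> c" for b c X Y
    proof -
      have "\<exists>Z\<in>C. b \<in> Z \<and> c \<in> Z" using lin[OF that(2,4)] that by blast
      then show ?thesis using CO that(5) by (auto simp: \<O>_def)
    qed
    then have "\<forall>b\<in>\<Union> C. \<forall>c\<in>\<Union> C. b \<noteq> c \<longrightarrow> cinner b c = 0" by (meson UnionE)
    moreover have "\<Union> C \<subseteq> W" "\<forall>b\<in>\<Union> C. norm b = 1" using CO by (auto simp: \<O>_def)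
    ultimately show "\<Union> C \<in> \<O>" by (simp add: \<O>_def)
  qed
  then obtain B where B: "B \<in> \<O>" and max: "\<And>X. X \<in> \<O> \<Longrightarrow> B \<subseteq> X \<Longrightarrow> X = B" by blast
  have BW: "B \<subseteq> W" and Bn: "\<And>b. b \<in> B \<Longrightarrow> norm b = 1"
    and Bo: "\<And>b c. b \<in> B \<Longrightarrow> c \<in> B \<Longrightarrow> b \<noteq> c \<Longrightarrow> cinner b c = 0"
    using B by (auto simp: \<O>_def)
  have sub: "closure (cvs.span B) \<subseteq> W"
    using cvs.span_minimal[OF BW W] cl by (rule closure_minimal)
  have "v \<in> closure (cvs.span B)" if v: "v \<in> W" for v
  proof -
    obtain p where p: "p \<in> closure (cvs.span B)"
      and orth: "\<And>w. w \<in> closure (cvs.span B) \<Longrightarrow> cinner w (v - p) = 0"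
      using projection_exists[of "closure (cvs.span B)" v]
      by (metis subspace_closure cvs.subspace_span closed_closure)
    have ob: "cinner b (v - p) = 0" if "b \<in> B" for b
      using orth closure_subset cvs.span_base[OF that] by blast
    have "v - p = 0"
    proof (rule ccontr)
      assume n0: "v - p \<noteq> 0"
      define u where "u = complex_of_real (1 / norm (v - p)) *\<^sub>C (v - p)"
      have nu: "norm u = 1" using n0 by (simp add: u_def norm_divide)
      have uW: "u \<in> W" unfolding u_def using v p sub
        by (intro cvs.subspace_scale[OF W] cvs.subspace_diff[OF W]) auto
      have bu: "cinner b u = 0" if "b \<in> B" for b
        using ob[OF that] by (simp add: u_def cinner_scaleC_right)
      have ub: "cinner u b = 0" if "b \<in> B" for b
        using bu[OF that] cinner_eq_0_commute by blast
      have "u \<notin> B" using bu[of u] nu by (auto simp: cinner_self_eq_0)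
      moreover have "insert u B \<in> \<O>"
        using BW Bn Bo nu uW bu ub by (auto simp: \<O>_def)
      ultimately show False using max[of "insert u B"] by blast
    qed
    then show ?thesis using p by simp
  qed
  then have "W = closure (cvs.span B)" using sub by blast
  with BW Bn Bo show ?thesis by (rule that)
qed

lemma Bessel_inequality:
  fixes e :: "'i \<Rightarrow> 'k::chilbert_space"
  assumes n: "\<And>i. norm (e i) = 1 \<or> e i = 0" and o: "\<And>i k. i \<noteq> k \<Longrightarrow> cinner (e i) (e k) = 0"
    and F: "finite F"
  shows "L2_set (\<lambda>i. cmod (cinner (e i) v)) F \<le> norm v"
proof -
  define p where "p = (\<Sum>i\<in>F. cinner (e i) v *\<^sub>C e i)"
  have orth: "cinner (e i) (v - p) = 0" if i: "i \<in> F" for i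
  proof -
    have "cinner (e i) p = (\<Sum>k\<in>F. cinner (e k) v * cinner (e i) (e k))"
      by (simp add: p_def cinner_sum_right cinner_scaleC_right)
    also have "\<dots> = (\<Sum>k\<in>F. if k = i then cinner (e i) v * cinner (e i) (e i) else 0)"
      using o by (intro sum.cong) auto
    also have "\<dots> = cinner (e i) v * cinner (e i) (e i)" using F i by simp
    also have "\<dots> = cinner (e i) v" using n[of i] by (auto simp: cinner_self)
    finally show ?thesis by (simp add: cinner_diff_right)
  qed
  have pv: "cinner p (v - p) = 0"
    by (subst (1) p_def) (simp add: cinner_sum_left cinner_scaleC_left orth)
  then have "cinner p p = cinner p v" by (simp add: cinner_diff_right)
  also have "\<dots> = complex_of_real (\<Sum>i\<in>F. (cmod (cinner (e i) v))\<^sup>2)"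
    unfolding of_real_sum
    by (simp add: p_def cinner_sum_left cinner_scaleC_left complex_norm_square mult.commute
        del: of_real_power)
  finally have "(norm p)\<^sup>2 = (\<Sum>i\<in>F. (cmod (cinner (e i) v))\<^sup>2)"
    unfolding cinner_self of_real_eq_iff .
  moreover have "(norm v)\<^sup>2 = (norm p)\<^sup>2 + (norm (v - p))\<^sup>2"
    using norm_add_sq[of p "v - p"] pv by simp
  ultimately have "(\<Sum>i\<in>F. (cmod (cinner (e i) v))\<^sup>2) \<le> (norm v)\<^sup>2" by simp
  then show ?thesis unfolding L2_set_def by (simp add: real_le_lsqrt)
qed

lemma star_hom_bounded_ops_adjoint:
  assumes "star_hom A bounded_ops \<phi>" "a \<in> carrier A"
  shows "cinner (\<phi> (involution A a) v) w = cinner v (\<phi> a w)"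
proof -
  have "bounded_clinear (\<phi> a)" "\<phi> (involution A a) = cadjoint (\<phi> a)"
    using assms by (auto simp: star_hom_def bounded_ops_def)
  then show ?thesis by (simp add: cinner_cadjoint)
qed

text \<open>The supremum in \<^const>\<open>max_norm\<close> dominates every \<open>*\<close>-representation on every
  Hilbert space, see \<open>onorm_representation_le_max_norm\<close> below.\<close>

lemma transfer_representation:
  fixes A :: "('a, 'm) star_alg_scheme" and \<phi> :: "'a \<Rightarrow> 'k::chilbert_space \<Rightarrow> 'k"
  assumes \<phi>: "star_hom A bounded_ops \<phi>" and a: "a \<in> carrier A"
    and closed: "\<And>x y. x \<in> carrier A \<Longrightarrow> y \<in> carrier A \<Longrightarrow> x \<oplus>\<^bsub>A\<^esub> y \<in> carrier A"
      "\<And>c x. x \<in> carrier A \<Longrightarrow> c \<odot>\<^bsub>A\<^esub> x \<in> carrier A"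
      "\<And>x y. x \<in> carrier A \<Longrightarrow> y \<in> carrier A \<Longrightarrow> x \<otimes>\<^bsub>A\<^esub> y \<in> carrier A"
      "\<And>x. x \<in> carrier A \<Longrightarrow> involution A x \<in> carrier A"
  obtains \<psi> where "star_hom A (bounded_ops :: (('a, complex) ell2 \<Rightarrow> ('a, complex) ell2) star_alg) \<psi>"
    "norm (\<phi> a \<xi>) \<le> onorm (\<psi> a) * norm \<xi>"
proof -
  have bl: "bounded_clinear (\<phi> x)" if "x \<in> carrier A" for x
    using \<phi> that by (auto simp: star_hom_def bounded_ops_def)
  have bl': "bounded_linear (\<phi> x)" if "x \<in> carrier A" for x
    using bl[OF that] by (simp add: bounded_clinear_def)
  have sc: "\<phi> x (c *\<^sub>C v) = c *\<^sub>C \<phi> x v" if "x \<in> carrier A" for x c v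
    using bl[OF that] by (simp add: bounded_clinear_def)
  have padd: "\<phi> (x \<oplus>\<^bsub>A\<^esub> y) = (\<lambda>v. \<phi> x v + \<phi> y v)" if "x \<in> carrier A" "y \<in> carrier A" for x y
    using \<phi> that by (simp add: star_hom_def bounded_ops_def)
  have psc: "\<phi> (c \<odot>\<^bsub>A\<^esub> x) = (\<lambda>v. c *\<^sub>C \<phi> x v)" if "x \<in> carrier A" for c x
    using \<phi> that by (simp add: star_hom_def bounded_ops_def)
  have pmult: "\<phi> (x \<otimes>\<^bsub>A\<^esub> y) = \<phi> x \<circ> \<phi> y" if "x \<in> carrier A" "y \<in> carrier A" for x y
    using \<phi> that by (simp add: star_hom_def bounded_ops_def)
  note adj = star_hom_bounded_ops_adjoint[OF \<phi>]
  have adj': "cinner (\<phi> x v) w = cinner v (\<phi> (involution A x) w)" if "x \<in> carrier A" for x v w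
    using adj[OF that, of w v] cinner_commute by metis

  define V where "V = (\<lambda>x. \<phi> x \<xi>) ` carrier A"
  define W where "W = closure V"
  have "cvs.subspace V"
  proof (rule cvs.subspaceI)
    have "\<phi> (0 \<odot>\<^bsub>A\<^esub> a) \<xi> = 0" using a by (simp add: psc)
    then show "0 \<in> V" unfolding V_def using closed(2)[OF a] by (metis imageI)
    show "x + y \<in> V" if "x \<in> V" "y \<in> V" for x y
    proof -
      from that obtain b c where "b \<in> carrier A" "c \<in> carrier A" "x = \<phi> b \<xi>" "y = \<phi> c \<xi>"
        by (auto simp: V_def)
      then show ?thesis unfolding V_def by (intro image_eqI[of _ _ "b \<oplus>\<^bsub>A\<^esub> c"]) (auto simp: padd closed)
    qed
    show "c *\<^sub>C x \<in> V" if "x \<in> V" for c x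
    proof -
      from that obtain b where "b \<in> carrier A" "x = \<phi> b \<xi>" by (auto simp: V_def)
      then show ?thesis unfolding V_def by (intro image_eqI[of _ _ "c \<odot>\<^bsub>A\<^esub> b"]) (auto simp: psc closed)
    qed
  qed
  then have W: "cvs.subspace W" unfolding W_def by (rule subspace_closure)
  have clW: "closed W" by (simp add: W_def)
  have inv: "\<phi> x w \<in> W" if x: "x \<in> carrier A" and w: "w \<in> W" for x w
  proof -
    have "\<phi> x ` closure V \<subseteq> closure (\<phi> x ` V)"
      by (rule image_closure_subset[OF linear_continuous_on[OF bl'[OF x]] closed_closure closure_subset])
    also have "\<phi> x ` V \<subseteq> V"
    proof
      fix u assume "u \<in> \<phi> x ` V"
      then obtain b where b: "b \<in> carrier A" "u = \<phi> x (\<phi> b \<xi>)" by (auto simp: V_def)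
      then have "u = \<phi> (x \<otimes>\<^bsub>A\<^esub> b) \<xi>" using x by (simp add: pmult)
      then show "u \<in> V" using closed(3)[OF x b(1)] by (auto simp: V_def)
    qed
    then have "closure (\<phi> x ` V) \<subseteq> closure V" by (rule closure_mono)
    finally show ?thesis using w unfolding W_def by blast
  qed

  obtain B where BW: "B \<subseteq> W" and Bn: "\<And>b. b \<in> B \<Longrightarrow> norm b = 1"
    and Bo: "\<And>b c. b \<in> B \<Longrightarrow> c \<in> B \<Longrightarrow> b \<noteq> c \<Longrightarrow> cinner b c = 0"
    and WB: "W = closure (cvs.span B)"
    using orthonormal_basis_exists[OF W clW] by metis
  have "\<exists>x\<in>carrier A. norm (\<phi> x \<xi> - b) < 1/2" if "b \<in> B" for b
  proof -
    have "b \<in> closure V" using BW that by (auto simp: W_def)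
    then have "\<exists>y\<in>V. dist y b < 1/2" unfolding closure_approachable by (metis half_gt_zero zero_less_one)
    then show ?thesis by (auto simp: V_def dist_norm)
  qed
  then obtain j where j: "\<And>b. b \<in> B \<Longrightarrow> norm (\<phi> (j b) \<xi> - b) < 1/2" by metis
  have inj: "inj_on j B"
  proof (rule inj_onI, rule ccontr)
    fix b c assume bc: "b \<in> B" "c \<in> B" "j b = j c" "b \<noteq> c"
    have "norm (b - c) = norm ((\<phi> (j c) \<xi> - c) - (\<phi> (j b) \<xi> - b))" using bc(3) by simp
    also have "\<dots> < 1"
      using norm_triangle_ineq4[of "\<phi> (j c) \<xi> - c" "\<phi> (j b) \<xi> - b"] j[OF bc(1)] j[OF bc(2)] by linarith
    finally have "(norm (b - c))\<^sup>2 < 1" by (simp add: power_less_one_iff)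
    then show False using Bn[OF bc(1)] Bn[OF bc(2)] Bo[OF bc(1,2,4)] by (simp add: norm_diff_sq)
  qed
  define e where "e i = (if i \<in> j ` B then inv_into B j i else 0)" for i
  have ej: "e (j b) = b" if "b \<in> B" for b using that inj by (simp add: e_def)
  have eB: "e i \<in> B \<or> e i = 0" for i by (auto simp: e_def inv_into_into)
  have en: "norm (e i) = 1 \<or> e i = 0" for i using eB Bn by blast
  have eo: "cinner (e i) (e k) = 0" if "i \<noteq> k" for i k
  proof (cases "i \<in> j ` B \<and> k \<in> j ` B")
    case True
    then have "e i \<in> B" "e k \<in> B" "e i \<noteq> e k"
      using that by (auto simp: e_def inv_into_into dest: inv_into_injective)
    then show ?thesis by (rule Bo)
  qed (auto simp: e_def)
  have eW: "e i \<in> W" for i using eB[of i] BW cvs.subspace_0[OF W] by auto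

  define U :: "'k \<Rightarrow> ('a, complex) ell2" where "U v = Abs_ell2 (\<lambda>i. cinner (e i) v)" for v
  have "(\<lambda>i. (norm (cinner (e i) v))\<^sup>2) summable_on UNIV" for v
    unfolding square_summable_iff
    using Bessel_inequality[of e, OF en eo] by blast
  then have RU: "Rep_ell2 (U v) = (\<lambda>i. cinner (e i) v)" for v
    by (simp add: U_def Abs_ell2_inverse)
  have U: "bounded_clinear U"
  proof (rule bounded_clinearI[where K = 1])
    show "U (x + y) = U x + U y" for x y
      by (rule Rep_ell2_inject[THEN iffD1]) (simp add: RU plus_ell2.rep_eq cinner_add_right)
    show "U (c *\<^sub>C x) = c *\<^sub>C U x" for c x
      by (rule Rep_ell2_inject[THEN iffD1])
        (simp add: RU scaleC_ell2.rep_eq cinner_scaleC_right scaleC_complex_def)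
    show "norm (U x) \<le> norm x * 1" for x
      unfolding norm_ell2.rep_eq RU using Bessel_inequality[of e, OF en eo]
      by (auto intro!: sqrt_infsum_le)
  qed
  then have Ubl: "bounded_linear U" by (simp add: bounded_clinear_def)
  have Unorm: "norm (U v) \<le> norm v" for v
    unfolding norm_ell2.rep_eq RU using Bessel_inequality[of e, OF en eo]
    by (auto intro!: sqrt_infsum_le)
  have Ub: "cinner (U v) (U b) = cinner v b" if b: "b \<in> B" for v b
  proof -
    have "cinner (U v) (U b) = (\<Sum>\<^sub>\<infinity>i. cinner (cinner (e i) v) (cinner (e i) b))"
      by (simp add: cinner_ell2.rep_eq RU)
    also have "\<dots> = (\<Sum>\<^sub>\<infinity>i\<in>{j b}. cinner (cinner (e i) v) (cinner (e i) b))"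
    proof (rule infsum_cong_neutral)
      fix i assume "i \<in> UNIV - {j b}"
      then have "cinner (e i) (e (j b)) = 0" by (intro eo) auto
      then show "cinner (cinner (e i) v) (cinner (e i) b) = 0" by (simp add: ej[OF b])
    qed auto
    also have "\<dots> = cnj (cinner b v)"
      using Bn[OF b] by (simp add: ej[OF b] cinner_complex_def cinner_self)
    also have "\<dots> = cinner v b" using cinner_commute[of v b] by simp
    finally show ?thesis .
  qed
  have UW: "cinner (U v) (U w) = cinner v w" if w: "w \<in> W" for v w
  proof -
    have lin: "bounded_linear (\<lambda>w. cinner (U v) (U w) - cinner v w)"
      by (intro bounded_linear_sub bounded_linear_compose[OF bounded_linear_cinner Ubl] bounded_linear_cinner)
    define S where "S = {w. cinner (U v) (U w) - cinner v w = 0}"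
    have "cvs.subspace S"
      using U by (intro cvs.subspaceI)
        (auto simp: S_def bounded_clinear_def linear_simps[OF Ubl] cinner_add_right
          cinner_scaleC_right right_diff_distrib[symmetric])
    moreover have "B \<subseteq> S" by (auto simp: S_def Ub)
    ultimately have "cvs.span B \<subseteq> S" by (intro cvs.span_minimal)
    moreover have "closed S" unfolding S_def
      by (intro closed_Collect_eq linear_continuous_on lin continuous_on_const)
    ultimately have "W \<subseteq> S" unfolding WB by (rule closure_minimal)
    then show ?thesis using w by (auto simp: S_def)
  qed
  define J where "J = cadjoint U"
  have J: "bounded_clinear J" unfolding J_def by (rule bounded_clinear_cadjoint[OF U])
  have JU: "cinner (J f) w = cinner f (U w)" for f w unfolding J_def by (rule cinner_cadjoint[OF U])
  have Uperp: "U v = 0" if "\<And>w. w \<in> W \<Longrightarrow> cinner w v = 0" for v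
    by (rule Rep_ell2_inject[THEN iffD1]) (simp add: RU zero_ell2.rep_eq that eW)
  have JW: "J f \<in> W" for f
  proof -
    obtain p where p: "p \<in> W" "\<And>w. w \<in> W \<Longrightarrow> cinner w (J f - p) = 0"
      using projection_exists[OF W clW] by metis
    have "cinner (J f) (J f - p) = 0" by (simp add: JU Uperp[OF p(2)])
    moreover have "cinner p (J f - p) = 0" using p by blast
    ultimately have "cinner (J f - p) (J f - p) = 0" by (simp add: cinner_diff_left)
    then show ?thesis using p(1) by (simp add: cinner_self_eq_0)
  qed
  have JUid: "J (U w) = w" if "w \<in> W" for w
  proof (rule cinner_ext)
    fix v
    have "cinner (J (U w)) v = cnj (cinner (U v) (U w))" using cinner_commute[of "U w"] by (simp add: JU)
    also have "\<dots> = cinner w v" using UW[OF that] cinner_commute[of w v] by simp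
    finally show "cinner (J (U w)) v = cinner w v" .
  qed

  define \<psi> where "\<psi> x = (\<lambda>f. U (\<phi> x (J f)))" for x
  have \<psi>bl: "bounded_clinear (\<psi> x)" if "x \<in> carrier A" for x
    unfolding \<psi>_def by (intro bounded_clinear_compose[OF U] bounded_clinear_compose[OF bl[OF that]] J)
  have UC: "U (c *\<^sub>C v) = c *\<^sub>C U v" for c v using U by (simp add: bounded_clinear_def)
  have "star_hom A (bounded_ops :: (('a, complex) ell2 \<Rightarrow> ('a, complex) ell2) star_alg) \<psi>"
    unfolding star_hom_def
  proof (intro conjI ballI allI)
    show "\<psi> \<in> carrier A \<rightarrow> carrier bounded_ops" by (auto simp: bounded_ops_def \<psi>bl)
    fix x y c assume x: "x \<in> carrier A"
    show "\<psi> (c \<odot>\<^bsub>A\<^esub> x) = c \<odot>\<^bsub>bounded_ops\<^esub> \<psi> x"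
      by (auto simp: bounded_ops_def \<psi>_def psc[OF x] UC)
    show "\<psi> (involution A x) = involution bounded_ops (\<psi> x)"
    proof -
      have "cinner (\<psi> (involution A x) f) g = cinner f (\<psi> x g)" for f g
      proof -
        have "cinner (\<psi> (involution A x) f) g = cnj (cinner g (U (\<phi> (involution A x) (J f))))"
          using cinner_commute[of _ g] by (simp add: \<psi>_def)
        also have "\<dots> = cnj (cinner (J g) (\<phi> (involution A x) (J f)))" by (simp add: JU)
        also have "\<dots> = cinner (\<phi> (involution A x) (J f)) (J g)"
          using cinner_commute[of _ "J g"] by simp
        also have "\<dots> = cinner f (\<psi> x g)" by (simp add: adj[OF x] JU \<psi>_def)
        finally show ?thesis .
      qed
      then have "cadjoint (\<psi> x) = \<psi> (involution A x)" by (rule cadjoint_eqI)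
      then show ?thesis by (simp add: bounded_ops_def)
    qed
    assume y: "y \<in> carrier A"
    show "\<psi> (x \<oplus>\<^bsub>A\<^esub> y) = \<psi> x \<oplus>\<^bsub>bounded_ops\<^esub> \<psi> y"
      by (auto simp: bounded_ops_def \<psi>_def padd[OF x y] linear_simps[OF Ubl])
    show "\<psi> (x \<otimes>\<^bsub>A\<^esub> y) = \<psi> x \<otimes>\<^bsub>bounded_ops\<^esub> \<psi> y"
      by (auto simp: bounded_ops_def \<psi>_def pmult[OF x y] JUid inv[OF y JW])
  qed
  moreover have "norm (\<phi> a \<xi>) \<le> onorm (\<psi> a) * norm \<xi>"
  proof -
    obtain p where p: "p \<in> W" "\<And>w. w \<in> W \<Longrightarrow> cinner w (\<xi> - p) = 0"
      using projection_exists[OF W clW] by metis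
    define u where "u = \<phi> a (\<xi> - p)"
    have aW: "\<phi> a \<xi> \<in> W" 
      unfolding W_def V_def using closure_subset a by (rule subsetD[OF _ imageI])
    have "u = \<phi> a \<xi> - \<phi> a p" unfolding u_def by (rule linear_simps(2)[OF bl'[OF a]])
    then have "u \<in> W" using cvs.subspace_diff[OF W aW inv[OF a p(1)]] by simp
    then have "cinner (\<phi> (involution A a) u) (\<xi> - p) = 0" by (intro p(2) inv closed(4) a)
    then have "cinner u u = 0" by (simp add: adj[OF a] u_def)
    then have "\<phi> a \<xi> = \<phi> a p"
      using \<open>u = \<phi> a \<xi> - \<phi> a p\<close> by (simp add: cinner_self_eq_0)
    define q where "q = \<phi> a p"
    have qW: "q \<in> W" unfolding q_def by (rule inv[OF a p(1)])
    have "complex_of_real ((norm (U q))\<^sup>2) = complex_of_real ((norm q)\<^sup>2)"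
      unfolding cinner_self[symmetric] by (rule UW[OF qW])
    then have "norm (U q) = norm q"
      unfolding of_real_eq_iff by (simp add: power2_eq_iff_nonneg)
    moreover have "\<psi> a (U p) = U q" by (simp add: \<psi>_def q_def JUid[OF p(1)])
    ultimately have "norm (\<phi> a \<xi>) = norm (\<psi> a (U p))"
      using \<open>\<phi> a \<xi> = \<phi> a p\<close> by (simp add: q_def)
    also have "\<dots> \<le> onorm (\<psi> a) * norm (U p)"
      using \<psi>bl[OF a] by (intro onorm) (simp add: bounded_clinear_def)
    also have "\<dots> \<le> onorm (\<psi> a) * norm \<xi>"
    proof (rule mult_left_mono)
      have "U \<xi> = U p"
        using Uperp[OF p(2)] by (simp add: linear_simps[OF Ubl])
      then show "norm (U p) \<le> norm \<xi>" using Unorm[of \<xi>] by simp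
      show "0 \<le> onorm (\<psi> a)"
        using \<psi>bl[OF a] by (intro onorm_pos_le) (simp add: bounded_clinear_def)
    qed
    finally show ?thesis .
  qed
  ultimately show ?thesis by (rule that)
qed

lemma onorm_representation_le_max_norm:
  fixes A :: "('a, 'm) star_alg_scheme" and \<phi> :: "'a \<Rightarrow> 'k::chilbert_space \<Rightarrow> 'k"
  assumes \<phi>: "star_hom A bounded_ops \<phi>" and a: "a \<in> carrier A"
    and closed: "\<And>x y. x \<in> carrier A \<Longrightarrow> y \<in> carrier A \<Longrightarrow> x \<oplus>\<^bsub>A\<^esub> y \<in> carrier A"
      "\<And>c x. x \<in> carrier A \<Longrightarrow> c \<odot>\<^bsub>A\<^esub> x \<in> carrier A"
      "\<And>x y. x \<in> carrier A \<Longrightarrow> y \<in> carrier A \<Longrightarrow> x \<otimes>\<^bsub>A\<^esub> y \<in> carrier A"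
      "\<And>x. x \<in> carrier A \<Longrightarrow> involution A x \<in> carrier A"
    and bdd: "bdd_above ((\<lambda>\<psi>. onorm (\<psi> a)) `
      {\<psi>. star_hom A (bounded_ops :: (('a, complex) ell2 \<Rightarrow> ('a, complex) ell2) star_alg) \<psi>})"
  shows "onorm (\<phi> a) \<le> max_norm A a"
proof -
  have *: "norm (\<phi> a \<xi>) \<le> max_norm A a * norm \<xi>" for \<xi>
  proof -
    obtain \<psi> where \<psi>: "star_hom A (bounded_ops :: (('a, complex) ell2 \<Rightarrow> ('a, complex) ell2) star_alg) \<psi>"
      "norm (\<phi> a \<xi>) \<le> onorm (\<psi> a) * norm \<xi>"
      using transfer_representation[OF \<phi> a closed] by metis
    have "onorm (\<psi> a) \<le> max_norm A a"
      unfolding max_norm_def using \<psi>(1) by (intro cSUP_upper bdd) simp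
    then show ?thesis using \<psi>(2) by (meson mult_right_mono norm_ge_zero order_trans)
  qed
  obtain \<psi> where \<psi>: "star_hom A (bounded_ops :: (('a, complex) ell2 \<Rightarrow> ('a, complex) ell2) star_alg) \<psi>"
    using transfer_representation[OF \<phi> a closed] by metis
  then have "bounded_linear (\<psi> a)"
    using a by (auto simp: star_hom_def bounded_ops_def bounded_clinear_def)
  then have "0 \<le> onorm (\<psi> a)" by (rule onorm_pos_le)
  also have "\<dots> \<le> max_norm A a"
    unfolding max_norm_def using \<psi> by (intro cSUP_upper bdd) simp
  finally show ?thesis using * by (rule onorm_bound)
qed

definition cauchy_seqs :: "('a, 'm) star_alg_scheme \<Rightarrow> ('a \<Rightarrow> real) \<Rightarrow> (nat \<Rightarrow> 'a) set" where
  "cauchy_seqs A p =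
     {s. range s \<subseteq> carrier A \<and> (\<forall>e>0. \<exists>N. \<forall>m\<ge>N. \<forall>n\<ge>N. p (s m \<ominus>\<^bsub>A\<^esub> s n) < e)}"

definition null_rel :: "('a, 'm) star_alg_scheme \<Rightarrow> ('a \<Rightarrow> real) \<Rightarrow> ((nat \<Rightarrow> 'a) \<times> (nat \<Rightarrow> 'a)) set" where
  "null_rel A p =
     {(s, t). s \<in> cauchy_seqs A p \<and> t \<in> cauchy_seqs A p \<and> (\<lambda>n. p (s n \<ominus>\<^bsub>A\<^esub> t n)) \<longlonglongrightarrow> 0}"

definition cauchy_class :: "('a, 'm) star_alg_scheme \<Rightarrow> ('a \<Rightarrow> real) \<Rightarrow> (nat \<Rightarrow> 'a) \<Rightarrow> (nat \<Rightarrow> 'a) set" where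
  "cauchy_class A p s = null_rel A p `` {s}"

text \<open>The completion with respect to a seminorm \<open>p\<close> (Hausdorff, i.e. elements of seminorm 0
  become 0).\<close>

definition completion :: "('a, 'm) star_alg_scheme \<Rightarrow> ('a \<Rightarrow> real) \<Rightarrow> (nat \<Rightarrow> 'a) set normed_star_alg" where
  "completion A p =
     \<lparr>carrier = cauchy_seqs A p // null_rel A p,
      mult = (\<lambda>P Q. \<Union>s\<in>P. \<Union>t\<in>Q. cauchy_class A p (\<lambda>n. s n \<otimes>\<^bsub>A\<^esub> t n)),
      one = undefined,
      zero = cauchy_class A p (\<lambda>_. \<zero>\<^bsub>A\<^esub>),
      add = (\<lambda>P Q. \<Union>s\<in>P. \<Union>t\<in>Q. cauchy_class A p (\<lambda>n. s n \<oplus>\<^bsub>A\<^esub> t n)),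
      smult = (\<lambda>c P. \<Union>s\<in>P. cauchy_class A p (\<lambda>n. c \<odot>\<^bsub>A\<^esub> s n)),
      involution = (\<lambda>P. \<Union>s\<in>P. cauchy_class A p (\<lambda>n. involution A (s n))),
      alg_norm = (\<lambda>P. lim (\<lambda>n. p ((SOME s. s \<in> P) n)))\<rparr>"

definition max_completion :: "('a, 'm) star_alg_scheme \<Rightarrow> (nat \<Rightarrow> 'a) set normed_star_alg" where
  "max_completion A = completion A (max_norm A)"

definition max_embed :: "('a, 'm) star_alg_scheme \<Rightarrow> 'a \<Rightarrow> (nat \<Rightarrow> 'a) set" where
  "max_embed A a = cauchy_class A (max_norm A) (\<lambda>_. a)"

definition max_extend :: "('a, 'm) star_alg_scheme \<Rightarrow> ('a \<Rightarrow> 'a) \<Rightarrow> (nat \<Rightarrow> 'a) set \<Rightarrow> (nat \<Rightarrow> 'a) set" where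
  "max_extend A f P = (\<Union>s\<in>P. cauchy_class A (max_norm A) (\<lambda>n. f (s n)))"

definition closed_subspace :: "('a, 'm) normed_star_alg_scheme \<Rightarrow> 'a set \<Rightarrow> bool" where
  "closed_subspace A V \<longleftrightarrow>
     V \<subseteq> carrier A \<and> \<zero>\<^bsub>A\<^esub> \<in> V \<and>
     (\<forall>a\<in>V. \<forall>b\<in>V. a \<oplus>\<^bsub>A\<^esub> b \<in> V) \<and> (\<forall>c. \<forall>a\<in>V. c \<odot>\<^bsub>A\<^esub> a \<in> V) \<and>
     (\<forall>a\<in>carrier A. (\<forall>e>0. \<exists>b\<in>V. alg_norm A (a \<ominus>\<^bsub>A\<^esub> b) < e) \<longrightarrow> a \<in> V)"

definition closed_span :: "('a, 'm) normed_star_alg_scheme \<Rightarrow> 'a set \<Rightarrow> 'a set" where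
  "closed_span A S = \<Inter> {V. closed_subspace A V \<and> S \<subseteq> V}"

definition quotient_alg :: "('a, 'm) normed_star_alg_scheme \<Rightarrow> 'a set \<Rightarrow> 'a set normed_star_alg" where
  "quotient_alg A I =
     \<lparr>carrier = a_rcosets\<^bsub>A\<^esub> I, mult = rcoset_mult A I, one = undefined, zero = I, add = set_add A,
      smult = (\<lambda>c Q. \<Union>a\<in>Q. I +>\<^bsub>A\<^esub> (c \<odot>\<^bsub>A\<^esub> a)),
      involution = (\<lambda>Q. \<Union>a\<in>Q. I +>\<^bsub>A\<^esub> involution A a),
      alg_norm = (\<lambda>Q. INF a\<in>Q. alg_norm A a)\<rparr>"

definition quotient_extend :: "('a, 'm) normed_star_alg_scheme \<Rightarrow> 'a set \<Rightarrow> ('a \<Rightarrow> 'a) \<Rightarrow> 'a set \<Rightarrow> 'a set" where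
  "quotient_extend A I f Q = (\<Union>a\<in>Q. I +>\<^bsub>A\<^esub> f a)"

text \<open>The algebraic crossed product: \<open>f\<close> stands for the finite sum $\sum_g f(g)\, u_g$, with
  $u_g a u_g^* = \alpha_g(a)$. Functions are 0 outside the carrier of the group.\<close>

definition alg_crossed_product ::
    "('g, 'z) monoid_scheme \<Rightarrow> ('a, 'm) star_alg_scheme \<Rightarrow> ('g \<Rightarrow> 'a \<Rightarrow> 'a) \<Rightarrow> ('g \<Rightarrow> 'a) star_alg" where
  "alg_crossed_product G A \<alpha> =
     \<lparr>carrier = {f. (\<forall>g. f g \<in> carrier A) \<and> (\<forall>g. g \<notin> carrier G \<longrightarrow> f g = \<zero>\<^bsub>A\<^esub>) \<and> finite {g. f g \<noteq> \<zero>\<^bsub>A\<^esub>}},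
      mult = (\<lambda>f h g. if g \<in> carrier G
                then (\<Oplus>\<^bsub>A\<^esub>k\<in>{k. f k \<noteq> \<zero>\<^bsub>A\<^esub>}. f k \<otimes>\<^bsub>A\<^esub> \<alpha> k (h (m_inv G k \<otimes>\<^bsub>G\<^esub> g))) else \<zero>\<^bsub>A\<^esub>),
      one = undefined,
      zero = (\<lambda>_. \<zero>\<^bsub>A\<^esub>),
      add = (\<lambda>f h g. f g \<oplus>\<^bsub>A\<^esub> h g),
      smult = (\<lambda>c f g. c \<odot>\<^bsub>A\<^esub> f g),
      involution = (\<lambda>f g. if g \<in> carrier G then \<alpha> g (involution A (f (m_inv G g))) else \<zero>\<^bsub>A\<^esub>)\<rparr>"

definition cp_single :: "('a, 'm) star_alg_scheme \<Rightarrow> 'g \<Rightarrow> 'a \<Rightarrow> 'g \<Rightarrow> 'a" where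
  "cp_single A g a = (\<lambda>k. if k = g then a else \<zero>\<^bsub>A\<^esub>)"

text \<open>For a discrete group acting on a C*-algebra, \<open>*\<close>-representations of the algebraic crossed
  product and (integrated forms of) covariant pairs give the same supremum.\<close>

definition full_crossed_product ::
    "('g, 'z) monoid_scheme \<Rightarrow> ('a, 'm) star_alg_scheme \<Rightarrow> ('g \<Rightarrow> 'a \<Rightarrow> 'a)
      \<Rightarrow> (nat \<Rightarrow> 'g \<Rightarrow> 'a) set normed_star_alg" where
  "full_crossed_product G A \<alpha> = max_completion (alg_crossed_product G A \<alpha>)"

section \<open>Large scale structures and coarse actions\<close>

definition st :: "'x set \<Rightarrow> 'x set set \<Rightarrow> 'x set" where
  "st B \<U> = \<Union> {U \<in> \<U>. U \<inter> B \<noteq> {}}"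

definition st_family :: "'x set set \<Rightarrow> 'x set set \<Rightarrow> 'x set set" where
  "st_family \<B> \<U> = (\<lambda>B. st B \<U>) ` \<B>"

definition large_scale_structure :: "'x set \<Rightarrow> 'x set set set \<Rightarrow> bool" where
  "large_scale_structure X L \<longleftrightarrow>
     L \<noteq> {} \<and> L \<subseteq> Pow (Pow X) \<and>
     (\<forall>\<B>1\<in>L. \<forall>\<B>2\<subseteq>Pow X.
        (\<forall>B\<in>\<B>2. (\<exists>x\<in>B. \<exists>y\<in>B. x \<noteq> y) \<longrightarrow> (\<exists>B'\<in>\<B>1. B \<subseteq> B')) \<longrightarrow> \<B>2 \<in> L) \<and>
     (\<forall>\<B>1\<in>L. \<forall>\<B>2\<in>L. st_family \<B>1 \<B>2 \<in> L)"

text \<open>The diameter of the empty set and the supremum over the empty family are $-\infty$ here.\<close>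

definition metric_diam :: "('x \<Rightarrow> 'x \<Rightarrow> real) \<Rightarrow> 'x set \<Rightarrow> ereal" where
  "metric_diam d U = (SUP (x, y)\<in>U \<times> U. ereal (d x y))"

definition metric_lss :: "'x set \<Rightarrow> ('x \<Rightarrow> 'x \<Rightarrow> real) \<Rightarrow> 'x set set set" where
  "metric_lss X d = {\<U>. \<U> \<subseteq> Pow X \<and> (SUP U\<in>\<U>. metric_diam d U) < \<infinity>}"

definition discrete_metric_space :: "'x set \<Rightarrow> ('x \<Rightarrow> 'x \<Rightarrow> real) \<Rightarrow> bool" where
  "discrete_metric_space X d \<longleftrightarrow>
     Metric_space X d \<and> Metric_space.mtopology X d = discrete_topology X"

definition bounded_geometry :: "'x set \<Rightarrow> ('x \<Rightarrow> 'x \<Rightarrow> real) \<Rightarrow> bool" where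
  "bounded_geometry X d \<longleftrightarrow>
     (\<forall>R>0. \<exists>N::nat. \<forall>x\<in>X. finite (Metric_space.mball X d x R) \<and> card (Metric_space.mball X d x R) \<le> N)"

definition acts_by_coarse_equivalences ::
    "('g, 'z) monoid_scheme \<Rightarrow> 'x set \<Rightarrow> ('x \<Rightarrow> 'x \<Rightarrow> real) \<Rightarrow> ('g \<Rightarrow> 'x \<Rightarrow> 'x) \<Rightarrow> bool" where
  "acts_by_coarse_equivalences G X d \<phi> \<longleftrightarrow>
     group_action G X \<phi> \<and>
     (\<forall>g\<in>carrier G. \<forall>R>0. \<exists>S>0. \<forall>x\<in>X. \<forall>y\<in>X. d x y \<le> R \<longrightarrow> d (\<phi> g x) (\<phi> g y) \<le> S)"

definition coarsely_discontinuous ::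
    "('g, 'z) monoid_scheme \<Rightarrow> 'x set \<Rightarrow> ('x \<Rightarrow> 'x \<Rightarrow> real) \<Rightarrow> ('g \<Rightarrow> 'x \<Rightarrow> 'x) \<Rightarrow> bool" where
  "coarsely_discontinuous G X d \<phi> \<longleftrightarrow>
     (\<forall>g\<in>carrier G - {\<one>\<^bsub>G\<^esub>}. \<forall>R>0. \<exists>K\<subseteq>X. Metric_space.mbounded X d K \<and>
        (\<forall>x\<in>X - K. d x (\<phi> g x) \<ge> R))"

definition orbit_lss ::
    "('g, 'z) monoid_scheme \<Rightarrow> 'x set \<Rightarrow> ('x \<Rightarrow> 'x \<Rightarrow> real) \<Rightarrow> ('g \<Rightarrow> 'x \<Rightarrow> 'x) \<Rightarrow> 'x set set set" where
  "orbit_lss G X d \<phi> =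
     \<Inter> {L. large_scale_structure X L \<and> metric_lss X d \<subseteq> L \<and>
          (\<forall>g\<in>carrier G. (\<lambda>x. {x, \<phi> g x}) ` X \<in> L)}"

section \<open>Roe algebras\<close>

text \<open>For a metric space with carrier \<open>X\<close>, operators on $\ell^2(X) \otimes H$ are identified with the
  operators on the ambient \<^typ>\<open>('x, 'h) ell2\<close> whose matrix entries vanish outside $X \times X$.\<close>

definition roe_alg :: "'x set \<Rightarrow> ('x \<Rightarrow> 'x \<Rightarrow> real) \<Rightarrow> (('x, 'h::chilbert_space) ell2 \<Rightarrow> ('x, 'h) ell2) star_alg" where
  "roe_alg X d = bounded_ops
     \<lparr>carrier := {T. bounded_clinear T \<and>
        (\<forall>x y. x \<notin> X \<or> y \<notin> X \<longrightarrow> matrix_entry T x y = (\<lambda>_. 0)) \<and>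
        (\<forall>x\<in>X. \<forall>y\<in>X. compact_operator (matrix_entry T x y)) \<and>
        (\<exists>R>0. \<forall>x\<in>X. \<forall>y\<in>X. d x y \<ge> R \<longrightarrow> matrix_entry T x y = (\<lambda>_. 0))}\<rparr>"

type_synonym ('x, 'h) max_roe = "(nat \<Rightarrow> ('x, 'h) ell2 \<Rightarrow> ('x, 'h) ell2) set"

definition max_roe_alg :: "'x set \<Rightarrow> ('x \<Rightarrow> 'x \<Rightarrow> real) \<Rightarrow> ('x, 'h::chilbert_space) max_roe normed_star_alg" where
  "max_roe_alg X d = max_completion (roe_alg X d)"

definition rank_one :: "'x \<Rightarrow> 'h \<Rightarrow> 'x \<Rightarrow> 'h \<Rightarrow> ('x, 'h::chilbert_space) ell2 \<Rightarrow> ('x, 'h) ell2" where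
  "rank_one x v y w = (\<lambda>f. cinner (ell2_single y w) f *\<^sub>C ell2_single x v)"

definition compact_ideal :: "'x set \<Rightarrow> ('x \<Rightarrow> 'x \<Rightarrow> real) \<Rightarrow> ('x, 'h::chilbert_space) max_roe set" where
  "compact_ideal X d =
     closed_span (max_roe_alg X d)
       {max_embed (roe_alg X d) (rank_one x v y w) | x v y w. x \<in> X \<and> y \<in> X}"

definition roe_quotient :: "'x set \<Rightarrow> ('x \<Rightarrow> 'x \<Rightarrow> real) \<Rightarrow> ('x, 'h::chilbert_space) max_roe set normed_star_alg" where
  "roe_quotient X d = quotient_alg (max_roe_alg X d) (compact_ideal X d)"

definition roe_class ::
    "'x set \<Rightarrow> ('x \<Rightarrow> 'x \<Rightarrow> real) \<Rightarrow> (('x, 'h::chilbert_space) ell2 \<Rightarrow> ('x, 'h) ell2) \<Rightarrow> ('x, 'h) max_roe set" where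
  "roe_class X d T = compact_ideal X d +>\<^bsub>max_roe_alg X d\<^esub> max_embed (roe_alg X d) T"

text \<open>The operators $M_g$, given on vectors by $(M_g f)(x) = f(g^{-1}x)$; see
  \<open>matrix_entry_translation\<close> for their matrix entries.\<close>

definition translation ::
    "('g, 'z) monoid_scheme \<Rightarrow> 'x set \<Rightarrow> ('g \<Rightarrow> 'x \<Rightarrow> 'x) \<Rightarrow> 'g \<Rightarrow> ('x, 'h::chilbert_space) ell2 \<Rightarrow> ('x, 'h) ell2"
where
  "translation G X \<phi> g f = Abs_ell2 (\<lambda>x. if x \<in> X then Rep_ell2 f (\<phi> (m_inv G g) x) else 0)"

lemma Rep_translation:
  assumes "group_action G X \<phi>" "g \<in> carrier G"
  shows "Rep_ell2 (translation G X \<phi> g f) = (\<lambda>x. if x \<in> X then Rep_ell2 f (\<phi> (m_inv G g) x) else 0)"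
proof -
  interpret group_action G X \<phi> by fact
  interpret group G using group_hom group_hom.axioms(1) by blast
  have inj: "inj_on (\<phi> (m_inv G g)) X"
    using inj_prop assms(2) by simp
  have "L2_set (\<lambda>x. norm (if x \<in> X then Rep_ell2 f (\<phi> (m_inv G g) x) else 0)) F \<le> norm f"
    if F: "finite F" for F
  proof -
    have i: "inj_on (\<phi> (m_inv G g)) (F \<inter> X)" using inj by (rule inj_on_subset) auto
    have "L2_set (\<lambda>x. norm (if x \<in> X then Rep_ell2 f (\<phi> (m_inv G g) x) else 0)) F
        = L2_set (\<lambda>x. norm (Rep_ell2 f (\<phi> (m_inv G g) x))) (F \<inter> X)"
      unfolding L2_set_def using F
      by (intro arg_cong[where f = sqrt] sum.mono_neutral_cong_right) auto
    also have "\<dots> = L2_set (\<lambda>x. norm (Rep_ell2 f x)) (\<phi> (m_inv G g) ` (F \<inter> X))"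
      unfolding L2_set_def by (simp add: sum.reindex[OF i])
    also have "\<dots> \<le> norm f"
      unfolding norm_ell2.rep_eq using F Rep_ell2[of f] by (intro L2_set_le_sqrt_infsum) auto
    finally show ?thesis .
  qed
  then have "(\<lambda>x. (norm (if x \<in> X then Rep_ell2 f (\<phi> (m_inv G g) x) else 0))\<^sup>2) summable_on UNIV"
    unfolding square_summable_iff by blast
  then show ?thesis unfolding translation_def by (subst Abs_ell2_inverse) simp_all
qed

lemma matrix_entry_translation:
  assumes "group_action G X \<phi>" "g \<in> carrier G"
  shows "matrix_entry (translation G X \<phi> g) x y = (if x \<in> X \<and> y \<in> X \<and> \<phi> g y = x then id else (\<lambda>_. 0))"
proof -
  interpret group_action G X \<phi> by fact
  interpret group G using group_hom group_hom.axioms(1) by blast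
  have "x \<in> X \<Longrightarrow> \<phi> (m_inv G g) x = y \<longleftrightarrow> y \<in> X \<and> \<phi> g y = x"
    using orbit_sym_aux[OF assms(2)] orbit_sym_aux[of "m_inv G g"] element_image assms(2)
    by (metis inv_closed inv_inv)
  then show ?thesis
    by (auto simp: matrix_entry_def Rep_translation[OF assms] ell2_single.rep_eq)
qed

definition roe_action ::
    "('g, 'z) monoid_scheme \<Rightarrow> 'x set \<Rightarrow> ('x \<Rightarrow> 'x \<Rightarrow> real) \<Rightarrow> ('g \<Rightarrow> 'x \<Rightarrow> 'x) \<Rightarrow> 'g
      \<Rightarrow> ('x, 'h::chilbert_space) max_roe set \<Rightarrow> ('x, 'h) max_roe set" where
  "roe_action G X d \<phi> g =
     quotient_extend (max_roe_alg X d) (compact_ideal X d)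
       (max_extend (roe_alg X d)
         (\<lambda>T. translation G X \<phi> g \<circ> T \<circ> cadjoint (translation G X \<phi> g)))"

end

theory Submission
 imports Defs
begin

text \<open>Both algebras are completions of the algebraic crossed product of $C[X]$ by conjugation with the
 $M_g$, via $T u_g \mapsto [T] u_g$ and via $T u_g \mapsto [T M_g]$, so it suffices that these two maps
 induce the same norm. A representation of the algebraic crossed product of $C^*_{\max}(X)/\mathcal{K}$
 descends to $C[X_G]$ because $\sum_g T_g M_g = 0$ forces every $T_g$ to have finitely many nonzero
 entries, by coarse discontinuity. Conversely, a representation $\sigma$ of $C[X_G]$ that kills the rank
 one operators yields maps $T \mapsto \sigma(T M_g)$, which extend to $C^*_{\max}(X)/\mathcal{K}$ and
 integrate to a representation of the crossed product. Such representations determine the norm of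
 $C^*_{\max}(X_G)/\mathcal{K}$: compressing representations of $C[X_G]$ by the complements of an
 approximate unit of $\mathcal{K}$ and passing to an ultrapower produces enough of them, so that no
 abstract representation theorem for C*-algebras is needed.\<close>

text \<open>Completions and quotients are handled as Banach star algebras with isometric involution;
  the C*-identity is used for operators on Hilbert spaces only. Upper bounds for quotient norms must
  therefore come from representations, and this is where the ultrapower enters. Separability of H
  and countability of X give an approximate unit that is a sequence of finite rank projections, so
  an ultrafilter on the natural numbers suffices.

  Finiteness of the maximal norms rests on one estimate: representations of a Banach star algebra
  are contractive. It is applied to block diagonal operators and to the coefficients of the crossed
  product.

  Pairs at bounded distance in X_G become d-close after one point is moved by an element of a fixed
  finite subset of G. Sorting the entries of an operator by such an element writes it as a finite
  sum of T_g M_g; coarse discontinuity controls the ambiguity of this decomposition. The entries of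
  M_g are identities of H, which are not compact, so a representation of C[X_G] is not defined on
  M_g itself. This is why the maps T \<mapsto> \<sigma>(T M_g) are extended instead.\<close>

type_synonym ('x, 'h) ell2_op = "('x, 'h) ell2 \<Rightarrow> ('x, 'h) ell2"

section \<open>Bounded and compact operators\<close>

lemma bounded_clinearD: "bounded_clinear T \<Longrightarrow> bounded_linear T"
 by (simp add: bounded_clinear_def)

lemma clinear_scaleC: "bounded_clinear T \<Longrightarrow> T (c *\<^sub>C v) = c *\<^sub>C T v"
 by (simp add: bounded_clinear_def)

lemma clinear_add: "bounded_clinear T \<Longrightarrow> T (x + y) = T x + T y"
 by (simp add: bounded_clinear_def linear_simps)

lemma clinear_diff: "bounded_clinear T \<Longrightarrow> T (x - y) = T x - T y"
 by (simp add: bounded_clinear_def linear_simps)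

lemma clinear_zero: "bounded_clinear T \<Longrightarrow> T 0 = 0"
 by (simp add: bounded_clinear_def linear_simps)

lemma clinear_sum: "bounded_clinear T \<Longrightarrow> T (sum f F) = (\<Sum>i\<in>F. T (f i))"
 by (induction F rule: infinite_finite_induct) (auto simp: clinear_add clinear_zero)

lemma clinear_const_0: "bounded_clinear (\<lambda>_. 0)"
 by (rule bounded_clinearI[where K = 0]) auto

lemma clinear_id: "bounded_clinear id" "bounded_clinear (\<lambda>x. x)"
 by (rule bounded_clinearI[where K = 1]; simp)+

lemma clinear_plus:
 assumes "bounded_clinear S" "bounded_clinear T"
 shows "bounded_clinear (\<lambda>v. S v + T v)"
 using assms unfolding bounded_clinear_def by (auto intro: bounded_linear_add simp: scaleC_add_right)

lemma clinear_minus: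
 assumes "bounded_clinear S" "bounded_clinear T"
 shows "bounded_clinear (\<lambda>v. S v - T v)"
 using assms unfolding bounded_clinear_def
 by (auto intro: bounded_linear_sub simp: cvs.scale_right_diff_distrib)

lemma clinear_cmult:
 assumes "bounded_clinear T"
 shows "bounded_clinear (\<lambda>v. c *\<^sub>C T v)"
 using assms unfolding bounded_clinear_def
 by (auto intro: bounded_linear_compose[OF bounded_linear_scaleC] simp: scaleC_scaleC mult.commute)

lemma clinear_setsum:
 "(\<And>i. i \<in> F \<Longrightarrow> bounded_clinear (T i)) \<Longrightarrow> bounded_clinear (\<lambda>v. \<Sum>i\<in>F. T i v)"
 by (induction F rule: infinite_finite_induct) (auto intro: clinear_const_0 clinear_plus)

lemma clinear_comp:
 "bounded_clinear S \<Longrightarrow> bounded_clinear T \<Longrightarrow> bounded_clinear (S \<circ> T)"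
 using bounded_clinear_compose by (simp add: o_def)

lemma norm_le_onorm: "bounded_clinear T \<Longrightarrow> norm (T x) \<le> onorm T * norm x"
 by (simp add: bounded_clinear_def onorm)

lemma onorm_nonneg: "bounded_clinear T \<Longrightarrow> 0 \<le> onorm T"
 by (simp add: bounded_clinear_def onorm_pos_le)

lemma onorm_scaleC:
 assumes "bounded_clinear T"
 shows "onorm (\<lambda>v. c *\<^sub>C T v) = cmod c * onorm T"
proof -
 have *: "onorm (\<lambda>v. c *\<^sub>C S v) \<le> cmod c * onorm S" if "bounded_clinear S" for c and S :: "'a \<Rightarrow> 'b"
  using onorm_nonneg[OF that] norm_le_onorm[OF that]
  by (intro onorm_bound) (auto simp: mult.assoc intro: mult_left_mono)
 show ?thesis
 proof (cases "c = 0")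
  case True
  then show ?thesis by (simp add: onorm_zero)
 next
  case False
  have "T = (\<lambda>v. inverse c *\<^sub>C (c *\<^sub>C T v))" using False by (simp add: scaleC_scaleC)
  then have "onorm T \<le> cmod (inverse c) * onorm (\<lambda>v. c *\<^sub>C T v)"
   using *[OF clinear_cmult[OF assms, of c], of "inverse c"] by simp
  then have "cmod c * onorm T \<le> cmod c * (inverse (cmod c) * onorm (\<lambda>v. c *\<^sub>C T v))"
   by (intro mult_left_mono) (auto simp: norm_inverse)
  also have "\<dots> = onorm (\<lambda>v. c *\<^sub>C T v)" using False by (simp flip: mult.assoc)
  finally have "cmod c * onorm T \<le> onorm (\<lambda>v. c *\<^sub>C T v)" .
  then show ?thesis using *[OF assms, of c] by simp
 qed
qed

lemma onorm_diff_commute: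
 fixes S T :: "'a::chilbert_space \<Rightarrow> 'b::chilbert_space"
 shows "onorm (\<lambda>v. S v - T v) = onorm (\<lambda>v. T v - S v)"
 unfolding onorm_def by (simp add: norm_minus_commute)

lemma cinner_cadjoint_right:
 "bounded_clinear T \<Longrightarrow> cinner w (cadjoint T v) = cinner (T w) v"
 by (metis cinner_cadjoint cinner_commute)

lemma cadjoint_cadjoint: "bounded_clinear T \<Longrightarrow> cadjoint (cadjoint T) = T"
 by (rule cadjoint_eqI) (simp add: cinner_cadjoint_right)

lemma cadjoint_comp:
 "bounded_clinear S \<Longrightarrow> bounded_clinear T \<Longrightarrow> cadjoint (S \<circ> T) = cadjoint T \<circ> cadjoint S"
 by (rule cadjoint_eqI) (simp add: cinner_cadjoint)

lemma cadjoint_plus: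
 "bounded_clinear S \<Longrightarrow> bounded_clinear T \<Longrightarrow> cadjoint (\<lambda>v. S v + T v) = (\<lambda>v. cadjoint S v + cadjoint T v)"
 by (rule cadjoint_eqI) (simp add: cinner_cadjoint cinner_add_left cinner_add_right)

lemma cadjoint_minus:
 "bounded_clinear S \<Longrightarrow> bounded_clinear T \<Longrightarrow> cadjoint (\<lambda>v. S v - T v) = (\<lambda>v. cadjoint S v - cadjoint T v)"
 by (rule cadjoint_eqI) (simp add: cinner_cadjoint cinner_diff_left cinner_diff_right)

lemma cadjoint_cmult:
 "bounded_clinear T \<Longrightarrow> cadjoint (\<lambda>v. c *\<^sub>C T v) = (\<lambda>v. cnj c *\<^sub>C cadjoint T v)"
 by (rule cadjoint_eqI) (simp add: cinner_cadjoint cinner_scaleC_left cinner_scaleC_right)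

lemma cadjoint_zero: "cadjoint (\<lambda>_. 0) = (\<lambda>_. 0)"
 by (rule cadjoint_eqI) simp

lemma norm_cadjoint_sq:
 assumes "bounded_clinear T"
 shows "(norm (T v))\<^sup>2 = Re (cinner v (cadjoint T (T v)))"
 by (simp add: cinner_cadjoint_right[OF assms] cinner_self)

lemma onorm_cadjoint_le:
 fixes T :: "'a::chilbert_space \<Rightarrow> 'b::chilbert_space"
 assumes T: "bounded_clinear T"
 shows "onorm (cadjoint T) \<le> onorm T"
proof (rule onorm_bound)
 fix x
 show "norm (cadjoint T x) \<le> onorm T * norm x"
 proof (cases "cadjoint T x = 0")
  case True
  then show ?thesis using onorm_nonneg[OF T] by simp
 next
  case False
  have "(norm (cadjoint T x))\<^sup>2 = cmod (cinner (cadjoint T x) (cadjoint T x))"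
   by (simp add: cinner_self norm_power)
  also have "\<dots> \<le> norm x * norm (T (cadjoint T x))"
   by (simp add: cinner_cadjoint[OF T] Cauchy_Schwarz_cinner)
  also have "\<dots> \<le> norm x * (onorm T * norm (cadjoint T x))"
   by (intro mult_left_mono norm_le_onorm[OF T]) auto
  finally show ?thesis using False by (simp add: power2_eq_square mult.assoc mult.left_commute)
 qed
qed (rule onorm_nonneg[OF T])

lemma onorm_cadjoint:
 fixes T :: "'a::chilbert_space \<Rightarrow> 'b::chilbert_space"
 assumes "bounded_clinear T"
 shows "onorm (cadjoint T) = onorm T"
 using onorm_cadjoint_le[OF assms] onorm_cadjoint_le[OF bounded_clinear_cadjoint[OF assms]]
 by (simp add: cadjoint_cadjoint[OF assms])

text \<open>The half of the C*-identity with content. It trades an operator for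
  \<open>cadjoint T \<circ> T\<close>, which in the applications lies in a smaller algebra where a
  bound is already available: block diagonal operators, coefficients of the crossed product, or C[X]
  inside C[X_G].\<close>

lemma onorm_le_sqrt:
 fixes T :: "'a::chilbert_space \<Rightarrow> 'b::chilbert_space"
 assumes T: "bounded_clinear T"
 shows "(onorm T)\<^sup>2 \<le> onorm (cadjoint T \<circ> T)"
proof -
 have b: "bounded_clinear (cadjoint T \<circ> T)"
  by (intro clinear_comp bounded_clinear_cadjoint T)
 have "onorm T \<le> sqrt (onorm (cadjoint T \<circ> T))"
 proof (rule onorm_bound)
  fix v
  have "(norm (T v))\<^sup>2 \<le> cmod (cinner v ((cadjoint T \<circ> T) v))"
   using complex_Re_le_cmod by (simp add: norm_cadjoint_sq[OF T])
  also have "\<dots> \<le> norm v * norm ((cadjoint T \<circ> T) v)"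
   by (rule Cauchy_Schwarz_cinner)
  also have "\<dots> \<le> norm v * (onorm (cadjoint T \<circ> T) * norm v)"
   by (intro mult_left_mono norm_le_onorm[OF b]) auto
  also have "\<dots> = (sqrt (onorm (cadjoint T \<circ> T)) * norm v)\<^sup>2"
   using onorm_nonneg[OF b] by (simp add: power_mult_distrib power2_eq_square)
  finally show "norm (T v) \<le> sqrt (onorm (cadjoint T \<circ> T)) * norm v"
   by (rule power2_le_imp_le) (simp add: onorm_nonneg[OF b])
 qed (simp add: onorm_nonneg[OF b])
 then have "(onorm T)\<^sup>2 \<le> (sqrt (onorm (cadjoint T \<circ> T)))\<^sup>2"
  by (intro power_mono onorm_nonneg[OF T])
 then show ?thesis using onorm_nonneg[OF b] by simp
qed

text \<open>Completeness is borrowed from the real Banach space of bounded linear maps; what remains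
  is complex homogeneity, which passes to pointwise limits.\<close>

lemma operator_limit:
 fixes T :: "nat \<Rightarrow> 'a::chilbert_space \<Rightarrow> 'b::chilbert_space"
 assumes T: "\<And>n. bounded_clinear (T n)"
  and C: "\<And>e. e > 0 \<Longrightarrow> \<exists>N. \<forall>m\<ge>N. \<forall>n\<ge>N. onorm (\<lambda>v. T m v - T n v) < e"
 obtains S where "bounded_clinear S" "(\<lambda>n. onorm (\<lambda>v. T n v - S v)) \<longlonglongrightarrow> 0" "\<And>v. (\<lambda>n. T n v) \<longlonglongrightarrow> S v"
proof -
 define B where "B n = Blinfun (T n)" for n
 have B: "blinfun_apply (B n) = T n" for n
  unfolding B_def by (rule bounded_linear_Blinfun_apply) (use T bounded_clinearD in blast)
 have nB: "norm (B m - x) = onorm (\<lambda>v. T m v - blinfun_apply x v)" for m x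
  unfolding norm_blinfun.rep_eq minus_blinfun.rep_eq B ..
 have "Cauchy B"
 proof (rule CauchyI)
  fix e :: real assume "0 < e"
  from C[OF this] show "\<exists>M. \<forall>m\<ge>M. \<forall>n\<ge>M. norm (B m - B n) < e" by (simp add: nB B)
 qed
 then obtain L where L: "B \<longlonglongrightarrow> L" using Cauchy_convergent convergent_def by blast
 define S where "S = blinfun_apply L"
 have pt: "(\<lambda>n. T n v) \<longlonglongrightarrow> S v" for v
  using blinfun.tendsto[OF L tendsto_const[of v]] by (simp add: B S_def)
 have "S (c *\<^sub>C v) = c *\<^sub>C S v" for c v
 proof (rule LIMSEQ_unique[OF pt])
  show "(\<lambda>n. T n (c *\<^sub>C v)) \<longlonglongrightarrow> c *\<^sub>C S v"
   using bounded_linear.tendsto[OF bounded_linear_scaleC pt[of v], of c]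
   by (simp add: clinear_scaleC[OF T])
 qed
 then have "bounded_clinear S"
  unfolding bounded_clinear_def S_def by (simp add: blinfun.bounded_linear_right)
 moreover have "(\<lambda>n. onorm (\<lambda>v. T n v - S v)) \<longlonglongrightarrow> 0"
  using tendsto_norm[OF LIM_zero[OF L]] by (simp add: nB S_def)
 ultimately show ?thesis using pt by (rule that)
qed

section \<open>Compact operators, described by finite nets in the unit ball\<close>

lemma compact_closed_subset: "compact T \<Longrightarrow> closed S \<Longrightarrow> S \<subseteq> T \<Longrightarrow> compact S"
 by (metis compact_Int_closed inf.absorb_iff2)

text \<open>Total boundedness of the image, with the centres of the net taken as values
  \<open>T k\<close> at points of the unit ball. Halving e pays for moving an arbitrary centre to
  such a value.\<close>

lemma compact_operator_iff:
 fixes T :: "'a::chilbert_space \<Rightarrow> 'b::chilbert_space"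
 shows "compact_operator T \<longleftrightarrow> bounded_clinear T \<and>
  (\<forall>e>0. \<exists>K. finite K \<and> K \<subseteq> cball 0 1 \<and> (\<forall>v\<in>cball 0 1. \<exists>k\<in>K. norm (T v - T k) < e))"
proof (intro iffI conjI allI impI)
 assume "compact_operator T"
 then show "bounded_clinear T" by (simp add: compact_operator_def)
 fix e :: real assume e: "0 < e"
 have "compact (closure (T ` cball 0 1))" using \<open>compact_operator T\<close> by (simp add: compact_operator_def)
 then obtain k where k: "finite k" "closure (T ` cball 0 1) \<subseteq> (\<Union>x\<in>k. ball x (e/2))"
  unfolding compact_eq_totally_bounded using e by (meson half_gt_zero)
 define h where "h x = (SOME v. v \<in> cball 0 1 \<and> T v \<in> ball x (e/2))" for x
 define K where "K = h ` {x\<in>k. \<exists>v\<in>cball 0 1. T v \<in> ball x (e/2)}"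
 have h: "h x \<in> cball 0 1 \<and> T (h x) \<in> ball x (e/2)" if "\<exists>v\<in>cball 0 1. T v \<in> ball x (e/2)" for x
  unfolding h_def by (rule someI_ex) (use that in blast)
 have "\<exists>k\<in>K. norm (T v - T k) < e" if v: "v \<in> cball 0 1" for v
 proof -
  obtain x where x: "x \<in> k" "T v \<in> ball x (e/2)"
   using subsetD[OF k(2) subsetD[OF closure_subset imageI[OF v]]] by (elim UN_E)
  then have ex: "\<exists>v\<in>cball 0 1. T v \<in> ball x (e/2)" using v by blast
  have hx: "T (h x) \<in> ball x (e/2)" "h x \<in> K"
   using h[OF ex] ex x(1) unfolding K_def by blast+
  have "dist (T v) (T (h x)) < e"
   by (rule dist_triangle_half_r[of x]) (use x(2) hx(1) in simp_all)
  then show ?thesis using hx(2) by (auto simp: dist_norm)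
 qed
 then show "\<exists>K. finite K \<and> K \<subseteq> cball 0 1 \<and> (\<forall>v\<in>cball 0 1. \<exists>k\<in>K. norm (T v - T k) < e)"
  using k(1) h by (intro exI[of _ K] conjI) (simp add: K_def, unfold K_def, blast, blast)
next
 assume *: "bounded_clinear T \<and>
  (\<forall>e>0. \<exists>K. finite K \<and> K \<subseteq> cball 0 1 \<and> (\<forall>v\<in>cball 0 1. \<exists>k\<in>K. norm (T v - T k) < e))"
 have "compact (closure (T ` cball 0 1))"
  unfolding compact_eq_totally_bounded
 proof (intro conjI allI impI)
  show "complete (closure (T ` cball 0 1))" by (simp add: complete_eq_closed)
  fix e :: real assume e: "0 < e"
  then obtain K where K: "finite K" "\<And>v. v\<in>cball 0 1 \<Longrightarrow> \<exists>k\<in>K. norm (T v - T k) < e/2"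
   using * by (meson half_gt_zero)
  have "closure (T ` cball 0 1) \<subseteq> (\<Union>x\<in>T ` K. ball x e)"
  proof
   fix y assume "y \<in> closure (T ` cball 0 1)"
   then obtain v where v: "v \<in> cball 0 1" "dist (T v) y < e/2"
    unfolding closure_approachable using e by (metis half_gt_zero imageE)
   from K(2)[OF v(1)] obtain k where "k \<in> K" "dist (T v) (T k) < e/2" by (auto simp: dist_norm)
   moreover have "dist (T k) y < e"
    by (rule dist_triangle_half_r[of "T v"]) (use calculation v(2) in \<open>simp_all add: dist_commute\<close>)
   ultimately show "y \<in> (\<Union>x\<in>T ` K. ball x e)" by auto
  qed
  then show "\<exists>k. finite k \<and> closure (T ` cball 0 1) \<subseteq> (\<Union>x\<in>k. ball x e)"
   using K(1) by blast
 qed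
 then show "compact_operator T" using * by (simp add: compact_operator_def)
qed

lemma compact_operatorD: "compact_operator T \<Longrightarrow> bounded_clinear T"
 by (simp add: compact_operator_def)

lemma compact_operator_net:
 fixes T :: "'a::chilbert_space \<Rightarrow> 'b::chilbert_space"
 assumes "compact_operator T" "e > 0"
 obtains K where "finite K" "K \<subseteq> cball 0 1" "\<And>v. norm v \<le> 1 \<Longrightarrow> \<exists>k\<in>K. norm (T v - T k) < e"
 using assms unfolding compact_operator_iff by (metis mem_cball_0)

lemma compact_operatorI:
 fixes T :: "'a::chilbert_space \<Rightarrow> 'b::chilbert_space"
 assumes "bounded_clinear T"
  and "\<And>e. e > 0 \<Longrightarrow> \<exists>K. finite K \<and> K \<subseteq> cball 0 1 \<and> (\<forall>v. norm v \<le> 1 \<longrightarrow> (\<exists>k\<in>K. norm (T v - T k) < e))"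
 shows "compact_operator T"
 using assms unfolding compact_operator_iff mem_cball_0 Ball_def by blast

text \<open>The net is parametrised by its preimages in the unit ball so that it is controlled by
 the operators S and T together.\<close>

lemma compact_operator_by_estimate:
 fixes T :: "'a::chilbert_space \<Rightarrow> 'b::chilbert_space" and S :: "'a \<Rightarrow> 'c::chilbert_space"
 assumes S: "compact_operator S" and T: "bounded_clinear T"
  and est: "\<And>e. e > 0 \<Longrightarrow> \<exists>\<delta>>0. \<forall>v w. norm v \<le> 1 \<longrightarrow> norm w \<le> 1 \<longrightarrow> norm (S v - S w) < \<delta> \<longrightarrow> norm (T v - T w) < e"
 shows "compact_operator T"
proof (rule compact_operatorI[OF T])
 fix e :: real assume "e > 0"
 then obtain \<delta> where \<delta>: "\<delta> > 0"
  "\<And>v w. norm v \<le> 1 \<Longrightarrow> norm w \<le> 1 \<Longrightarrow> norm (S v - S w) < \<delta> \<Longrightarrow> norm (T v - T w) < e" using est by blast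
 obtain K where "finite K" "K \<subseteq> cball 0 1" "\<And>v. norm v \<le> 1 \<Longrightarrow> \<exists>k\<in>K. norm (S v - S k) < \<delta>"
  using compact_operator_net[OF S \<delta>(1)] by metis
 then show "\<exists>K. finite K \<and> K \<subseteq> cball 0 1 \<and> (\<forall>v. norm v \<le> 1 \<longrightarrow> (\<exists>k\<in>K. norm (T v - T k) < e))"
  using \<delta>(2) by (intro exI[of _ K]) (meson mem_cball_0 subsetD)
qed

lemma compact_operator_comp_left:
 assumes "bounded_clinear S" "compact_operator T"
 shows "compact_operator (S \<circ> T)"
proof (rule compact_operator_by_estimate[OF assms(2)])
 have S: "bounded_linear S" using assms(1) by (rule bounded_clinearD)
 obtain K where K: "K > 0" "\<And>x. norm (S x) \<le> norm x * K"
  using bounded_linear.pos_bounded[OF S] by blast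
 fix e :: real assume "e > 0"
 then show "\<exists>\<delta>>0. \<forall>v w. norm v \<le> 1 \<longrightarrow> norm w \<le> 1 \<longrightarrow> norm (T v - T w) < \<delta> \<longrightarrow> norm ((S \<circ> T) v - (S \<circ> T) w) < e"
  using K(1) K(2)[of "T v - T w" for v w]
  by (intro exI[of _ "e / K"])
   (auto simp: clinear_diff[OF assms(1)] pos_less_divide_eq intro: le_less_trans)
qed (intro clinear_comp assms compact_operatorD)

lemma compact_operator_scaleC:
 assumes "compact_operator T"
 shows "compact_operator (\<lambda>v. c *\<^sub>C T v)"
 using compact_operator_comp_left[OF clinear_cmult[OF clinear_id(2)] assms, of c]
 by (simp add: o_def)

lemma compact_operator_comp_right:
 assumes S: "bounded_clinear S" and T: "compact_operator T"
 shows "compact_operator (T \<circ> S)"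
proof -
 have Tb: "bounded_clinear T" using T by (rule compact_operatorD)
 \<comment> \<open>The summand 1 keeps \<open>r\<close> positive when \<open>S\<close> vanishes.
   After division by \<open>r\<close>, \<open>S\<close> maps the unit ball into itself, so the image
   under \<open>T\<close> stays inside a compact set.\<close>
 define r where "r = onorm S + 1"
 have r: "r > 0" using onorm_nonneg[OF S] by (simp add: r_def)
 have rC: "complex_of_real r \<noteq> 0" using r by simp
 define S' where "S' v = complex_of_real (1/r) *\<^sub>C S v" for v
 have S'b: "bounded_clinear S'" unfolding S'_def by (rule clinear_cmult[OF S])
 have S': "norm (S' v) \<le> 1" if "norm v \<le> 1" for v
 proof -
  have "norm (S v) \<le> onorm S * norm v" by (rule norm_le_onorm[OF S])
  also have "\<dots> \<le> onorm S * 1" using that by (intro mult_left_mono onorm_nonneg[OF S])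
  finally have "norm (S v) \<le> r" by (simp add: r_def)
  then show ?thesis using r by (simp add: S'_def norm_divide)
 qed
 have "compact_operator (T \<circ> S')"
  unfolding compact_operator_def
 proof
  show "bounded_clinear (T \<circ> S')" by (intro clinear_comp Tb S'b)
  have "closure ((T \<circ> S') ` cball 0 1) \<subseteq> closure (T ` cball 0 1)"
   using S' by (intro closure_mono) auto
  then show "compact (closure ((T \<circ> S') ` cball 0 1))"
   using T unfolding compact_operator_def
   by (metis closed_closure compact_closed_subset)
 qed
 from compact_operator_scaleC[OF this, of "complex_of_real r"]
 have "compact_operator (\<lambda>v. complex_of_real r *\<^sub>C T (complex_of_real (1/r) *\<^sub>C S v))"
  by (simp add: S'_def)
 moreover have "complex_of_real r *\<^sub>C T (complex_of_real (1/r) *\<^sub>C S v) = T (S v)" for v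
  by (simp only: clinear_scaleC[OF Tb] scaleC_scaleC) (use r in simp)
 ultimately show ?thesis by (simp add: o_def)
qed

lemma compact_operator_add:
 assumes S: "compact_operator S" and T: "compact_operator T"
 shows "compact_operator (\<lambda>v. S v + T v)"
proof -
 have "compact ((\<lambda>p. fst p + snd p) ` (closure (S ` cball 0 1) \<times> closure (T ` cball 0 1)))"
  using assms by (intro compact_continuous_image continuous_intros compact_Times)
   (auto simp: compact_operator_def)
 moreover have "closure ((\<lambda>v. S v + T v) ` cball 0 1)
   \<subseteq> (\<lambda>p. fst p + snd p) ` (closure (S ` cball 0 1) \<times> closure (T ` cball 0 1))"
 proof (rule closure_minimal)
  show "closed ((\<lambda>p. fst p + snd p) ` (closure (S ` cball 0 1) \<times> closure (T ` cball 0 1)))"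
   using calculation by (rule compact_imp_closed)
  show "(\<lambda>v. S v + T v) ` cball 0 1
   \<subseteq> (\<lambda>p. fst p + snd p) ` (closure (S ` cball 0 1) \<times> closure (T ` cball 0 1))"
  proof
   fix y assume "y \<in> (\<lambda>v. S v + T v) ` cball 0 1"
   then obtain v where "v \<in> cball 0 1" "y = S v + T v" by blast
   then show "y \<in> (\<lambda>p. fst p + snd p) ` (closure (S ` cball 0 1) \<times> closure (T ` cball 0 1))"
    by (intro image_eqI[of _ _ "(S v, T v)"]) (auto intro: subsetD[OF closure_subset])
  qed
 qed
 ultimately have "compact (closure ((\<lambda>v. S v + T v) ` cball 0 1))"
  by (metis closed_closure compact_closed_subset)
 then show ?thesis using assms by (auto simp: compact_operator_def intro: clinear_plus)
qed

lemma compact_operator_zero: "compact_operator (\<lambda>_. 0)"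
 unfolding compact_operator_def
 by (simp add: clinear_const_0 image_constant_conv)

lemma compact_operator_sum:
 "(\<And>i. i \<in> F \<Longrightarrow> compact_operator (T i)) \<Longrightarrow> compact_operator (\<lambda>v. \<Sum>i\<in>F. T i v)"
 by (induction F rule: infinite_finite_induct) (auto intro: compact_operator_zero compact_operator_add)

text \<open>Schauder's theorem. The squared norm of \<open>cadjoint T u\<close> is at most the norm
  of u times the norm of \<open>T (cadjoint T u)\<close>, so the compact operator
  \<open>T \<circ> cadjoint T\<close> controls \<open>cadjoint T\<close>. The threshold e^2 / 2
  absorbs the bound 2 for the difference of two points of the unit ball.\<close>

lemma compact_operator_cadjoint:
 fixes T :: "'a::chilbert_space \<Rightarrow> 'b::chilbert_space"
 assumes T: "compact_operator T"
 shows "compact_operator (cadjoint T)"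
proof (rule compact_operator_by_estimate)
 have b: "bounded_clinear T" using T by (rule compact_operatorD)
 then show c: "bounded_clinear (cadjoint T)" by (rule bounded_clinear_cadjoint)
 show "compact_operator (T \<circ> cadjoint T)" by (rule compact_operator_comp_right[OF c T])
 fix e :: real assume e: "e > 0"
 have "norm (cadjoint T v - cadjoint T w) < e"
  if v: "norm v \<le> 1" "norm w \<le> 1" and n: "norm ((T \<circ> cadjoint T) v - (T \<circ> cadjoint T) w) < e\<^sup>2 / 2" for v w
 proof -
  define u where "u = v - w"
  have u: "norm u \<le> 2" unfolding u_def using norm_triangle_ineq4[of v w] v by linarith
  have "(norm (cadjoint T u))\<^sup>2 = Re (cinner u (cadjoint (cadjoint T) (cadjoint T u)))"
   by (rule norm_cadjoint_sq[OF c])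
  also have "\<dots> = Re (cinner u (T (cadjoint T u)))" by (simp add: cadjoint_cadjoint[OF b])
  also have "\<dots> \<le> norm u * norm (T (cadjoint T u))"
   using Cauchy_Schwarz_cinner complex_Re_le_cmod by (meson order_trans)
  also have "\<dots> \<le> 2 * norm (T (cadjoint T u))" by (intro mult_right_mono u) simp
  also have "\<dots> < e\<^sup>2"
   using n by (simp add: u_def clinear_diff[OF b] clinear_diff[OF c])
  finally show ?thesis using e
   by (simp add: u_def clinear_diff[OF c] power2_less_imp_less)
 qed
 then show "\<exists>\<delta>>0. \<forall>v w. norm v \<le> 1 \<longrightarrow> norm w \<le> 1 \<longrightarrow>
   norm ((T \<circ> cadjoint T) v - (T \<circ> cadjoint T) w) < \<delta> \<longrightarrow> norm (cadjoint T v - cadjoint T w) < e"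
  using e by (intro exI[of _ "e\<^sup>2 / 2"]) simp
qed

lemma compact_operator_limit:
 fixes T :: "'a::chilbert_space \<Rightarrow> 'b::chilbert_space"
 assumes T: "bounded_clinear T" and lim: "\<And>e. e > 0 \<Longrightarrow> \<exists>S. compact_operator S \<and> onorm (\<lambda>v. T v - S v) < e"
 shows "compact_operator T"
proof (rule compact_operatorI[OF T])
 fix e :: real assume e: "e > 0"
 then obtain S where S: "compact_operator S" "onorm (\<lambda>v. T v - S v) < e/3" using lim[of "e/3"] by auto
 have Sb: "bounded_clinear S" using S(1) by (rule compact_operatorD)
 have d: "norm (T v - S v) \<le> e/3" if "norm v \<le> 1" for v
 proof -
  have "norm (T v - S v) \<le> onorm (\<lambda>v. T v - S v) * norm v"
   by (rule norm_le_onorm[OF clinear_minus[OF T Sb]])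
  also have "\<dots> \<le> onorm (\<lambda>v. T v - S v) * 1"
   using that by (intro mult_left_mono onorm_nonneg clinear_minus[OF T Sb])
  finally show ?thesis using S(2) by simp
 qed
 obtain K where K: "finite K" "K \<subseteq> cball 0 1" "\<And>v. norm v \<le> 1 \<Longrightarrow> \<exists>k\<in>K. norm (S v - S k) < e/3"
  using compact_operator_net[OF S(1), of "e/3"] e by (metis divide_pos_pos zero_less_numeral)
 have "\<exists>k\<in>K. norm (T v - T k) < e" if v: "norm v \<le> 1" for v
 proof -
  obtain k where k: "k \<in> K" "norm (S v - S k) < e/3" using K(3)[OF v] by blast
  have kn: "norm k \<le> 1" using K(2) k(1) by auto
  have "T v - T k = (T v - S v) + (S v - S k) - (T k - S k)" by simp
  then have "norm (T v - T k) \<le> norm (T v - S v) + norm (S v - S k) + norm (T k - S k)"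
   using norm_triangle_ineq[of "T v - S v" "S v - S k"]
    norm_triangle_ineq4[of "(T v - S v) + (S v - S k)" "T k - S k"] by simp
  then show ?thesis using d[OF v] d[OF kn] k by (intro bexI[of _ k]) auto
 qed
 then show "\<exists>K. finite K \<and> K \<subseteq> cball 0 1 \<and> (\<forall>v. norm v \<le> 1 \<longrightarrow> (\<exists>k\<in>K. norm (T v - T k) < e))"
  using K(1,2) by (intro exI[of _ K] conjI allI impI)
qed

lemma compact_operator_rank_one: "compact_operator (\<lambda>v::'a::chilbert_space. cinner w v *\<^sub>C (u::'b::chilbert_space))"
 unfolding compact_operator_def
proof
 show b: "bounded_clinear (\<lambda>v::'a. cinner w v *\<^sub>C u)"
 proof (rule bounded_clinearI[where K = "norm w * norm u"])
  show "norm (cinner w x *\<^sub>C u) \<le> norm x * (norm w * norm u)" for x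
   using mult_right_mono[OF Cauchy_Schwarz_cinner[of w x], of "norm u"] by (simp add: mult_ac)
 qed (auto simp: cinner_add_right scaleC_add_left cinner_scaleC_right scaleC_scaleC)
 have cont: "continuous_on UNIV (\<lambda>c. c *\<^sub>C u)"
  by (rule linear_continuous_on, rule bounded_linear_intro[where K = "norm u"])
   (auto simp: scaleC_add_left scaleR_scaleC scaleC_scaleC scaleC_complex_def)
 have c: "compact ((\<lambda>c. c *\<^sub>C u) ` cball 0 (norm w))"
  by (intro compact_continuous_image continuous_on_subset[OF cont]) auto
 have "closure ((\<lambda>v::'a. cinner w v *\<^sub>C u) ` cball 0 1) \<subseteq> (\<lambda>c. c *\<^sub>C u) ` cball 0 (norm w)"
 proof (rule closure_minimal)
  show "(\<lambda>v::'a. cinner w v *\<^sub>C u) ` cball 0 1 \<subseteq> (\<lambda>c. c *\<^sub>C u) ` cball 0 (norm w)"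
  proof
   fix y assume "y \<in> (\<lambda>v::'a. cinner w v *\<^sub>C u) ` cball 0 1"
   then obtain v where v: "norm v \<le> 1" "y = cinner w v *\<^sub>C u" by auto
   have "cmod (cinner w v) \<le> norm w * 1"
    using Cauchy_Schwarz_cinner[of w v] mult_left_mono[OF v(1), of "norm w"] by simp
   then show "y \<in> (\<lambda>c. c *\<^sub>C u) ` cball 0 (norm w)" using v(2) by auto
  qed
 qed (rule compact_imp_closed[OF c])
 with c show "compact (closure ((\<lambda>v::'a. cinner w v *\<^sub>C u) ` cball 0 1))"
  by (metis closed_closure compact_closed_subset)
qed

section \<open>Matrices of operators\<close>

lemma ell2_eqI: "(\<And>x. Rep_ell2 f x = Rep_ell2 g x) \<Longrightarrow> f = g"
 by (metis Rep_ell2_inject ext)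

lemma Rep_ell2_sum: "Rep_ell2 (sum f F) x = (\<Sum>i\<in>F. Rep_ell2 (f i) x)"
 by (induction F rule: infinite_finite_induct) (auto simp: plus_ell2.rep_eq zero_ell2.rep_eq)

lemma norm_Rep_ell2_le: "norm (Rep_ell2 f x) \<le> norm f"
 using L2_set_le_sqrt_infsum[of "Rep_ell2 f" "{x}"] Rep_ell2[of f] by (simp add: norm_ell2.rep_eq)

lemma clinear_Rep_ell2: "bounded_clinear (\<lambda>f. Rep_ell2 f x)"
 by (rule bounded_clinearI[where K = 1])
  (auto simp: plus_ell2.rep_eq scaleC_ell2.rep_eq norm_Rep_ell2_le)

lemma Rep_ell2_single: "Rep_ell2 (ell2_single x v) y = (if y = x then v else 0)"
 by (simp add: ell2_single.rep_eq)

lemma cinner_ell2_single: "cinner (ell2_single x v) f = cinner v (Rep_ell2 f x)"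
proof -
 have "cinner (ell2_single x v) f = (\<Sum>\<^sub>\<infinity>i. cinner (if i = x then v else 0) (Rep_ell2 f i))"
  by (simp add: cinner_ell2.rep_eq ell2_single.rep_eq)
 also have "\<dots> = (\<Sum>\<^sub>\<infinity>i\<in>{x}. cinner (if i = x then v else 0) (Rep_ell2 f i))"
  by (rule infsum_cong_neutral) auto
 finally show ?thesis by simp
qed

lemma norm_ell2_single [simp]: "norm (ell2_single x v) = norm v"
proof -
 have "complex_of_real ((norm (ell2_single x v))\<^sup>2) = complex_of_real ((norm v)\<^sup>2)"
  unfolding cinner_self[symmetric] by (simp add: cinner_ell2_single Rep_ell2_single)
 then show ?thesis unfolding of_real_eq_iff by (simp add: power2_eq_iff_nonneg)
qed

lemma clinear_ell2_single: "bounded_clinear (ell2_single x)"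
 by (rule bounded_clinearI[where K = 1])
  (auto intro!: ell2_eqI simp: plus_ell2.rep_eq scaleC_ell2.rep_eq Rep_ell2_single)

lemma clinear_matrix_entry: "bounded_clinear T \<Longrightarrow> bounded_clinear (matrix_entry T x y)"
 unfolding matrix_entry_def
 using bounded_clinear_compose[OF clinear_Rep_ell2
   bounded_clinear_compose[OF _ clinear_ell2_single]] .

lemma norm_matrix_entry_le:
 assumes "bounded_clinear T"
 shows "norm (matrix_entry T x y v) \<le> onorm T * norm v"
 unfolding matrix_entry_def
 using order_trans[OF norm_Rep_ell2_le norm_le_onorm[OF assms, of "ell2_single y v"]] by simp

lemma cinner_matrix_entry:
 "cinner (ell2_single x v) (T (ell2_single y w)) = cinner v (matrix_entry T x y w)"
 by (simp add: cinner_ell2_single matrix_entry_def)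

lemma matrix_entry_cadjoint:
 assumes "bounded_clinear T"
 shows "matrix_entry (cadjoint T) x y = cadjoint (matrix_entry T y x)"
proof (rule cadjoint_eqI[symmetric])
 fix v w
 have "cinner (matrix_entry (cadjoint T) x y v) w = cnj (cinner (ell2_single x w) (cadjoint T (ell2_single y v)))"
  by (subst cinner_commute) (simp add: cinner_matrix_entry)
 also have "\<dots> = cinner (cadjoint T (ell2_single y v)) (ell2_single x w)"
  by (rule cinner_commute[symmetric])
 finally show "cinner (matrix_entry (cadjoint T) x y v) w = cinner v (matrix_entry T y x w)"
  by (simp add: cinner_cadjoint[OF assms] cinner_matrix_entry)
qed

text \<open>A coordinate of \<open>S f\<close> is tested by pairing \<open>f\<close> with the image
  of a single vector under the adjoint, and that image is read off the matrix. Going through the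
  adjoint replaces a density argument for finitely supported vectors.\<close>

lemma operator_eqI:
 assumes S: "bounded_clinear S" and T: "bounded_clinear T"
  and eq: "\<And>x y. matrix_entry S x y = matrix_entry T x y"
 shows "S = T"
proof
 fix f
 have "cadjoint S (ell2_single x v) = cadjoint T (ell2_single x v)" for x v
 proof (rule ell2_eqI)
  fix y
  show "Rep_ell2 (cadjoint S (ell2_single x v)) y = Rep_ell2 (cadjoint T (ell2_single x v)) y"
   using matrix_entry_cadjoint[OF S, of y x] matrix_entry_cadjoint[OF T, of y x] eq[of x y]
   unfolding matrix_entry_def by metis
 qed
 then have *: "cinner v (Rep_ell2 (S f) x) = cinner v (Rep_ell2 (T f) x)" for x v
  using cinner_cadjoint[OF S, of "ell2_single x v" f] cinner_cadjoint[OF T, of "ell2_single x v" f]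
  by (simp add: cinner_ell2_single)
 have "cinner (Rep_ell2 (S f) x) v = cinner (Rep_ell2 (T f) x) v" for x v
  unfolding cinner_commute[of _ v] * ..
 then have "Rep_ell2 (S f) x = Rep_ell2 (T f) x" for x by (rule cinner_ext)
 then show "S f = T f" by (rule ell2_eqI)
qed

lemma matrix_entry_zero [simp]: "matrix_entry (\<lambda>_. 0) x y = (\<lambda>_. 0)"
 by (simp add: matrix_entry_def zero_ell2.rep_eq)

lemma matrix_entry_plus: "matrix_entry (\<lambda>f. S f + T f) x y = (\<lambda>v. matrix_entry S x y v + matrix_entry T x y v)"
 by (simp add: matrix_entry_def plus_ell2.rep_eq)

lemma matrix_entry_minus: "matrix_entry (\<lambda>f. S f - T f) x y = (\<lambda>v. matrix_entry S x y v - matrix_entry T x y v)"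
 by (simp add: matrix_entry_def minus_ell2.rep_eq)

lemma matrix_entry_cmult: "matrix_entry (\<lambda>f. c *\<^sub>C T f) x y = (\<lambda>v. c *\<^sub>C matrix_entry T x y v)"
 by (simp add: matrix_entry_def scaleC_ell2.rep_eq)

lemma matrix_entry_sum: "matrix_entry (\<lambda>f. \<Sum>i\<in>I. T i f) x y = (\<lambda>v. \<Sum>i\<in>I. matrix_entry (T i) x y v)"
 by (simp add: matrix_entry_def Rep_ell2_sum)

lemma apply_ell2_single:
 assumes "finite F" "\<And>y. y \<notin> F \<Longrightarrow> matrix_entry T y z = (\<lambda>_. 0)"
 shows "T (ell2_single z v) = (\<Sum>y\<in>F. ell2_single y (matrix_entry T y z v))"
proof (rule ell2_eqI)
 fix x
 have "Rep_ell2 (\<Sum>y\<in>F. ell2_single y (matrix_entry T y z v)) x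
   = (\<Sum>y\<in>F. if y = x then matrix_entry T y z v else 0)"
  by (auto simp: Rep_ell2_sum Rep_ell2_single intro!: sum.cong)
 also have "\<dots> = matrix_entry T x z v" using assms by (auto simp: fun_eq_iff)
 finally show "Rep_ell2 (T (ell2_single z v)) x = Rep_ell2 (\<Sum>y\<in>F. ell2_single y (matrix_entry T y z v)) x"
  by (simp add: matrix_entry_def)
qed

text \<open>A finite column of \<open>T\<close> keeps the matrix product a finite sum. In Roe
  algebras the columns are finite by bounded geometry.\<close>

lemma matrix_entry_comp:
 assumes "bounded_clinear S" "finite F" "\<And>y. y \<notin> F \<Longrightarrow> matrix_entry T y z = (\<lambda>_. 0)"
 shows "matrix_entry (S \<circ> T) x z = (\<lambda>v. \<Sum>y\<in>F. matrix_entry S x y (matrix_entry T y z v))"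
proof
 fix v
 have "Rep_ell2 (S (T (ell2_single z v))) x = (\<Sum>y\<in>F. Rep_ell2 (S (ell2_single y (matrix_entry T y z v))) x)"
  by (subst apply_ell2_single[OF assms(2,3)]) (simp_all add: clinear_sum[OF assms(1)] Rep_ell2_sum)
 then show "matrix_entry (S \<circ> T) x z v = (\<Sum>y\<in>F. matrix_entry S x y (matrix_entry T y z v))"
  by (simp add: matrix_entry_def)
qed

text \<open>A weighted partial permutation: row \<open>x\<close> of \<open>D\<close> has its only
  block \<open>t x\<close> in column \<open>\<beta> x\<close>. The function on the right is square
  summable when \<open>\<beta>\<close> is injective on \<open>D\<close> and the blocks are uniformly
  bounded, which the context below assumes; this justifies \<open>Abs_ell2\<close>.\<close>

definition matching_op :: "'x set \<Rightarrow> ('x \<Rightarrow> 'x) \<Rightarrow> ('x \<Rightarrow> 'h \<Rightarrow> 'h::chilbert_space) \<Rightarrow> ('x, 'h) ell2_op" where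
 "matching_op D \<beta> t f = Abs_ell2 (\<lambda>x. if x \<in> D then t x (Rep_ell2 f (\<beta> x)) else 0)"

context
 fixes D :: "'x set" and \<beta> :: "'x \<Rightarrow> 'x" and t :: "'x \<Rightarrow> 'h \<Rightarrow> 'h::chilbert_space" and C :: real
 assumes inj: "inj_on \<beta> D" and t: "\<And>x. x \<in> D \<Longrightarrow> bounded_clinear (t x)"
  and C: "\<And>x v. x \<in> D \<Longrightarrow> norm (t x v) \<le> C * norm v" and C0: "0 \<le> C"
begin

lemma matching_op_L2_le:
 assumes "finite F"
 shows "L2_set (\<lambda>x. norm (if x \<in> D then t x (Rep_ell2 f (\<beta> x)) else 0)) F \<le> C * norm f"
proof -
 have i: "inj_on \<beta> (F \<inter> D)" using inj by (rule inj_on_subset) auto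
 have "L2_set (\<lambda>x. norm (if x \<in> D then t x (Rep_ell2 f (\<beta> x)) else 0)) F
   = L2_set (\<lambda>x. norm (t x (Rep_ell2 f (\<beta> x)))) (F \<inter> D)"
  unfolding L2_set_def using assms
  by (intro arg_cong[where f = sqrt] sum.mono_neutral_cong_right) auto
 also have "\<dots> \<le> L2_set (\<lambda>x. C * norm (Rep_ell2 f (\<beta> x))) (F \<inter> D)"
  using C by (intro L2_set_mono) auto
 also have "\<dots> = C * L2_set (\<lambda>x. norm (Rep_ell2 f (\<beta> x))) (F \<inter> D)"
  using C0 by (rule L2_set_right_distrib[symmetric])
 also have "L2_set (\<lambda>x. norm (Rep_ell2 f (\<beta> x))) (F \<inter> D) = L2_set (\<lambda>x. norm (Rep_ell2 f x)) (\<beta> ` (F \<inter> D))"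
  unfolding L2_set_def by (simp add: sum.reindex[OF i])
 also have "C * \<dots> \<le> C * norm f"
  unfolding norm_ell2.rep_eq using assms Rep_ell2[of f]
  by (intro mult_left_mono L2_set_le_sqrt_infsum C0) auto
 finally show ?thesis .
qed

lemma Rep_matching_op: "Rep_ell2 (matching_op D \<beta> t f) = (\<lambda>x. if x \<in> D then t x (Rep_ell2 f (\<beta> x)) else 0)"
proof -
 have "(\<lambda>x. (norm (if x \<in> D then t x (Rep_ell2 f (\<beta> x)) else 0))\<^sup>2) summable_on UNIV"
  unfolding square_summable_iff using matching_op_L2_le by blast
 then show ?thesis unfolding matching_op_def by (subst Abs_ell2_inverse) simp_all
qed

lemma norm_matching_op_le: "norm (matching_op D \<beta> t f) \<le> C * norm f"
 unfolding norm_ell2.rep_eq[of "matching_op D \<beta> t f"] Rep_matching_op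
 by (rule sqrt_infsum_le) (rule matching_op_L2_le)

lemma clinear_matching_op: "bounded_clinear (matching_op D \<beta> t)"
 by (rule bounded_clinearI[where K = C])
  (auto intro!: ell2_eqI simp: Rep_matching_op plus_ell2.rep_eq scaleC_ell2.rep_eq
   clinear_add[OF t] clinear_scaleC[OF t] norm_matching_op_le mult.commute)

lemma matrix_entry_matching_op:
 "matrix_entry (matching_op D \<beta> t) x y = (if x \<in> D \<and> \<beta> x = y then t x else (\<lambda>_. 0))"
 using clinear_zero[OF t]
 by (auto simp: matrix_entry_def Rep_matching_op Rep_ell2_single)

end

text \<open>At most one nonzero block in each row and in each column. For such operators
  \<open>cadjoint V \<circ> V\<close> is block diagonal, which is how their norm in an arbitrary
  representation gets bounded.\<close>

definition matching :: "(('x, 'h::chilbert_space) ell2 \<Rightarrow> ('x, 'h) ell2) \<Rightarrow> bool" where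
 "matching T \<longleftrightarrow>
   (\<forall>x y z. matrix_entry T x y \<noteq> (\<lambda>_. 0) \<longrightarrow> matrix_entry T x z \<noteq> (\<lambda>_. 0) \<longrightarrow> y = z) \<and>
   (\<forall>x y z. matrix_entry T y x \<noteq> (\<lambda>_. 0) \<longrightarrow> matrix_entry T z x \<noteq> (\<lambda>_. 0) \<longrightarrow> y = z)"

section \<open>Algebraic Roe algebras\<close>

lemma carrier_roe_alg:
 "T \<in> carrier (roe_alg X d) \<longleftrightarrow> bounded_clinear T \<and>
    (\<forall>x y. x \<notin> X \<or> y \<notin> X \<longrightarrow> matrix_entry T x y = (\<lambda>_. 0)) \<and>
    (\<forall>x y. compact_operator (matrix_entry T x y)) \<and>
    (\<exists>R>0. \<forall>x\<in>X. \<forall>y\<in>X. d x y \<ge> R \<longrightarrow> matrix_entry T x y = (\<lambda>_. 0))"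
proof -
 have "(\<forall>x y. compact_operator (matrix_entry T x y)) \<longleftrightarrow> (\<forall>x\<in>X. \<forall>y\<in>X. compact_operator (matrix_entry T x y))"
  if "\<forall>x y. x \<notin> X \<or> y \<notin> X \<longrightarrow> matrix_entry T x y = (\<lambda>_. 0)"
 proof (intro iffI allI)
  fix x y assume "\<forall>x\<in>X. \<forall>y\<in>X. compact_operator (matrix_entry T x y)"
  then show "compact_operator (matrix_entry T x y)"
   using that compact_operator_zero by (cases "x \<in> X \<and> y \<in> X") auto
 qed blast
 then show ?thesis by (auto simp: roe_alg_def)
qed

lemma roe_propagation:
 assumes "T \<in> carrier (roe_alg X d)"
 obtains R where "R > 0" "\<And>x y. x \<in> X \<Longrightarrow> y \<in> X \<Longrightarrow> d x y \<ge> R \<Longrightarrow> matrix_entry T x y = (\<lambda>_. 0)"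
 using assms unfolding carrier_roe_alg by blast

lemma roe_alg_simps [simp]:
 "S \<otimes>\<^bsub>roe_alg X d\<^esub> T = S \<circ> T" "S \<oplus>\<^bsub>roe_alg X d\<^esub> T = (\<lambda>v. S v + T v)"
 "c \<odot>\<^bsub>roe_alg X d\<^esub> T = (\<lambda>v. c *\<^sub>C T v)" "\<zero>\<^bsub>roe_alg X d\<^esub> = (\<lambda>_. 0)"
 "involution (roe_alg X d) = cadjoint"
 by (simp_all add: roe_alg_def bounded_ops_def)

lemma roe_bounded: "T \<in> carrier (roe_alg X d) \<Longrightarrow> bounded_clinear T"
 by (simp add: carrier_roe_alg)

locale bounded_geometry_space = Metric_space X d for X :: "'x set" and d +
 assumes bg: "bounded_geometry X d"
begin

lemma ball_card:
 assumes "R > 0"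
 obtains N :: nat where "\<And>x. x \<in> X \<Longrightarrow> finite {y \<in> X. d x y < R}" "\<And>x. x \<in> X \<Longrightarrow> card {y \<in> X. d x y < R} \<le> N"
proof -
 have eq: "mball x R = {y \<in> X. d x y < R}" if "x \<in> X" for x using that by (auto simp: mball_def)
 obtain N :: nat where N: "\<forall>x\<in>X. finite (mball x R) \<and> card (mball x R) \<le> N"
  using bg assms unfolding bounded_geometry_def by blast
 show ?thesis
 proof (rule that[of N])
  fix x assume x: "x \<in> X"
  show "finite {y \<in> X. d x y < R}" "card {y \<in> X. d x y < R} \<le> N"
   using bspec[OF N x] unfolding eq[OF x] by blast+
 qed
qed

lemma finite_ball: "finite {y \<in> X. d x y < R}" if "x \<in> X"
proof (cases "R > 0")
 case True
 then obtain N :: nat where "\<And>x. x \<in> X \<Longrightarrow> finite {y \<in> X. d x y < R}" using ball_card[OF True] by blast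
 then show ?thesis using that by blast
next
 case False
 have "\<not> d x y < R" for y using False nonneg[of x y] by linarith
 then show ?thesis by simp
qed

text \<open>Numbering the points of each ball labels a pair of close points by the number of each of
 them in the ball around the other one; pairs with the same label form a partial injection.\<close>

lemma band_cover:
 assumes "R > 0"
 obtains I :: "(nat \<times> nat) set" and D \<beta> where "finite I"
  "\<And>i. inj_on (\<beta> i) (D i)" "\<And>i. D i \<subseteq> X" "\<And>i. \<beta> i ` D i \<subseteq> X"
  "\<And>i x. x \<in> D i \<Longrightarrow> d x (\<beta> i x) < R"
  "\<And>x y. x \<in> X \<Longrightarrow> y \<in> X \<Longrightarrow> d x y < R \<Longrightarrow> \<exists>!i. i \<in> I \<and> x \<in> D i \<and> \<beta> i x = y"
proof -
 obtain N :: nat where fin: "\<And>x. x \<in> X \<Longrightarrow> finite {y \<in> X. d x y < R}"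
  and card: "\<And>x. x \<in> X \<Longrightarrow> card {y \<in> X. d x y < R} \<le> N"
  using ball_card[OF assms] by metis
 have "\<exists>e. inj_on e {y \<in> X. d x y < R} \<and> e ` {y \<in> X. d x y < R} \<subseteq> {..<N}" if x: "x \<in> X" for x
  using card_le_inj[of "{y \<in> X. d x y < R}" "{..<N}"] fin[OF x] card[OF x] by auto
 then obtain e where e: "\<And>x. x \<in> X \<Longrightarrow> inj_on (e x) {y \<in> X. d x y < R}"
  and eN: "\<And>x. x \<in> X \<Longrightarrow> e x ` {y \<in> X. d x y < R} \<subseteq> {..<N}" by metis
 have einj: "y = z" if "x \<in> X" "y \<in> X" "z \<in> X" "d x y < R" "d x z < R" "e x y = e x z" for x y z
  using inj_onD[OF e[OF that(1)] that(6)] that by simp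
 define P where "P i x y \<longleftrightarrow> x \<in> X \<and> y \<in> X \<and> d x y < R \<and> i = (e x y, e y x)" for i x y
 define D where "D i = {x. \<exists>y. P i x y}" for i
 define \<beta> where "\<beta> i x = (SOME y. P i x y)" for i x
 have \<beta>: "P i x (\<beta> i x)" if "x \<in> D i" for i x
  using that someI_ex[of "P i x"] by (simp add: D_def \<beta>_def)
 have P1: "y = z" if "P i x y" "P i x z" for i x y z
  using that einj[of x y z] by (auto simp: P_def)
 have P2: "x = z" if "P i x y" "P i z y" for i x y z
  using that einj[of y x z] by (auto simp: P_def commute)
 show ?thesis
 proof (rule that[of "{..<N} \<times> {..<N}" \<beta> D])
  show "inj_on (\<beta> i) (D i)" for i
  proof (rule inj_onI)
   fix x y assume "x \<in> D i" "y \<in> D i" "\<beta> i x = \<beta> i y"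
   then show "x = y" using P2[OF \<beta>[of x i], of y] \<beta>[of y i] by simp
  qed
  show "D i \<subseteq> X" "\<beta> i ` D i \<subseteq> X" for i using \<beta> by (auto simp: D_def P_def)
  show "d x (\<beta> i x) < R" if "x \<in> D i" for i x using \<beta>[OF that] by (simp add: P_def)
  fix x y assume xy: "x \<in> X" "y \<in> X" "d x y < R"
  show "\<exists>!i. i \<in> {..<N} \<times> {..<N} \<and> x \<in> D i \<and> \<beta> i x = y"
  proof (rule ex1I[of _ "(e x y, e y x)"])
   have "P (e x y, e y x) x y" using xy by (simp add: P_def)
   moreover from this have "x \<in> D (e x y, e y x)" by (auto simp: D_def)
   moreover from this have "\<beta> (e x y, e y x) x = y" using P1[OF \<beta>] calculation(1) by blast
   moreover have "e x y < N" "e y x < N" using eN[of x] eN[of y] xy commute[of x y] by (auto simp: image_subset_iff)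
   ultimately show "(e x y, e y x) \<in> {..<N} \<times> {..<N} \<and> x \<in> D (e x y, e y x) \<and> \<beta> (e x y, e y x) x = y"
    by simp
   show "i = (e x y, e y x)" if "i \<in> {..<N} \<times> {..<N} \<and> x \<in> D i \<and> \<beta> i x = y" for i
    using \<beta>[of x i] that by (simp add: P_def)
  qed
 qed simp
qed

text \<open>The nonzero entries of column \<open>z\<close> lie in a ball around \<open>z\<close>,
  and bounded geometry makes that ball finite.\<close>

lemma roe_alg_columns:
 assumes "T \<in> carrier (roe_alg X d)"
 obtains F where "finite F" "F \<subseteq> X" "\<And>y. y \<notin> F \<Longrightarrow> matrix_entry T y z = (\<lambda>_. 0)"
proof (cases "z \<in> X")
 case True
 obtain R where R: "\<And>x y. x \<in> X \<Longrightarrow> y \<in> X \<Longrightarrow> d x y \<ge> R \<Longrightarrow> matrix_entry T x y = (\<lambda>_. 0)"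
  using roe_propagation[OF assms] by metis
 show ?thesis
 proof (rule that[OF finite_ball[OF True, of R]])
  fix y assume y: "y \<notin> {y \<in> X. d z y < R}"
  show "matrix_entry T y z = (\<lambda>_. 0)"
  proof (cases "y \<in> X")
   case True
   then show ?thesis using y R[of y z] \<open>z \<in> X\<close> commute[of y z] by simp
  next
   case False
   then show ?thesis using assms by (simp add: carrier_roe_alg)
  qed
 qed auto
next
 case False
 then show ?thesis using assms that[of "{}"] by (auto simp: carrier_roe_alg)
qed

lemma roe_mult_closed:
 assumes S: "S \<in> carrier (roe_alg X d)" and T: "T \<in> carrier (roe_alg X d)"
 shows "S \<circ> T \<in> carrier (roe_alg X d)"
 unfolding carrier_roe_alg
proof (intro conjI allI impI)
 have Sb: "bounded_clinear S" and Tb: "bounded_clinear T" using S T by (auto simp: carrier_roe_alg)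
 show "bounded_clinear (S \<circ> T)" by (rule clinear_comp[OF Sb Tb])
 have z: "matrix_entry S x y 0 = 0" for x y
  using clinear_zero[OF clinear_matrix_entry[OF Sb]] .
 have ent: "\<exists>F\<subseteq>X. finite F \<and> matrix_entry (S \<circ> T) x y = (\<lambda>v. \<Sum>k\<in>F. matrix_entry S x k (matrix_entry T k y v))" for x y
  using roe_alg_columns[OF T, of y] matrix_entry_comp[OF Sb, of _ T y x] by metis
 fix x y
 obtain F where F: "F \<subseteq> X" "finite F"
  "matrix_entry (S \<circ> T) x y = (\<lambda>v. \<Sum>k\<in>F. matrix_entry S x k (matrix_entry T k y v))"
  using ent by blast
 show "matrix_entry (S \<circ> T) x y = (\<lambda>_. 0)" if "x \<notin> X \<or> y \<notin> X"
  unfolding F(3) using S T that z by (auto simp: carrier_roe_alg)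
 show "compact_operator (matrix_entry (S \<circ> T) x y)"
  unfolding F(3)
 proof (rule compact_operator_sum)
  show "compact_operator (\<lambda>v. matrix_entry S x k (matrix_entry T k y v))" for k
   using compact_operator_comp_left[OF clinear_matrix_entry[OF Sb], of "matrix_entry T k y" x k] T
   by (simp add: carrier_roe_alg o_def)
 qed
next
 obtain R1 where R1: "R1 > 0" "\<And>x y. x \<in> X \<Longrightarrow> y \<in> X \<Longrightarrow> d x y \<ge> R1 \<Longrightarrow> matrix_entry S x y = (\<lambda>_. 0)"
  using roe_propagation[OF S] by metis
 obtain R2 where R2: "R2 > 0" "\<And>x y. x \<in> X \<Longrightarrow> y \<in> X \<Longrightarrow> d x y \<ge> R2 \<Longrightarrow> matrix_entry T x y = (\<lambda>_. 0)"
  using roe_propagation[OF T] by metis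
 have Sb: "bounded_clinear S" and Tb: "bounded_clinear T" using S T by (auto simp: carrier_roe_alg)
 have z: "matrix_entry S x y 0 = 0" for x y
  using clinear_zero[OF clinear_matrix_entry[OF Sb]] .
 have "matrix_entry (S \<circ> T) x y = (\<lambda>_. 0)" if xy: "x \<in> X" "y \<in> X" "d x y \<ge> R1 + R2" for x y
 proof -
  obtain F where F: "F \<subseteq> X" "finite F"
   "matrix_entry (S \<circ> T) x y = (\<lambda>v. \<Sum>k\<in>F. matrix_entry S x k (matrix_entry T k y v))"
   using roe_alg_columns[OF T, of y] matrix_entry_comp[OF Sb, of _ T y x] by metis
  have "matrix_entry S x k (matrix_entry T k y v) = 0" if "k \<in> F" for k v
  proof -
   have k: "k \<in> X" using that F(1) by blast
   have "d x y \<le> d x k + d k y" using triangle xy k by blast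
   then consider "d x k \<ge> R1" | "d k y \<ge> R2" using xy(3) by linarith
   then show ?thesis
   proof cases
    case 1
    then show ?thesis using R1(2)[OF xy(1) k] by simp
   next
    case 2
    then show ?thesis using R2(2)[OF k xy(2)] z by simp
   qed
  qed
  then show ?thesis unfolding F(3) by simp
 qed
 then show "\<exists>R>0. \<forall>x\<in>X. \<forall>y\<in>X. R \<le> d x y \<longrightarrow> matrix_entry (S \<circ> T) x y = (\<lambda>_. 0)"
  using R1(1) R2(1) by (intro exI[of _ "R1 + R2"]) auto
qed

lemma roe_cadjoint_closed:
 assumes T: "T \<in> carrier (roe_alg X d)"
 shows "cadjoint T \<in> carrier (roe_alg X d)"
proof -
 have b: "bounded_clinear T" using T by (rule roe_bounded)
 obtain R where R: "R > 0" "\<And>x y. x \<in> X \<Longrightarrow> y \<in> X \<Longrightarrow> d x y \<ge> R \<Longrightarrow> matrix_entry T x y = (\<lambda>_. 0)"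
  using roe_propagation[OF T] by metis
 show ?thesis
  unfolding carrier_roe_alg matrix_entry_cadjoint[OF b]
 proof (intro conjI allI impI)
  show "\<exists>R>0. \<forall>x\<in>X. \<forall>y\<in>X. R \<le> d x y \<longrightarrow> cadjoint (matrix_entry T y x) = (\<lambda>_. 0)"
   using R commute by (intro exI[of _ R]) (simp add: cadjoint_zero)
 qed (use T in \<open>auto simp: carrier_roe_alg cadjoint_zero intro: compact_operator_cadjoint bounded_clinear_cadjoint\<close>)
qed

lemma roe_add_closed:
 assumes "S \<in> carrier (roe_alg X d)" "T \<in> carrier (roe_alg X d)"
 shows "(\<lambda>v. S v + T v) \<in> carrier (roe_alg X d)"
proof -
 obtain R1 where R1: "R1 > 0" "\<And>x y. x \<in> X \<Longrightarrow> y \<in> X \<Longrightarrow> d x y \<ge> R1 \<Longrightarrow> matrix_entry S x y = (\<lambda>_. 0)"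
  using roe_propagation[OF assms(1)] by metis
 obtain R2 where R2: "R2 > 0" "\<And>x y. x \<in> X \<Longrightarrow> y \<in> X \<Longrightarrow> d x y \<ge> R2 \<Longrightarrow> matrix_entry T x y = (\<lambda>_. 0)"
  using roe_propagation[OF assms(2)] by metis
 show ?thesis
  unfolding carrier_roe_alg matrix_entry_plus
 proof (intro conjI allI impI)
  show "\<exists>R>0. \<forall>x\<in>X. \<forall>y\<in>X. R \<le> d x y \<longrightarrow> (\<lambda>v. matrix_entry S x y v + matrix_entry T x y v) = (\<lambda>_. 0)"
   using R1 R2 by (intro exI[of _ "R1 + R2"]) auto
 qed (use assms in \<open>auto simp: carrier_roe_alg intro: compact_operator_add clinear_plus\<close>)
qed

lemma roe_scale_closed:
 "T \<in> carrier (roe_alg X d) \<Longrightarrow> (\<lambda>v. c *\<^sub>C T v) \<in> carrier (roe_alg X d)"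
 unfolding carrier_roe_alg matrix_entry_cmult
 by (auto intro: clinear_cmult compact_operator_scaleC)

lemma roe_zero_closed: "(\<lambda>_. 0) \<in> carrier (roe_alg X d)"
 unfolding carrier_roe_alg by (auto intro: clinear_const_0 compact_operator_zero exI[of _ 1])

lemma roe_sum_closed:
 "(\<And>i. i \<in> I \<Longrightarrow> T i \<in> carrier (roe_alg X d)) \<Longrightarrow> (\<lambda>v. \<Sum>i\<in>I. T i v) \<in> carrier (roe_alg X d)"
 by (induction I rule: infinite_finite_induct) (auto intro: roe_zero_closed roe_add_closed)

text \<open>The mask \<open>E\<close> is arbitrary. Deleting entries of a bounded matrix can destroy
  boundedness in general, but a summand supported on a partial injection stays bounded by the norm
  of \<open>T\<close> under any deletion, and finitely many labels cover all entries. The constant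
  mask splits \<open>T\<close> into matching operators; a general mask restricts
  \<open>T\<close>.\<close>

lemma roe_alg_matching_decomposition:
 assumes T: "T \<in> carrier (roe_alg X d)"
 obtains I :: "(nat \<times> nat) set" and V where "finite I"
  "\<And>i. V i \<in> carrier (roe_alg X d)" "\<And>i. matching (V i)"
  "\<And>x y v. (\<Sum>i\<in>I. matrix_entry (V i) x y v) = (if E x y then matrix_entry T x y v else 0)"
proof -
 have b: "bounded_clinear T" using T by (rule roe_bounded)
 obtain R where R: "R > 0" "\<And>x y. x \<in> X \<Longrightarrow> y \<in> X \<Longrightarrow> d x y \<ge> R \<Longrightarrow> matrix_entry T x y = (\<lambda>_. 0)"
  using roe_propagation[OF T] by metis
 obtain I :: "(nat \<times> nat) set" and D \<beta> where I: "finite I"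
  and inj: "\<And>i. inj_on (\<beta> i) (D i)" and D: "\<And>i. D i \<subseteq> X" "\<And>i. \<beta> i ` D i \<subseteq> X"
  and DR: "\<And>i x. x \<in> D i \<Longrightarrow> d x (\<beta> i x) < R"
  and ex1: "\<And>x y. x \<in> X \<Longrightarrow> y \<in> X \<Longrightarrow> d x y < R \<Longrightarrow> \<exists>!i. i \<in> I \<and> x \<in> D i \<and> \<beta> i x = y"
  using band_cover[OF R(1)] by metis
 define D' where "D' i = {x \<in> D i. E x (\<beta> i x)}" for i
 define V where "V i = matching_op (D' i) (\<beta> i) (\<lambda>x. matrix_entry T x (\<beta> i x))" for i
 have inj': "inj_on (\<beta> i) (D' i)" for i using inj by (rule inj_on_subset) (auto simp: D'_def)
 note m = inj' clinear_matrix_entry[OF b] norm_matrix_entry_le[OF b] onorm_nonneg[OF b]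
 have ent: "matrix_entry (V i) x y = (if x \<in> D' i \<and> \<beta> i x = y then matrix_entry T x y else (\<lambda>_. 0))" for i x y
  unfolding V_def by (subst matrix_entry_matching_op[OF m]) auto
 have V: "V i \<in> carrier (roe_alg X d)" for i
  unfolding carrier_roe_alg
 proof (intro conjI allI impI)
  show "bounded_clinear (V i)" unfolding V_def by (rule clinear_matching_op[OF m])
  show "\<exists>R>0. \<forall>x\<in>X. \<forall>y\<in>X. R \<le> d x y \<longrightarrow> matrix_entry (V i) x y = (\<lambda>_. 0)"
   using R by (intro exI[of _ R]) (auto simp: ent)
  show "matrix_entry (V i) x y = (\<lambda>_. 0)" if "x \<notin> X \<or> y \<notin> X" for x y
   using that D[of i] by (auto simp: ent D'_def)
  show "compact_operator (matrix_entry (V i) x y)" for x y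
   using T by (auto simp: ent carrier_roe_alg compact_operator_zero)
 qed
 have mt: "matching (V i)" for i
 proof -
  have "x \<in> D' i \<and> \<beta> i x = y" if "matrix_entry (V i) x y \<noteq> (\<lambda>_. 0)" for x y
   using that by (metis ent)
  then show ?thesis unfolding matching_def using inj_onD[OF inj'[of i]] by metis
 qed
 have "(\<Sum>i\<in>I. matrix_entry (V i) x y v) = (if E x y then matrix_entry T x y v else 0)" for x y v
 proof (cases "x \<in> X \<and> y \<in> X \<and> d x y < R")
  case True
  then obtain i where i: "i \<in> I" "x \<in> D i" "\<beta> i x = y"
   and u: "\<And>j. j \<in> I \<Longrightarrow> x \<in> D j \<Longrightarrow> \<beta> j x = y \<Longrightarrow> j = i" using ex1[of x y] by blast
  have "(\<Sum>i\<in>I. matrix_entry (V i) x y v) = (\<Sum>j\<in>I. if j = i then if E x y then matrix_entry T x y v else 0 else 0)"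
  proof (rule sum.cong[OF refl])
   fix j assume j: "j \<in> I"
   show "matrix_entry (V j) x y v = (if j = i then if E x y then matrix_entry T x y v else 0 else 0)"
   proof (cases "j = i")
    case True
    then show ?thesis using i by (simp add: ent D'_def)
   next
    case False
    then have "\<not> (x \<in> D' j \<and> \<beta> j x = y)" using u[OF j] unfolding D'_def by blast
    then show ?thesis using False by (simp only: ent if_False)
   qed
  qed
  then show ?thesis using I i(1) by simp
 next
  case False
  have "matrix_entry (V i) x y v = 0" for i
  proof -
   have "\<not> (x \<in> D' i \<and> \<beta> i x = y)"
    using False subsetD[OF D(1)[of i]] subsetD[OF D(2)[of i] imageI] DR[of x i] unfolding D'_def by blast
   then show ?thesis by (simp only: ent if_False)
  qed
  moreover have "matrix_entry T x y v = 0"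
   using False T R(2)[of x y] by (cases "x \<in> X \<and> y \<in> X") (auto simp: carrier_roe_alg)
  ultimately show ?thesis by simp
 qed
 with I V mt show ?thesis by (rule that)
qed

lemma roe_alg_restrict:
 assumes T: "T \<in> carrier (roe_alg X d)"
 obtains S where "S \<in> carrier (roe_alg X d)"
  "\<And>x y. matrix_entry S x y = (if E x y then matrix_entry T x y else (\<lambda>_. 0))"
proof -
 obtain I :: "(nat \<times> nat) set" and V where *: "finite I"
  "\<And>i. V i \<in> carrier (roe_alg X d)" "\<And>i. matching (V i)"
  "\<And>x y v. (\<Sum>i\<in>I. matrix_entry (V i) x y v) = (if E x y then matrix_entry T x y v else 0)"
  using roe_alg_matching_decomposition[OF T, of E] by metis
 show ?thesis
  by (rule that[of "\<lambda>v. \<Sum>i\<in>I. V i v"]) (auto intro!: roe_sum_closed * simp: matrix_entry_sum *)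
qed

lemma roe_alg_matching_sum:
 assumes T: "T \<in> carrier (roe_alg X d)"
 obtains I :: "(nat \<times> nat) set" and V where "finite I"
  "\<And>i. V i \<in> carrier (roe_alg X d)" "\<And>i. matching (V i)" "T = (\<lambda>v. \<Sum>i\<in>I. V i v)"
proof -
 obtain I :: "(nat \<times> nat) set" and V where *: "finite I"
  "\<And>i. V i \<in> carrier (roe_alg X d)" "\<And>i. matching (V i)"
  "\<And>x y v. (\<Sum>i\<in>I. matrix_entry (V i) x y v) = (if True then matrix_entry T x y v else 0)"
  using roe_alg_matching_decomposition[OF T, of "\<lambda>_ _. True"] by metis
 have "T = (\<lambda>v. \<Sum>i\<in>I. V i v)"
  by (intro operator_eqI roe_bounded[OF T] clinear_setsum
    roe_bounded[OF *(2)]) (use *(4) in \<open>simp add: matrix_entry_sum\<close>)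
 with *(1-3) show ?thesis by (rule that)
qed

end

text \<open>A row of \<open>V\<close> cannot have nonzero blocks in both columns \<open>x\<close>
  and \<open>z\<close>, so every summand of the product vanishes.\<close>

lemma matching_cadjoint_comp_diagonal:
 assumes V: "bounded_clinear V" "matching V" and ne: "x \<noteq> z"
 shows "matrix_entry (cadjoint V \<circ> V) x z = (\<lambda>_. 0)"
proof -
 define F where "F = {y. matrix_entry V y z \<noteq> (\<lambda>_. 0)}"
 have cV: "bounded_clinear (cadjoint V)" by (rule bounded_clinear_cadjoint[OF V(1)])
 \<comment> \<open>Column \<open>z\<close> has at most one nonzero block, so the set
   \<open>F\<close> of its rows is finite and the product formula applies.\<close>
 have "F \<subseteq> {SOME y. matrix_entry V y z \<noteq> (\<lambda>_. 0)}"
 proof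
  fix y assume "y \<in> F"
  then have y: "matrix_entry V y z \<noteq> (\<lambda>_. 0)" by (simp add: F_def)
  have "matrix_entry V (SOME y. matrix_entry V y z \<noteq> (\<lambda>_. 0)) z \<noteq> (\<lambda>_. 0)"
   using y by (rule someI)
  then have "y = (SOME y. matrix_entry V y z \<noteq> (\<lambda>_. 0))"
   using V(2) y unfolding matching_def by (metis (no_types, lifting))
  then show "y \<in> {SOME y. matrix_entry V y z \<noteq> (\<lambda>_. 0)}" by simp
 qed
 then have "finite F" by (rule finite_subset) simp
 then have "matrix_entry (cadjoint V \<circ> V) x z = (\<lambda>v. \<Sum>y\<in>F. matrix_entry (cadjoint V) x y (matrix_entry V y z v))"
  by (intro matrix_entry_comp[OF cV]) (auto simp: F_def)
 also have "\<dots> = (\<lambda>v. 0)"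
 proof
  fix v
  have "matrix_entry (cadjoint V) x y (matrix_entry V y z v) = 0" if "y \<in> F" for y
  proof -
   have "matrix_entry V y x = (\<lambda>_. 0)" using that V(2) ne unfolding matching_def F_def by blast
   then show ?thesis by (simp add: matrix_entry_cadjoint[OF V(1)] cadjoint_zero)
  qed
  then show "(\<Sum>y\<in>F. matrix_entry (cadjoint V) x y (matrix_entry V y z v)) = 0" by simp
 qed
 finally show ?thesis .
qed

section \<open>Star algebras\<close>

text \<open>The linear laws together with closure under product and involution. The algebraic
  crossed product and the algebra of Cauchy sequences are treated at this level; the multiplicative
  laws of their completions are derived from representations instead.\<close>

locale star_space =
 fixes A :: "('a, 'm) star_alg_scheme" (structure)
 assumes add_closed: "x \<in> carrier A \<Longrightarrow> y \<in> carrier A \<Longrightarrow> x \<oplus> y \<in> carrier A"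
  and zero_in_carrier: "\<zero> \<in> carrier A"
  and add_assoc: "x \<in> carrier A \<Longrightarrow> y \<in> carrier A \<Longrightarrow> z \<in> carrier A \<Longrightarrow> (x \<oplus> y) \<oplus> z = x \<oplus> (y \<oplus> z)"
  and add_comm: "x \<in> carrier A \<Longrightarrow> y \<in> carrier A \<Longrightarrow> x \<oplus> y = y \<oplus> x"
  and zero_add: "x \<in> carrier A \<Longrightarrow> \<zero> \<oplus> x = x"
  and smult_closed: "x \<in> carrier A \<Longrightarrow> c \<odot> x \<in> carrier A"
  and smult_add_right: "x \<in> carrier A \<Longrightarrow> y \<in> carrier A \<Longrightarrow> c \<odot> (x \<oplus> y) = c \<odot> x \<oplus> c \<odot> y"
  and smult_add_left: "x \<in> carrier A \<Longrightarrow> (b + c) \<odot> x = b \<odot> x \<oplus> c \<odot> x"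
  and smult_smult: "x \<in> carrier A \<Longrightarrow> b \<odot> (c \<odot> x) = (b * c) \<odot> x"
  and smult_1: "x \<in> carrier A \<Longrightarrow> 1 \<odot> x = x"
  and smult_0: "x \<in> carrier A \<Longrightarrow> 0 \<odot> x = \<zero>"
  and mult_closed: "x \<in> carrier A \<Longrightarrow> y \<in> carrier A \<Longrightarrow> x \<otimes> y \<in> carrier A"
  and involution_closed: "x \<in> carrier A \<Longrightarrow> involution A x \<in> carrier A"
begin

sublocale abelian_group A
proof (rule abelian_groupI)
 fix x assume x: "x \<in> carrier A"
 have "(- 1) \<odot> x \<oplus> x = (- 1 + 1) \<odot> x" using x by (simp only: smult_add_left smult_1)
 then show "\<exists>y\<in>carrier A. y \<oplus> x = \<zero>" using x by (auto intro!: bexI[of _ "(-1) \<odot> x"] smult_closed simp: smult_0)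
qed (auto intro: add_closed zero_in_carrier add_assoc add_comm zero_add)

lemma a_inv_eq_smult: "x \<in> carrier A \<Longrightarrow> \<ominus> x = (- 1) \<odot> x"
proof -
 assume x: "x \<in> carrier A"
 have "(- 1) \<odot> x \<oplus> x = (- 1 + 1) \<odot> x" using x by (simp only: smult_add_left smult_1)
 then have "(- 1) \<odot> x \<oplus> x = \<zero>" using x by (simp add: smult_0)
 then show ?thesis using x by (intro minus_equality smult_closed)
qed

lemma minus_eq_smult: "x \<in> carrier A \<Longrightarrow> y \<in> carrier A \<Longrightarrow> x \<ominus> y = x \<oplus> (- 1) \<odot> y"
 by (simp add: a_minus_def a_inv_eq_smult)

lemma diff_closed: "x \<in> carrier A \<Longrightarrow> y \<in> carrier A \<Longrightarrow> x \<ominus> y \<in> carrier A"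
 by (rule minus_closed)

lemma minus_self: "x \<in> carrier A \<Longrightarrow> x \<ominus> x = \<zero>"
 by (simp add: a_minus_def r_neg)

lemma smult_zero_right: "c \<odot> \<zero> = \<zero>"
 using smult_smult[OF zero_in_carrier, of c 0] by (simp add: smult_0 zero_in_carrier)

lemma smult_minus: "x \<in> carrier A \<Longrightarrow> y \<in> carrier A \<Longrightarrow> c \<odot> (x \<ominus> y) = c \<odot> x \<ominus> c \<odot> y"
 by (simp add: minus_eq_smult smult_closed smult_add_right smult_smult mult.commute)

lemma eq_of_minus_zero: "x \<in> carrier A \<Longrightarrow> y \<in> carrier A \<Longrightarrow> x \<ominus> y = \<zero> \<Longrightarrow> x = y"
 by (metis a_inv_closed a_minus_def minus_equality minus_minus)

lemma add_minus_cancel: "x \<in> carrier A \<Longrightarrow> y \<in> carrier A \<Longrightarrow> (x \<ominus> y) \<oplus> y = x"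
 by (simp add: a_minus_def a_assoc l_neg)

lemma minus_add_cancel: "x \<in> carrier A \<Longrightarrow> y \<in> carrier A \<Longrightarrow> (x \<oplus> y) \<ominus> y = x"
 by (simp add: a_minus_def a_assoc r_neg)

lemma minus_minus_add: "x \<in> carrier A \<Longrightarrow> y \<in> carrier A \<Longrightarrow> z \<in> carrier A \<Longrightarrow> x \<ominus> z = (x \<ominus> y) \<oplus> (y \<ominus> z)"
proof -
 assume c: "x \<in> carrier A" "y \<in> carrier A" "z \<in> carrier A"
 then have "(x \<ominus> y) \<oplus> (y \<ominus> z) = ((x \<ominus> y) \<oplus> y) \<oplus> \<ominus> z" by (simp add: a_minus_def[of _ y z] a_assoc)
 also have "\<dots> = x \<ominus> z" using c by (simp add: add_minus_cancel a_minus_def[of _ x z])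
 finally show ?thesis ..
qed

lemma add_minus_add:
 assumes c: "x \<in> carrier A" "y \<in> carrier A" "x' \<in> carrier A" "y' \<in> carrier A"
 shows "(x \<oplus> y) \<ominus> (x' \<oplus> y') = (x \<ominus> x') \<oplus> (y \<ominus> y')"
 using c by (simp add: a_minus_def minus_add a_ac)

lemma a_inv_minus: "x \<in> carrier A \<Longrightarrow> y \<in> carrier A \<Longrightarrow> (- 1) \<odot> (x \<ominus> y) = y \<ominus> x"
 by (simp add: a_inv_eq_smult[symmetric] a_minus_def minus_add a_comm)

end

locale star_ring_space = star_space +
 assumes distrib_right: "x \<in> carrier A \<Longrightarrow> y \<in> carrier A \<Longrightarrow> z \<in> carrier A \<Longrightarrow> (x \<oplus> y) \<otimes> z = x \<otimes> z \<oplus> y \<otimes> z"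
  and distrib_left: "x \<in> carrier A \<Longrightarrow> y \<in> carrier A \<Longrightarrow> z \<in> carrier A \<Longrightarrow> x \<otimes> (y \<oplus> z) = x \<otimes> y \<oplus> x \<otimes> z"
  and smult_mult_left: "x \<in> carrier A \<Longrightarrow> y \<in> carrier A \<Longrightarrow> (c \<odot> x) \<otimes> y = c \<odot> (x \<otimes> y)"
  and smult_mult_right: "x \<in> carrier A \<Longrightarrow> y \<in> carrier A \<Longrightarrow> x \<otimes> (c \<odot> y) = c \<odot> (x \<otimes> y)"
  and involution_add: "x \<in> carrier A \<Longrightarrow> y \<in> carrier A \<Longrightarrow> involution A (x \<oplus> y) = involution A x \<oplus> involution A y"
  and involution_smult: "x \<in> carrier A \<Longrightarrow> involution A (c \<odot> x) = cnj c \<odot> involution A x"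
  and involution_mult: "x \<in> carrier A \<Longrightarrow> y \<in> carrier A \<Longrightarrow> involution A (x \<otimes> y) = involution A y \<otimes> involution A x"
  and involution_involution: "x \<in> carrier A \<Longrightarrow> involution A (involution A x) = x"
begin

lemma mult_minus_left:
 "x \<in> carrier A \<Longrightarrow> y \<in> carrier A \<Longrightarrow> z \<in> carrier A \<Longrightarrow> (x \<ominus> y) \<otimes> z = x \<otimes> z \<ominus> y \<otimes> z"
 by (simp add: minus_eq_smult smult_closed mult_closed distrib_right smult_mult_left)

lemma mult_minus_right:
 "x \<in> carrier A \<Longrightarrow> y \<in> carrier A \<Longrightarrow> z \<in> carrier A \<Longrightarrow> z \<otimes> (x \<ominus> y) = z \<otimes> x \<ominus> z \<otimes> y"
 by (simp add: minus_eq_smult smult_closed mult_closed distrib_left smult_mult_right)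

lemma involution_minus:
 "x \<in> carrier A \<Longrightarrow> y \<in> carrier A \<Longrightarrow> involution A (x \<ominus> y) = involution A x \<ominus> involution A y"
 by (simp add: minus_eq_smult smult_closed involution_closed involution_add involution_smult)

lemma mult_minus_mult:
 assumes c: "x \<in> carrier A" "y \<in> carrier A" "x' \<in> carrier A" "y' \<in> carrier A"
 shows "x \<otimes> y \<ominus> x' \<otimes> y' = (x \<ominus> x') \<otimes> y \<oplus> x' \<otimes> (y \<ominus> y')"
 using c minus_minus_add[of "x \<otimes> y" "x' \<otimes> y" "x' \<otimes> y'"]
 by (simp add: mult_minus_left mult_minus_right mult_closed)

end

definition linear_map :: "('a, 'm) star_alg_scheme \<Rightarrow> ('b, 'n) star_alg_scheme \<Rightarrow> ('a \<Rightarrow> 'b) \<Rightarrow> bool" where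
 "linear_map A B f \<longleftrightarrow>
   f \<in> carrier A \<rightarrow> carrier B \<and>
   (\<forall>a\<in>carrier A. \<forall>b\<in>carrier A. f (a \<oplus>\<^bsub>A\<^esub> b) = f a \<oplus>\<^bsub>B\<^esub> f b) \<and>
   (\<forall>c. \<forall>a\<in>carrier A. f (c \<odot>\<^bsub>A\<^esub> a) = c \<odot>\<^bsub>B\<^esub> f a)"

lemma star_hom_linear: "star_hom A B f \<Longrightarrow> linear_map A B f"
 by (simp add: star_hom_def linear_map_def)

lemma star_hom_iff:
 "star_hom A B f \<longleftrightarrow> linear_map A B f \<and>
   (\<forall>a\<in>carrier A. \<forall>b\<in>carrier A. f (a \<otimes>\<^bsub>A\<^esub> b) = f a \<otimes>\<^bsub>B\<^esub> f b) \<and>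
   (\<forall>a\<in>carrier A. f (involution A a) = involution B (f a))"
 by (auto simp: star_hom_def linear_map_def)

lemma linear_map_closed: "linear_map A B f \<Longrightarrow> x \<in> carrier A \<Longrightarrow> f x \<in> carrier B"
 by (auto simp: linear_map_def)

lemma linear_map_add: "linear_map A B f \<Longrightarrow> x \<in> carrier A \<Longrightarrow> y \<in> carrier A \<Longrightarrow> f (x \<oplus>\<^bsub>A\<^esub> y) = f x \<oplus>\<^bsub>B\<^esub> f y"
 by (auto simp: linear_map_def)

lemma linear_map_smult: "linear_map A B f \<Longrightarrow> x \<in> carrier A \<Longrightarrow> f (c \<odot>\<^bsub>A\<^esub> x) = c \<odot>\<^bsub>B\<^esub> f x"
 by (auto simp: linear_map_def)

lemma linear_map_comp: "linear_map A B f \<Longrightarrow> linear_map B C g \<Longrightarrow> linear_map A C (g \<circ> f)"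
 by (auto simp: linear_map_def Pi_iff)

lemma star_hom_comp: "star_hom A B f \<Longrightarrow> star_hom B C g \<Longrightarrow> star_hom A C (g \<circ> f)"
 by (auto simp: star_hom_def Pi_iff)

lemma star_hom_closed: "star_hom A B f \<Longrightarrow> x \<in> carrier A \<Longrightarrow> f x \<in> carrier B"
 by (auto simp: star_hom_def)

lemma star_hom_mult: "star_hom A B f \<Longrightarrow> x \<in> carrier A \<Longrightarrow> y \<in> carrier A \<Longrightarrow> f (x \<otimes>\<^bsub>A\<^esub> y) = f x \<otimes>\<^bsub>B\<^esub> f y"
 by (auto simp: star_hom_def)

lemma star_hom_involution: "star_hom A B f \<Longrightarrow> x \<in> carrier A \<Longrightarrow> f (involution A x) = involution B (f x)"
 by (auto simp: star_hom_def)

lemma linear_map_minus: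
 assumes "star_space A" "star_space B" "linear_map A B f" "x \<in> carrier A" "y \<in> carrier A"
 shows "f (x \<ominus>\<^bsub>A\<^esub> y) = f x \<ominus>\<^bsub>B\<^esub> f y"
 using assms
 by (simp add: star_space.minus_eq_smult star_space.smult_closed linear_map_add linear_map_smult linear_map_closed)

lemma linear_map_zero:
 assumes "star_space A" "star_space B" "linear_map A B f"
 shows "f \<zero>\<^bsub>A\<^esub> = \<zero>\<^bsub>B\<^esub>"
 using linear_map_smult[OF assms(3) star_space.zero_in_carrier[OF assms(1)], of 0]
 by (simp add: star_space.smult_0[OF assms(1)] star_space.smult_0[OF assms(2)]
   star_space.zero_in_carrier[OF assms(1)] linear_map_closed[OF assms(3)])

text \<open>Well-definedness of \<open>\<sigma>\<close> on the image is absorbed into the equation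
  \<open>\<sigma> (f a) = \<rho> a\<close>. The lemma serves the maps induced on completions and on
  quotients, and the descent of a representation to C[X_G].\<close>

lemma star_hom_factor:
 assumes D: "star_space D" and f: "star_hom D B f" and surj: "\<And>b. b \<in> carrier B \<Longrightarrow> \<exists>a\<in>carrier D. b = f a"
  and \<rho>: "star_hom D E \<rho>" and \<sigma>: "\<And>a. a \<in> carrier D \<Longrightarrow> \<sigma> (f a) = \<rho> a"
 shows "star_hom B E \<sigma>"
proof -
 interpret D: star_space D by fact
 note fl = star_hom_linear[OF f] and \<rho>l = star_hom_linear[OF \<rho>]
 show ?thesis
  unfolding star_hom_def
 proof (intro conjI ballI allI)
  show "\<sigma> \<in> carrier B \<rightarrow> carrier E"
  proof
   fix b assume "b \<in> carrier B"
   then obtain a where "a \<in> carrier D" "b = f a" using surj by blast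
   then show "\<sigma> b \<in> carrier E" using star_hom_closed[OF \<rho>] \<sigma> by simp
  qed
  fix b c assume "b \<in> carrier B"
  then obtain a where a: "a \<in> carrier D" "b = f a" using surj by blast
  have "\<sigma> (f (c \<odot>\<^bsub>D\<^esub> a)) = c \<odot>\<^bsub>E\<^esub> \<sigma> (f a)"
   using a(1) by (simp only: \<sigma> D.smult_closed linear_map_smult[OF \<rho>l])
  then show "\<sigma> (c \<odot>\<^bsub>B\<^esub> b) = c \<odot>\<^bsub>E\<^esub> \<sigma> b" using a by (simp add: linear_map_smult[OF fl])
  have "\<sigma> (f (involution D a)) = involution E (\<sigma> (f a))"
   using a(1) by (simp only: \<sigma> D.involution_closed star_hom_involution[OF \<rho>])
  then show "\<sigma> (involution B b) = involution E (\<sigma> b)" using a by (simp add: star_hom_involution[OF f])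
  fix b' assume "b' \<in> carrier B"
  then obtain a' where a': "a' \<in> carrier D" "b' = f a'" using surj by blast
  have "\<sigma> (f (a \<oplus>\<^bsub>D\<^esub> a')) = \<sigma> (f a) \<oplus>\<^bsub>E\<^esub> \<sigma> (f a')"
   using a(1) a'(1) by (simp only: \<sigma> D.add_closed linear_map_add[OF \<rho>l])
  then show "\<sigma> (b \<oplus>\<^bsub>B\<^esub> b') = \<sigma> b \<oplus>\<^bsub>E\<^esub> \<sigma> b'" using a a' by (simp add: linear_map_add[OF fl])
  have "\<sigma> (f (a \<otimes>\<^bsub>D\<^esub> a')) = \<sigma> (f a) \<otimes>\<^bsub>E\<^esub> \<sigma> (f a')"
   using a(1) a'(1) by (simp only: \<sigma> D.mult_closed star_hom_mult[OF \<rho>])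
  then show "\<sigma> (b \<otimes>\<^bsub>B\<^esub> b') = \<sigma> b \<otimes>\<^bsub>E\<^esub> \<sigma> b'" using a a' by (simp add: star_hom_mult[OF f])
 qed
qed

section \<open>Banach star algebras\<close>

text \<open>No C*-identity is imposed: submultiplicativity and an isometric involution pass directly
  to completions and to quotients by closed star ideals.\<close>

locale normed_star = star_ring_space C for C :: "('c, 'm) normed_star_alg_scheme" (structure) +
 assumes norm_nonneg: "x \<in> carrier C \<Longrightarrow> 0 \<le> alg_norm C x"
  and norm_eq_0: "x \<in> carrier C \<Longrightarrow> alg_norm C x = 0 \<Longrightarrow> x = \<zero>"
  and norm_add: "x \<in> carrier C \<Longrightarrow> y \<in> carrier C \<Longrightarrow> alg_norm C (x \<oplus> y) \<le> alg_norm C x + alg_norm C y"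
  and norm_smult: "x \<in> carrier C \<Longrightarrow> alg_norm C (c \<odot> x) = cmod c * alg_norm C x"
  and norm_mult: "x \<in> carrier C \<Longrightarrow> y \<in> carrier C \<Longrightarrow> alg_norm C (x \<otimes> y) \<le> alg_norm C x * alg_norm C y"
  and norm_involution: "x \<in> carrier C \<Longrightarrow> alg_norm C (involution C x) = alg_norm C x"
begin

abbreviation "nrm \<equiv> alg_norm C"

definition conv :: "(nat \<Rightarrow> 'c) \<Rightarrow> 'c \<Rightarrow> bool" where
 "conv s a \<longleftrightarrow> range s \<subseteq> carrier C \<and> a \<in> carrier C \<and> (\<lambda>n. nrm (s n \<ominus> a)) \<longlonglongrightarrow> 0"

definition cauchy :: "(nat \<Rightarrow> 'c) \<Rightarrow> bool" where
 "cauchy s \<longleftrightarrow> range s \<subseteq> carrier C \<and> (\<forall>e>0. \<exists>M. \<forall>m\<ge>M. \<forall>n\<ge>M. nrm (s m \<ominus> s n) < e)"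

lemma norm_zero: "nrm \<zero> = 0"
 using norm_smult[OF zero_in_carrier, of 0] by (simp add: smult_0 zero_in_carrier)

lemma norm_minus_commute: "x \<in> carrier C \<Longrightarrow> y \<in> carrier C \<Longrightarrow> nrm (x \<ominus> y) = nrm (y \<ominus> x)"
 using norm_smult[of "x \<ominus> y" "-1"] by (simp add: diff_closed a_inv_minus)

lemma norm_triangle:
 "x \<in> carrier C \<Longrightarrow> y \<in> carrier C \<Longrightarrow> z \<in> carrier C \<Longrightarrow> nrm (x \<ominus> z) \<le> nrm (x \<ominus> y) + nrm (y \<ominus> z)"
 using norm_add[of "x \<ominus> y" "y \<ominus> z"] by (simp add: diff_closed minus_minus_add[of x y z])

lemma norm_le_minus_add:
 "x \<in> carrier C \<Longrightarrow> y \<in> carrier C \<Longrightarrow> nrm x \<le> nrm (x \<ominus> y) + nrm y"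
 using norm_add[of "x \<ominus> y" y] by (simp add: diff_closed add_minus_cancel)

lemma norm_diff_le:
 assumes "x \<in> carrier C" "y \<in> carrier C"
 shows "\<bar>nrm x - nrm y\<bar> \<le> nrm (x \<ominus> y)"
 using norm_le_minus_add[of x y] norm_le_minus_add[of y x] norm_minus_commute[of x y] assms by linarith

lemma norm_mult_diff:
 assumes c: "x \<in> carrier C" "y \<in> carrier C" "x' \<in> carrier C" "y' \<in> carrier C"
 shows "nrm (x \<otimes> y \<ominus> x' \<otimes> y')
  \<le> nrm (x \<ominus> x') * nrm y + nrm x' * nrm (y \<ominus> y')"
proof -
 have "nrm (x \<otimes> y \<ominus> x' \<otimes> y') \<le> nrm ((x \<ominus> x') \<otimes> y) + nrm (x' \<otimes> (y \<ominus> y'))"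
  using c by (simp add: mult_minus_mult norm_add mult_closed diff_closed)
 also have "\<dots> \<le> nrm (x \<ominus> x') * nrm y + nrm x' * nrm (y \<ominus> y')"
  using c by (intro add_mono norm_mult diff_closed)
 finally show ?thesis .
qed

lemma eq_if_norm_minus_0: "x \<in> carrier C \<Longrightarrow> y \<in> carrier C \<Longrightarrow> nrm (x \<ominus> y) = 0 \<Longrightarrow> x = y"
 by (rule eq_of_minus_zero, assumption, assumption, rule norm_eq_0[OF diff_closed])

lemma conv_carrier: "conv s a \<Longrightarrow> s n \<in> carrier C" "conv s a \<Longrightarrow> a \<in> carrier C"
 by (auto simp: conv_def)

lemma convI: "(\<And>n. s n \<in> carrier C) \<Longrightarrow> a \<in> carrier C \<Longrightarrow> (\<lambda>n. nrm (s n \<ominus> a)) \<longlonglongrightarrow> 0 \<Longrightarrow> conv s a"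
 by (auto simp: conv_def)

lemma convI_le:
 assumes "\<And>n. s n \<in> carrier C" "a \<in> carrier C" "\<And>n. nrm (s n \<ominus> a) \<le> f n" "f \<longlonglongrightarrow> 0"
 shows "conv s a"
proof (rule convI[OF assms(1,2)])
 show "(\<lambda>n. nrm (s n \<ominus> a)) \<longlonglongrightarrow> 0"
  by (rule tendsto_sandwich[OF _ _ tendsto_const assms(4)])
   (use assms(1-3) in \<open>auto intro!: always_eventually norm_nonneg diff_closed\<close>)
qed

lemma conv_tendsto: "conv s a \<Longrightarrow> (\<lambda>n. nrm (s n \<ominus> a)) \<longlonglongrightarrow> 0"
 by (simp add: conv_def)

lemma conv_const: "a \<in> carrier C \<Longrightarrow> conv (\<lambda>_. a) a"
 by (rule convI) (auto simp: minus_self norm_zero)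

lemma conv_add:
 assumes "conv s a" "conv t b"
 shows "conv (\<lambda>n. s n \<oplus> t n) (a \<oplus> b)"
proof (rule convI_le)
 show "(\<lambda>n. nrm (s n \<ominus> a) + nrm (t n \<ominus> b)) \<longlonglongrightarrow> 0"
  using tendsto_add[OF conv_tendsto[OF assms(1)] conv_tendsto[OF assms(2)]] by simp
 show "nrm (s n \<oplus> t n \<ominus> (a \<oplus> b)) \<le> nrm (s n \<ominus> a) + nrm (t n \<ominus> b)" for n
  using conv_carrier[OF assms(1)] conv_carrier[OF assms(2)]
  by (simp add: add_minus_add norm_add diff_closed)
qed (auto intro!: add_closed conv_carrier[OF assms(1)] conv_carrier[OF assms(2)])

lemma conv_smult:
 assumes "conv s a"
 shows "conv (\<lambda>n. c \<odot> s n) (c \<odot> a)"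
proof (rule convI_le)
 show "(\<lambda>n. cmod c * nrm (s n \<ominus> a)) \<longlonglongrightarrow> 0"
  using tendsto_mult_left[OF conv_tendsto[OF assms], of "cmod c"] by simp
 show "nrm (c \<odot> s n \<ominus> c \<odot> a) \<le> cmod c * nrm (s n \<ominus> a)" for n
  using conv_carrier[OF assms] by (simp add: smult_minus[symmetric] norm_smult diff_closed)
qed (auto intro!: smult_closed conv_carrier[OF assms])

lemma conv_involution:
 assumes "conv s a"
 shows "conv (\<lambda>n. involution C (s n)) (involution C a)"
proof (rule convI_le[OF _ _ _ conv_tendsto[OF assms]])
 show "nrm (involution C (s n) \<ominus> involution C a) \<le> nrm (s n \<ominus> a)" for n
  using conv_carrier[OF assms] by (simp add: involution_minus[symmetric] norm_involution diff_closed)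
qed (auto intro!: involution_closed conv_carrier[OF assms])

lemma conv_norm:
 assumes "conv s a"
 shows "(\<lambda>n. nrm (s n)) \<longlonglongrightarrow> nrm a"
proof (rule LIM_zero_cancel, rule tendsto_rabs_zero_cancel,
  rule tendsto_sandwich[OF _ _ tendsto_const conv_tendsto[OF assms]])
 show "\<forall>\<^sub>F n in sequentially. \<bar>nrm (s n) - nrm a\<bar> \<le> nrm (s n \<ominus> a)"
  by (intro always_eventually allI norm_diff_le conv_carrier[OF assms])
qed auto

lemma conv_mult:
 assumes "conv s a" "conv t b"
 shows "conv (\<lambda>n. s n \<otimes> t n) (a \<otimes> b)"
proof (rule convI_le)
 show "(\<lambda>n. nrm (s n \<ominus> a) * nrm (t n) + nrm a * nrm (t n \<ominus> b)) \<longlonglongrightarrow> 0"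
  using tendsto_add[OF tendsto_mult[OF conv_tendsto[OF assms(1)] conv_norm[OF assms(2)]]
    tendsto_mult_left[OF conv_tendsto[OF assms(2)], of "nrm a"]] by simp
 show "nrm (s n \<otimes> t n \<ominus> a \<otimes> b)
   \<le> nrm (s n \<ominus> a) * nrm (t n) + nrm a * nrm (t n \<ominus> b)" for n
  by (intro norm_mult_diff conv_carrier[OF assms(1)] conv_carrier[OF assms(2)])
qed (auto intro!: mult_closed conv_carrier[OF assms(1)] conv_carrier[OF assms(2)])

lemma conv_unique:
 assumes "conv s a" "conv s b"
 shows "a = b"
proof (rule eq_if_norm_minus_0[OF conv_carrier(2)[OF assms(1)] conv_carrier(2)[OF assms(2)]])
 have "(\<lambda>n. nrm (s n \<ominus> a) + nrm (s n \<ominus> b)) \<longlonglongrightarrow> 0"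
  using tendsto_add[OF conv_tendsto[OF assms(1)] conv_tendsto[OF assms(2)]] by simp
 moreover have "nrm (a \<ominus> b) \<le> nrm (s n \<ominus> a) + nrm (s n \<ominus> b)" for n
  using norm_triangle[of a "s n" b] norm_minus_commute[of a "s n"]
   conv_carrier[OF assms(1)] conv_carrier[OF assms(2)] by simp
 ultimately have "nrm (a \<ominus> b) \<le> 0" by (intro LIMSEQ_le_const) auto
 then show "nrm (a \<ominus> b) = 0"
  using norm_nonneg[OF diff_closed[OF conv_carrier(2)[OF assms(1)] conv_carrier(2)[OF assms(2)]]] by simp
qed

lemma conv_cauchy:
 assumes "conv s a"
 shows "cauchy s"
 unfolding cauchy_def
proof (intro conjI allI impI)
 show "range s \<subseteq> carrier C" using assms by (simp add: conv_def)
 fix e :: real assume "e > 0"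
 then obtain M where M: "\<And>n. n \<ge> M \<Longrightarrow> norm (nrm (s n \<ominus> a) - 0) < e/2"
  using LIMSEQ_D[OF conv_tendsto[OF assms], of "e/2"] by auto
 have "nrm (s m \<ominus> s n) < e" if "m \<ge> M" "n \<ge> M" for m n
 proof -
  have "nrm (s m \<ominus> s n) \<le> nrm (s m \<ominus> a) + nrm (s n \<ominus> a)"
   using norm_triangle[of "s m" a "s n"] norm_minus_commute[of a "s n"] conv_carrier[OF assms] by simp
  then show ?thesis using M[OF that(1)] M[OF that(2)] unfolding real_norm_def by linarith
 qed
 then show "\<exists>M. \<forall>m\<ge>M. \<forall>n\<ge>M. nrm (s m \<ominus> s n) < e" by blast
qed

definition dense_image :: "('d \<Rightarrow> 'c) \<Rightarrow> 'd set \<Rightarrow> bool" where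
 "dense_image j D \<longleftrightarrow> j ` D \<subseteq> carrier C \<and> (\<forall>a\<in>carrier C. \<forall>e>0. \<exists>x\<in>D. nrm (a \<ominus> j x) < e)"

lemma dense_imageE:
 assumes "dense_image j D" "a \<in> carrier C"
 obtains x where "\<And>n. x n \<in> D" "conv (\<lambda>n. j (x n)) a" "\<And>n. nrm (a \<ominus> j (x n)) < 1 / Suc n"
proof -
 have "\<exists>x\<in>D. nrm (a \<ominus> j x) < 1 / Suc n" for n
  using assms by (simp add: dense_image_def)
 then obtain x where x: "\<And>n. x n \<in> D" "\<And>n. nrm (a \<ominus> j (x n)) < 1 / Suc n" by metis
 have jx: "j (x n) \<in> carrier C" for n using assms(1) x(1) by (auto simp: dense_image_def)
 have "conv (\<lambda>n. j (x n)) a"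
  by (rule convI_le[OF jx assms(2) _ LIMSEQ_Suc[OF lim_1_over_n]])
   (use x(2) in \<open>auto simp: norm_minus_commute[OF jx assms(2)] intro: less_imp_le\<close>)
 with x show ?thesis using that by blast
qed

lemma cauchy_subseq_conv:
 assumes "cauchy s" "conv (s \<circ> r) a" "strict_mono r"
 shows "conv s a"
proof (rule convI)
 show sc: "s n \<in> carrier C" for n using assms(1) by (auto simp: cauchy_def)
 show a: "a \<in> carrier C" by (rule conv_carrier(2)[OF assms(2)])
 show "(\<lambda>n. nrm (s n \<ominus> a)) \<longlonglongrightarrow> 0"
 proof (rule LIMSEQ_I)
  fix e :: real assume e: "e > 0"
  then have "\<exists>M. \<forall>m\<ge>M. \<forall>n\<ge>M. nrm (s m \<ominus> s n) < e/2"
   using assms(1) unfolding cauchy_def by (meson half_gt_zero)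
  then obtain M where M: "\<And>m n. m \<ge> M \<Longrightarrow> n \<ge> M \<Longrightarrow> nrm (s m \<ominus> s n) < e/2" by blast
  obtain K where K: "\<And>n. n \<ge> K \<Longrightarrow> norm (nrm ((s \<circ> r) n \<ominus> a) - 0) < e/2"
   using LIMSEQ_D[OF conv_tendsto[OF assms(2)], of "e/2"] e by auto
  have "norm (nrm (s n \<ominus> a) - 0) < e" if "n \<ge> M" for n
  proof -
   have r: "r (max M K) \<ge> M" using seq_suble[OF assms(3), of "max M K"] by linarith
   have "nrm (s n \<ominus> a) \<le> nrm (s n \<ominus> s (r (max M K))) + nrm (s (r (max M K)) \<ominus> a)"
    by (intro norm_triangle sc a)
   moreover have "nrm (s n \<ominus> s (r (max M K))) < e/2" by (rule M[OF that r])
   moreover have "nrm (s (r (max M K)) \<ominus> a) < e/2" using K[of "max M K"] by simp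
   moreover have "nrm (s n \<ominus> a) \<ge> 0" by (intro norm_nonneg diff_closed sc a)
   ultimately show ?thesis by simp
  qed
  then show "\<exists>no. \<forall>n\<ge>no. norm (nrm (s n \<ominus> a) - 0) < e" by blast
 qed
qed

lemma cauchy_subseq:
 assumes "cauchy s"
 obtains r where "strict_mono r" "\<And>n. nrm (s (r (Suc n)) \<ominus> s (r n)) < (1/2) ^ n"
proof -
 have "\<exists>M. \<forall>m\<ge>M. \<forall>n\<ge>M. nrm (s m \<ominus> s n) < (1/2) ^ k" for k
  using assms unfolding cauchy_def by simp
 then obtain M where M: "\<And>k m n. m \<ge> M k \<Longrightarrow> n \<ge> M k \<Longrightarrow> nrm (s m \<ominus> s n) < (1/2) ^ k" by metis
 have "\<exists>r. \<forall>n. r n \<ge> M n \<and> r n < r (Suc n)"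
 proof (rule dependent_nat_choice)
  show "\<exists>x. x \<ge> M 0" by blast
  show "\<exists>y. y \<ge> M (Suc n) \<and> x < y" if "x \<ge> M n" for x n
   by (rule exI[of _ "max (M (Suc n)) (Suc x)"]) auto
 qed
 then obtain r where r: "\<And>n. r n \<ge> M n" "\<And>n. r n < r (Suc n)" by blast
 show ?thesis
 proof (rule that[of r])
  show "strict_mono r" using r(2) by (simp add: strict_mono_Suc_iff)
  fix n
  have "r (Suc n) \<ge> M n" using r(1)[of n] r(2)[of n] by linarith
  then show "nrm (s (r (Suc n)) \<ominus> s (r n)) < (1/2) ^ n" using M r(1) by blast
 qed
qed

lemma geometric_cauchy:
 assumes s: "\<And>n. s n \<in> carrier C" and g: "\<And>n. nrm (s (Suc n) \<ominus> s n) \<le> K * q ^ n" and q: "0 \<le> q" "q < 1" and K: "0 \<le> K"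
 shows "cauchy s"
 unfolding cauchy_def
proof (intro conjI allI impI)
 show "range s \<subseteq> carrier C" using s by blast
 fix e :: real assume e: "e > 0"
 have le: "nrm (s (n + k) \<ominus> s n) \<le> (\<Sum>i<k. K * q ^ (n + i))" for n k
 proof (induction k)
  case 0
  then show ?case by (simp add: minus_self s norm_zero)
 next
  case (Suc k)
  have "nrm (s (n + Suc k) \<ominus> s n) \<le> nrm (s (Suc (n + k)) \<ominus> s (n + k)) + nrm (s (n + k) \<ominus> s n)"
   using norm_triangle[OF s s s] by simp
  then show ?case using Suc g[of "n + k"] by simp
 qed
 have sum: "(\<Sum>i<k. K * q ^ (n + i)) \<le> K * q ^ n / (1 - q)" for n k
 proof -
  have "(\<Sum>i<k. K * q ^ (n + i)) = K * q ^ n * (\<Sum>i<k. q ^ i)" by (simp add: sum_distrib_left power_add mult.assoc)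
  also have "(\<Sum>i<k. q ^ i) \<le> 1 / (1 - q)"
   using q by (simp add: sum_gp_strict divide_right_mono)
  then have "K * q ^ n * (\<Sum>i<k. q ^ i) \<le> K * q ^ n * (1 / (1 - q))" using K q by (intro mult_left_mono) auto
  finally show ?thesis by simp
 qed
 have "(\<lambda>n. K * q ^ n / (1 - q)) \<longlonglongrightarrow> K * 0 / (1 - q)"
  using q by (intro tendsto_divide tendsto_mult tendsto_const LIMSEQ_realpow_zero) auto
 then obtain M where M: "\<And>n. n \<ge> M \<Longrightarrow> norm (K * q ^ n / (1 - q) - 0) < e"
  using LIMSEQ_D[of "\<lambda>n. K * q ^ n / (1 - q)" 0 e] e by auto
 have *: "nrm (s m \<ominus> s n) < e" if "m \<ge> n" "n \<ge> M" for m n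
 proof -
  have "nrm (s (n + (m - n)) \<ominus> s n) \<le> K * q ^ n / (1 - q)" using le sum order_trans by blast
  also have "\<dots> < e" using M[OF that(2)] unfolding real_norm_def diff_0_right by (rule abs_less_iff[THEN iffD1, THEN conjunct1])
  finally show ?thesis using that(1) by simp
 qed
 have "nrm (s m \<ominus> s n) < e" if "m \<ge> M" "n \<ge> M" for m n
  using *[of m n] *[of n m] that norm_minus_commute[OF s s, of m n] by (cases "n \<le> m") auto
 then show "\<exists>M. \<forall>m\<ge>M. \<forall>n\<ge>M. nrm (s m \<ominus> s n) < e" by blast
qed

end

locale banach_star = normed_star C for C :: "('c, 'm) normed_star_alg_scheme" (structure) +
 assumes complete: "cauchy s \<Longrightarrow> \<exists>a. conv s a"

text \<open>Replacing the n-th member of a Cauchy sequence by a dense element at distance below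
  1/(n+1) changes neither the Cauchy property nor the limit.\<close>

lemma (in normed_star) banach_star_from_dense:
 assumes dense: "dense_image j D"
  and lim: "\<And>x. (\<And>n. x n \<in> D) \<Longrightarrow> cauchy (\<lambda>n. j (x n)) \<Longrightarrow> \<exists>a. conv (\<lambda>n. j (x n)) a"
 shows "banach_star C"
proof unfold_locales
 fix s assume s: "cauchy s"
 have sc: "s n \<in> carrier C" for n using s by (auto simp: cauchy_def)
 have "\<exists>x\<in>D. nrm (s n \<ominus> j x) < 1 / Suc n" for n
  using dense sc by (simp add: dense_image_def)
 then obtain x where x: "\<And>n. x n \<in> D" "\<And>n. nrm (s n \<ominus> j (x n)) < 1 / Suc n" by metis
 have jx: "j (x n) \<in> carrier C" for n using dense x(1) by (auto simp: dense_image_def)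
 have t0: "(\<lambda>n. 1 / real (Suc n)) \<longlonglongrightarrow> 0" by (rule LIMSEQ_Suc[OF lim_1_over_n])
 have "cauchy (\<lambda>n. j (x n))"
  unfolding cauchy_def
 proof (intro conjI allI impI)
  fix e :: real assume e: "e > 0"
  then have "\<exists>M. \<forall>m\<ge>M. \<forall>n\<ge>M. nrm (s m \<ominus> s n) < e/3"
   using s unfolding cauchy_def by (meson divide_pos_pos zero_less_numeral)
  then obtain M where M: "\<And>m n. m \<ge> M \<Longrightarrow> n \<ge> M \<Longrightarrow> nrm (s m \<ominus> s n) < e/3" by blast
  obtain K where K: "\<And>n. n \<ge> K \<Longrightarrow> norm (1 / real (Suc n) - 0) < e/3"
   using LIMSEQ_D[OF t0, of "e/3"] e by auto
  have "nrm (j (x m) \<ominus> j (x n)) < e" if "m \<ge> max M K" "n \<ge> max M K" for m n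
  proof -
   have "nrm (j (x m) \<ominus> j (x n)) \<le> nrm (j (x m) \<ominus> s m) + nrm (s m \<ominus> j (x n))"
    by (intro norm_triangle jx sc)
   moreover have "nrm (s m \<ominus> j (x n)) \<le> nrm (s m \<ominus> s n) + nrm (s n \<ominus> j (x n))"
    by (intro norm_triangle jx sc)
   moreover have "nrm (j (x m) \<ominus> s m) < e/3"
    using x(2)[of m] K[of m] that by (simp add: norm_minus_commute[OF jx sc])
   moreover have "nrm (s n \<ominus> j (x n)) < e/3"
    using x(2)[of n] K[of n] that by simp
   moreover have "nrm (s m \<ominus> s n) < e/3" using M that by simp
   ultimately show ?thesis by linarith
  qed
  then show "\<exists>M. \<forall>m\<ge>M. \<forall>n\<ge>M. nrm (j (x m) \<ominus> j (x n)) < e" by blast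
 qed (use jx in blast)
 then obtain a where a: "conv (\<lambda>n. j (x n)) a" using lim[of x] x(1) by blast
 have ac: "a \<in> carrier C" by (rule conv_carrier(2)[OF a])
 have "conv s a"
 proof (rule convI_le[OF sc ac])
  show "nrm (s n \<ominus> a) \<le> 1 / real (Suc n) + nrm (j (x n) \<ominus> a)" for n
   using norm_triangle[OF sc[of n] jx[of n] ac] x(2)[of n] by simp
  show "(\<lambda>n. 1 / real (Suc n) + nrm (j (x n) \<ominus> a)) \<longlonglongrightarrow> 0"
   using tendsto_add[OF t0 conv_tendsto[OF a]] by simp
 qed
 then show "\<exists>a. conv s a" ..
qed

subsection \<open>Algebras of operators\<close>

lemma bounded_ops_simps [simp]:
 "carrier bounded_ops = {T. bounded_clinear T}" "S \<otimes>\<^bsub>bounded_ops\<^esub> T = S \<circ> T"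
 "S \<oplus>\<^bsub>bounded_ops\<^esub> T = (\<lambda>v. S v + T v)" "c \<odot>\<^bsub>bounded_ops\<^esub> T = (\<lambda>v. c *\<^sub>C T v)"
 "\<zero>\<^bsub>bounded_ops\<^esub> = (\<lambda>_. 0)" "involution bounded_ops = cadjoint"
 by (simp_all add: bounded_ops_def)

text \<open>\<open>bounded_ops\<close> has no norm field. This version adds the operator norm, and
  the variable carrier admits subalgebras such as the block diagonal operators.\<close>

definition normed_ops :: "('k::chilbert_space \<Rightarrow> 'k) set \<Rightarrow> ('k \<Rightarrow> 'k) normed_star_alg" where
 "normed_ops V =
   \<lparr>carrier = V, mult = (\<lambda>S T. S \<circ> T), one = id,
   zero = (\<lambda>_. 0), add = (\<lambda>S T v. S v + T v), smult = (\<lambda>c T v. c *\<^sub>C T v),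
   involution = cadjoint, alg_norm = onorm\<rparr>"

lemma normed_ops_simps [simp]:
 "carrier (normed_ops V) = V" "S \<otimes>\<^bsub>normed_ops V\<^esub> T = S \<circ> T"
 "S \<oplus>\<^bsub>normed_ops V\<^esub> T = (\<lambda>v. S v + T v)" "c \<odot>\<^bsub>normed_ops V\<^esub> T = (\<lambda>v. c *\<^sub>C T v)"
 "\<zero>\<^bsub>normed_ops V\<^esub> = (\<lambda>_. 0)" "involution (normed_ops V) = cadjoint" "alg_norm (normed_ops V) = onorm"
 by (simp_all add: normed_ops_def)

locale operator_algebra =
 fixes V :: "('k::chilbert_space \<Rightarrow> 'k) set"
 assumes V: "T \<in> V \<Longrightarrow> bounded_clinear T" and V0: "(\<lambda>_. 0) \<in> V"
  and Vadd: "S \<in> V \<Longrightarrow> T \<in> V \<Longrightarrow> (\<lambda>v. S v + T v) \<in> V"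
  and Vscale: "T \<in> V \<Longrightarrow> (\<lambda>v. c *\<^sub>C T v) \<in> V"
  and Vcomp: "S \<in> V \<Longrightarrow> T \<in> V \<Longrightarrow> S \<circ> T \<in> V"
  and Vadj: "T \<in> V \<Longrightarrow> cadjoint T \<in> V"
begin

lemma star_ring_space_ops:
 assumes [simp]: "carrier A = V" "\<And>S T. S \<otimes>\<^bsub>A\<^esub> T = S \<circ> T"
 "\<And>S T. S \<oplus>\<^bsub>A\<^esub> T = (\<lambda>v. S v + T v)" "\<And>c T. c \<odot>\<^bsub>A\<^esub> T = (\<lambda>v. c *\<^sub>C T v)"
 "\<zero>\<^bsub>A\<^esub> = (\<lambda>_. 0)" "involution A = cadjoint"
 shows "star_ring_space A"
 by unfold_locales
  (simp_all add: Vadd V0 Vscale Vcomp Vadj add.assoc add.commute scaleC_add_right scaleC_add_left scaleC_scaleC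
   V clinear_add clinear_scaleC cadjoint_plus cadjoint_cmult cadjoint_comp cadjoint_cadjoint
   clinear_comp fun_eq_iff)

sublocale normed_star "normed_ops V"
proof -
 interpret star_ring_space "normed_ops V" by (rule star_ring_space_ops) simp_all
 show "normed_star (normed_ops V)"
 proof unfold_locales
  fix S T c assume "S \<in> carrier (normed_ops V)"
  then have S: "S \<in> V" "bounded_clinear S" by (auto simp: V)
  show "0 \<le> alg_norm (normed_ops V) S" by (simp add: onorm_nonneg S)
  show "S = \<zero>\<^bsub>normed_ops V\<^esub>" if "alg_norm (normed_ops V) S = 0"
   using onorm_eq_0[OF bounded_clinearD[OF S(2)]] that by auto
  show "alg_norm (normed_ops V) (c \<odot>\<^bsub>normed_ops V\<^esub> S) = cmod c * alg_norm (normed_ops V) S"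
   by (simp add: onorm_scaleC S)
  show "alg_norm (normed_ops V) (involution (normed_ops V) S) = alg_norm (normed_ops V) S"
   by (simp add: onorm_cadjoint S)
  assume "T \<in> carrier (normed_ops V)"
  then have T: "bounded_clinear T" by (auto simp: V)
  show "alg_norm (normed_ops V) (S \<oplus>\<^bsub>normed_ops V\<^esub> T) \<le> alg_norm (normed_ops V) S + alg_norm (normed_ops V) T"
   by (simp add: onorm_triangle bounded_clinearD S T)
  show "alg_norm (normed_ops V) (S \<otimes>\<^bsub>normed_ops V\<^esub> T) \<le> alg_norm (normed_ops V) S * alg_norm (normed_ops V) T"
   by (simp add: onorm_compose bounded_clinearD S T)
 qed
qed

lemma minus_ops: "S \<in> V \<Longrightarrow> T \<in> V \<Longrightarrow> S \<ominus>\<^bsub>normed_ops V\<^esub> T = (\<lambda>v. S v - T v)"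
 by (simp add: minus_eq_smult)

lemma banach_star_ops:
 assumes closed: "\<And>T S. (\<And>n. T n \<in> V) \<Longrightarrow> bounded_clinear S \<Longrightarrow>
  (\<lambda>n. onorm (\<lambda>v. T n v - S v)) \<longlonglongrightarrow> 0 \<Longrightarrow> (\<And>v. (\<lambda>n. T n v) \<longlonglongrightarrow> S v) \<Longrightarrow> S \<in> V"
 shows "banach_star (normed_ops V)"
proof unfold_locales
 fix s assume s: "cauchy s"
 have sV: "s n \<in> V" for n using s by (auto simp: cauchy_def)
 obtain S where S: "bounded_clinear S" "(\<lambda>n. onorm (\<lambda>v. s n v - S v)) \<longlonglongrightarrow> 0" "\<And>v. (\<lambda>n. s n v) \<longlonglongrightarrow> S v"
 proof (rule operator_limit[of s])
  show "bounded_clinear (s n)" for n using sV V by blast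
  show "\<exists>N. \<forall>m\<ge>N. \<forall>n\<ge>N. onorm (\<lambda>v. s m v - s n v) < e" if "e > 0" for e
   using s that unfolding cauchy_def by (simp add: minus_ops sV)
 qed blast
 have SV: "S \<in> V" using closed[OF sV S] .
 have "conv s S" by (rule convI) (use sV SV S(2) in \<open>simp_all add: minus_ops\<close>)
 then show "\<exists>a. conv s a" by blast
qed

end

interpretation all_ops: operator_algebra "{T. bounded_clinear T}"
 by unfold_locales
  (auto intro: clinear_const_0 clinear_plus clinear_cmult clinear_comp
   bounded_clinear_cadjoint)

interpretation all_ops: banach_star "normed_ops {T. bounded_clinear T}"
 by (rule all_ops.banach_star_ops) simp

interpretation bounded_ops: star_ring_space bounded_ops
 by (rule all_ops.star_ring_space_ops) simp_all

lemma bounded_ops_minus: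
 "bounded_clinear S \<Longrightarrow> bounded_clinear T \<Longrightarrow> S \<ominus>\<^bsub>bounded_ops\<^esub> T = (\<lambda>v. S v - T v)"
 by (simp add: bounded_ops.minus_eq_smult)

lemma linear_map_normed_ops_iff:
 "linear_map A (normed_ops {T. bounded_clinear T}) \<phi> \<longleftrightarrow> linear_map A bounded_ops \<phi>"
 by (simp add: linear_map_def)

lemma rep_facts:
 assumes "star_hom A bounded_ops \<phi>" "x \<in> carrier A"
 shows "bounded_clinear (\<phi> x)" "\<phi> (involution A x) = cadjoint (\<phi> x)" "\<phi> (c \<odot>\<^bsub>A\<^esub> x) = (\<lambda>v. c *\<^sub>C \<phi> x v)"
  "y \<in> carrier A \<Longrightarrow> \<phi> (x \<oplus>\<^bsub>A\<^esub> y) = (\<lambda>v. \<phi> x v + \<phi> y v)" "y \<in> carrier A \<Longrightarrow> \<phi> (x \<otimes>\<^bsub>A\<^esub> y) = \<phi> x \<circ> \<phi> y"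
 using assms by (auto simp: star_hom_def)

lemma rep_minus:
 assumes "star_space A" "star_hom A bounded_ops \<phi>" "x \<in> carrier A" "y \<in> carrier A"
 shows "\<phi> (x \<ominus>\<^bsub>A\<^esub> y) = (\<lambda>v. \<phi> x v - \<phi> y v)"
 using linear_map_minus[OF assms(1) bounded_ops.star_space_axioms star_hom_linear[OF assms(2)] assms(3,4)]
  rep_facts(1)[OF assms(2)] assms(3,4) by (simp add: bounded_ops_minus)

subsection \<open>Extension by continuity\<close>

lemma contraction_conv:
 assumes "normed_star C1" "normed_star C2" "linear_map C1 C2 f"
  and le: "\<And>a. a \<in> carrier C1 \<Longrightarrow> alg_norm C2 (f a) \<le> alg_norm C1 a"
  and conv: "normed_star.conv C1 s a"
 shows "normed_star.conv C2 (\<lambda>n. f (s n)) (f a)"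
proof -
 interpret C1: normed_star C1 by fact
 interpret C2: normed_star C2 by fact
 have c: "s n \<in> carrier C1" "a \<in> carrier C1" for n using C1.conv_carrier[OF conv] .
 show ?thesis
 proof (rule C2.convI_le[OF _ _ _ C1.conv_tendsto[OF conv]])
  show "alg_norm C2 (f (s n) \<ominus>\<^bsub>C2\<^esub> f a) \<le> alg_norm C1 (s n \<ominus>\<^bsub>C1\<^esub> a)" for n
   using le[OF C1.diff_closed[OF c]]
    linear_map_minus[OF C1.star_space_axioms C2.star_space_axioms assms(3) c] by simp
 qed (auto intro!: linear_map_closed[OF assms(3)] c)
qed

text \<open>The norm comparison puts the kernel of \<open>j1\<close> into that of \<open>j2\<close>,
  so the closure of the set of pairs (j1 x, j2 x), called \<open>S\<close> below, is the graph of a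
  contraction defined everywhere by density and completeness.\<close>

lemma extension_by_continuity:
 assumes C1: "normed_star C1" and C2: "banach_star C2" and D: "star_space D"
  and j1: "linear_map D C1 j1" and j2: "linear_map D C2 j2"
  and dense: "normed_star.dense_image C1 j1 (carrier D)"
  and le: "\<And>x. x \<in> carrier D \<Longrightarrow> alg_norm C2 (j2 x) \<le> alg_norm C1 (j1 x)"
 obtains \<Phi> where "linear_map C1 C2 \<Phi>" "\<And>a. a \<in> carrier C1 \<Longrightarrow> alg_norm C2 (\<Phi> a) \<le> alg_norm C1 a"
  "\<And>x. x \<in> carrier D \<Longrightarrow> \<Phi> (j1 x) = j2 x"
proof -
 interpret C1: normed_star C1 by fact
 interpret C2: banach_star C2 by fact
 interpret D: star_space D by fact
 note c1 = linear_map_closed[OF j1] and c2 = linear_map_closed[OF j2]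
 define S where "S a b \<longleftrightarrow> (\<exists>x. (\<forall>n. x n \<in> carrier D) \<and> C1.conv (\<lambda>n. j1 (x n)) a \<and> C2.conv (\<lambda>n. j2 (x n)) b)" for a b
 have Sc: "a \<in> carrier C1" "b \<in> carrier C2" if "S a b" for a b
  using that C1.conv_carrier(2) C2.conv_carrier(2) by (auto simp: S_def)
 have ex: "\<exists>b. S a b" if a: "a \<in> carrier C1" for a
 proof -
  obtain x where x: "\<And>n. x n \<in> carrier D" "C1.conv (\<lambda>n. j1 (x n)) a"
   using C1.dense_imageE[OF dense a] by metis
  have "C2.cauchy (\<lambda>n. j2 (x n))"
   unfolding C2.cauchy_def
  proof (intro conjI allI impI)
   show "range (\<lambda>n. j2 (x n)) \<subseteq> carrier C2" using c2 x(1) by blast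
   fix e :: real assume "e > 0"
   then obtain M where M: "\<forall>m\<ge>M. \<forall>n\<ge>M. alg_norm C1 (j1 (x m) \<ominus>\<^bsub>C1\<^esub> j1 (x n)) < e"
    using C1.conv_cauchy[OF x(2)] unfolding C1.cauchy_def by blast
   have *: "alg_norm C2 (j2 (x m) \<ominus>\<^bsub>C2\<^esub> j2 (x n)) \<le> alg_norm C1 (j1 (x m) \<ominus>\<^bsub>C1\<^esub> j1 (x n))" for m n
    using le[OF D.diff_closed[OF x(1) x(1)]]
     linear_map_minus[OF D C1.star_space_axioms j1 x(1) x(1)]
     linear_map_minus[OF D C2.star_space_axioms j2 x(1) x(1)] by simp
   show "\<exists>M. \<forall>m\<ge>M. \<forall>n\<ge>M. alg_norm C2 (j2 (x m) \<ominus>\<^bsub>C2\<^esub> j2 (x n)) < e"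
    using M by (intro exI[of _ M]) (meson * le_less_trans)
  qed
  then show ?thesis using C2.complete x unfolding S_def by blast
 qed
 have Sadd: "S (a \<oplus>\<^bsub>C1\<^esub> a') (b \<oplus>\<^bsub>C2\<^esub> b')" if ab: "S a b" "S a' b'" for a b a' b'
 proof -
  obtain x y where x: "\<And>n. x n \<in> carrier D" "C1.conv (\<lambda>n. j1 (x n)) a" "C2.conv (\<lambda>n. j2 (x n)) b"
   and y: "\<And>n. y n \<in> carrier D" "C1.conv (\<lambda>n. j1 (y n)) a'" "C2.conv (\<lambda>n. j2 (y n)) b'"
   using ab unfolding S_def by blast
  show ?thesis unfolding S_def
   using C1.conv_add[OF x(2) y(2)] C2.conv_add[OF x(3) y(3)] x(1) y(1)
   by (intro exI[of _ "\<lambda>n. x n \<oplus>\<^bsub>D\<^esub> y n"])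
    (simp add: linear_map_add[OF j1] linear_map_add[OF j2])
 qed
 have Ssc: "S (c \<odot>\<^bsub>C1\<^esub> a) (c \<odot>\<^bsub>C2\<^esub> b)" if ab: "S a b" for a b c
 proof -
  obtain x where x: "\<And>n. x n \<in> carrier D" "C1.conv (\<lambda>n. j1 (x n)) a" "C2.conv (\<lambda>n. j2 (x n)) b"
   using ab unfolding S_def by blast
  show ?thesis unfolding S_def
   using C1.conv_smult[OF x(2)] C2.conv_smult[OF x(3)] x(1)
   by (intro exI[of _ "\<lambda>n. c \<odot>\<^bsub>D\<^esub> x n"])
    (simp add: linear_map_smult[OF j1] linear_map_smult[OF j2] D.smult_closed)
 qed
 have Sle: "alg_norm C2 b \<le> alg_norm C1 a" if ab: "S a b" for a b
 proof -
  obtain x where x: "\<And>n. x n \<in> carrier D" "C1.conv (\<lambda>n. j1 (x n)) a" "C2.conv (\<lambda>n. j2 (x n)) b"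
   using ab unfolding S_def by blast
  show ?thesis
   by (rule LIMSEQ_le[OF C2.conv_norm[OF x(3)] C1.conv_norm[OF x(2)]]) (use le x(1) in blast)
 qed
 have uniq: "b = b'" if ab: "S a b" "S a b'" for a b b'
 proof -
  \<comment> \<open>\<open>S\<close> is closed under linear combinations, so uniqueness of the value
    reduces to the norm estimate for a pair with first component zero.\<close>
  have "S (a \<ominus>\<^bsub>C1\<^esub> a) (b \<ominus>\<^bsub>C2\<^esub> b')"
   using Sadd[OF ab(1) Ssc[OF ab(2), of "-1"]] Sc[OF ab(1)] Sc[OF ab(2)]
   by (simp add: C1.minus_eq_smult C2.minus_eq_smult)
  from Sle[OF this] have "alg_norm C2 (b \<ominus>\<^bsub>C2\<^esub> b') \<le> 0"
   using Sc[OF ab(1)] by (simp add: C1.minus_self C1.norm_zero)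
  moreover have "alg_norm C2 (b \<ominus>\<^bsub>C2\<^esub> b') \<ge> 0"
   using Sc[OF ab(1)] Sc[OF ab(2)] by (intro C2.norm_nonneg C2.diff_closed)
  ultimately show ?thesis using Sc[OF ab(1)] Sc[OF ab(2)] by (intro C2.eq_if_norm_minus_0) auto
 qed
 define \<Phi> where "\<Phi> a = (SOME b. S a b)" for a
 have \<Phi>: "S a (\<Phi> a)" if "a \<in> carrier C1" for a
  unfolding \<Phi>_def using ex[OF that] by (rule someI_ex)
 have \<Phi>eq: "\<Phi> a = b" if "S a b" for a b
  using uniq[OF \<Phi> that] Sc(1)[OF that] by blast
 show ?thesis
 proof (rule that[of \<Phi>])
  show "linear_map C1 C2 \<Phi>" unfolding linear_map_def
   using \<Phi> Sc(2)[OF \<Phi>] \<Phi>eq[OF Sadd[OF \<Phi> \<Phi>]] \<Phi>eq[OF Ssc[OF \<Phi>]] by auto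
  show "alg_norm C2 (\<Phi> a) \<le> alg_norm C1 a" if "a \<in> carrier C1" for a using Sle[OF \<Phi>[OF that]] .
  fix x assume x: "x \<in> carrier D"
  have "S (j1 x) (j2 x)" unfolding S_def
   using x by (intro exI[of _ "\<lambda>_. x"]) (simp add: C1.conv_const C2.conv_const c1 c2)
  then show "\<Phi> (j1 x) = j2 x" by (rule \<Phi>eq)
 qed
qed

text \<open>\<open>D\<close> serves only as a common source of approximants, so all content lies in
  the equality of the two norms. The extensions in both directions are inverse to each other because
  they are so on dense images; product and involution are carried along limits.\<close>

lemma star_iso_of_dense_images:
 assumes C1: "banach_star C1" and C2: "banach_star C2" and D: "star_space D"
  and j1: "star_hom D C1 j1" and j2: "star_hom D C2 j2"
  and dense1: "normed_star.dense_image C1 j1 (carrier D)"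
  and dense2: "normed_star.dense_image C2 j2 (carrier D)"
  and eq: "\<And>x. x \<in> carrier D \<Longrightarrow> alg_norm C1 (j1 x) = alg_norm C2 (j2 x)"
 obtains \<Phi> where "star_iso C1 C2 \<Phi>" "\<And>x. x \<in> carrier D \<Longrightarrow> \<Phi> (j1 x) = j2 x"
proof -
 interpret C1: banach_star C1 by fact
 interpret C2: banach_star C2 by fact
 interpret D: star_space D by fact
 note n1 = C1.normed_star_axioms and n2 = C2.normed_star_axioms
 obtain \<Phi> where \<Phi>: "linear_map C1 C2 \<Phi>" "\<And>a. a \<in> carrier C1 \<Longrightarrow> alg_norm C2 (\<Phi> a) \<le> alg_norm C1 a"
  and \<Phi>j: "\<And>x. x \<in> carrier D \<Longrightarrow> \<Phi> (j1 x) = j2 x"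
  using extension_by_continuity[OF n1 C2 D star_hom_linear[OF j1] star_hom_linear[OF j2] dense1] eq
  by (metis order_refl)
 obtain \<Psi> where \<Psi>: "linear_map C2 C1 \<Psi>" "\<And>a. a \<in> carrier C2 \<Longrightarrow> alg_norm C1 (\<Psi> a) \<le> alg_norm C2 a"
  and \<Psi>j: "\<And>x. x \<in> carrier D \<Longrightarrow> \<Psi> (j2 x) = j1 x"
  using extension_by_continuity[OF n2 C1 D star_hom_linear[OF j2] star_hom_linear[OF j1] dense2] eq
  by (metis order_refl)
 have \<Phi>c: "C2.conv (\<lambda>n. \<Phi> (s n)) (\<Phi> a)" if "C1.conv s a" for s a
  by (rule contraction_conv[OF n1 n2 \<Phi>(1) _ that]) (rule \<Phi>(2))
 have \<Psi>c: "C1.conv (\<lambda>n. \<Psi> (s n)) (\<Psi> a)" if "C2.conv s a" for s a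
  by (rule contraction_conv[OF n2 n1 \<Psi>(1) _ that]) (rule \<Psi>(2))
 have \<Psi>\<Phi>: "\<Psi> (\<Phi> a) = a" if a: "a \<in> carrier C1" for a
 proof -
  obtain x where x: "\<And>n. x n \<in> carrier D" "C1.conv (\<lambda>n. j1 (x n)) a"
   using C1.dense_imageE[OF dense1 a] by metis
  have "C1.conv (\<lambda>n. j1 (x n)) (\<Psi> (\<Phi> a))"
   using \<Psi>c[OF \<Phi>c[OF x(2)]] x(1) by (simp add: \<Phi>j \<Psi>j)
  then show ?thesis using C1.conv_unique x(2) by blast
 qed
 have \<Phi>\<Psi>: "\<Phi> (\<Psi> a) = a" if a: "a \<in> carrier C2" for a
 proof -
  obtain x where x: "\<And>n. x n \<in> carrier D" "C2.conv (\<lambda>n. j2 (x n)) a"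
   using C2.dense_imageE[OF dense2 a] by metis
  have "C2.conv (\<lambda>n. j2 (x n)) (\<Phi> (\<Psi> a))"
   using \<Phi>c[OF \<Psi>c[OF x(2)]] x(1) by (simp add: \<Phi>j \<Psi>j)
  then show ?thesis using C2.conv_unique x(2) by blast
 qed
 have "star_hom C1 C2 \<Phi>"
  unfolding star_hom_iff
 proof (intro conjI ballI \<Phi>(1))
  fix a assume a: "a \<in> carrier C1"
  obtain x where x: "\<And>n. x n \<in> carrier D" "C1.conv (\<lambda>n. j1 (x n)) a"
   using C1.dense_imageE[OF dense1 a] by metis
  have xa: "C2.conv (\<lambda>n. j2 (x n)) (\<Phi> a)" using \<Phi>c[OF x(2)] x(1) by (simp add: \<Phi>j)
  have "C2.conv (\<lambda>n. involution C2 (j2 (x n))) (\<Phi> (involution C1 a))"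
   using \<Phi>c[OF C1.conv_involution[OF x(2)]] x(1)
   by (simp add: star_hom_involution[OF j1, symmetric] star_hom_involution[OF j2, symmetric]
     \<Phi>j D.involution_closed)
  then show "\<Phi> (involution C1 a) = involution C2 (\<Phi> a)"
   using C2.conv_unique C2.conv_involution[OF xa] by blast
  fix b assume b: "b \<in> carrier C1"
  obtain y where y: "\<And>n. y n \<in> carrier D" "C1.conv (\<lambda>n. j1 (y n)) b"
   using C1.dense_imageE[OF dense1 b] by metis
  have yb: "C2.conv (\<lambda>n. j2 (y n)) (\<Phi> b)" using \<Phi>c[OF y(2)] y(1) by (simp add: \<Phi>j)
  have "C2.conv (\<lambda>n. j2 (x n) \<otimes>\<^bsub>C2\<^esub> j2 (y n)) (\<Phi> (a \<otimes>\<^bsub>C1\<^esub> b))"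
   using \<Phi>c[OF C1.conv_mult[OF x(2) y(2)]] x(1) y(1)
   by (simp add: star_hom_mult[OF j1, symmetric] star_hom_mult[OF j2, symmetric]
     \<Phi>j D.mult_closed)
  then show "\<Phi> (a \<otimes>\<^bsub>C1\<^esub> b) = \<Phi> a \<otimes>\<^bsub>C2\<^esub> \<Phi> b"
   using C2.conv_unique C2.conv_mult[OF xa yb] by blast
 qed
 moreover have "bij_betw \<Phi> (carrier C1) (carrier C2)"
  by (rule bij_betw_byWitness[where f' = \<Psi>])
   (use \<Psi>\<Phi> \<Phi>\<Psi> linear_map_closed[OF \<Phi>(1)] linear_map_closed[OF \<Psi>(1)] in auto)
 ultimately have "star_iso C1 C2 \<Phi>" by (simp add: star_iso_def)
 then show ?thesis using \<Phi>j by (rule that)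
qed

subsection \<open>Representations of Banach star algebras are contractive\<close>

text \<open>The fixed point equation says $(1 - b)^2 = 1 - x$; no holomorphic calculus is needed.\<close>

lemma (in banach_star) quasi_square_root:
 assumes x: "x \<in> carrier C" "involution C x = x" and Nx: "nrm x < 1"
 obtains b where "b \<in> carrier C" "involution C b = b" "(2::complex) \<odot> b = x \<oplus> b \<otimes> b"
proof -
 define h :: complex where "h = 1/2"
 have hr: "cnj h = h" "cmod h = 1/2" by (simp_all add: h_def norm_divide)
 define F where "F b = h \<odot> (x \<oplus> b \<otimes> b)" for b
 define s where "s n = (F ^^ n) \<zero>" for n
 have s0: "s 0 = \<zero>" and sS: "s (Suc n) = F (s n)" for n by (simp_all add: s_def)
 have Fc: "F b \<in> carrier C" if "b \<in> carrier C" for b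
  unfolding F_def using that x by (intro smult_closed add_closed mult_closed)
 have sc: "s n \<in> carrier C" for n by (induction n) (simp_all add: s0 sS Fc zero_in_carrier)
 have inv0: "involution C \<zero> = \<zero>"
  using involution_smult[OF zero_in_carrier, of 0]
  by (simp add: smult_0 zero_in_carrier involution_closed)
 have sinv: "involution C (s n) = s n" for n
 proof (induction n)
  case (Suc n)
  then show ?case
   using x sc[of n] by (simp add: sS F_def involution_smult hr involution_add involution_mult add_closed mult_closed)
 qed (simp add: s0 inv0)
 define c where "c = nrm x"
 have c: "0 \<le> c" "c < 1" using x norm_nonneg Nx by (auto simp: c_def)
 \<comment> \<open>\<open>r\<close> is the smaller fixed point of u \<mapsto> (c + u^2)/2. It is at
   once the radius of a ball invariant under \<open>F\<close> and the contraction factor of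
   \<open>F\<close> on that ball, which is below 1 because c < 1.\<close>
 define r where "r = 1 - sqrt (1 - c)"
 have r: "0 \<le> r" "r < 1" using c by (auto simp: r_def)
 have rc: "c + r * r = 2 * r" using c unfolding r_def by (simp add: algebra_simps)
 have sr: "nrm (s n) \<le> r" for n
 proof (induction n)
  case (Suc n)
  have "nrm (s (Suc n)) = 1/2 * nrm (x \<oplus> s n \<otimes> s n)"
   using x sc by (simp add: sS F_def norm_smult hr add_closed mult_closed)
  also have "\<dots> \<le> 1/2 * (nrm x + nrm (s n \<otimes> s n))"
   using x sc by (intro mult_left_mono norm_add mult_closed) auto
  also have "\<dots> \<le> 1/2 * (nrm x + nrm (s n) * nrm (s n))"
   using sc by (intro mult_left_mono add_left_mono norm_mult) auto
  also have "\<dots> \<le> 1/2 * (c + r * r)"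
   unfolding c_def using Suc r norm_nonneg[OF sc] by (intro mult_left_mono add_left_mono mult_mono) auto
  finally show ?case using rc by simp
 qed (simp add: s0 norm_zero r)
 have step: "nrm (s (Suc (Suc n)) \<ominus> s (Suc n)) \<le> r * nrm (s (Suc n) \<ominus> s n)" for n
 proof -
  have "s (Suc (Suc n)) \<ominus> s (Suc n) = h \<odot> ((x \<oplus> s (Suc n) \<otimes> s (Suc n)) \<ominus> (x \<oplus> s n \<otimes> s n))"
   unfolding sS[of "Suc n"] unfolding sS[of n] F_def
   by (rule smult_minus[symmetric]; intro add_closed mult_closed smult_closed x sc)
  also have "(x \<oplus> s (Suc n) \<otimes> s (Suc n)) \<ominus> (x \<oplus> s n \<otimes> s n) = s (Suc n) \<otimes> s (Suc n) \<ominus> s n \<otimes> s n"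
   using x sc by (simp add: add_minus_add mult_closed minus_self zero_add diff_closed)
  finally have "nrm (s (Suc (Suc n)) \<ominus> s (Suc n)) = 1/2 * nrm (s (Suc n) \<otimes> s (Suc n) \<ominus> s n \<otimes> s n)"
   using sc by (simp add: norm_smult hr diff_closed mult_closed)
  also have "\<dots> \<le> 1/2 * (nrm (s (Suc n) \<ominus> s n) * nrm (s (Suc n)) + nrm (s n) * nrm (s (Suc n) \<ominus> s n))"
   using sc by (intro mult_left_mono norm_mult_diff) auto
  also have "\<dots> \<le> 1/2 * (nrm (s (Suc n) \<ominus> s n) * r + r * nrm (s (Suc n) \<ominus> s n))"
   using sc sr by (intro mult_left_mono add_mono mult_right_mono norm_nonneg diff_closed) auto
  finally show ?thesis by simp
 qed
 have "cauchy s"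
 proof (rule geometric_cauchy[where K = "nrm (s 1 \<ominus> s 0)"])
  show "nrm (s (Suc n) \<ominus> s n) \<le> nrm (s 1 \<ominus> s 0) * r ^ n" for n
  proof (induction n)
   case (Suc n)
   have "nrm (s (Suc (Suc n)) \<ominus> s (Suc n)) \<le> r * (nrm (s 1 \<ominus> s 0) * r ^ n)"
    using step[of n] mult_left_mono[OF Suc r(1)] by linarith
   then show ?case by (simp add: mult_ac)
  qed simp
 qed (use sc r norm_nonneg[OF diff_closed[OF sc sc]] in auto)
 then obtain b where b: "conv s b" using complete by blast
 have bc: "b \<in> carrier C" by (rule conv_carrier(2)[OF b])
 have "conv (\<lambda>n. s (Suc n)) b"
  by (rule convI[OF sc bc LIMSEQ_Suc[OF conv_tendsto[OF b]]])
 moreover have "conv (\<lambda>n. s (Suc n)) (F b)"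
  unfolding sS F_def by (intro conv_smult conv_add conv_const conv_mult b x)
 ultimately have bF: "b = F b" by (rule conv_unique)
 have "(2::complex) \<odot> F b = x \<oplus> b \<otimes> b"
  unfolding F_def using x bc by (simp add: smult_smult add_closed mult_closed h_def smult_1)
 then have "(2::complex) \<odot> b = x \<oplus> b \<otimes> b" using bF by simp
 moreover have "involution C b = b"
  using conv_unique[OF conv_involution[OF b]] b by (simp add: sinv)
 ultimately show ?thesis using bc that by blast
qed

text \<open>If y has norm below 1, take the self-adjoint b with (1 - b)^2 = 1 - x for x the product
  of the adjoint of y with y. Then the squared norm of v - \<phi>(b) v equals the squared norm of v
  minus that of \<phi>(y) v, and it is nonnegative. The general case follows by scaling with 1/t for
  t above the norm of a.\<close>

lemma (in banach_star) rep_contractive: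
 fixes \<phi> :: "'c \<Rightarrow> 'k::chilbert_space \<Rightarrow> 'k"
 assumes \<phi>: "star_hom C bounded_ops \<phi>" and a: "a \<in> carrier C"
 shows "onorm (\<phi> a) \<le> nrm a"
proof -
 have small: "norm (\<phi> y v) \<le> norm v" if y: "y \<in> carrier C" "nrm y < 1" for y v
 proof -
  define x where "x = involution C y \<otimes> y"
  have x: "x \<in> carrier C" "involution C x = x"
   using y by (auto simp: x_def mult_closed involution_closed involution_mult involution_involution)
  have "nrm x \<le> nrm y * nrm y"
   using y norm_mult[of "involution C y" y] by (simp add: x_def involution_closed norm_involution)
  also have "\<dots> \<le> nrm y * 1" using y norm_nonneg[OF y(1)] by (intro mult_left_mono) auto
  also have "\<dots> < 1" using y by simp
  finally obtain b where b: "b \<in> carrier C" "involution C b = b" "(2::complex) \<odot> b = x \<oplus> b \<otimes> b"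
   using quasi_square_root[OF x] by metis
  note f = rep_facts[OF \<phi>]
  have bl: "bounded_clinear (\<phi> b)" "bounded_clinear (\<phi> y)" using f(1) b(1) y(1) by auto
  have "\<phi> ((2::complex) \<odot> b) = \<phi> (x \<oplus> b \<otimes> b)" using b by simp
  then have "2 *\<^sub>C \<phi> b v = \<phi> x v + \<phi> b (\<phi> b v)"
   using b(1) x(1) by (simp add: f mult_closed fun_eq_iff)
  then have e: "cinner v (2 *\<^sub>C \<phi> b v) = cinner v (\<phi> x v) + cinner v (\<phi> b (\<phi> b v))"
   by (simp add: cinner_add_right)
  have "\<phi> x v = cadjoint (\<phi> y) (\<phi> y v)" using y by (simp add: x_def f involution_closed)
  then have ex: "cinner v (\<phi> x v) = complex_of_real ((norm (\<phi> y v))\<^sup>2)"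
   by (simp add: cinner_cadjoint_right[OF bl(2)] cinner_self)
  have sa: "cadjoint (\<phi> b) = \<phi> b" using f(2)[OF b(1)] b(2) by simp
  have "cinner v (\<phi> b (\<phi> b v)) = complex_of_real ((norm (\<phi> b v))\<^sup>2)"
   using cinner_cadjoint[OF bl(1), of v "\<phi> b v"] by (simp add: sa cinner_self)
  then have "Re (cinner v (2 *\<^sub>C \<phi> b v)) = (norm (\<phi> y v))\<^sup>2 + (norm (\<phi> b v))\<^sup>2"
   using e ex by simp
  then have "2 * Re (cinner v (\<phi> b v)) = (norm (\<phi> y v))\<^sup>2 + (norm (\<phi> b v))\<^sup>2"
   by (simp add: cinner_scaleC_right)
  then have "(norm (v - \<phi> b v))\<^sup>2 = (norm v)\<^sup>2 - (norm (\<phi> y v))\<^sup>2"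
   by (simp add: norm_diff_sq)
  then have "(norm (\<phi> y v))\<^sup>2 \<le> (norm v)\<^sup>2" using zero_le_power2[of "norm (v - \<phi> b v)"] by linarith
  then show ?thesis by (rule power2_le_imp_le) simp
 qed
 have "norm (\<phi> a v) \<le> t * norm v" if t: "t > nrm a" for t v
 proof -
  have t0: "t > 0" using t norm_nonneg[OF a] by linarith
  define y where "y = complex_of_real (1/t) \<odot> a"
  have "nrm y < 1" using t t0 a by (simp add: y_def norm_smult norm_divide)
  then have "norm (\<phi> y v) \<le> norm v" using small a by (simp add: y_def smult_closed)
  then have "norm (\<phi> a v) / t \<le> norm v"
   using t0 a by (simp add: y_def rep_facts[OF \<phi>] norm_divide)
  then show ?thesis using t0 by (simp add: pos_divide_le_eq mult.commute)
 qed
 then have "onorm (\<phi> a) \<le> t" if "t > nrm a" for t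
  using that norm_nonneg[OF a] by (intro onorm_bound) auto
 then show ?thesis by (rule dense_ge)
qed

lemma tendsto_0_by_estimate:
 fixes f g :: "nat \<Rightarrow> real"
 assumes "\<And>n. 0 \<le> f n" "\<And>n. f n \<le> g n" "g \<longlonglongrightarrow> 0"
 shows "f \<longlonglongrightarrow> 0"
 using tendsto_sandwich[of "\<lambda>_. 0" f sequentially g 0] assms by simp

lemma star_space_image:
 assumes D: "star_space D" and surj: "j ` carrier D = carrier C" and hom: "star_hom D C j"
  and z: "\<zero>\<^bsub>C\<^esub> = j \<zero>\<^bsub>D\<^esub>"
 shows "star_space C"
proof -
 interpret D: star_space D by fact
 note [simp] = star_hom_mult[OF hom, symmetric] star_hom_involution[OF hom, symmetric]
  linear_map_add[OF star_hom_linear[OF hom], symmetric]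
  linear_map_smult[OF star_hom_linear[OF hom], symmetric] z
  D.smult_closed D.mult_closed D.involution_closed D.smult_add_right D.smult_add_left D.smult_smult
  D.smult_1 D.smult_0
 have c [simp]: "j x \<in> carrier C" if "x \<in> carrier D" for x using surj that by blast
 have ex: "\<exists>x'\<in>carrier D. x = j x'" if "x \<in> carrier C" for x using surj that by blast
 show ?thesis
 proof unfold_locales
  show "\<zero>\<^bsub>C\<^esub> \<in> carrier C" by simp
  fix x a b assume "x \<in> carrier C"
  then obtain x' where x: "x' \<in> carrier D" "x = j x'" using ex by blast
  show "\<zero>\<^bsub>C\<^esub> \<oplus>\<^bsub>C\<^esub> x = x" "a \<odot>\<^bsub>C\<^esub> x \<in> carrier C" "(a + b) \<odot>\<^bsub>C\<^esub> x = a \<odot>\<^bsub>C\<^esub> x \<oplus>\<^bsub>C\<^esub> b \<odot>\<^bsub>C\<^esub> x"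
   "a \<odot>\<^bsub>C\<^esub> (b \<odot>\<^bsub>C\<^esub> x) = (a * b) \<odot>\<^bsub>C\<^esub> x" "1 \<odot>\<^bsub>C\<^esub> x = x" "0 \<odot>\<^bsub>C\<^esub> x = \<zero>\<^bsub>C\<^esub>"
   "involution C x \<in> carrier C"
   using x by simp_all
  fix y assume "y \<in> carrier C"
  then obtain y' where y: "y' \<in> carrier D" "y = j y'" using ex by blast
  show "x \<oplus>\<^bsub>C\<^esub> y \<in> carrier C" "a \<odot>\<^bsub>C\<^esub> (x \<oplus>\<^bsub>C\<^esub> y) = a \<odot>\<^bsub>C\<^esub> x \<oplus>\<^bsub>C\<^esub> a \<odot>\<^bsub>C\<^esub> y" "x \<otimes>\<^bsub>C\<^esub> y \<in> carrier C"
   using x y by simp_all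
  show "x \<oplus>\<^bsub>C\<^esub> y = y \<oplus>\<^bsub>C\<^esub> x" using x y by (simp add: D.a_comm)
  fix w assume "w \<in> carrier C"
  then obtain w' where w: "w' \<in> carrier D" "w = j w'" using ex by blast
  show "x \<oplus>\<^bsub>C\<^esub> y \<oplus>\<^bsub>C\<^esub> w = x \<oplus>\<^bsub>C\<^esub> (y \<oplus>\<^bsub>C\<^esub> w)" using x y w by (simp add: D.a_assoc)
 qed
qed

text \<open>The identities are required after applying \<open>j\<close>. For Cauchy sequences they
  may fail before passing to classes, because the underlying algebra is only a
  \<open>star_space\<close>.\<close>

lemma star_ring_space_image:
 assumes D: "star_space D" and surj: "j ` carrier D = carrier C" and hom: "star_hom D C j"
  and z: "\<zero>\<^bsub>C\<^esub> = j \<zero>\<^bsub>D\<^esub>"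
  and ids: "\<And>x y w. x \<in> carrier D \<Longrightarrow> y \<in> carrier D \<Longrightarrow> w \<in> carrier D \<Longrightarrow>
    j ((x \<oplus>\<^bsub>D\<^esub> y) \<otimes>\<^bsub>D\<^esub> w) = j (x \<otimes>\<^bsub>D\<^esub> w \<oplus>\<^bsub>D\<^esub> y \<otimes>\<^bsub>D\<^esub> w)"
   "\<And>x y w. x \<in> carrier D \<Longrightarrow> y \<in> carrier D \<Longrightarrow> w \<in> carrier D \<Longrightarrow>
    j (x \<otimes>\<^bsub>D\<^esub> (y \<oplus>\<^bsub>D\<^esub> w)) = j (x \<otimes>\<^bsub>D\<^esub> y \<oplus>\<^bsub>D\<^esub> x \<otimes>\<^bsub>D\<^esub> w)"
   "\<And>c x y. x \<in> carrier D \<Longrightarrow> y \<in> carrier D \<Longrightarrow> j ((c \<odot>\<^bsub>D\<^esub> x) \<otimes>\<^bsub>D\<^esub> y) = j (c \<odot>\<^bsub>D\<^esub> (x \<otimes>\<^bsub>D\<^esub> y))"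
   "\<And>c x y. x \<in> carrier D \<Longrightarrow> y \<in> carrier D \<Longrightarrow> j (x \<otimes>\<^bsub>D\<^esub> (c \<odot>\<^bsub>D\<^esub> y)) = j (c \<odot>\<^bsub>D\<^esub> (x \<otimes>\<^bsub>D\<^esub> y))"
   "\<And>x y. x \<in> carrier D \<Longrightarrow> y \<in> carrier D \<Longrightarrow> j (involution D (x \<oplus>\<^bsub>D\<^esub> y)) = j (involution D x \<oplus>\<^bsub>D\<^esub> involution D y)"
   "\<And>c x. x \<in> carrier D \<Longrightarrow> j (involution D (c \<odot>\<^bsub>D\<^esub> x)) = j (cnj c \<odot>\<^bsub>D\<^esub> involution D x)"
   "\<And>x y. x \<in> carrier D \<Longrightarrow> y \<in> carrier D \<Longrightarrow> j (involution D (x \<otimes>\<^bsub>D\<^esub> y)) = j (involution D y \<otimes>\<^bsub>D\<^esub> involution D x)"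
   "\<And>x. x \<in> carrier D \<Longrightarrow> j (involution D (involution D x)) = j x"
 shows "star_ring_space C"
proof -
 interpret D: star_space D by fact
 interpret C: star_space C by (rule star_space_image[OF D surj hom z])
 note [simp] = star_hom_mult[OF hom, symmetric] star_hom_involution[OF hom, symmetric]
  linear_map_add[OF star_hom_linear[OF hom], symmetric]
  linear_map_smult[OF star_hom_linear[OF hom], symmetric]
  D.smult_closed D.mult_closed D.involution_closed
 have ex: "\<exists>x'\<in>carrier D. x = j x'" if "x \<in> carrier C" for x using surj that by blast
 show ?thesis
 proof unfold_locales
  fix x c assume "x \<in> carrier C"
  then obtain x' where x: "x' \<in> carrier D" "x = j x'" using ex by blast
  show "involution C (c \<odot>\<^bsub>C\<^esub> x) = cnj c \<odot>\<^bsub>C\<^esub> involution C x" "involution C (involution C x) = x"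
   using x by (simp_all add: ids)
  fix y assume "y \<in> carrier C"
  then obtain y' where y: "y' \<in> carrier D" "y = j y'" using ex by blast
  show "c \<odot>\<^bsub>C\<^esub> x \<otimes>\<^bsub>C\<^esub> y = c \<odot>\<^bsub>C\<^esub> (x \<otimes>\<^bsub>C\<^esub> y)" "x \<otimes>\<^bsub>C\<^esub> (c \<odot>\<^bsub>C\<^esub> y) = c \<odot>\<^bsub>C\<^esub> (x \<otimes>\<^bsub>C\<^esub> y)"
   "involution C (x \<oplus>\<^bsub>C\<^esub> y) = involution C x \<oplus>\<^bsub>C\<^esub> involution C y"
   "involution C (x \<otimes>\<^bsub>C\<^esub> y) = involution C y \<otimes>\<^bsub>C\<^esub> involution C x"
   using x y by (simp_all add: ids)
  fix w assume "w \<in> carrier C"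
  then obtain w' where w: "w' \<in> carrier D" "w = j w'" using ex by blast
  show "(x \<oplus>\<^bsub>C\<^esub> y) \<otimes>\<^bsub>C\<^esub> w = x \<otimes>\<^bsub>C\<^esub> w \<oplus>\<^bsub>C\<^esub> y \<otimes>\<^bsub>C\<^esub> w" "x \<otimes>\<^bsub>C\<^esub> (y \<oplus>\<^bsub>C\<^esub> w) = x \<otimes>\<^bsub>C\<^esub> y \<oplus>\<^bsub>C\<^esub> x \<otimes>\<^bsub>C\<^esub> w"
   using x y w by (simp_all add: ids)
 qed
qed

section \<open>Maximal completions\<close>

text \<open>\<open>max_norm\<close> is a real supremum, so its value is meaningful only if the norms
  over all representations are bounded. This has to be proved for each algebra separately.\<close>

locale star_bdd = star_space A for A :: "('a, 'm) star_alg_scheme" (structure) +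
 assumes bdd: "x \<in> carrier A \<Longrightarrow> bdd_above ((\<lambda>\<psi>. onorm (\<psi> x)) `
   {\<psi>. star_hom A (bounded_ops :: (('a, complex) ell2 \<Rightarrow> ('a, complex) ell2) star_alg) \<psi>})"
begin

abbreviation rep :: "('a \<Rightarrow> ('a, complex) ell2 \<Rightarrow> ('a, complex) ell2) \<Rightarrow> bool" where
 "rep \<psi> \<equiv> star_hom A bounded_ops \<psi>"

abbreviation "p \<equiv> max_norm A"

abbreviation "C \<equiv> max_completion A"

abbreviation "nrm \<equiv> alg_norm C"

lemma rep_zero: "rep (\<lambda>_ _. 0)"
 by (simp add: star_hom_def clinear_const_0 cadjoint_zero o_def)

lemma rep_le_max_norm:
 fixes \<phi> :: "'a \<Rightarrow> 'k::chilbert_space \<Rightarrow> 'k"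
 assumes "star_hom A bounded_ops \<phi>" "x \<in> carrier A"
 shows "onorm (\<phi> x) \<le> p x"
 using assms bdd by (intro onorm_representation_le_max_norm add_closed smult_closed mult_closed involution_closed)

lemma max_norm_leI:
 assumes "\<And>\<psi>. rep \<psi> \<Longrightarrow> onorm (\<psi> x) \<le> c"
 shows "p x \<le> c"
 unfolding max_norm_def using rep_zero assms by (intro cSUP_least) auto

lemma max_norm_nonneg: "x \<in> carrier A \<Longrightarrow> 0 \<le> p x"
 using rep_le_max_norm[OF rep_zero] by (simp add: onorm_zero)

lemma max_norm_add:
 assumes "x \<in> carrier A" "y \<in> carrier A"
 shows "p (x \<oplus> y) \<le> p x + p y"
proof (rule max_norm_leI)
 fix \<psi> assume \<psi>: "rep \<psi>"
 have "onorm (\<psi> (x \<oplus> y)) \<le> onorm (\<psi> x) + onorm (\<psi> y)"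
  using rep_facts[OF \<psi>] assms by (simp add: onorm_triangle bounded_clinearD)
 then show "onorm (\<psi> (x \<oplus> y)) \<le> p x + p y"
  using rep_le_max_norm[OF \<psi>] assms by (meson add_mono order_trans)
qed

lemma max_norm_smult:
 assumes "x \<in> carrier A"
 shows "p (c \<odot> x) = cmod c * p x"
proof -
 have le: "p (c \<odot> y) \<le> cmod c * p y" if "y \<in> carrier A" for c y
 proof (rule max_norm_leI)
  fix \<psi> assume \<psi>: "rep \<psi>"
  show "onorm (\<psi> (c \<odot> y)) \<le> cmod c * p y"
   using rep_le_max_norm[OF \<psi> that] that
   by (simp add: rep_facts[OF \<psi>] onorm_scaleC mult_left_mono)
 qed
 show ?thesis
 proof (cases "c = 0")
  case True
  have "p (0 \<odot> x) \<le> 0" "0 \<le> p (0 \<odot> x)"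
   using le[OF assms, of 0] max_norm_nonneg[OF smult_closed[OF assms]] by auto
  then show ?thesis using True by simp
 next
  case False
  have "p x = p (inverse c \<odot> (c \<odot> x))" using assms False by (simp add: smult_smult smult_1)
  also have "\<dots> \<le> cmod (inverse c) * p (c \<odot> x)" by (rule le[OF smult_closed[OF assms]])
  finally have "cmod c * p x \<le> cmod c * (cmod (inverse c) * p (c \<odot> x))" by (simp add: mult_left_mono)
  also have "\<dots> = p (c \<odot> x)" using False by (simp add: norm_inverse flip: mult.assoc)
  finally show ?thesis using le[OF assms, of c] by simp
 qed
qed

lemma max_norm_mult:
 assumes "x \<in> carrier A" "y \<in> carrier A"
 shows "p (x \<otimes> y) \<le> p x * p y"
proof (rule max_norm_leI)
 fix \<psi> assume \<psi>: "rep \<psi>"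
 have b: "bounded_clinear (\<psi> x)" "bounded_clinear (\<psi> y)" using rep_facts[OF \<psi>] assms by auto
 have "onorm (\<psi> (x \<otimes> y)) \<le> onorm (\<psi> x) * onorm (\<psi> y)"
  using rep_facts[OF \<psi>] assms by (simp add: onorm_compose bounded_clinearD)
 also have "\<dots> \<le> p x * p y"
  using rep_le_max_norm[OF \<psi>] assms b
  by (intro mult_mono) (auto intro: onorm_nonneg max_norm_nonneg)
 finally show "onorm (\<psi> (x \<otimes> y)) \<le> p x * p y" .
qed

text \<open>Splitting the difference of products requires distributivity, which a
  \<open>star_space\<close> does not provide. It holds for the operators of every representation,
  and the maximal norm sees nothing else.\<close>

lemma max_norm_mult_diff:
 assumes c: "x \<in> carrier A" "y \<in> carrier A" "x' \<in> carrier A" "y' \<in> carrier A"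
 shows "p (x \<otimes> y \<ominus> x' \<otimes> y') \<le> p (x \<ominus> x') * p y + p x' * p (y \<ominus> y')"
proof (rule max_norm_leI)
 fix \<psi> assume \<psi>: "rep \<psi>"
 have b: "bounded_clinear (\<psi> z)" if "z \<in> carrier A" for z using rep_facts(1)[OF \<psi> that] .
 note m = rep_minus[OF star_space_axioms \<psi>]
 show "onorm (\<psi> (x \<otimes> y \<ominus> x' \<otimes> y')) \<le> p (x \<ominus> x') * p y + p x' * p (y \<ominus> y')"
 proof (rule onorm_bound)
  fix v
  have *: "norm (\<psi> a (\<psi> b v)) \<le> p a * p b * norm v" if "a \<in> carrier A" "b \<in> carrier A" for a b
  proof -
   have "norm (\<psi> a (\<psi> b v)) \<le> onorm (\<psi> (a \<otimes> b)) * norm v"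
    using norm_le_onorm[OF b[OF mult_closed[OF that]], of v] that by (simp add: rep_facts[OF \<psi>])
   also have "\<dots> \<le> p a * p b * norm v"
    using rep_le_max_norm[OF \<psi> mult_closed[OF that]] max_norm_mult[OF that]
    by (intro mult_right_mono) auto
   finally show ?thesis .
  qed
  have "\<psi> (x \<otimes> y \<ominus> x' \<otimes> y') v = \<psi> (x \<ominus> x') (\<psi> y v) + \<psi> x' (\<psi> (y \<ominus> y') v)"
   using c by (simp add: m mult_closed rep_facts[OF \<psi>] clinear_diff[OF b])
  then show "norm (\<psi> (x \<otimes> y \<ominus> x' \<otimes> y') v) \<le> (p (x \<ominus> x') * p y + p x' * p (y \<ominus> y')) * norm v"
   using *[OF diff_closed[OF c(1,3)] c(2)] *[OF c(3) diff_closed[OF c(2,4)]]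
    norm_triangle_ineq[of "\<psi> (x \<ominus> x') (\<psi> y v)" "\<psi> x' (\<psi> (y \<ominus> y') v)"]
   by (simp add: distrib_right)
 qed (use c in \<open>intro add_nonneg_nonneg mult_nonneg_nonneg max_norm_nonneg diff_closed\<close>)
qed

lemma max_norm_involution_le:
 assumes "x \<in> carrier A" "y \<in> carrier A"
 shows "p (involution A x \<ominus> involution A y) \<le> p (x \<ominus> y)"
proof (rule max_norm_leI)
 fix \<psi> assume \<psi>: "rep \<psi>"
 note m = rep_minus[OF star_space_axioms \<psi>] and f = rep_facts[OF \<psi>]
 have "\<psi> (involution A x \<ominus> involution A y) = cadjoint (\<psi> (x \<ominus> y))"
  using assms by (simp add: m f involution_closed cadjoint_minus)
 then have "onorm (\<psi> (involution A x \<ominus> involution A y)) = onorm (\<psi> (x \<ominus> y))"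
  using assms by (simp add: onorm_cadjoint f diff_closed)
 then show "onorm (\<psi> (involution A x \<ominus> involution A y)) \<le> p (x \<ominus> y)"
  using rep_le_max_norm[OF \<psi>] assms by (simp add: diff_closed)
qed

lemma max_norm_zero: "p \<zero> = 0"
 using max_norm_smult[OF zero_in_carrier, of 0] by (simp add: smult_0 zero_in_carrier)

lemma max_norm_involution:
 assumes x: "x \<in> carrier A"
 shows "p (involution A x) = p x"
proof -
 have le: "p (involution A x) \<le> p x" if "x \<in> carrier A" for x
 proof (rule max_norm_leI)
  fix \<psi> assume \<psi>: "rep \<psi>"
  show "onorm (\<psi> (involution A x)) \<le> p x"
   using that rep_le_max_norm[OF \<psi> that] by (simp add: rep_facts[OF \<psi>] onorm_cadjoint)
 qed
 have "p x \<le> p (involution A x)"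
 proof (rule max_norm_leI)
  fix \<psi> assume \<psi>: "rep \<psi>"
  have "onorm (\<psi> x) = onorm (\<psi> (involution A x))"
   using x by (simp add: rep_facts[OF \<psi>] onorm_cadjoint)
  then show "onorm (\<psi> x) \<le> p (involution A x)"
   using rep_le_max_norm[OF \<psi> involution_closed[OF x]] by simp
 qed
 with le[OF x] show ?thesis by simp
qed

text \<open>Elements that no representation separates become equal in the completion.\<close>

lemma max_norm_minus_eq_0:
 assumes "x \<in> carrier A" "y \<in> carrier A" "\<And>\<psi>. rep \<psi> \<Longrightarrow> \<psi> x = \<psi> y"
 shows "p (x \<ominus> y) = 0"
proof (rule antisym)
 show "p (x \<ominus> y) \<le> 0"
 proof (rule max_norm_leI)
  fix \<psi> assume \<psi>: "rep \<psi>"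
  show "onorm (\<psi> (x \<ominus> y)) \<le> 0"
   using assms by (simp add: rep_minus[OF star_space_axioms \<psi>] \<psi> onorm_zero)
 qed
qed (intro max_norm_nonneg diff_closed assms)

lemma max_norm_minus_commute: "x \<in> carrier A \<Longrightarrow> y \<in> carrier A \<Longrightarrow> p (x \<ominus> y) = p (y \<ominus> x)"
 using max_norm_smult[of "x \<ominus> y" "-1"] by (simp add: diff_closed a_inv_minus)

lemma max_norm_triangle:
 "x \<in> carrier A \<Longrightarrow> y \<in> carrier A \<Longrightarrow> z \<in> carrier A \<Longrightarrow> p (x \<ominus> z) \<le> p (x \<ominus> y) + p (y \<ominus> z)"
 using max_norm_add[of "x \<ominus> y" "y \<ominus> z"] by (simp add: diff_closed minus_minus_add[of x y z])

lemma max_norm_diff_le: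
 assumes "x \<in> carrier A" "y \<in> carrier A"
 shows "\<bar>p x - p y\<bar> \<le> p (x \<ominus> y)"
 using max_norm_add[of "x \<ominus> y" y] max_norm_add[of "y \<ominus> x" x] max_norm_minus_commute[of x y] assms
 by (simp add: diff_closed add_minus_cancel)

section \<open>Cauchy sequences and their classes\<close>

abbreviation "CS \<equiv> cauchy_seqs A p"
abbreviation "cls \<equiv> cauchy_class A p"

lemma CS_carrier: "s \<in> CS \<Longrightarrow> s n \<in> carrier A"
 by (auto simp: cauchy_seqs_def)

lemma CSI:
 assumes c: "\<And>n. s n \<in> carrier A"
  and e: "\<And>e. e > 0 \<Longrightarrow> \<exists>N. \<forall>m\<ge>N. \<forall>n\<ge>N. p (s m \<ominus> s n) < e"
 shows "s \<in> CS"
 using assms by (auto simp: cauchy_seqs_def)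

lemma CSD: "s \<in> CS \<Longrightarrow> e > 0 \<Longrightarrow> \<exists>N. \<forall>m\<ge>N. \<forall>n\<ge>N. p (s m \<ominus> s n) < e"
 by (simp add: cauchy_seqs_def)

lemma CS_const: "x \<in> carrier A \<Longrightarrow> (\<lambda>_. x) \<in> CS"
 by (rule CSI) (auto simp: minus_self max_norm_zero)

lemma CS_norm_convergent:
 assumes s: "s \<in> CS"
 shows "convergent (\<lambda>n. p (s n))"
proof (rule Cauchy_convergent, rule CauchyI)
 fix e :: real assume "e > 0"
 then obtain N where N: "\<forall>m\<ge>N. \<forall>n\<ge>N. p (s m \<ominus> s n) < e" using CSD[OF s] by blast
 show "\<exists>M. \<forall>m\<ge>M. \<forall>n\<ge>M. norm (p (s m) - p (s n)) < e"
  using N max_norm_diff_le[OF CS_carrier[OF s] CS_carrier[OF s]]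
  by (intro exI[of _ N]) (metis le_less_trans real_norm_def)
qed

lemma CS_bounded:
 assumes "s \<in> CS"
 obtains B where "B > 0" "\<And>n. p (s n) \<le> B"
proof -
 have "Bseq (\<lambda>n. p (s n))" using CS_norm_convergent[OF assms] by (rule convergent_imp_Bseq)
 then obtain B where "B > 0" "\<And>n. norm (p (s n)) \<le> B" by (auto elim: BseqE)
 then show ?thesis using that[of B] by (metis abs_le_D1 real_norm_def)
qed

lemma CS_by_estimate:
 assumes s: "s \<in> CS" and t: "t \<in> CS" and u: "\<And>n. u n \<in> carrier A" and K: "K \<ge> 0" "L \<ge> 0"
  and le: "\<And>m n. p (u m \<ominus> u n) \<le> K * p (s m \<ominus> s n) + L * p (t m \<ominus> t n)"
 shows "u \<in> CS"
proof (rule CSI[OF u])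
 fix e :: real assume e: "e > 0"
 \<comment> \<open>The summand 1 covers K = L = 0 and makes the final inequality strict.\<close>
 define d where "d = e / (K + L + 1)"
 have d: "d > 0" "(K + L) * d < e" using e K by (auto simp: d_def field_simps)
 obtain M N where M: "\<forall>m\<ge>M. \<forall>n\<ge>M. p (s m \<ominus> s n) < d" and N: "\<forall>m\<ge>N. \<forall>n\<ge>N. p (t m \<ominus> t n) < d"
  using CSD[OF s d(1)] CSD[OF t d(1)] by blast
 have "p (u m \<ominus> u n) < e" if "m \<ge> max M N" "n \<ge> max M N" for m n
 proof -
  have "p (s m \<ominus> s n) \<le> d" "p (t m \<ominus> t n) \<le> d" using M N that by (auto intro: less_imp_le)
  then have "K * p (s m \<ominus> s n) + L * p (t m \<ominus> t n) \<le> K * d + L * d"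
   using K by (intro add_mono mult_left_mono)
  then show ?thesis using le[of m n] d(2) by (simp add: distrib_right)
 qed
 then show "\<exists>N. \<forall>m\<ge>N. \<forall>n\<ge>N. p (u m \<ominus> u n) < e" by blast
qed

lemma CS_add:
 assumes s: "s \<in> CS" and t: "t \<in> CS"
 shows "(\<lambda>n. s n \<oplus> t n) \<in> CS"
 by (rule CS_by_estimate[OF s t, of _ 1 1])
  (use CS_carrier[OF s] CS_carrier[OF t] in \<open>auto simp: add_minus_add max_norm_add diff_closed add_closed\<close>)

lemma CS_smult:
 assumes s: "s \<in> CS"
 shows "(\<lambda>n. c \<odot> s n) \<in> CS"
 by (rule CS_by_estimate[OF s s, of _ "cmod c" 0])
  (use CS_carrier[OF s] in \<open>auto simp: smult_minus[symmetric] max_norm_smult diff_closed smult_closed\<close>)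

lemma CS_involution:
 assumes s: "s \<in> CS"
 shows "(\<lambda>n. involution A (s n)) \<in> CS"
 by (rule CS_by_estimate[OF s s, of _ 1 0])
  (use CS_carrier[OF s] in \<open>auto simp: max_norm_involution_le involution_closed\<close>)

lemma CS_mult:
 assumes s: "s \<in> CS" and t: "t \<in> CS"
 shows "(\<lambda>n. s n \<otimes> t n) \<in> CS"
proof -
 obtain K where K: "K > 0" "\<And>n. p (s n) \<le> K" using CS_bounded[OF s] by blast
 obtain L where L: "L > 0" "\<And>n. p (t n) \<le> L" using CS_bounded[OF t] by blast
 note sc = CS_carrier[OF s] and tc = CS_carrier[OF t]
 show ?thesis
 proof (rule CS_by_estimate[OF s t, of _ L K])
  fix m n
  have "p (s m \<otimes> t m \<ominus> s n \<otimes> t n) \<le> p (s m \<ominus> s n) * p (t m) + p (s n) * p (t m \<ominus> t n)"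
   by (rule max_norm_mult_diff[OF sc tc sc tc])
  also have "\<dots> \<le> p (s m \<ominus> s n) * L + K * p (t m \<ominus> t n)"
   using K L by (intro add_mono mult_left_mono mult_right_mono max_norm_nonneg diff_closed sc tc)
  finally show "p (s m \<otimes> t m \<ominus> s n \<otimes> t n) \<le> L * p (s m \<ominus> s n) + K * p (t m \<ominus> t n)" by (simp add: mult.commute)
 qed (use sc tc K L in \<open>auto intro: mult_closed\<close>)
qed

lemma equiv_null_rel: "equiv CS (null_rel A p)"
proof (rule equivI)
 show "null_rel A p \<subseteq> CS \<times> CS" by (auto simp: null_rel_def)
 show "refl_on CS (null_rel A p)"
  by (rule refl_onI) (simp add: null_rel_def CS_carrier minus_self max_norm_zero)
 show "sym (null_rel A p)"
  by (rule symI) (auto simp: null_rel_def max_norm_minus_commute[OF CS_carrier CS_carrier])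
 show "trans (null_rel A p)"
 proof (rule transI)
  fix s t u assume "(s, t) \<in> null_rel A p" "(t, u) \<in> null_rel A p"
  then have *: "s \<in> CS" "t \<in> CS" "u \<in> CS"
   and lim: "(\<lambda>n. p (s n \<ominus> t n)) \<longlonglongrightarrow> 0" "(\<lambda>n. p (t n \<ominus> u n)) \<longlonglongrightarrow> 0"
   by (auto simp: null_rel_def)
  have "(\<lambda>n. p (s n \<ominus> u n)) \<longlonglongrightarrow> 0"
  proof (rule tendsto_0_by_estimate)
   show "p (s n \<ominus> u n) \<le> p (s n \<ominus> t n) + p (t n \<ominus> u n)" for n
    using * by (intro max_norm_triangle CS_carrier)
   show "(\<lambda>n. p (s n \<ominus> t n) + p (t n \<ominus> u n)) \<longlonglongrightarrow> 0" using tendsto_add[OF lim] by simp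
  qed (use * in \<open>intro max_norm_nonneg diff_closed CS_carrier\<close>)
  then show "(s, u) \<in> null_rel A p" using * by (simp add: null_rel_def)
 qed
qed

lemma cls_eq_iff: "s \<in> CS \<Longrightarrow> t \<in> CS \<Longrightarrow> cls s = cls t \<longleftrightarrow> (\<lambda>n. p (s n \<ominus> t n)) \<longlonglongrightarrow> 0"
 unfolding cauchy_class_def by (subst eq_equiv_class_iff[OF equiv_null_rel]) (auto simp: null_rel_def)

lemma mem_cls: "s \<in> CS \<Longrightarrow> t \<in> cls s \<longleftrightarrow> t \<in> CS \<and> cls t = cls s"
 using equiv_class_eq_iff[OF equiv_null_rel, of s t] by (auto simp: cauchy_class_def)

lemma carrier_completion: "carrier C = cls ` CS"
 by (auto simp: max_completion_def completion_def quotient_def cauchy_class_def)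

text \<open>Operations on classes are encoded as unions over representatives. Once the value does
  not depend on the representative, the union collapses to it.\<close>

lemma UN_cls:
 assumes s: "s \<in> CS" and f: "\<And>t. t \<in> CS \<Longrightarrow> cls t = cls s \<Longrightarrow> f t = f s"
 shows "(\<Union>t\<in>cls s. f t) = f s"
proof -
 have mem: "s \<in> cls s" using s by (simp add: mem_cls)
 have eq: "f t = f s" if "t \<in> cls s" for t using f that mem_cls[OF s] by blast
 show ?thesis
 proof (rule equalityI)
  show "(\<Union>t\<in>cls s. f t) \<subseteq> f s" by (rule UN_least) (simp only: eq subset_refl)
  show "f s \<subseteq> (\<Union>t\<in>cls s. f t)" by (rule UN_upper[OF mem])
 qed
qed

lemma cls_by_estimate:
 assumes s: "s \<in> CS" "s' \<in> CS" "cls s = cls s'" and t: "t \<in> CS" "t' \<in> CS" "cls t = cls t'"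
  and u: "u \<in> CS" "u' \<in> CS"
  and le: "\<And>n. p (u n \<ominus> u' n) \<le> K * p (s n \<ominus> s' n) + L * p (t n \<ominus> t' n)"
 shows "cls u = cls u'"
proof -
 have "(\<lambda>n. p (u n \<ominus> u' n)) \<longlonglongrightarrow> 0"
 proof (rule tendsto_0_by_estimate[OF _ le])
  have lims: "(\<lambda>n. p (s n \<ominus> s' n)) \<longlonglongrightarrow> 0" "(\<lambda>n. p (t n \<ominus> t' n)) \<longlonglongrightarrow> 0"
   using cls_eq_iff[OF s(1,2)] s(3) cls_eq_iff[OF t(1,2)] t(3) by blast+
  show "(\<lambda>n. K * p (s n \<ominus> s' n) + L * p (t n \<ominus> t' n)) \<longlonglongrightarrow> 0"
   using tendsto_add[OF tendsto_mult[OF tendsto_const[of K sequentially] lims(1)]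
     tendsto_mult[OF tendsto_const[of L sequentially] lims(2)]] by simp
 qed (use u in \<open>intro max_norm_nonneg diff_closed CS_carrier\<close>)
 then show ?thesis using cls_eq_iff[OF u] by simp
qed

lemma completion_ops:
 assumes s: "s \<in> CS"
 shows "c \<odot>\<^bsub>C\<^esub> cls s = cls (\<lambda>n. c \<odot> s n)"
  and "involution C (cls s) = cls (\<lambda>n. involution A (s n))"
  and "t \<in> CS \<Longrightarrow> cls s \<oplus>\<^bsub>C\<^esub> cls t = cls (\<lambda>n. s n \<oplus> t n)"
  and "t \<in> CS \<Longrightarrow> cls s \<otimes>\<^bsub>C\<^esub> cls t = cls (\<lambda>n. s n \<otimes> t n)"
  and "\<zero>\<^bsub>C\<^esub> = cls (\<lambda>_. \<zero>)"
proof -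
 note sc = CS_carrier[OF s]
 have "cls (\<lambda>n. c \<odot> t n) = cls (\<lambda>n. c \<odot> s n)" if t: "t \<in> CS" "cls t = cls s" for t
  by (rule cls_by_estimate[OF t(1) s t(2) t(1) s t(2) CS_smult[OF t(1)] CS_smult[OF s], where K = "cmod c" and L = 0])
   (use sc CS_carrier[OF t(1)] in \<open>simp add: smult_minus[symmetric] max_norm_smult diff_closed\<close>)
 then show "c \<odot>\<^bsub>C\<^esub> cls s = cls (\<lambda>n. c \<odot> s n)"
  using UN_cls[OF s, of "\<lambda>t. cls (\<lambda>n. c \<odot> t n)"] by (simp add: max_completion_def completion_def)
 have "cls (\<lambda>n. involution A (t n)) = cls (\<lambda>n. involution A (s n))" if t: "t \<in> CS" "cls t = cls s" for t
  by (rule cls_by_estimate[OF t(1) s t(2) t(1) s t(2) CS_involution[OF t(1)] CS_involution[OF s], where K = 1 and L = 0])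
   (use sc CS_carrier[OF t(1)] in \<open>simp add: max_norm_involution_le\<close>)
 then show "involution C (cls s) = cls (\<lambda>n. involution A (s n))"
  using UN_cls[OF s, of "\<lambda>t. cls (\<lambda>n. involution A (t n))"] by (simp add: max_completion_def completion_def)
 show "\<zero>\<^bsub>C\<^esub> = cls (\<lambda>_. \<zero>)" by (simp add: max_completion_def completion_def)
 assume t: "t \<in> CS"
 note tc = CS_carrier[OF t]
 have a: "cls (\<lambda>n. s' n \<oplus> t' n) = cls (\<lambda>n. s n \<oplus> t n)"
  if s': "s' \<in> CS" "cls s' = cls s" and t': "t' \<in> CS" "cls t' = cls t" for s' t'
  by (rule cls_by_estimate[OF s'(1) s s'(2) t'(1) t t'(2) CS_add[OF s'(1) t'(1)] CS_add[OF s t], where K = 1 and L = 1])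
   (use sc tc CS_carrier[OF s'(1)] CS_carrier[OF t'(1)] in \<open>simp add: add_minus_add max_norm_add diff_closed\<close>)
 have "(\<Union>t'\<in>cls t. cls (\<lambda>n. s' n \<oplus> t' n)) = cls (\<lambda>n. s n \<oplus> t n)" if s': "s' \<in> CS" "cls s' = cls s" for s'
 proof -
  have "(\<Union>t'\<in>cls t. cls (\<lambda>n. s' n \<oplus> t' n)) = cls (\<lambda>n. s' n \<oplus> t n)"
   by (rule UN_cls[OF t]) (simp only: a[OF s'] t)
  then show ?thesis by (simp only: a[OF s' t refl])
 qed
 then show "cls s \<oplus>\<^bsub>C\<^esub> cls t = cls (\<lambda>n. s n \<oplus> t n)"
  using UN_cls[OF s, of "\<lambda>s'. \<Union>t'\<in>cls t. cls (\<lambda>n. s' n \<oplus> t' n)"] s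
  by (simp add: max_completion_def completion_def)
 have m: "cls (\<lambda>n. s' n \<otimes> t' n) = cls (\<lambda>n. s n \<otimes> t n)"
  if s': "s' \<in> CS" "cls s' = cls s" and t': "t' \<in> CS" "cls t' = cls t" for s' t'
 proof -
  obtain K where K: "K > 0" "\<And>n. p (s n) \<le> K" using CS_bounded[OF s] by blast
  obtain L where L: "L > 0" "\<And>n. p (t' n) \<le> L" using CS_bounded[OF t'(1)] by blast
  note sc' = CS_carrier[OF s'(1)] and tc' = CS_carrier[OF t'(1)]
  show ?thesis
  proof (rule cls_by_estimate[OF s'(1) s s'(2) t'(1) t t'(2) CS_mult[OF s'(1) t'(1)] CS_mult[OF s t], where K = L and L = K])
   fix n
   have "p (s' n \<otimes> t' n \<ominus> s n \<otimes> t n) \<le> p (s' n \<ominus> s n) * p (t' n) + p (s n) * p (t' n \<ominus> t n)"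
    by (rule max_norm_mult_diff[OF sc' tc' sc tc])
   also have "\<dots> \<le> p (s' n \<ominus> s n) * L + K * p (t' n \<ominus> t n)"
    using K L by (intro add_mono mult_left_mono mult_right_mono max_norm_nonneg diff_closed sc tc sc' tc')
   finally show "p (s' n \<otimes> t' n \<ominus> s n \<otimes> t n) \<le> L * p (s' n \<ominus> s n) + K * p (t' n \<ominus> t n)"
    by (simp add: mult.commute)
  qed
 qed
 have "(\<Union>t'\<in>cls t. cls (\<lambda>n. s' n \<otimes> t' n)) = cls (\<lambda>n. s n \<otimes> t n)" if s': "s' \<in> CS" "cls s' = cls s" for s'
 proof -
  have "(\<Union>t'\<in>cls t. cls (\<lambda>n. s' n \<otimes> t' n)) = cls (\<lambda>n. s' n \<otimes> t n)"
   by (rule UN_cls[OF t]) (simp only: m[OF s'] t)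
  then show ?thesis by (simp only: m[OF s' t refl])
 qed
 then show "cls s \<otimes>\<^bsub>C\<^esub> cls t = cls (\<lambda>n. s n \<otimes> t n)"
  using UN_cls[OF s, of "\<lambda>s'. \<Union>t'\<in>cls t. cls (\<lambda>n. s' n \<otimes> t' n)"] s
  by (simp add: max_completion_def completion_def)
qed

text \<open>\<open>alg_norm\<close> reads the norm off a representative picked by
  \<open>SOME\<close>. Equivalent sequences have the same limit of norms, so any representative may
  be used.\<close>

lemma norm_cls:
 assumes s: "s \<in> CS"
 shows "(\<lambda>n. p (s n)) \<longlonglongrightarrow> nrm (cls s)"
proof -
 define t where "t = (SOME t. t \<in> cls s)"
 have "s \<in> cls s" using s by (simp add: mem_cls)
 then have "t \<in> cls s" unfolding t_def by (rule someI[of "\<lambda>t. t \<in> cls s"])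
 then have t: "t \<in> CS" "cls t = cls s" using s mem_cls by auto
 obtain L where L: "(\<lambda>n. p (s n)) \<longlonglongrightarrow> L" using CS_norm_convergent[OF s] convergent_def by blast
 have "(\<lambda>n. p (t n) - p (s n)) \<longlonglongrightarrow> 0"
 proof (rule tendsto_rabs_zero_cancel, rule tendsto_0_by_estimate)
  show "\<bar>p (t n) - p (s n)\<bar> \<le> p (t n \<ominus> s n)" for n
   by (rule max_norm_diff_le[OF CS_carrier[OF t(1)] CS_carrier[OF s]])
  show "(\<lambda>n. p (t n \<ominus> s n)) \<longlonglongrightarrow> 0" using t s cls_eq_iff by blast
 qed simp
 from tendsto_add[OF this L] have "(\<lambda>n. p (t n)) \<longlonglongrightarrow> L" by simp
 then have "nrm (cls s) = L"
  by (simp add: max_completion_def completion_def t_def limI)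
 then show ?thesis using L by simp
qed

lemma norm_cls_eqI: "s \<in> CS \<Longrightarrow> (\<lambda>n. p (s n)) \<longlonglongrightarrow> L \<Longrightarrow> nrm (cls s) = L"
 using norm_cls LIMSEQ_unique by blast

text \<open>With pointwise operations on Cauchy sequences the completion becomes the image of
  \<open>cls\<close>, so its axioms can be transported along a surjection.\<close>

definition seq_alg :: "(nat \<Rightarrow> 'a) star_alg" where
 "seq_alg = \<lparr>carrier = CS, mult = (\<lambda>s t n. s n \<otimes> t n), one = undefined, zero = (\<lambda>_. \<zero>),
   add = (\<lambda>s t n. s n \<oplus> t n), smult = (\<lambda>c s n. c \<odot> s n), involution = (\<lambda>s n. involution A (s n))\<rparr>"

lemma seq_alg_simps [simp]:
 "carrier seq_alg = CS" "s \<otimes>\<^bsub>seq_alg\<^esub> t = (\<lambda>n. s n \<otimes> t n)" "s \<oplus>\<^bsub>seq_alg\<^esub> t = (\<lambda>n. s n \<oplus> t n)"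
 "c \<odot>\<^bsub>seq_alg\<^esub> s = (\<lambda>n. c \<odot> s n)" "\<zero>\<^bsub>seq_alg\<^esub> = (\<lambda>_. \<zero>)" "involution seq_alg s = (\<lambda>n. involution A (s n))"
 by (simp_all add: seq_alg_def)

lemma star_space_seq_alg: "star_space seq_alg"
 by unfold_locales
  (auto simp: CS_add CS_smult CS_mult CS_involution CS_const zero_in_carrier fun_eq_iff
   add_assoc CS_carrier zero_add smult_add_right smult_add_left smult_smult smult_1 smult_0 intro: add_comm CS_carrier)

text \<open>Multiplicative laws of the completion are proved this way: they hold for operators,
  hence termwise under every representation.\<close>

lemma cls_eq_by_reps:
 assumes s: "s \<in> CS" and t: "t \<in> CS" and eq: "\<And>\<psi> n. rep \<psi> \<Longrightarrow> \<psi> (s n) = \<psi> (t n)"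
 shows "cls s = cls t"
 using max_norm_minus_eq_0[OF CS_carrier[OF s] CS_carrier[OF t] eq] by (simp add: cls_eq_iff s t)

lemma star_hom_cls: "star_hom seq_alg C cls"
 by (simp add: star_hom_def completion_ops carrier_completion)

lemma star_ring_space_completion: "star_ring_space C"
proof (rule star_ring_space_image[OF star_space_seq_alg _ star_hom_cls])
 show "cls ` carrier seq_alg = carrier C" by (simp add: carrier_completion)
 show "\<zero>\<^bsub>C\<^esub> = cls \<zero>\<^bsub>seq_alg\<^esub>" by (simp add: completion_ops(5)[OF CS_const[OF zero_in_carrier]])
 note cl = CS_add CS_smult CS_mult CS_involution CS_carrier add_closed smult_closed mult_closed involution_closed
 note [simp] = cl
 fix s c assume s: "s \<in> carrier seq_alg"
 show "cls (involution seq_alg (c \<odot>\<^bsub>seq_alg\<^esub> s)) = cls (cnj c \<odot>\<^bsub>seq_alg\<^esub> involution seq_alg s)"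
  "cls (involution seq_alg (involution seq_alg s)) = cls s"
  using s by - (rule cls_eq_by_reps; simp add: rep_facts cadjoint_cmult cadjoint_cadjoint)+
 fix t assume t: "t \<in> carrier seq_alg"
 show "cls (c \<odot>\<^bsub>seq_alg\<^esub> s \<otimes>\<^bsub>seq_alg\<^esub> t) = cls (c \<odot>\<^bsub>seq_alg\<^esub> (s \<otimes>\<^bsub>seq_alg\<^esub> t))"
  "cls (s \<otimes>\<^bsub>seq_alg\<^esub> (c \<odot>\<^bsub>seq_alg\<^esub> t)) = cls (c \<odot>\<^bsub>seq_alg\<^esub> (s \<otimes>\<^bsub>seq_alg\<^esub> t))"
  "cls (involution seq_alg (s \<oplus>\<^bsub>seq_alg\<^esub> t)) = cls (involution seq_alg s \<oplus>\<^bsub>seq_alg\<^esub> involution seq_alg t)"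
  using s t by - (rule cls_eq_by_reps; simp add: rep_facts cadjoint_plus clinear_scaleC[OF rep_facts(1)] fun_eq_iff)+
 show "cls (involution seq_alg (s \<otimes>\<^bsub>seq_alg\<^esub> t)) = cls (involution seq_alg t \<otimes>\<^bsub>seq_alg\<^esub> involution seq_alg s)"
  using s t by - (rule cls_eq_by_reps; simp add: rep_facts cadjoint_comp[unfolded o_def] o_def)
 fix u assume u: "u \<in> carrier seq_alg"
 show "cls ((s \<oplus>\<^bsub>seq_alg\<^esub> t) \<otimes>\<^bsub>seq_alg\<^esub> u) = cls (s \<otimes>\<^bsub>seq_alg\<^esub> u \<oplus>\<^bsub>seq_alg\<^esub> t \<otimes>\<^bsub>seq_alg\<^esub> u)"
  "cls (s \<otimes>\<^bsub>seq_alg\<^esub> (t \<oplus>\<^bsub>seq_alg\<^esub> u)) = cls (s \<otimes>\<^bsub>seq_alg\<^esub> t \<oplus>\<^bsub>seq_alg\<^esub> s \<otimes>\<^bsub>seq_alg\<^esub> u)"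
  using s t u by - (rule cls_eq_by_reps; simp add: rep_facts clinear_add[OF rep_facts(1)] fun_eq_iff)+
qed

interpretation C: star_ring_space C
 by (rule star_ring_space_completion)

lemma cls_minus:
 assumes s: "s \<in> CS" and t: "t \<in> CS"
 shows "cls s \<ominus>\<^bsub>C\<^esub> cls t = cls (\<lambda>n. s n \<ominus> t n)" "(\<lambda>n. s n \<ominus> t n) \<in> CS"
proof -
 have "s \<ominus>\<^bsub>seq_alg\<^esub> t = (\<lambda>n. s n \<ominus> t n)"
  using s t by (simp add: star_space.minus_eq_smult[OF star_space_seq_alg] minus_eq_smult CS_carrier)
 then show "cls s \<ominus>\<^bsub>C\<^esub> cls t = cls (\<lambda>n. s n \<ominus> t n)" "(\<lambda>n. s n \<ominus> t n) \<in> CS"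
  using linear_map_minus[OF star_space_seq_alg C.star_space_axioms star_hom_linear[OF star_hom_cls], of s t]
   star_space.diff_closed[OF star_space_seq_alg, of s t] s t by simp_all
qed

lemma normed_star_completion: "normed_star C"
proof unfold_locales
 note n = norm_cls
 fix x c assume "x \<in> carrier C"
 then obtain s where s: "s \<in> CS" "x = cls s" by (auto simp: carrier_completion)
 note sc = CS_carrier[OF s(1)]
 show "0 \<le> nrm x"
  unfolding s(2) by (rule LIMSEQ_le_const[OF n[OF s(1)]]) (use sc max_norm_nonneg in blast)
 show "x = \<zero>\<^bsub>C\<^esub>" if "nrm x = 0"
  using n[OF s(1)] that s sc
  by (simp add: completion_ops(5)[OF s(1)] cls_eq_iff CS_const zero_in_carrier minus_eq_smult smult_zero_right)
 show "nrm (c \<odot>\<^bsub>C\<^esub> x) = cmod c * nrm x"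
  using tendsto_mult_left[OF n[OF s(1)], of "cmod c"] s sc
  by (simp add: completion_ops) (intro norm_cls_eqI, auto simp: CS_smult max_norm_smult)
 show "nrm (involution C x) = nrm x"
  using n[OF s(1)] s sc
  by (simp add: completion_ops) (intro norm_cls_eqI, auto simp: CS_involution max_norm_involution)
 fix y assume "y \<in> carrier C"
 then obtain t where t: "t \<in> CS" "y = cls t" by (auto simp: carrier_completion)
 note tc = CS_carrier[OF t(1)]
 show "nrm (x \<oplus>\<^bsub>C\<^esub> y) \<le> nrm x + nrm y"
  unfolding s(2) t(2) completion_ops(3)[OF s(1) t(1)]
  by (rule LIMSEQ_le[OF n[OF CS_add[OF s(1) t(1)]] tendsto_add[OF n[OF s(1)] n[OF t(1)]]])
   (use sc tc max_norm_add in blast)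
 show "nrm (x \<otimes>\<^bsub>C\<^esub> y) \<le> nrm x * nrm y"
  unfolding s(2) t(2) completion_ops(4)[OF s(1) t(1)]
  by (rule LIMSEQ_le[OF n[OF CS_mult[OF s(1) t(1)]] tendsto_mult[OF n[OF s(1)] n[OF t(1)]]])
   (use sc tc max_norm_mult in blast)
qed

interpretation C: normed_star C
 by (rule normed_star_completion)

lemma max_embed_eq: "max_embed A x = cls (\<lambda>_. x)"
 by (simp add: max_embed_def)

lemma star_hom_max_embed: "star_hom A C (max_embed A)"
 by (auto simp: star_hom_def max_embed_eq completion_ops CS_const carrier_completion)

lemma norm_max_embed: "x \<in> carrier A \<Longrightarrow> nrm (max_embed A x) = p x"
 unfolding max_embed_eq by (intro norm_cls_eqI CS_const) auto

lemma max_embed_minus: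
 "x \<in> carrier A \<Longrightarrow> y \<in> carrier A \<Longrightarrow> max_embed A (x \<ominus> y) = max_embed A x \<ominus>\<^bsub>C\<^esub> max_embed A y"
 using linear_map_minus[OF star_space_axioms C.star_space_axioms star_hom_linear[OF star_hom_max_embed]] .

lemma cls_conv:
 assumes s: "s \<in> CS"
 shows "C.conv (\<lambda>n. max_embed A (s n)) (cls s)"
proof (rule C.convI)
 note sc = CS_carrier[OF s]
 show "max_embed A (s n) \<in> carrier C" for n
  by (rule star_hom_closed[OF star_hom_max_embed sc])
 show "cls s \<in> carrier C" using s by (simp add: carrier_completion)
 show "(\<lambda>n. nrm (max_embed A (s n) \<ominus>\<^bsub>C\<^esub> cls s)) \<longlonglongrightarrow> 0"
 proof (rule LIMSEQ_I)
  fix e :: real assume e: "e > 0"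
  then obtain N where N: "\<forall>m\<ge>N. \<forall>n\<ge>N. p (s m \<ominus> s n) < e/2" using CSD[OF s, of "e/2"] by auto
  have "norm (nrm (max_embed A (s n) \<ominus>\<^bsub>C\<^esub> cls s) - 0) < e" if "n \<ge> N" for n
  proof -
   have eq: "max_embed A (s n) \<ominus>\<^bsub>C\<^esub> cls s = cls (\<lambda>m. s n \<ominus> s m)"
    and c: "(\<lambda>m. s n \<ominus> s m) \<in> CS"
    unfolding max_embed_eq using cls_minus[OF CS_const[OF sc[of n]] s] by simp_all
   have "nrm (cls (\<lambda>m. s n \<ominus> s m)) \<le> e/2"
    by (rule LIMSEQ_le_const2[OF norm_cls[OF c]]) (use N that less_imp_le in blast)
   moreover have "0 \<le> nrm (cls (\<lambda>m. s n \<ominus> s m))"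
    by (rule C.norm_nonneg) (use c in \<open>simp add: carrier_completion\<close>)
   ultimately show ?thesis using e unfolding eq by simp
  qed
  then show "\<exists>no. \<forall>n\<ge>no. norm (nrm (max_embed A (s n) \<ominus>\<^bsub>C\<^esub> cls s) - 0) < e"
   by blast
 qed
qed

lemma dense_max_embed: "C.dense_image (max_embed A) (carrier A)"
 unfolding C.dense_image_def
proof (intro conjI ballI allI impI)
 show "max_embed A ` carrier A \<subseteq> carrier C"
  using star_hom_closed[OF star_hom_max_embed] by blast
 fix a and e :: real assume "a \<in> carrier C" and e: "e > 0"
 then obtain s where s: "s \<in> CS" "a = cls s" by (auto simp: carrier_completion)
 obtain N where N: "\<And>n. n \<ge> N \<Longrightarrow> norm (nrm (max_embed A (s n) \<ominus>\<^bsub>C\<^esub> a) - 0) < e"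
  using LIMSEQ_D[OF C.conv_tendsto[OF cls_conv[OF s(1)]] e] s(2) by blast
 have "nrm (a \<ominus>\<^bsub>C\<^esub> max_embed A (s N)) < e"
  using N[of N] C.norm_minus_commute[OF C.conv_carrier(1)[OF cls_conv[OF s(1)], of N]
    C.conv_carrier(2)[OF cls_conv[OF s(1)]]] s(2) by simp
 then show "\<exists>x\<in>carrier A. nrm (a \<ominus>\<^bsub>C\<^esub> max_embed A x) < e"
  using CS_carrier[OF s(1)] by blast
qed

text \<open>On embedded elements the norm of the completion is the maximal norm. A Cauchy sequence
  of embedded elements is therefore itself one of the sequences whose classes form the completion,
  and it converges to its own class.\<close>

lemma banach_star_completion: "banach_star C"
proof (rule C.banach_star_from_dense[OF dense_max_embed])
 fix x assume x: "\<And>n. x n \<in> carrier A" and c: "C.cauchy (\<lambda>n. max_embed A (x n))"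
 have "x \<in> CS"
  using c x by (intro CSI) (auto simp: C.cauchy_def max_embed_minus[symmetric] norm_max_embed diff_closed)
 from cls_conv[OF this] show "\<exists>a. C.conv (\<lambda>n. max_embed A (x n)) a" ..
qed

end

lemma star_bddI:
 assumes "star_space A"
  and "\<And>x. x \<in> carrier A \<Longrightarrow> \<exists>B. \<forall>\<psi>. star_hom A (bounded_ops :: (('a, complex) ell2 \<Rightarrow> ('a, complex) ell2) star_alg) \<psi>
   \<longrightarrow> onorm (\<psi> x) \<le> B"
 shows "star_bdd (A :: ('a, 'm) star_alg_scheme)"
proof -
 interpret star_space A by fact
 show ?thesis
 proof unfold_locales
  fix x assume "x \<in> carrier A"
  from assms(2)[OF this] show "bdd_above ((\<lambda>\<psi>. onorm (\<psi> x)) `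
   {\<psi>. star_hom A (bounded_ops :: (('a, complex) ell2 \<Rightarrow> ('a, complex) ell2) star_alg) \<psi>})"
   unfolding bdd_above_def by auto
 qed
qed

section \<open>Quotients by closed ideals\<close>

text \<open>Lets products of infima be estimated by elements that come strictly close to them, with
  no case distinction on zero norms.\<close>

lemma le_mult_of_greater:
 fixes a b z :: real
 assumes "\<And>s t. s > a \<Longrightarrow> t > b \<Longrightarrow> z \<le> s * t"
 shows "z \<le> a * b"
proof (rule LIMSEQ_le_const)
 show "(\<lambda>n. (a + 1 / Suc n) * (b + 1 / Suc n)) \<longlonglongrightarrow> a * b"
  using tendsto_mult[OF tendsto_add[OF tendsto_const[of a] LIMSEQ_Suc[OF lim_1_over_n]]
    tendsto_add[OF tendsto_const[of b] LIMSEQ_Suc[OF lim_1_over_n]]] by simp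
 show "\<exists>N. \<forall>n\<ge>N. z \<le> (a + 1 / Suc n) * (b + 1 / Suc n)"
  by (intro exI[of _ 0] allI impI assms) auto
qed

text \<open>Closed ideals of C*-algebras are automatically self-adjoint; in a Banach star algebra
  this is a condition.\<close>

locale closed_star_ideal = banach_star +
 fixes I
 assumes I_closed: "closed_subspace C I"
  and I_left: "a \<in> carrier C \<Longrightarrow> x \<in> I \<Longrightarrow> a \<otimes> x \<in> I"
  and I_right: "a \<in> carrier C \<Longrightarrow> x \<in> I \<Longrightarrow> x \<otimes> a \<in> I"
  and I_star: "x \<in> I \<Longrightarrow> involution C x \<in> I"
begin

abbreviation "coset a \<equiv> I +> a"
abbreviation "Q \<equiv> quotient_alg C I"

lemma I_sub: "x \<in> I \<Longrightarrow> x \<in> carrier C"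
 and I_zero: "\<zero> \<in> I"
 and I_add: "x \<in> I \<Longrightarrow> y \<in> I \<Longrightarrow> x \<oplus> y \<in> I"
 and I_smult: "x \<in> I \<Longrightarrow> c \<odot> x \<in> I"
 and I_limit: "a \<in> carrier C \<Longrightarrow> (\<And>e. e > 0 \<Longrightarrow> \<exists>b\<in>I. nrm (a \<ominus> b) < e) \<Longrightarrow> a \<in> I"
 using I_closed unfolding closed_subspace_def by blast+

lemma I_minus: "x \<in> I \<Longrightarrow> y \<in> I \<Longrightarrow> x \<ominus> y \<in> I"
 by (simp add: minus_eq_smult I_sub I_add I_smult)

lemma mem_cos:
 assumes a: "a \<in> carrier C"
 shows "b \<in> coset a \<longleftrightarrow> b \<in> carrier C \<and> b \<ominus> a \<in> I"
proof
 assume "b \<in> coset a"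
 then obtain h where "h \<in> I" "b = h \<oplus> a" by (auto simp: a_r_coset_def')
 then show "b \<in> carrier C \<and> b \<ominus> a \<in> I" using a I_sub by (simp add: minus_add_cancel)
next
 assume b: "b \<in> carrier C \<and> b \<ominus> a \<in> I"
 then have "b = (b \<ominus> a) \<oplus> a" using a by (simp add: add_minus_cancel)
 then show "b \<in> coset a" using b unfolding a_r_coset_def' by blast
qed

lemma cos_self: "a \<in> carrier C \<Longrightarrow> a \<in> coset a"
 by (simp add: mem_cos minus_self I_zero)

lemma cos_eq_iff:
 assumes a: "a \<in> carrier C" and b: "b \<in> carrier C"
 shows "coset a = coset b \<longleftrightarrow> a \<ominus> b \<in> I"
proof
 assume "coset a = coset b"
 then show "a \<ominus> b \<in> I" using cos_self[OF a] by (simp add: mem_cos[OF b])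
next
 assume ab: "a \<ominus> b \<in> I"
 have ba: "b \<ominus> a \<in> I" using I_smult[OF ab, of "-1"] a b by (simp add: a_inv_minus)
 have "x \<ominus> a \<in> I \<longleftrightarrow> x \<ominus> b \<in> I" if x: "x \<in> carrier C" for x
  using I_add[OF _ ab, of "x \<ominus> a"] I_add[OF _ ba, of "x \<ominus> b"]
  by (auto simp: minus_minus_add[OF x a b, symmetric] minus_minus_add[OF x b a, symmetric])
 then show "coset a = coset b" by (auto simp: mem_cos[OF a] mem_cos[OF b])
qed

lemma cos_eqI: "a \<in> carrier C \<Longrightarrow> b \<in> coset a \<Longrightarrow> coset b = coset a"
 by (simp add: mem_cos cos_eq_iff)

lemma carrier_quotient: "carrier Q = (\<lambda>a. coset a) ` carrier C"
 by (auto simp: quotient_alg_def A_RCOSETS_def')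

lemma UN_cos:
 assumes a: "a \<in> carrier C" and f: "\<And>b. b \<in> coset a \<Longrightarrow> f b = f a"
 shows "(\<Union>b\<in>coset a. f b) = f a"
proof (rule equalityI)
 show "(\<Union>b\<in>coset a. f b) \<subseteq> f a" by (rule UN_least) (simp only: f subset_refl)
 show "f a \<subseteq> (\<Union>b\<in>coset a. f b)" by (rule UN_upper[OF cos_self[OF a]])
qed

lemma quotient_zero: "\<zero>\<^bsub>Q\<^esub> = coset \<zero>"
proof -
 have "I = coset \<zero>" by (auto simp: mem_cos zero_in_carrier minus_eq_smult smult_zero_right I_sub)
 then show ?thesis by (simp add: quotient_alg_def)
qed

lemma quotient_smult: "a \<in> carrier C \<Longrightarrow> c \<odot>\<^bsub>Q\<^esub> coset a = coset (c \<odot> a)"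
 using UN_cos[of a "\<lambda>b. coset (c \<odot> b)"]
 by (simp add: quotient_alg_def mem_cos cos_eq_iff smult_closed smult_minus[symmetric] I_smult)

lemma quotient_involution: "a \<in> carrier C \<Longrightarrow> involution Q (coset a) = coset (involution C a)"
 using UN_cos[of a "\<lambda>b. coset (involution C b)"]
 by (simp add: quotient_alg_def mem_cos cos_eq_iff involution_closed involution_minus[symmetric] I_star)

lemma quotient_mult:
 assumes a: "a \<in> carrier C" and b: "b \<in> carrier C"
 shows "coset a \<otimes>\<^bsub>Q\<^esub> coset b = coset (a \<otimes> b)"
proof -
 have *: "coset (x \<otimes> y) = coset (a \<otimes> b)" if x: "x \<in> coset a" and y: "y \<in> coset b" for x y
 proof -
  have c: "x \<in> carrier C" "y \<in> carrier C" "x \<ominus> a \<in> I" "y \<ominus> b \<in> I"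
   using x y by (auto simp: mem_cos a b)
  have "x \<otimes> y \<ominus> a \<otimes> b \<in> I"
   using c a b by (simp add: mult_minus_mult I_add I_left I_right)
  then show ?thesis using c a b by (simp add: cos_eq_iff mult_closed)
 qed
 have "(\<Union>y\<in>coset b. coset (x \<otimes> y)) = coset (a \<otimes> b)" if x: "x \<in> coset a" for x
 proof -
  have "(\<Union>y\<in>coset b. coset (x \<otimes> y)) = coset (x \<otimes> b)"
   by (rule UN_cos[OF b]) (simp only: *[OF x] cos_self[OF b])
  then show ?thesis by (simp only: *[OF x cos_self[OF b]])
 qed
 then have "(\<Union>x\<in>coset a. \<Union>y\<in>coset b. coset (x \<otimes> y)) = coset (a \<otimes> b)"
  using UN_cos[OF a, of "\<lambda>_. coset (a \<otimes> b)"] by simp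
 then show ?thesis by (simp add: quotient_alg_def rcoset_mult_def)
qed

lemma quotient_add:
 assumes a: "a \<in> carrier C" and b: "b \<in> carrier C"
 shows "coset a \<oplus>\<^bsub>Q\<^esub> coset b = coset (a \<oplus> b)"
proof -
 have "set_add C (coset a) (coset b) = coset (a \<oplus> b)"
 proof (intro equalityI subsetI)
  fix z assume "z \<in> set_add C (coset a) (coset b)"
  then obtain x y where x: "x \<in> coset a" and y: "y \<in> coset b" and z: "z = x \<oplus> y"
   by (auto simp: set_add_def')
  then have c: "x \<in> carrier C" "y \<in> carrier C" "x \<ominus> a \<in> I" "y \<ominus> b \<in> I"
   by (auto simp: mem_cos a b)
  then show "z \<in> coset (a \<oplus> b)" using a b z by (simp add: mem_cos add_minus_add I_add)
 next
  fix z assume "z \<in> coset (a \<oplus> b)"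
  then have z: "z \<in> carrier C" "z \<ominus> (a \<oplus> b) \<in> I" using a b by (auto simp: mem_cos)
  have "(z \<ominus> b) \<oplus> b \<ominus> (a \<oplus> b) = ((z \<ominus> b) \<ominus> a) \<oplus> (b \<ominus> b)"
   using z a b by (intro add_minus_add diff_closed)
  then have "(z \<ominus> b) \<ominus> a \<in> I" using z a b by (simp add: add_minus_cancel minus_self diff_closed)
  then have "z \<ominus> b \<in> coset a" using z a b by (simp add: mem_cos diff_closed)
  then have "(z \<ominus> b) \<oplus> b \<in> set_add C (coset a) (coset b)"
   using cos_self[OF b] unfolding set_add_def' by blast
  then show "z \<in> set_add C (coset a) (coset b)" using z b by (simp add: add_minus_cancel)
 qed
 then show ?thesis by (simp add: quotient_alg_def)
qed

lemma star_hom_cos: "star_hom C Q (\<lambda>a. coset a)"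
 by (auto simp: star_hom_def carrier_quotient quotient_add quotient_smult quotient_mult quotient_involution)

lemma star_ring_space_quotient: "star_ring_space Q"
 by (rule star_ring_space_image[OF star_space_axioms carrier_quotient[symmetric] star_hom_cos quotient_zero])
  (simp_all add: distrib_right distrib_left smult_mult_left smult_mult_right involution_add involution_smult
   involution_mult involution_involution)

interpretation Q: star_ring_space Q by (rule star_ring_space_quotient)

lemma quotient_minus: "a \<in> carrier C \<Longrightarrow> b \<in> carrier C \<Longrightarrow> coset a \<ominus>\<^bsub>Q\<^esub> coset b = coset (a \<ominus> b)"
 using linear_map_minus[OF star_space_axioms Q.star_space_axioms star_hom_linear[OF star_hom_cos]] by simp

lemma quotient_norm_bdd: "a \<in> carrier C \<Longrightarrow> bdd_below (nrm ` coset a)"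
 by (rule bdd_belowI2[where m = 0]) (simp add: mem_cos norm_nonneg)

lemma quotient_norm_le: "a \<in> carrier C \<Longrightarrow> b \<in> coset a \<Longrightarrow> alg_norm Q (coset a) \<le> nrm b"
 by (simp add: quotient_alg_def) (rule cINF_lower[OF quotient_norm_bdd])

lemma quotient_norm_less:
 assumes "a \<in> carrier C" "alg_norm Q (coset a) < r"
 obtains b where "b \<in> coset a" "b \<in> carrier C" "coset b = coset a" "nrm b < r"
proof -
 have "coset a \<noteq> {}" using cos_self[OF assms(1)] by blast
 moreover have "(INF b\<in>coset a. nrm b) < r" using assms(2) by (simp add: quotient_alg_def)
 ultimately have "\<exists>b\<in>coset a. nrm b < r"
  by (simp add: cINF_less_iff[OF _ quotient_norm_bdd[OF assms(1)]])
 then obtain b where "b \<in> coset a" "nrm b < r" by blast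
 then show ?thesis using that[of b] cos_eqI[OF assms(1)] mem_cos[OF assms(1)] by blast
qed

lemma quotient_norm_le_self: "a \<in> carrier C \<Longrightarrow> alg_norm Q (coset a) \<le> nrm a"
 by (rule quotient_norm_le[OF _ cos_self])

lemma quotient_norm_le_minus: "a \<in> carrier C \<Longrightarrow> k \<in> I \<Longrightarrow> alg_norm Q (coset a) \<le> nrm (a \<ominus> k)"
proof (rule quotient_norm_le)
 assume a: "a \<in> carrier C" and k: "k \<in> I"
 then have "(a \<ominus> k) \<ominus> a = (a \<ominus> a) \<ominus> k"
  using I_sub[OF k] by (simp add: a_minus_def a_ac)
 then show "a \<ominus> k \<in> coset a"
  using a k I_sub[OF k] by (simp add: mem_cos diff_closed minus_self I_minus I_zero)
qed

lemma quotient_norm_geI: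
 assumes "a \<in> carrier C" "\<And>k. k \<in> I \<Longrightarrow> c \<le> nrm (a \<ominus> k)"
 shows "c \<le> alg_norm Q (coset a)"
proof (rule ccontr)
 assume "\<not> ?thesis"
 then obtain b where b: "b \<in> coset a" "b \<in> carrier C" "nrm b < c"
  using quotient_norm_less[OF assms(1), of c] by (metis not_le)
 have ba: "b \<ominus> a \<in> I" using b assms(1) by (simp add: mem_cos)
 have k: "a \<ominus> b \<in> I" using I_smult[OF ba, of "-1"] assms(1) b(2) by (simp add: a_inv_minus)
 have "a \<ominus> (a \<ominus> b) = b" using assms(1) b(2) by (simp add: a_minus_def minus_add a_assoc[symmetric] r_neg)
 then show False using assms(2)[OF k] b(3) by simp
qed

text \<open>Closedness of the ideal gives that only the zero coset has norm zero. The inequalities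
  come from representatives whose norm is arbitrarily close to the quotient norm.\<close>

lemma normed_star_quotient: "normed_star Q"
proof unfold_locales
 fix x c assume "x \<in> carrier Q"
 then obtain a where a: "a \<in> carrier C" "x = coset a" by (auto simp: carrier_quotient)
 show nn: "0 \<le> alg_norm Q x"
  unfolding a(2) by (rule quotient_norm_geI[OF a(1)]) (simp add: norm_nonneg diff_closed a(1) I_sub)
 show "x = \<zero>\<^bsub>Q\<^esub>" if z: "alg_norm Q x = 0"
 proof -
  have "a \<in> I"
  proof (rule I_limit[OF a(1)])
   fix e :: real assume e: "e > 0"
   have "alg_norm Q (coset a) < e" using z e a(2) by simp
   then obtain b where b: "b \<in> coset a" "b \<in> carrier C" "nrm b < e"
    using quotient_norm_less[OF a(1)] by metis
   have ba: "b \<ominus> a \<in> I" using b a(1) by (simp add: mem_cos)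
   have k: "a \<ominus> b \<in> I" using I_smult[OF ba, of "-1"] a(1) b(2) by (simp add: a_inv_minus)
   have "a \<ominus> (a \<ominus> b) = b" using a(1) b(2) by (simp add: a_minus_def minus_add a_assoc[symmetric] r_neg)
   then show "\<exists>b\<in>I. nrm (a \<ominus> b) < e" using k b(3) by (intro bexI[of _ "a \<ominus> b"]) simp_all
  qed
  then show ?thesis
   using a by (simp add: quotient_zero cos_eq_iff zero_in_carrier minus_eq_smult smult_zero_right)
 qed
 have sm: "alg_norm Q (coset (c \<odot> a)) \<le> cmod c * alg_norm Q (coset a)" if a: "a \<in> carrier C" for a c
 proof (rule le_mult_of_greater)
  fix s t assume st: "cmod c < s" "alg_norm Q (coset a) < t"
  obtain b where b: "b \<in> coset a" "b \<in> carrier C" "coset b = coset a" "nrm b < t"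
   using quotient_norm_less[OF a st(2)] by metis
  have "coset (c \<odot> a) = coset (c \<odot> b)" using a b by (metis quotient_smult)
  then have "alg_norm Q (coset (c \<odot> a)) \<le> nrm (c \<odot> b)"
   using quotient_norm_le_self[OF smult_closed[OF b(2)]] by simp
  also have "\<dots> = cmod c * nrm b" by (rule norm_smult[OF b(2)])
  also have "\<dots> \<le> s * t"
  proof (rule mult_mono)
   show "cmod c \<le> s" "0 \<le> s" using st(1) norm_ge_zero[of c] by linarith+
  qed (use b(4) norm_nonneg[OF b(2)] in auto)
  finally show "alg_norm Q (coset (c \<odot> a)) \<le> s * t" .
 qed
 show "alg_norm Q (c \<odot>\<^bsub>Q\<^esub> x) = cmod c * alg_norm Q x"
 proof (cases "c = 0")
  case True
  have "0 \<le> alg_norm Q (coset (0 \<odot> a))"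
   by (rule quotient_norm_geI) (simp_all add: norm_nonneg diff_closed smult_closed a(1) I_sub)
  then have "alg_norm Q (coset (0 \<odot> a)) = 0" using sm[OF a(1), of 0] by simp
  then show ?thesis using True a by (simp add: quotient_smult)
 next
  case False
  have "alg_norm Q (coset a) = alg_norm Q (coset (inverse c \<odot> (c \<odot> a)))"
   using a(1) False by (simp add: smult_smult smult_1)
  also have "\<dots> \<le> cmod (inverse c) * alg_norm Q (coset (c \<odot> a))" by (rule sm[OF smult_closed[OF a(1)]])
  finally have "cmod c * alg_norm Q (coset a) \<le> cmod c * (cmod (inverse c) * alg_norm Q (coset (c \<odot> a)))"
   by (simp add: mult_left_mono)
  also have "\<dots> = alg_norm Q (coset (c \<odot> a))" using False by (simp add: norm_inverse flip: mult.assoc)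
  finally show ?thesis using sm[OF a(1), of c] a by (simp add: quotient_smult)
 qed
 have iv: "alg_norm Q (coset (involution C a)) \<le> alg_norm Q (coset a)" if a: "a \<in> carrier C" for a
 proof (rule dense_ge)
  fix t assume "alg_norm Q (coset a) < t"
  then obtain b where b: "b \<in> coset a" "b \<in> carrier C" "coset b = coset a" "nrm b < t"
   using quotient_norm_less[OF a] by metis
  have "coset (involution C a) = coset (involution C b)" using a b by (metis quotient_involution)
  then show "alg_norm Q (coset (involution C a)) \<le> t"
   using quotient_norm_le_self[OF involution_closed[OF b(2)]] b by (simp add: norm_involution)
 qed
 show "alg_norm Q (involution Q x) = alg_norm Q x"
  using iv[OF a(1)] iv[OF involution_closed[OF a(1)]] a
  by (simp add: quotient_involution involution_involution)
 fix y assume "y \<in> carrier Q"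
 then obtain a' where a': "a' \<in> carrier C" "y = coset a'" by (auto simp: carrier_quotient)
 show "alg_norm Q (x \<otimes>\<^bsub>Q\<^esub> y) \<le> alg_norm Q x * alg_norm Q y"
 proof (rule le_mult_of_greater)
  fix s t assume st: "alg_norm Q x < s" "alg_norm Q y < t"
  obtain b where b: "b \<in> carrier C" "coset b = coset a" "nrm b < s"
   using quotient_norm_less[OF a(1)] st(1) a(2) by metis
  obtain b' where b': "b' \<in> carrier C" "coset b' = coset a'" "nrm b' < t"
   using quotient_norm_less[OF a'(1)] st(2) a'(2) by metis
  have "x \<otimes>\<^bsub>Q\<^esub> y = coset (b \<otimes> b')" using a a' b b' by (metis quotient_mult)
  then have "alg_norm Q (x \<otimes>\<^bsub>Q\<^esub> y) \<le> nrm (b \<otimes> b')"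
   using quotient_norm_le_self[OF mult_closed[OF b(1) b'(1)]] by simp
  also have "\<dots> \<le> nrm b * nrm b'" by (rule norm_mult[OF b(1) b'(1)])
  also have "\<dots> \<le> s * t"
   using b b' norm_nonneg[OF b(1)] norm_nonneg[OF b'(1)] by (intro mult_mono) auto
  finally show "alg_norm Q (x \<otimes>\<^bsub>Q\<^esub> y) \<le> s * t" .
 qed
 show "alg_norm Q (x \<oplus>\<^bsub>Q\<^esub> y) \<le> alg_norm Q x + alg_norm Q y"
 proof (rule field_le_epsilon)
  fix e :: real assume e: "e > 0"
  obtain b where b: "b \<in> carrier C" "coset b = coset a" "nrm b < alg_norm Q x + e/2"
   using quotient_norm_less[OF a(1), of "alg_norm Q x + e/2"] a(2) e by auto
  obtain b' where b': "b' \<in> carrier C" "coset b' = coset a'" "nrm b' < alg_norm Q y + e/2"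
   using quotient_norm_less[OF a'(1), of "alg_norm Q y + e/2"] a'(2) e by auto
  have "x \<oplus>\<^bsub>Q\<^esub> y = coset (b \<oplus> b')" using a a' b b' by (metis quotient_add)
  then have "alg_norm Q (x \<oplus>\<^bsub>Q\<^esub> y) \<le> nrm (b \<oplus> b')"
   using quotient_norm_le_self[OF add_closed[OF b(1) b'(1)]] by simp
  also have "\<dots> \<le> nrm b + nrm b'" by (rule norm_add[OF b(1) b'(1)])
  finally show "alg_norm Q (x \<oplus>\<^bsub>Q\<^esub> y) \<le> alg_norm Q x + alg_norm Q y + e" using b b' by simp
 qed
qed

interpretation Q: normed_star Q by (rule normed_star_quotient)

text \<open>A subsequence with increments of norm below (1/2)^n lifts one term at a time to a
  sequence with the same bound on its increments, because the quotient norm is an infimum over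
  representatives. The lift converges, and so does its image.\<close>

lemma banach_star_quotient: "banach_star Q"
proof unfold_locales
 fix s assume s: "Q.cauchy s"
 obtain r where r: "strict_mono r" "\<And>n. alg_norm Q (s (r (Suc n)) \<ominus>\<^bsub>Q\<^esub> s (r n)) < (1/2) ^ n"
  using Q.cauchy_subseq[OF s] by metis
 have ex: "\<exists>a\<in>carrier C. s n = coset a" for n
 proof -
  have "s n \<in> (\<lambda>a. coset a) ` carrier C" using s unfolding Q.cauchy_def carrier_quotient by blast
  then show ?thesis by blast
 qed
 have "\<exists>a. \<forall>n. (a n \<in> carrier C \<and> s (r n) = coset (a n)) \<and> nrm (a (Suc n) \<ominus> a n) < (1/2) ^ n"
 proof (rule dependent_nat_choice)
  show "\<exists>x. x \<in> carrier C \<and> s (r 0) = coset x" using ex by blast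
  fix x n assume x: "x \<in> carrier C \<and> s (r n) = coset x"
  obtain z where z: "z \<in> carrier C" "s (r (Suc n)) = coset z" using ex by blast
  have zx: "z \<ominus> x \<in> carrier C" using x z by (simp add: diff_closed)
  have "alg_norm Q (coset (z \<ominus> x)) < (1/2) ^ n" using r(2)[of n] x z by (simp add: quotient_minus)
  then obtain b where b: "b \<in> coset (z \<ominus> x)" "b \<in> carrier C" "coset b = coset (z \<ominus> x)" "nrm b < (1/2) ^ n"
   using quotient_norm_less[OF zx] by metis
  have "coset (b \<oplus> x) = coset (z \<ominus> x) \<oplus>\<^bsub>Q\<^esub> coset x" using b x by (simp add: quotient_add[symmetric])
  also have "\<dots> = coset z" using x z zx by (simp add: quotient_add add_minus_cancel)
  finally show "\<exists>y. (y \<in> carrier C \<and> s (r (Suc n)) = coset y) \<and> nrm (y \<ominus> x) < (1/2) ^ n"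
   using b x z by (intro exI[of _ "b \<oplus> x"]) (simp add: add_closed minus_add_cancel)
 qed
 then obtain a where a: "\<And>n. a n \<in> carrier C" "\<And>n. s (r n) = coset (a n)" "\<And>n. nrm (a (Suc n) \<ominus> a n) < (1/2) ^ n"
  by blast
 have "cauchy a"
  by (rule geometric_cauchy[where K = 1 and q = "1/2"]) (use a in \<open>auto intro: less_imp_le\<close>)
 then obtain L where L: "conv a L" using complete by blast
 have "Q.conv (\<lambda>n. coset (a n)) (coset L)"
  by (rule contraction_conv[OF normed_star_axioms Q.normed_star_axioms star_hom_linear[OF star_hom_cos] _ L])
   (rule quotient_norm_le_self)
 then have "Q.conv (s \<circ> r) (coset L)" using a(2) by (simp add: o_def)
 then show "\<exists>a. Q.conv s a" using Q.cauchy_subseq_conv[OF s _ r(1)] by blast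
qed

lemma dense_image_quotient:
 assumes "dense_image j D"
 shows "Q.dense_image (\<lambda>x. coset (j x)) D"
 unfolding Q.dense_image_def
proof (intro conjI ballI allI impI)
 have jx: "j x \<in> carrier C" if "x \<in> D" for x using assms that by (auto simp: dense_image_def)
 then show "(\<lambda>x. coset (j x)) ` D \<subseteq> carrier Q" by (auto simp: carrier_quotient)
 fix q and e :: real assume "q \<in> carrier Q" and e: "e > 0"
 then obtain a where a: "a \<in> carrier C" "q = coset a" by (auto simp: carrier_quotient)
 obtain x where x: "x \<in> D" "nrm (a \<ominus> j x) < e" using assms a(1) e unfolding dense_image_def by blast
 have "alg_norm Q (q \<ominus>\<^bsub>Q\<^esub> coset (j x)) < e"
  using a x jx[OF x(1)] quotient_norm_le_self[OF diff_closed[OF a(1) jx[OF x(1)]]]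
  by (simp add: quotient_minus)
 then show "\<exists>x\<in>D. alg_norm Q (q \<ominus>\<^bsub>Q\<^esub> coset (j x)) < e" using x(1) by blast
qed

end

section \<open>Ultrapowers of Hilbert spaces\<close>

text \<open>Zorn's lemma for the reversed order of proper filters below \<open>sequentially\<close>.
  A property holding eventually in the infimum of a nonempty chain holds eventually in some member,
  so the infimum stays proper. A minimal filter decides every set, since restricting it to an
  undecided set would be a smaller proper filter.\<close>

lemma free_ultrafilter_exists:
 "\<exists>U :: nat filter. U \<noteq> bot \<and> U \<le> sequentially \<and> (\<forall>P. eventually P U \<or> eventually (\<lambda>n. \<not> P n) U)"
proof -
 define \<F> where "\<F> = {U :: nat filter. U \<noteq> bot \<and> U \<le> sequentially}"
 have "\<exists>M\<in>\<F>. \<forall>U\<in>\<F>. U \<le> M \<longrightarrow> U = M"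
 proof (rule predicate_Zorn)
  show "partial_order_on \<F> (relation_of (\<lambda>U V. V \<le> U) \<F>)"
   by (rule partial_order_on_relation_ofI) auto
  fix \<C> assume C: "\<C> \<in> Chains (relation_of (\<lambda>U V. V \<le> U) \<F>)"
  have CF: "U \<in> \<F>" if "U \<in> \<C>" for U using C that by (auto simp: Chains_def relation_of_def)
  have lin: "U \<le> V \<or> V \<le> U" if "U \<in> \<C>" "V \<in> \<C>" for U V
   using C that by (auto simp: Chains_def relation_of_def)
  show "\<exists>U\<in>\<F>. \<forall>V\<in>\<C>. U \<le> V"
  proof (cases "\<C> = {}")
   case True
   then show ?thesis by (auto simp: \<F>_def intro!: exI[of _ sequentially])
  next
   case False
   then obtain V where V: "V \<in> \<C>" by blast
   have "eventually P (Inf \<C>) \<longleftrightarrow> (\<exists>U\<in>\<C>. eventually P U)" for P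
    by (rule eventually_Inf_base[OF False]) (metis lin inf.absorb1 inf.absorb2 order_refl)
   then have "Inf \<C> \<noteq> bot" using CF by (auto simp: trivial_limit_def \<F>_def)
   moreover have "Inf \<C> \<le> sequentially" using Inf_lower[OF V] CF[OF V] by (auto simp: \<F>_def)
   ultimately show ?thesis by (intro bexI[of _ "Inf \<C>"]) (auto simp: \<F>_def Inf_lower)
  qed
 qed
 then obtain U where U: "U \<noteq> bot" "U \<le> sequentially"
  and min: "\<And>V. V \<noteq> bot \<Longrightarrow> V \<le> sequentially \<Longrightarrow> V \<le> U \<Longrightarrow> V = U"
  by (auto simp: \<F>_def)
 have "eventually P U" if "\<not> eventually (\<lambda>n. \<not> P n) U" for P
 proof -
  define V where "V = inf U (principal {n. P n})"
  have "V \<noteq> bot" using that by (simp add: V_def trivial_limit_def eventually_inf_principal)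
  then have "V = U" by (rule min) (use U(2) in \<open>simp_all add: V_def le_infI1\<close>)
  moreover have "eventually P V" by (simp add: V_def eventually_inf_principal)
  ultimately show ?thesis by simp
 qed
 then show ?thesis using U by blast
qed

text \<open>One ultrafilter is fixed globally, so that the ultrapower becomes a type constructor
  without parameters.\<close>

definition ultra :: "nat filter" where
 "ultra = (SOME U. U \<noteq> bot \<and> U \<le> sequentially \<and> (\<forall>P. eventually P U \<or> eventually (\<lambda>n. \<not> P n) U))"

lemma ultra: "ultra \<noteq> bot" "ultra \<le> sequentially" "eventually P ultra \<or> eventually (\<lambda>n. \<not> P n) ultra"
 using someI_ex[OF free_ultrafilter_exists] unfolding ultra_def by blast+

text \<open>If no point were a limit, finitely many neighbourhoods, each avoided eventually, would
  cover the compact closure of the range.\<close>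

lemma ultra_tendsto:
 fixes f :: "nat \<Rightarrow> 'a::heine_borel"
 assumes "bounded (range f)"
 shows "\<exists>l. (f \<longlongrightarrow> l) ultra"
proof (rule ccontr)
 assume no: "\<not> ?thesis"
 define S where "S = closure (range f)"
 have S: "compact S" unfolding S_def using assms by (simp add: compact_closure)
 have "\<exists>V. open V \<and> l \<in> V \<and> \<not> eventually (\<lambda>n. f n \<in> V) ultra" for l
  using no by (auto simp: tendsto_def)
 then obtain V where V: "\<And>l. open (V l)" "\<And>l. l \<in> V l" "\<And>l. \<not> eventually (\<lambda>n. f n \<in> V l) ultra" by metis
 obtain C where C: "C \<subseteq> S" "finite C" "S \<subseteq> (\<Union>c\<in>C. V c)"
  using compactE_image[OF S, of S V] V(1,2) by blast
 have "eventually (\<lambda>n. f n \<notin> V c) ultra" for c using V(3)[of c] ultra(3)[of "\<lambda>n. f n \<in> V c"] by blast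
 then have "eventually (\<lambda>n. \<forall>c\<in>C. f n \<notin> V c) ultra" using C(2) by (simp add: eventually_ball_finite)
 moreover have "\<not> (\<forall>c\<in>C. f n \<notin> V c)" for n
 proof -
  have "f n \<in> S" unfolding S_def by (rule subsetD[OF closure_subset]) simp
  then show ?thesis using C(3) by blast
 qed
 ultimately have "eventually (\<lambda>n. False) ultra" by simp
 then show False using ultra(1) by (simp add: trivial_limit_def)
qed

definition ulim :: "(nat \<Rightarrow> 'a::heine_borel) \<Rightarrow> 'a" where
 "ulim f = Lim ultra f"

lemma ulim_tendsto: "bounded (range f) \<Longrightarrow> (f \<longlongrightarrow> ulim f) ultra"
 unfolding ulim_def using ultra_tendsto tendsto_Lim ultra(1) by metis

lemma ulim_eqI: "(f \<longlongrightarrow> l) ultra \<Longrightarrow> ulim f = l"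
 unfolding ulim_def by (rule tendsto_Lim[OF ultra(1)])

section \<open>Bounded sequences modulo sequences that vanish along the ultrafilter\<close>

definition useq :: "(nat \<Rightarrow> 'h::chilbert_space) \<Rightarrow> bool" where
 "useq f \<longleftrightarrow> bounded (range f)"

lemma useqI: "(\<And>n. norm (f n) \<le> B) \<Longrightarrow> useq f"
 unfolding useq_def by (auto intro!: boundedI)

lemma useqE: "useq f \<Longrightarrow> (\<And>B. (\<And>n. norm (f n) \<le> B) \<Longrightarrow> thesis) \<Longrightarrow> thesis"
 unfolding useq_def bounded_iff by auto

lemma useq_0: "useq (\<lambda>_. 0)" by (rule useqI[of _ 0]) simp

lemma useq_add: "useq f \<Longrightarrow> useq g \<Longrightarrow> useq (\<lambda>n. f n + g n)"
proof -
 assume "useq f" "useq g"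
 then obtain B C where "\<And>n. norm (f n) \<le> B" "\<And>n. norm (g n) \<le> C" by (elim useqE) blast
 then show ?thesis 
  by (intro useqI[of _ "B + C"]) (rule order_trans[OF norm_triangle_ineq add_mono])
qed

lemma useq_minus: "useq f \<Longrightarrow> useq (\<lambda>n. - f n)"
 by (erule useqE) (rule useqI, simp)

lemma useq_diff: "useq f \<Longrightarrow> useq g \<Longrightarrow> useq (\<lambda>n. f n - g n)"
 using useq_add[OF _ useq_minus, of f g] by simp

lemma useq_bounded_clinear:
 assumes "useq f" "\<And>n v. norm (T n v) \<le> K * norm v" "0 \<le> K"
 shows "useq (\<lambda>n. T n (f n))"
 using assms(1)
proof (rule useqE)
 fix B assume "\<And>n. norm (f n) \<le> B"
 then show ?thesis 
  using assms(2,3) by (intro useqI[of _ "K * B"]) (rule order_trans[OF _ mult_left_mono], auto)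
qed

lemma useq_scaleC: "useq f \<Longrightarrow> useq (\<lambda>n. c *\<^sub>C f n)"
 by (rule useq_bounded_clinear[of _ "\<lambda>_ v. c *\<^sub>C v" "cmod c"]) auto

lemma useq_scaleR: "useq f \<Longrightarrow> useq (\<lambda>n. r *\<^sub>R f n)"
 by (simp add: scaleR_scaleC useq_scaleC)

lemma useq_norm: "useq f \<Longrightarrow> bounded (range (\<lambda>n. norm (f n)))"
 by (elim useqE) (auto intro!: boundedI)

lemma useq_cinner: "useq f \<Longrightarrow> useq g \<Longrightarrow> bounded (range (\<lambda>n. cinner (f n) (g n)))"
proof -
 assume "useq f" "useq g"
 then obtain B C where B: "\<And>n. norm (f n) \<le> B" and C: "\<And>n. norm (g n) \<le> C" by (elim useqE) blast
 have "norm (cinner (f n) (g n)) \<le> B * C" for n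
 proof -
  have "norm (cinner (f n) (g n)) \<le> norm (f n) * norm (g n)" by (rule Cauchy_Schwarz_cinner)
  also have "\<dots> \<le> B * C" using B C order_trans[OF norm_ge_zero B] by (intro mult_mono) auto
  finally show ?thesis .
 qed
 then show ?thesis by (auto intro!: boundedI)
qed

text \<open>Boundedness is part of the relation, so \<open>urel f f\<close> says exactly that
  \<open>f\<close> is bounded, and the partial quotient type consists of classes of bounded
  sequences.\<close>

definition urel :: "(nat \<Rightarrow> 'h::chilbert_space) \<Rightarrow> (nat \<Rightarrow> 'h) \<Rightarrow> bool" where
 "urel f g \<longleftrightarrow> useq f \<and> useq g \<and> ((\<lambda>n. norm (f n - g n)) \<longlongrightarrow> 0) ultra"

lemma urel_refl: "useq f \<Longrightarrow> urel f f" by (simp add: urel_def)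

lemma urel_sym: "urel f g \<Longrightarrow> urel g f" by (simp add: urel_def norm_minus_commute)

lemma tendsto_0_le_ultra:
 fixes f g :: "nat \<Rightarrow> real"
 assumes "(g \<longlongrightarrow> 0) ultra" "\<And>n. 0 \<le> f n" "\<And>n. f n \<le> g n"
 shows "(f \<longlongrightarrow> 0) ultra"
 by (rule tendsto_sandwich[OF _ _ tendsto_const assms(1)]) (use assms in auto)

lemma urel_trans: "urel f g \<Longrightarrow> urel g h \<Longrightarrow> urel f h"
proof -
 assume fg: "urel f g" and gh: "urel g h"
 have "((\<lambda>n. norm (f n - h n)) \<longlongrightarrow> 0) ultra"
 proof (rule tendsto_0_le_ultra)
  show "((\<lambda>n. norm (f n - g n) + norm (g n - h n)) \<longlongrightarrow> 0) ultra"
   using tendsto_add[of "\<lambda>n. norm (f n - g n)" 0 ultra "\<lambda>n. norm (g n - h n)" 0] fg gh by (simp add: urel_def)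
  show "norm (f n - h n) \<le> norm (f n - g n) + norm (g n - h n)" for n
   using norm_triangle_ineq[of "f n - g n" "g n - h n"] by simp
 qed simp
 then show ?thesis using fg gh by (simp add: urel_def)
qed

quotient_type (overloaded) 'h upow = "nat \<Rightarrow> 'h::chilbert_space" / partial: urel
 by (rule part_equivpI) (auto intro: exI[of _ "\<lambda>_. 0"] urel_refl useq_0 sympI transpI urel_sym urel_trans)

lemma urel_add: "urel f f' \<Longrightarrow> urel g g' \<Longrightarrow> urel (\<lambda>n. f n + g n) (\<lambda>n. f' n + g' n)"
proof -
 assume f: "urel f f'" and g: "urel g g'"
 have "((\<lambda>n. norm ((f n + g n) - (f' n + g' n))) \<longlongrightarrow> 0) ultra"
 proof (rule tendsto_0_le_ultra)
  show "((\<lambda>n. norm (f n - f' n) + norm (g n - g' n)) \<longlongrightarrow> 0) ultra"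
   using tendsto_add[of "\<lambda>n. norm (f n - f' n)" 0 ultra "\<lambda>n. norm (g n - g' n)" 0] f g by (simp add: urel_def)
  show "norm ((f n + g n) - (f' n + g' n)) \<le> norm (f n - f' n) + norm (g n - g' n)" for n
   using norm_triangle_ineq[of "f n - f' n" "g n - g' n"] by (simp add: algebra_simps)
 qed simp
 then show ?thesis using f g by (simp add: urel_def useq_add)
qed

lemma urel_apply:
 assumes f: "urel f f'" and T: "\<And>n. bounded_clinear (T n)" and K: "\<And>n v. norm (T n v) \<le> K * norm v" "0 \<le> K"
 shows "urel (\<lambda>n. T n (f n)) (\<lambda>n. T n (f' n))"
proof -
 have "((\<lambda>n. norm (T n (f n) - T n (f' n))) \<longlongrightarrow> 0) ultra"
 proof (rule tendsto_0_le_ultra)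
  show "((\<lambda>n. K * norm (f n - f' n)) \<longlongrightarrow> 0) ultra"
   using tendsto_mult_left[of "\<lambda>n. norm (f n - f' n)" 0 ultra K] f by (simp add: urel_def)
  show "norm (T n (f n) - T n (f' n)) \<le> K * norm (f n - f' n)" for n
   using K(1)[of n "f n - f' n"] by (simp add: clinear_diff[OF T])
 qed simp
 moreover have "useq (\<lambda>n. T n (f n))" "useq (\<lambda>n. T n (f' n))"
  using f by (auto simp: urel_def intro: useq_bounded_clinear[where K = K] K)
 ultimately show ?thesis by (simp add: urel_def)
qed

lemma urel_scaleC: "urel f f' \<Longrightarrow> urel (\<lambda>n. c *\<^sub>C f n) (\<lambda>n. c *\<^sub>C f' n)"
 by (rule urel_apply[where K = "cmod c"]) (auto intro: clinear_cmult clinear_id)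

lemma urel_minus: "urel f f' \<Longrightarrow> urel (\<lambda>n. - f n) (\<lambda>n. - f' n)"
 using urel_scaleC[of f f' "-1"] by simp

lemma ulim_cong:
 assumes "((\<lambda>n. norm (f n - g n)) \<longlongrightarrow> 0) ultra" "bounded (range f)"
 shows "ulim f = ulim (g :: nat \<Rightarrow> 'a::{heine_borel, real_normed_vector})"
proof (rule ulim_eqI[symmetric])
 have "((\<lambda>n. f n - g n) \<longlongrightarrow> 0) ultra" using assms(1) by (rule tendsto_norm_zero_cancel)
 from tendsto_diff[OF ulim_tendsto[OF assms(2)] this] show "(g \<longlongrightarrow> ulim f) ultra" by simp
qed

lemma urel_norm:
 assumes "urel f g"
 shows "ulim (\<lambda>n. norm (f n)) = ulim (\<lambda>n. norm (g n))"
proof (rule ulim_cong)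
 show "((\<lambda>n. norm (norm (f n) - norm (g n))) \<longlongrightarrow> 0) ultra"
  by (rule tendsto_0_le_ultra[of "\<lambda>n. norm (f n - g n)"])
   (use assms in \<open>auto simp: urel_def norm_triangle_ineq3\<close>)
qed (use assms in \<open>simp add: urel_def useq_norm\<close>)

lemma urel_cinner:
 assumes f: "urel f f'" and g: "urel g g'"
 shows "ulim (\<lambda>n. cinner (f n) (g n)) = ulim (\<lambda>n. cinner (f' n) (g' n))"
proof (rule ulim_cong)
 have u: "useq f" "useq g" "useq f'" "useq g'" using f g by (auto simp: urel_def)
 obtain B C where B: "\<And>n. norm (f' n) \<le> B" and C: "\<And>n. norm (g n) \<le> C" using u by (elim useqE) blast
 show "((\<lambda>n. norm (cinner (f n) (g n) - cinner (f' n) (g' n))) \<longlongrightarrow> 0) ultra"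
 proof (rule tendsto_0_le_ultra)
  show "((\<lambda>n. norm (f n - f' n) * C + B * norm (g n - g' n)) \<longlongrightarrow> 0) ultra"
   using tendsto_add[OF tendsto_mult_right[of "\<lambda>n. norm (f n - f' n)" 0 ultra C]
     tendsto_mult_left[of "\<lambda>n. norm (g n - g' n)" 0 ultra B]] f g by (simp add: urel_def)
  fix n
  have "cinner (f n) (g n) - cinner (f' n) (g' n) = cinner (f n - f' n) (g n) + cinner (f' n) (g n - g' n)"
   by (simp add: cinner_diff_left cinner_diff_right)
  then have "norm (cinner (f n) (g n) - cinner (f' n) (g' n))
    \<le> norm (f n - f' n) * norm (g n) + norm (f' n) * norm (g n - g' n)"
   using norm_triangle_ineq[of "cinner (f n - f' n) (g n)" "cinner (f' n) (g n - g' n)"]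
    Cauchy_Schwarz_cinner[of "f n - f' n" "g n"] Cauchy_Schwarz_cinner[of "f' n" "g n - g' n"] by simp
  also have "\<dots> \<le> norm (f n - f' n) * C + B * norm (g n - g' n)"
   using B C by (intro add_mono mult_left_mono mult_right_mono) auto
  finally show "norm (cinner (f n) (g n) - cinner (f' n) (g' n)) \<le> norm (f n - f' n) * C + B * norm (g n - g' n)" .
 qed simp
 show "bounded (range (\<lambda>n. cinner (f n) (g n)))" by (rule useq_cinner[OF u(1,2)])
qed

instantiation upow :: (chilbert_space) real_normed_vector
begin
lift_definition zero_upow :: "'a upow" is "\<lambda>_. 0" by (rule urel_refl[OF useq_0])
lift_definition plus_upow :: "'a upow \<Rightarrow> 'a upow \<Rightarrow> 'a upow" is "\<lambda>f g n. f n + g n" by (rule urel_add)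
lift_definition uminus_upow :: "'a upow \<Rightarrow> 'a upow" is "\<lambda>f n. - f n" by (rule urel_minus)
lift_definition minus_upow :: "'a upow \<Rightarrow> 'a upow \<Rightarrow> 'a upow" is "\<lambda>f g n. f n - g n"
 using urel_add[OF _ urel_minus] by fastforce
lift_definition scaleR_upow :: "real \<Rightarrow> 'a upow \<Rightarrow> 'a upow" is "\<lambda>r f n. r *\<^sub>R f n"
 by (simp add: scaleR_scaleC urel_scaleC)
lift_definition norm_upow :: "'a upow \<Rightarrow> real" is "\<lambda>f. ulim (\<lambda>n. norm (f n))" by (rule urel_norm)
definition dist_upow :: "'a upow \<Rightarrow> 'a upow \<Rightarrow> real" where "dist_upow f g = norm (f - g)"
definition sgn_upow :: "'a upow \<Rightarrow> 'a upow" where "sgn_upow f = scaleR (inverse (norm f)) f"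
definition uniformity_upow :: "('a upow \<times> 'a upow) filter" where
 "uniformity_upow = (INF e\<in>{0<..}. principal {(f, g). dist f g < e})"
definition open_upow :: "'a upow set \<Rightarrow> bool" where
 "open_upow U \<longleftrightarrow> (\<forall>x\<in>U. \<forall>\<^sub>F (x', y) in uniformity. x' = x \<longrightarrow> y \<in> U)"

instance
proof
 fix f g h :: "'a upow" and a b :: real
 note r = urel_refl useq_add useq_0 useq_minus useq_diff useq_scaleR
 have u: "urel f f \<Longrightarrow> useq f" for f :: "nat \<Rightarrow> 'a" by (simp add: urel_def)
 show "f + g + h = f + (g + h)" by transfer (simp add: add.assoc r u)
 show "f + g = g + f" by transfer (simp add: add.commute r u)
 show "0 + f = f" by transfer simp
 show "- f + f = 0" by transfer (simp add: r)
 show "f - g = f + - g" by transfer (simp add: r u)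
 show "a *\<^sub>R (f + g) = a *\<^sub>R f + a *\<^sub>R g" by transfer (simp add: scaleR_add_right r u)
 show "(a + b) *\<^sub>R f = a *\<^sub>R f + b *\<^sub>R f" by transfer (simp add: scaleR_add_left r u)
 show "a *\<^sub>R b *\<^sub>R f = (a * b) *\<^sub>R f" by transfer (simp add: r u)
 show "1 *\<^sub>R f = f" by transfer simp
 show "dist f g = norm (f - g)" by (rule dist_upow_def)
 show "sgn f = scaleR (inverse (norm f)) f" unfolding sgn_upow_def ..
 show "uniformity = (INF e\<in>{0<..}. principal {(x, y::'a upow). dist x y < e})"
  by (rule uniformity_upow_def)
 show "open U \<longleftrightarrow> (\<forall>x\<in>U. \<forall>\<^sub>F (x', y) in uniformity. x' = x \<longrightarrow> y \<in> U)" for U :: "'a upow set"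
  by (rule open_upow_def)
 show "norm f = 0 \<longleftrightarrow> f = 0"
 proof transfer
  fix f :: "nat \<Rightarrow> 'a" assume "urel f f"
  then have f: "useq f" by (rule u)
  show "ulim (\<lambda>n. norm (f n)) = 0 \<longleftrightarrow> urel f (\<lambda>_. 0)"
   using ulim_tendsto[OF useq_norm[OF f]] ulim_eqI[of "\<lambda>n. norm (f n)" 0] f useq_0 by (auto simp: urel_def)
 qed
 show "norm (f + g) \<le> norm f + norm g"
 proof transfer
  fix f g :: "nat \<Rightarrow> 'a" assume "urel f f" "urel g g"
  then have u: "useq f" "useq g" by (auto simp: urel_def)
  show "ulim (\<lambda>n. norm (f n + g n)) \<le> ulim (\<lambda>n. norm (f n)) + ulim (\<lambda>n. norm (g n))"
   by (rule tendsto_le[OF ultra(1) tendsto_add[OF ulim_tendsto ulim_tendsto] ulim_tendsto])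
    (use u in \<open>auto intro!: always_eventually useq_norm useq_add norm_triangle_ineq\<close>)
 qed
 show "norm (a *\<^sub>R f) = \<bar>a\<bar> * norm f"
 proof transfer
  fix a :: real and f :: "nat \<Rightarrow> 'a" assume "urel f f"
  then have f: "useq f" by (rule u)
  show "ulim (\<lambda>n. norm (a *\<^sub>R f n)) = \<bar>a\<bar> * ulim (\<lambda>n. norm (f n))"
   using tendsto_mult_left[OF ulim_tendsto[OF useq_norm[OF f]], of "\<bar>a\<bar>"] by (intro ulim_eqI) simp
 qed
qed
end

lemma norm_abs_upow: "useq f \<Longrightarrow> norm (abs_upow f) = ulim (\<lambda>n. norm (f n))"
 by (simp add: norm_upow.abs_eq urel_refl)

lemma abs_upow_minus: "useq f \<Longrightarrow> useq g \<Longrightarrow> abs_upow f - abs_upow g = abs_upow (\<lambda>n. f n - g n)"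
 by (simp add: minus_upow.abs_eq urel_refl)

lemma upow_cases:
 obtains f where "useq f" "\<xi> = abs_upow f"
proof (rule that)
 show "useq (rep_upow \<xi>)" using Quotient3_rep_reflp[OF Quotient3_upow, of \<xi>] by (simp add: urel_def)
 show "\<xi> = abs_upow (rep_upow \<xi>)" by (rule Quotient3_abs_rep[OF Quotient3_upow, symmetric])
qed

text \<open>A Cauchy sequence of classes is diagonalised along the decreasing sets \<open>B k\<close>.\<close>

instance upow :: (chilbert_space) banach
proof
 fix s :: "nat \<Rightarrow> 'a upow"
 assume s: "Cauchy s"
 have "\<exists>M. \<forall>m\<ge>M. \<forall>n\<ge>M. norm (s m - s n) < (1/2) ^ k" for k using CauchyD[OF s, of "(1/2)^k"] by simp
 then obtain M where M: "\<And>k m n. m \<ge> M k \<Longrightarrow> n \<ge> M k \<Longrightarrow> norm (s m - s n) < (1/2) ^ k" by metis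
 have "\<exists>r. \<forall>n. r n \<ge> M n \<and> r n < r (Suc n)"
 proof (rule dependent_nat_choice)
  show "\<exists>x. x \<ge> M 0" by blast
  show "\<exists>y. y \<ge> M (Suc n) \<and> x < y" if "x \<ge> M n" for x n
   by (rule exI[of _ "max (M (Suc n)) (Suc x)"]) auto
 qed
 then obtain r where r: "\<And>n. r n \<ge> M n" "\<And>n. r n < r (Suc n)" by blast
 have sm: "strict_mono r" using r(2) by (simp add: strict_mono_Suc_iff)
 have step: "norm (s (r (Suc k)) - s (r k)) < (1/2) ^ k" for k
  using M[of k "r (Suc k)" "r k"] r(1)[of k] r(2)[of k] by simp
 have "\<exists>f. useq f \<and> s (r k) = abs_upow f" for k by (rule upow_cases[of "s (r k)"]) blast
 then obtain x where x: "\<And>k. useq (x k)" "\<And>k. s (r k) = abs_upow (x k)" by metis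
 have ev: "eventually (\<lambda>n. norm (x (Suc k) n - x k n) < (1/2) ^ k) ultra" for k
 proof -
  have u: "useq (\<lambda>n. x (Suc k) n - x k n)" by (intro useq_diff x)
  have "ulim (\<lambda>n. norm (x (Suc k) n - x k n)) < (1/2) ^ k"
   using step[of k] by (simp add: x(2) abs_upow_minus x(1) norm_abs_upow u)
  then show ?thesis by (rule order_tendstoD(2)[OF ulim_tendsto[OF useq_norm[OF u]]])
 qed
 define B where "B k = {n. n \<ge> k \<and> (\<forall>j<k. norm (x (Suc j) n - x j n) < (1/2) ^ j)}" for k
 have Bev: "eventually (\<lambda>n. n \<in> B k) ultra" for k
 proof -
  have "eventually (\<lambda>n. n \<ge> k) ultra" using ultra(2) eventually_ge_at_top[of k] by (rule filter_leD)
  moreover have "eventually (\<lambda>n. \<forall>j\<in>{..<k}. norm (x (Suc j) n - x j n) < (1/2) ^ j) ultra"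
   by (rule eventually_ball_finite) (use ev in auto)
  ultimately show ?thesis by eventually_elim (simp add: B_def)
 qed
 \<comment> \<open>The largest k with n in \<open>B k\<close>. The maximum ranges over a finite set
   that contains 0, because \<open>B 0\<close> is everything.\<close>
 define \<kappa> where "\<kappa> n = Max {k. k \<le> n \<and> n \<in> B k}" for n
 have B0: "n \<in> B 0" for n by (simp add: B_def)
 have \<kappa>B: "n \<in> B (\<kappa> n)" for n
 proof -
  have "\<kappa> n \<in> {k. k \<le> n \<and> n \<in> B k}" unfolding \<kappa>_def using B0[of n] by (intro Max_in) auto
  then show ?thesis by simp
 qed
 have \<kappa>ge: "k \<le> \<kappa> n" if "n \<in> B k" for n k
  unfolding \<kappa>_def using that by (intro Max_ge) (auto simp: B_def)
 define y where "y n = x (\<kappa> n) n" for n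
 \<comment> \<open>Partial sums of a geometric series: (1/2)^k + ... + (1/2)^(k+i-1) = (1/2)^k (2 -
   2 (1/2)^i).\<close>
 have tele: "norm (x (k + i) n - x k n) \<le> (1/2) ^ k * (2 - 2 * (1/2) ^ i)"
  if "\<And>j. j < k + i \<Longrightarrow> norm (x (Suc j) n - x j n) < (1/2) ^ j" for k i n
  using that
 proof (induction i)
  case (Suc i)
  have "norm (x (k + Suc i) n - x k n) \<le> norm (x (Suc (k + i)) n - x (k + i) n) + norm (x (k + i) n - x k n)"
   using norm_triangle_ineq[of "x (Suc (k + i)) n - x (k + i) n" "x (k + i) n - x k n"] by simp
  also have "\<dots> \<le> (1/2) ^ (k + i) + (1/2) ^ k * (2 - 2 * (1/2) ^ i)"
   using Suc.IH Suc.prems Suc.prems[of "k + i"] by (intro add_mono) (auto intro: less_imp_le)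
  also have "\<dots> = (1/2) ^ k * (2 - 2 * (1/2) ^ Suc i)" by (simp add: power_add algebra_simps)
  finally show ?case .
 qed simp
 have near: "norm (y n - x k n) \<le> 2 * (1/2) ^ k" if n: "n \<in> B k" for n k
 proof -
  have "norm (x (k + (\<kappa> n - k)) n - x k n) \<le> (1/2) ^ k * (2 - 2 * (1/2) ^ (\<kappa> n - k))"
   by (rule tele) (use \<kappa>B[of n] \<kappa>ge[OF n] in \<open>auto simp: B_def\<close>)
  also have "\<dots> \<le> (1/2) ^ k * 2" by (intro mult_left_mono) auto
  finally show ?thesis using \<kappa>ge[OF n] by (simp add: y_def)
 qed
 have y: "useq y"
 proof -
  obtain C where C: "\<And>n. norm (x 0 n) \<le> C" using x(1)[of 0] by (elim useqE) blast
  have "norm (y n) \<le> 2 + C" for n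
   using near[OF B0, of n] C[of n] norm_triangle_ineq2[of "y n" "x 0 n"] by simp
  then show ?thesis by (rule useqI)
 qed
 have "norm (abs_upow y - s (r k)) \<le> 2 * (1/2) ^ k" for k
 proof -
  have u: "useq (\<lambda>n. y n - x k n)" by (intro useq_diff x y)
  have "ulim (\<lambda>n. norm (y n - x k n)) \<le> 2 * (1/2) ^ k"
   by (rule tendsto_upperbound[OF ulim_tendsto[OF useq_norm[OF u]] _ ultra(1)])
    (rule eventually_mono[OF Bev near])
  then show ?thesis by (simp add: x(2) abs_upow_minus x(1) y norm_abs_upow u)
 qed
 then have le: "norm (s (r k) - abs_upow y) \<le> 2 * (1/2) ^ k" for k by (subst norm_minus_commute)
 have lim0: "(\<lambda>k. 2 * (1/2::real) ^ k) \<longlonglongrightarrow> 0"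
  using tendsto_mult_left[OF LIMSEQ_realpow_zero[of "1/2"], of 2] by simp
 have "(\<lambda>k. norm (s (r k) - abs_upow y)) \<longlonglongrightarrow> 0"
  by (rule tendsto_sandwich[OF _ _ tendsto_const lim0]; intro always_eventually allI norm_ge_zero le)
 then have "(\<lambda>k. s (r k) - abs_upow y) \<longlonglongrightarrow> 0" by (rule tendsto_norm_zero_cancel)
 then have "(\<lambda>k. s (r k)) \<longlonglongrightarrow> abs_upow y" by (rule LIM_zero_cancel)
 then have "(s \<circ> r) \<longlonglongrightarrow> abs_upow y" by (simp only: o_def)
 then have "s \<longlonglongrightarrow> abs_upow y" by (rule Cauchy_converges_subseq[OF s sm])
 then show "convergent s" by (rule convergentI)
qed

instantiation upow :: (chilbert_space) chilbert_space
begin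
lift_definition scaleC_upow :: "complex \<Rightarrow> 'a upow \<Rightarrow> 'a upow" is "\<lambda>c f n. c *\<^sub>C f n"
 by (rule urel_scaleC)
lift_definition cinner_upow :: "'a upow \<Rightarrow> 'a upow \<Rightarrow> complex" is "\<lambda>f g. ulim (\<lambda>n. cinner (f n) (g n))"
 by (rule urel_cinner)
instance
proof
 fix f g h :: "'a upow" and a b :: complex and r :: real
 have u: "urel f f \<Longrightarrow> useq f" for f :: "nat \<Rightarrow> 'a" by (simp add: urel_def)
 note s = urel_refl useq_add useq_scaleC useq_scaleR
 show "a *\<^sub>C (f + g) = a *\<^sub>C f + a *\<^sub>C g" by transfer (simp add: scaleC_add_right s u)
 show "(a + b) *\<^sub>C f = a *\<^sub>C f + b *\<^sub>C f" by transfer (simp add: scaleC_add_left s u)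
 show "a *\<^sub>C b *\<^sub>C f = (a * b) *\<^sub>C f" by transfer (simp add: scaleC_scaleC s u)
 show "r *\<^sub>R f = complex_of_real r *\<^sub>C f" by transfer (simp add: scaleR_scaleC s u)
 show "cinner f g = cnj (cinner g f)"
 proof transfer
  fix f g :: "nat \<Rightarrow> 'a" assume "urel f f" "urel g g"
  then have b: "bounded (range (\<lambda>n. cinner (g n) (f n)))" by (intro useq_cinner u)
  show "ulim (\<lambda>n. cinner (f n) (g n)) = cnj (ulim (\<lambda>n. cinner (g n) (f n)))"
   using tendsto_cnj[OF ulim_tendsto[OF b]] by (intro ulim_eqI) (simp add: cinner_commute[symmetric])
 qed
 show "cinner f (g + h) = cinner f g + cinner f h"
 proof transfer
  fix f g h :: "nat \<Rightarrow> 'a" assume "urel f f" "urel g g" "urel h h"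
  then have b: "bounded (range (\<lambda>n. cinner (f n) (g n)))" "bounded (range (\<lambda>n. cinner (f n) (h n)))"
   by (auto intro!: useq_cinner u)
  show "ulim (\<lambda>n. cinner (f n) (g n + h n)) = ulim (\<lambda>n. cinner (f n) (g n)) + ulim (\<lambda>n. cinner (f n) (h n))"
   using tendsto_add[OF ulim_tendsto[OF b(1)] ulim_tendsto[OF b(2)]]
   by (intro ulim_eqI) (simp add: cinner_add_right)
 qed
 show "cinner f (a *\<^sub>C g) = a * cinner f g"
 proof transfer
  fix f g :: "nat \<Rightarrow> 'a" and a assume "urel f f" "urel g g"
  then have b: "bounded (range (\<lambda>n. cinner (f n) (g n)))" by (intro useq_cinner u)
  show "ulim (\<lambda>n. cinner (f n) (a *\<^sub>C g n)) = a * ulim (\<lambda>n. cinner (f n) (g n))"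
   using tendsto_mult_left[OF ulim_tendsto[OF b], of a] by (intro ulim_eqI) (simp add: cinner_scaleC_right)
 qed
 show "cinner f f = complex_of_real ((norm f)\<^sup>2)"
 proof transfer
  fix f :: "nat \<Rightarrow> 'a" assume "urel f f"
  then have b: "bounded (range (\<lambda>n. norm (f n)))" by (intro useq_norm u)
  show "ulim (\<lambda>n. cinner (f n) (f n)) = complex_of_real ((ulim (\<lambda>n. norm (f n)))\<^sup>2)"
   using tendsto_of_real[OF tendsto_power[OF ulim_tendsto[OF b], of 2], where ?'a = complex]
   by (intro ulim_eqI) (simp add: cinner_self)
 qed
qed
end

lemma abs_upow_ops:
 assumes "useq f" "useq g"
 shows "abs_upow f + abs_upow g = abs_upow (\<lambda>n. f n + g n)"
  and "c *\<^sub>C abs_upow f = abs_upow (\<lambda>n. c *\<^sub>C f n)"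
  and "cinner (abs_upow f) (abs_upow g) = ulim (\<lambda>n. cinner (f n) (g n))"
 using assms by (simp_all add: plus_upow.abs_eq scaleC_upow.abs_eq cinner_upow.abs_eq urel_refl)

lemma abs_upow_eq_iff: "useq f \<Longrightarrow> useq g \<Longrightarrow> abs_upow f = abs_upow g \<longleftrightarrow> urel f g"
 using Quotient3_rel[OF Quotient3_upow, of f g] urel_refl by blast

section \<open>Uniformly bounded sequences of operators acting on the ultrapower\<close>

definition ulift :: "(nat \<Rightarrow> 'h \<Rightarrow> 'h) \<Rightarrow> 'h::chilbert_space upow \<Rightarrow> 'h upow" where
 "ulift T \<xi> = abs_upow (\<lambda>n. T n (rep_upow \<xi> n))"

definition ubdd :: "(nat \<Rightarrow> 'h::chilbert_space \<Rightarrow> 'h) \<Rightarrow> bool" where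
 "ubdd T \<longleftrightarrow> (\<forall>n. bounded_clinear (T n)) \<and> (\<exists>K. \<forall>n. onorm (T n) \<le> K)"

lemma ubddE:
 assumes "ubdd T"
 obtains K where "0 \<le> K" "\<And>n v. norm (T n v) \<le> K * norm v" "\<And>n. bounded_clinear (T n)"
proof -
 obtain K where K: "\<And>n. onorm (T n) \<le> K" and b: "\<And>n. bounded_clinear (T n)" using assms by (auto simp: ubdd_def)
 have "0 \<le> K" using onorm_nonneg[OF b[of 0]] K[of 0] by simp
 moreover have "norm (T n v) \<le> K * norm v" for n v
  using norm_le_onorm[OF b[of n], of v] mult_right_mono[OF K[of n], of "norm v"] by simp
 ultimately show ?thesis using b by (rule that)
qed

lemma ubdd_useq: "ubdd T \<Longrightarrow> useq f \<Longrightarrow> useq (\<lambda>n. T n (f n))"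
 by (elim ubddE) (rule useq_bounded_clinear)

lemma ulift_abs:
 assumes T: "ubdd T" and f: "useq f"
 shows "ulift T (abs_upow f) = abs_upow (\<lambda>n. T n (f n))"
proof -
 have r: "urel (rep_upow (abs_upow f)) f"
  using Quotient3_rep_abs[OF Quotient3_upow] f urel_refl by blast
 then have u: "useq (rep_upow (abs_upow f))" by (simp add: urel_def)
 obtain K where K: "0 \<le> K" "\<And>n v. norm (T n v) \<le> K * norm v" "\<And>n. bounded_clinear (T n)"
  using ubddE[OF T] by blast
 show ?thesis unfolding ulift_def
  using urel_apply[OF r K(3,2,1)] abs_upow_eq_iff[OF ubdd_useq[OF T u] ubdd_useq[OF T f]] by simp
qed

lemma clinear_ulift:
 assumes T: "ubdd T"
 shows "bounded_clinear (ulift T)"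
proof -
 obtain K where K: "0 \<le> K" "\<And>n v. norm (T n v) \<le> K * norm v" "\<And>n. bounded_clinear (T n)"
  using ubddE[OF T] by blast
 show ?thesis
 proof (rule bounded_clinearI[where K = K])
  fix \<xi> \<eta> :: "'a upow" and c
  obtain f where f: "useq f" "\<xi> = abs_upow f" by (rule upow_cases)
  obtain g where g: "useq g" "\<eta> = abs_upow g" by (rule upow_cases)
  note Tu = ubdd_useq[OF T f(1)] ubdd_useq[OF T g(1)]
  show "ulift T (\<xi> + \<eta>) = ulift T \<xi> + ulift T \<eta>"
   using f g Tu by (simp add: abs_upow_ops ulift_abs[OF T] useq_add clinear_add[OF K(3)])
  show "ulift T (c *\<^sub>C \<xi>) = c *\<^sub>C ulift T \<xi>"
   using f Tu by (simp add: abs_upow_ops ulift_abs[OF T] useq_scaleC clinear_scaleC[OF K(3)])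
  have "ulim (\<lambda>n. norm (T n (f n))) \<le> K * ulim (\<lambda>n. norm (f n))"
   by (rule tendsto_le[OF ultra(1) tendsto_mult_left[OF ulim_tendsto[OF useq_norm[OF f(1)]]]
      ulim_tendsto[OF useq_norm[OF Tu(1)]]]) (use K(2) in simp)
  then show "norm (ulift T \<xi>) \<le> norm \<xi> * K"
   using f Tu by (simp add: ulift_abs[OF T] norm_abs_upow mult.commute)
 qed
qed

section \<open>Representations of quotients\<close>

text \<open>The restriction to an invariant subspace is realised on the whole space as
  \<open>\<phi> a \<circ> E\<close>, with \<open>E\<close> the orthogonal projection onto
  \<open>W\<close>, so it vanishes on the complement and the Hilbert space type stays the same.
  Invariance of \<open>W\<close> makes this multiplicative and compatible with adjoints.\<close>

lemma subrepresentation: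
 fixes \<phi> :: "'a \<Rightarrow> 'k::chilbert_space \<Rightarrow> 'k" and A :: "('a, 'm) star_alg_scheme"
 assumes A: "star_space A" and \<phi>: "star_hom A bounded_ops \<phi>" and W: "cvs.subspace W" "closed W"
  and inv: "\<And>a w. a \<in> carrier A \<Longrightarrow> w \<in> W \<Longrightarrow> \<phi> a w \<in> W"
 obtains \<psi> :: "'a \<Rightarrow> 'k \<Rightarrow> 'k" where "star_hom A bounded_ops \<psi>"
  "\<And>a w. w \<in> W \<Longrightarrow> \<psi> a w = \<phi> a w"
  "\<And>a. (\<And>w. w \<in> W \<Longrightarrow> \<phi> a w = 0) \<Longrightarrow> \<psi> a = (\<lambda>_. 0)"
proof -
 interpret star_space A by fact
 define E where "E v = (SOME q. q \<in> W \<and> (\<forall>w\<in>W. cinner w (v - q) = 0))" for v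
 have E: "E v \<in> W" "w \<in> W \<Longrightarrow> cinner w (v - E v) = 0" for v w
 proof -
  have "\<exists>q. q \<in> W \<and> (\<forall>w\<in>W. cinner w (v - q) = 0)" by (rule projection_exists[OF W, of v]) blast
  from someI_ex[OF this] show "E v \<in> W" "w \<in> W \<Longrightarrow> cinner w (v - E v) = 0" unfolding E_def by auto
 qed
 \<comment> \<open>\<open>E\<close> is defined by choice; linearity follows because the
   orthogonality condition singles out the chosen point.\<close>
 have uniq: "E v = q" if q: "q \<in> W" "\<And>w. w \<in> W \<Longrightarrow> cinner w (v - q) = 0" for v q
 proof -
  have d: "E v - q \<in> W" by (rule cvs.subspace_diff[OF W(1) E(1) q(1)])
  have "cinner (E v - q) ((v - q) - (v - E v)) = 0"
   unfolding cinner_diff_right[of "E v - q" "v - q"] using q(2)[OF d] E(2)[OF d] by simp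
  then have "cinner (E v - q) (E v - q) = 0" by simp
  then show ?thesis by (simp add: cinner_self_eq_0)
 qed
 have EW: "E w = w" if "w \<in> W" for w by (rule uniq) (use that in auto)
 have Eb: "bounded_clinear E"
 proof (rule bounded_clinearI[where K = 1])
  show "E (x + y) = E x + E y" for x y
  proof (rule uniq)
   show "E x + E y \<in> W" by (intro cvs.subspace_add[OF W(1)] E)
   fix w assume w: "w \<in> W"
   have "x + y - (E x + E y) = (x - E x) + (y - E y)" by simp
   then show "cinner w (x + y - (E x + E y)) = 0" using E(2)[OF w] by (simp only: cinner_add_right) simp
  qed
  show "E (c *\<^sub>C x) = c *\<^sub>C E x" for c x
  proof (rule uniq)
   show "c *\<^sub>C E x \<in> W" by (intro cvs.subspace_scale[OF W(1)] E)
   fix w assume w: "w \<in> W"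
   have "c *\<^sub>C x - c *\<^sub>C E x = c *\<^sub>C (x - E x)" by (simp add: cvs.scale_right_diff_distrib)
   then show "cinner w (c *\<^sub>C x - c *\<^sub>C E x) = 0" using E(2)[OF w] by (simp only: cinner_scaleC_right) simp
  qed
  show "norm (E x) \<le> norm x * 1" for x
  proof -
   have "(norm x)\<^sup>2 = (norm (E x))\<^sup>2 + (norm (x - E x))\<^sup>2"
    using norm_add_sq[of "E x" "x - E x"] E(2)[OF E(1), of x x] by simp
   then have "(norm (E x))\<^sup>2 \<le> (norm x)\<^sup>2" using zero_le_power2[of "norm (x - E x)"] by linarith
   then show ?thesis using power2_le_imp_le[OF _ norm_ge_zero] by simp
  qed
 qed
 note f = rep_facts[OF \<phi>]
 have perp: "cinner w v = cinner w (E v)" if "w \<in> W" for w v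
  using E(2)[OF that, of v] by (simp add: cinner_diff_right)
 have perp': "cinner v w = cinner (E v) w" if "w \<in> W" for w v
  using perp[OF that, of v] cinner_commute by metis
 define \<psi> where "\<psi> a = \<phi> a \<circ> E" for a
 have "star_hom A bounded_ops \<psi>"
  unfolding star_hom_def
 proof (intro conjI ballI allI)
  show "\<psi> \<in> carrier A \<rightarrow> carrier bounded_ops"
   using f(1) Eb by (simp add: \<psi>_def clinear_comp)
  fix a c assume a: "a \<in> carrier A"
  show "\<psi> (c \<odot>\<^bsub>A\<^esub> a) = c \<odot>\<^bsub>bounded_ops\<^esub> \<psi> a" by (simp add: \<psi>_def f(3)[OF a] o_def)
  have "cinner (\<psi> (involution A a) v) w = cinner v (\<psi> a w)" for v w
  proof -
   have "cinner (\<psi> (involution A a) v) w = cinner (\<phi> (involution A a) (E v)) (E w)"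
    using perp[OF inv[OF involution_closed[OF a] E(1)]] by (simp add: \<psi>_def)
   also have "\<dots> = cinner (E v) (\<phi> a (E w))" by (rule star_hom_bounded_ops_adjoint[OF \<phi> a])
   also have "\<dots> = cinner v (\<psi> a w)" using perp'[OF inv[OF a E(1)]] by (simp add: \<psi>_def)
   finally show ?thesis .
  qed
  then show "\<psi> (involution A a) = involution bounded_ops (\<psi> a)"
   unfolding bounded_ops_simps by (rule cadjoint_eqI[symmetric])
  fix b assume b: "b \<in> carrier A"
  show "\<psi> (a \<oplus>\<^bsub>A\<^esub> b) = \<psi> a \<oplus>\<^bsub>bounded_ops\<^esub> \<psi> b" by (simp add: \<psi>_def f(4)[OF a b] o_def)
  show "\<psi> (a \<otimes>\<^bsub>A\<^esub> b) = \<psi> a \<otimes>\<^bsub>bounded_ops\<^esub> \<psi> b"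
   by (simp add: \<psi>_def f(5)[OF a b] fun_eq_iff EW inv[OF b E(1)])
 qed
 then show ?thesis by (rule that) (auto simp: \<psi>_def EW E(1))
qed

lemma norm_projection_complement_le:
 assumes E: "bounded_clinear E" "cadjoint E = E" "E \<circ> E = E"
 shows "norm (v - E v) \<le> norm v"
proof -
 have "cinner (E v) (v - E v) = cinner (E v) v - cinner (E v) (E v)" by (rule cinner_diff_right)
 also have "cinner (E v) (E v) = cinner (E (E v)) v"
  using cinner_cadjoint[OF E(1), of "E v" v] by (simp add: E(2))
 also have "E (E v) = E v" using fun_cong[OF E(3), of v] by simp
 finally have "cinner (E v) (v - E v) = 0" by simp
 then have "(norm v)\<^sup>2 = (norm (E v))\<^sup>2 + (norm (v - E v))\<^sup>2"
  using norm_add_sq[of "E v" "v - E v"] by simp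
 then have "(norm (v - E v))\<^sup>2 \<le> (norm v)\<^sup>2" using zero_le_power2[of "norm (E v)"] by linarith
 then show ?thesis by (rule power2_le_imp_le) simp
qed

context star_bdd
begin

text \<open>The vectors \<open>z\<close> witnessing the norm are moved away from the ideal by the projections \<open>P n\<close>;
 in the ultrapower they are annihilated by the ideal.\<close>

lemma representation_of_quotient:
 assumes J: "J \<subseteq> carrier A" and J_right: "\<And>j x. j \<in> J \<Longrightarrow> x \<in> carrier A \<Longrightarrow> j \<otimes> x \<in> J"
  and P: "\<And>n. P n \<in> carrier A" "\<And>n. involution A (P n) = P n" "\<And>n. P n \<otimes> P n = P n"
  and approx: "\<And>j. j \<in> J \<Longrightarrow> (\<lambda>n. p (j \<ominus> j \<otimes> P n)) \<longlonglongrightarrow> 0"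
  and a: "a \<in> carrier A" and c0: "0 \<le> c" and c: "\<And>n::nat. c < p (a \<ominus> a \<otimes> P n)"
 obtains \<psi> :: "'a \<Rightarrow> ('a, complex) ell2 upow \<Rightarrow> ('a, complex) ell2 upow"
 where "star_hom A bounded_ops \<psi>" "\<And>j. j \<in> J \<Longrightarrow> \<psi> j = (\<lambda>_. 0)" "c \<le> onorm (\<psi> a)"
proof -
 \<comment> \<open>For each n a separate representation and a unit vector on which
   \<open>a \<ominus> a \<otimes> P n\<close> exceeds c. All of them act on the same Hilbert space,
   so they combine into one representation on its ultrapower.\<close>
 have "\<exists>\<rho> \<xi>. rep \<rho> \<and> norm \<xi> = 1 \<and> c < norm (\<rho> (a \<ominus> a \<otimes> P n) \<xi>)" for n
 proof -
  have "\<not> p (a \<ominus> a \<otimes> P n) \<le> c" using c[of n] by simp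
  then obtain \<rho> where \<rho>: "rep \<rho>" "c < onorm (\<rho> (a \<ominus> a \<otimes> P n))"
   using max_norm_leI[of "a \<ominus> a \<otimes> P n" c] by (meson not_le)
  have b: "bounded_clinear (\<rho> (a \<ominus> a \<otimes> P n))"
   using a P(1) by (intro rep_facts(1)[OF \<rho>(1)] diff_closed mult_closed)
  have "\<exists>x. \<not> norm (\<rho> (a \<ominus> a \<otimes> P n) x) \<le> c * norm x"
   using onorm_bound[OF c0, of "\<rho> (a \<ominus> a \<otimes> P n)"] \<rho>(2) by (meson not_le)
  then obtain x where x: "c * norm x < norm (\<rho> (a \<ominus> a \<otimes> P n) x)" by (meson not_le)
  have x0: "norm x > 0" using x clinear_zero[OF b] by auto
  define \<xi> where "\<xi> = complex_of_real (1 / norm x) *\<^sub>C x"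
  have "norm \<xi> = 1" using x0 by (simp add: \<xi>_def norm_divide)
  moreover have "norm (\<rho> (a \<ominus> a \<otimes> P n) \<xi>) = norm (\<rho> (a \<ominus> a \<otimes> P n) x) / norm x"
   using x0 by (simp add: \<xi>_def clinear_scaleC[OF b] norm_divide)
  then have "c < norm (\<rho> (a \<ominus> a \<otimes> P n) \<xi>)" using x x0 by (simp add: pos_less_divide_eq)
  ultimately show ?thesis using \<rho>(1) by blast
 qed
 then obtain \<rho> \<xi> where \<rho>: "\<And>n. rep (\<rho> n)" and \<xi>: "\<And>n. norm (\<xi> n) = 1"
  and big: "\<And>n. c < norm (\<rho> n (a \<ominus> a \<otimes> P n) (\<xi> n))" by metis
 note f = rep_facts[OF \<rho>]
 define \<pi> where "\<pi> x = ulift (\<lambda>n. \<rho> n x)" for x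
 have ub: "ubdd (\<lambda>n. \<rho> n x)" if "x \<in> carrier A" for x
  unfolding ubdd_def using f(1)[OF that] rep_le_max_norm[OF \<rho> that] by blast
 have \<pi>: "\<pi> x (abs_upow g) = abs_upow (\<lambda>n. \<rho> n x (g n))" if "x \<in> carrier A" "useq g" for x g
  unfolding \<pi>_def by (rule ulift_abs[OF ub[OF that(1)] that(2)])
 have u: "useq (\<lambda>n. \<rho> n x (g n))" if "x \<in> carrier A" "useq g" for x g
  by (rule ubdd_useq[OF ub[OF that(1)] that(2)])
 have \<pi>b: "bounded_clinear (\<pi> x)" if "x \<in> carrier A" for x
  unfolding \<pi>_def by (rule clinear_ulift[OF ub[OF that]])
 have \<pi>hom: "star_hom A bounded_ops \<pi>"
  unfolding star_hom_def
 proof (intro conjI ballI allI)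
  show "\<pi> \<in> carrier A \<rightarrow> carrier bounded_ops" using \<pi>b by simp
  fix x s assume x: "x \<in> carrier A"
  show "\<pi> (s \<odot> x) = s \<odot>\<^bsub>bounded_ops\<^esub> \<pi> x"
  proof
   fix \<eta> :: "('a, complex) ell2 upow"
   obtain g where g: "useq g" "\<eta> = abs_upow g" by (rule upow_cases)
   show "\<pi> (s \<odot> x) \<eta> = (s \<odot>\<^bsub>bounded_ops\<^esub> \<pi> x) \<eta>"
    using x g by (simp add: \<pi> smult_closed f abs_upow_ops u)
  qed
  have "cinner (\<pi> (involution A x) \<eta>) \<theta> = cinner \<eta> (\<pi> x \<theta>)" for \<eta> \<theta>
  proof -
   obtain g where g: "useq g" "\<eta> = abs_upow g" by (rule upow_cases)
   obtain h where h: "useq h" "\<theta> = abs_upow h" by (rule upow_cases)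
   show ?thesis
    using x g h by (simp add: \<pi> involution_closed abs_upow_ops(3) u star_hom_bounded_ops_adjoint[OF \<rho> x])
  qed
  then show "\<pi> (involution A x) = involution bounded_ops (\<pi> x)"
   unfolding bounded_ops_simps by (rule cadjoint_eqI[symmetric])
  fix y assume y: "y \<in> carrier A"
  show "\<pi> (x \<oplus> y) = \<pi> x \<oplus>\<^bsub>bounded_ops\<^esub> \<pi> y"
  proof
   fix \<eta> :: "('a, complex) ell2 upow"
   obtain g where g: "useq g" "\<eta> = abs_upow g" by (rule upow_cases)
   show "\<pi> (x \<oplus> y) \<eta> = (\<pi> x \<oplus>\<^bsub>bounded_ops\<^esub> \<pi> y) \<eta>"
    using x y g by (simp add: \<pi> add_closed f abs_upow_ops u)
  qed
  show "\<pi> (x \<otimes> y) = \<pi> x \<otimes>\<^bsub>bounded_ops\<^esub> \<pi> y"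
  proof
   fix \<eta> :: "('a, complex) ell2 upow"
   obtain g where g: "useq g" "\<eta> = abs_upow g" by (rule upow_cases)
   show "\<pi> (x \<otimes> y) \<eta> = (\<pi> x \<otimes>\<^bsub>bounded_ops\<^esub> \<pi> y) \<eta>"
    using x y g by (simp add: \<pi> mult_closed f u)
  qed
 qed
 \<comment> \<open>The common kernel of the operators \<pi>(j) is invariant because \<open>J\<close>
   absorbs factors on the right.\<close>
 define W where "W = {\<eta>. \<forall>j\<in>J. \<pi> j \<eta> = 0}"
 have Jc: "j \<in> carrier A" if "j \<in> J" for j using J that by blast
 have W: "cvs.subspace W"
  by (rule cvs.subspaceI)
   (simp_all add: W_def clinear_zero[OF \<pi>b[OF Jc]] clinear_add[OF \<pi>b[OF Jc]] clinear_scaleC[OF \<pi>b[OF Jc]])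
 have clW: "closed W"
 proof -
  have "W = (\<Inter>j\<in>J. {\<eta>. \<pi> j \<eta> = 0})" by (auto simp: W_def)
  moreover have "closed {\<eta>. \<pi> j \<eta> = 0}" if "j \<in> J" for j
   by (intro closed_Collect_eq linear_continuous_on bounded_clinearD \<pi>b Jc that continuous_on_const)
  ultimately show ?thesis by auto
 qed
 have inv: "\<pi> x w \<in> W" if x: "x \<in> carrier A" and w: "w \<in> W" for x w
 proof -
  have "\<pi> j (\<pi> x w) = 0" if j: "j \<in> J" for j
  proof -
   have "\<pi> j (\<pi> x w) = \<pi> (j \<otimes> x) w" using rep_facts(5)[OF \<pi>hom Jc[OF j] x] by simp
   then show ?thesis using w J_right[OF j x] by (simp add: W_def)
  qed
  then show ?thesis by (simp add: W_def)
 qed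
 obtain \<psi> where \<psi>: "star_hom A bounded_ops \<psi>" "\<And>a w. w \<in> W \<Longrightarrow> \<psi> a w = \<pi> a w"
  "\<And>a. (\<And>w. w \<in> W \<Longrightarrow> \<pi> a w = 0) \<Longrightarrow> \<psi> a = (\<lambda>_. 0)"
  using subrepresentation[OF star_space_axioms \<pi>hom W clW inv] by metis
 \<comment> \<open>The vector (1 - P_n) \<xi>_n, written without a unit. Applying x to it is the
   same as applying \<open>x \<ominus> x \<otimes> P n\<close> to \<open>\<xi> n\<close>, which is
   small for x in \<open>J\<close> and large for \<open>a\<close>.\<close>
 define \<zeta> where "\<zeta> n = \<xi> n - \<rho> n (P n) (\<xi> n)" for n
 have n\<zeta>: "norm (\<zeta> n) \<le> 1" for n
 proof -
  have "norm (\<zeta> n) \<le> norm (\<xi> n)" unfolding \<zeta>_def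
  proof (rule norm_projection_complement_le)
   show "bounded_clinear (\<rho> n (P n))" by (rule f(1)[OF P(1)])
   show "cadjoint (\<rho> n (P n)) = \<rho> n (P n)" using f(2)[OF P(1), of n n] P(2)[of n] by simp
   show "\<rho> n (P n) \<circ> \<rho> n (P n) = \<rho> n (P n)" using f(5)[OF P(1) P(1), of n n n] P(3)[of n] by simp
  qed
  then show ?thesis by (simp add: \<xi>)
 qed
 have u\<zeta>: "useq \<zeta>" using n\<zeta> by (rule useqI)
 have app: "\<rho> n x (\<zeta> n) = \<rho> n (x \<ominus> x \<otimes> P n) (\<xi> n)" if x: "x \<in> carrier A" for x n
  unfolding \<zeta>_def
  using x P(1)[of n] by (simp add: rep_minus[OF star_space_axioms \<rho>] mult_closed f clinear_diff[OF f(1)])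
 define z where "z = abs_upow \<zeta>"
 have zW: "z \<in> W"
 proof -
  have "\<pi> j z = 0" if j: "j \<in> J" for j
  proof -
   have jc: "j \<in> carrier A" by (rule Jc[OF j])
   have "((\<lambda>n. norm (\<rho> n j (\<zeta> n) - 0)) \<longlongrightarrow> 0) ultra"
   proof (rule tendsto_0_le_ultra)
    show "((\<lambda>n. p (j \<ominus> j \<otimes> P n)) \<longlongrightarrow> 0) ultra" using approx[OF j] ultra(2) by (rule tendsto_mono[rotated])
    fix n
    have jp: "j \<ominus> j \<otimes> P n \<in> carrier A" using jc P(1) by (intro diff_closed mult_closed)
    have "norm (\<rho> n j (\<zeta> n) - 0) \<le> onorm (\<rho> n (j \<ominus> j \<otimes> P n)) * norm (\<xi> n)"
     using norm_le_onorm[OF f(1)[OF jp]] by (simp add: app[OF jc])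
    also have "\<dots> \<le> p (j \<ominus> j \<otimes> P n)" using rep_le_max_norm[OF \<rho> jp] by (simp add: \<xi>)
    finally show "norm (\<rho> n j (\<zeta> n) - 0) \<le> p (j \<ominus> j \<otimes> P n)" .
   qed simp
   then have "urel (\<lambda>n. \<rho> n j (\<zeta> n)) (\<lambda>_. 0)" using u[OF jc u\<zeta>] useq_0 by (simp add: urel_def)
   then have "abs_upow (\<lambda>n. \<rho> n j (\<zeta> n)) = abs_upow (\<lambda>_. 0)"
    using abs_upow_eq_iff[OF u[OF jc u\<zeta>] useq_0] by simp
   then show ?thesis by (simp add: z_def \<pi>[OF jc u\<zeta>] zero_upow_def)
  qed
  then show ?thesis by (simp add: W_def)
 qed
 have "norm z \<le> 1"
  unfolding z_def norm_abs_upow[OF u\<zeta>]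
  by (rule tendsto_upperbound[OF ulim_tendsto[OF useq_norm[OF u\<zeta>]] _ ultra(1)]) (simp add: n\<zeta>)
 have "c \<le> norm (\<psi> a z)"
 proof -
  have "c \<le> ulim (\<lambda>n. norm (\<rho> n a (\<zeta> n)))"
   by (rule tendsto_lowerbound[OF ulim_tendsto[OF useq_norm[OF u[OF a u\<zeta>]]] _ ultra(1)])
    (intro always_eventually allI, simp add: app[OF a] less_imp_le[OF big])
  then show ?thesis using zW by (simp add: \<psi>(2) z_def \<pi>[OF a u\<zeta>] norm_abs_upow[OF u[OF a u\<zeta>]])
 qed
 also have "\<dots> \<le> onorm (\<psi> a) * norm z" by (rule norm_le_onorm[OF rep_facts(1)[OF \<psi>(1) a]])
 also have "\<dots> \<le> onorm (\<psi> a) * 1"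
  using \<open>norm z \<le> 1\<close> by (intro mult_left_mono onorm_nonneg rep_facts(1)[OF \<psi>(1) a])
 finally have "c \<le> onorm (\<psi> a)" by simp
 moreover have "\<psi> j = (\<lambda>_. 0)" if "j \<in> J" for j by (rule \<psi>(3)) (use that in \<open>simp add: W_def\<close>)
 ultimately show ?thesis using \<psi>(1) that by blast
qed

end

section \<open>Closed spans\<close>

context normed_star
begin

lemma closed_subspace_conv:
 assumes V: "closed_subspace C V" and s: "conv s a" "\<And>n. s n \<in> V"
 shows "a \<in> V"
proof -
 have a: "a \<in> carrier C" by (rule conv_carrier(2)[OF s(1)])
 have "\<exists>b\<in>V. alg_norm C (a \<ominus> b) < e" if e: "e > 0" for e
 proof -
  obtain N where "\<And>n. n \<ge> N \<Longrightarrow> norm (alg_norm C (s n \<ominus> a) - 0) < e"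
   using LIMSEQ_D[OF conv_tendsto[OF s(1)] e] by blast
  then have "alg_norm C (s N \<ominus> a) < e" by fastforce
  then show ?thesis using s(2) norm_minus_commute[OF conv_carrier(1)[OF s(1)] a] by (intro bexI[of _ "s N"]) simp_all
 qed
 then show ?thesis using V a unfolding closed_subspace_def by blast
qed

lemma closed_subspaceI:
 assumes "V \<subseteq> carrier C" "\<zero> \<in> V" "\<And>a b. a \<in> V \<Longrightarrow> b \<in> V \<Longrightarrow> a \<oplus> b \<in> V" "\<And>c a. a \<in> V \<Longrightarrow> c \<odot> a \<in> V"
  and lim: "\<And>s a. conv s a \<Longrightarrow> (\<And>n. s n \<in> V) \<Longrightarrow> a \<in> V"
 shows "closed_subspace C V"
 unfolding closed_subspace_def
proof (intro conjI ballI allI impI)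
 fix a assume a: "a \<in> carrier C" and e: "\<forall>e>0. \<exists>b\<in>V. alg_norm C (a \<ominus> b) < e"
 have "\<exists>b\<in>V. alg_norm C (a \<ominus> b) < 1 / Suc n" for n using e by simp
 then obtain s where s: "\<And>n. s n \<in> V" "\<And>n. alg_norm C (a \<ominus> s n) < 1 / Suc n" by metis
 have sc: "s n \<in> carrier C" for n using s(1) assms(1) by blast
 have "conv s a"
 proof (rule convI_le[OF sc a _ LIMSEQ_Suc[OF lim_1_over_n]])
  show "alg_norm C (s n \<ominus> a) \<le> 1 / real (Suc n)" for n
   using s(2)[of n] norm_minus_commute[OF sc a, of n] by simp
 qed
 then show "a \<in> V" using lim s(1) by blast
qed (use assms in auto)

lemma closed_subspace_carrier: "closed_subspace C (carrier C)"
 by (rule closed_subspaceI) (auto intro: zero_in_carrier add_closed smult_closed conv_carrier(2))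

lemma closed_span_minimal: "closed_subspace C V \<Longrightarrow> S \<subseteq> V \<Longrightarrow> closed_span C S \<subseteq> V"
 by (auto simp: closed_span_def)

lemma closed_span_superset: "S \<subseteq> closed_span C S"
 by (auto simp: closed_span_def)

lemma closed_subspace_closed_span:
 assumes S: "S \<subseteq> carrier C"
 shows "closed_subspace C (closed_span C S)"
proof (rule closed_subspaceI)
 show "closed_span C S \<subseteq> carrier C" by (rule closed_span_minimal[OF closed_subspace_carrier S])
 fix s a assume c: "conv s a" and s: "\<And>n. s n \<in> closed_span C S"
 show "a \<in> closed_span C S"
  unfolding closed_span_def
 proof (rule InterI)
  fix V assume V: "V \<in> {V. closed_subspace C V \<and> S \<subseteq> V}"
  then have "s n \<in> V" for n using s[of n] closed_span_minimal[of V S] by blast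
  then show "a \<in> V" using V closed_subspace_conv[OF _ c] by blast
 qed
qed (auto simp: closed_span_def closed_subspace_def)

end

text \<open>The factor \<open>k c\<close> covers conjugate linear maps.\<close>

lemma closed_span_image:
 assumes "normed_star C" "normed_star C'" and S: "S \<subseteq> carrier C" and V: "closed_subspace C' V"
  and f0: "f \<zero>\<^bsub>C\<^esub> \<in> V"
  and add: "\<And>x y. x \<in> carrier C \<Longrightarrow> y \<in> carrier C \<Longrightarrow> f (x \<oplus>\<^bsub>C\<^esub> y) = f x \<oplus>\<^bsub>C'\<^esub> f y"
  and smult: "\<And>c x. x \<in> carrier C \<Longrightarrow> f (c \<odot>\<^bsub>C\<^esub> x) = k c \<odot>\<^bsub>C'\<^esub> f x"
  and cont: "\<And>s a. normed_star.conv C s a \<Longrightarrow> normed_star.conv C' (\<lambda>n. f (s n)) (f a)"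
  and fS: "\<And>r. r \<in> S \<Longrightarrow> f r \<in> V" and x: "x \<in> closed_span C S"
 shows "f x \<in> V"
proof -
 interpret C: normed_star C by fact
 interpret C': normed_star C' by fact
 have "closed_subspace C {x \<in> carrier C. f x \<in> V}"
 proof (rule C.closed_subspaceI)
  fix s a assume s: "C.conv s a" "\<And>n. s n \<in> {x \<in> carrier C. f x \<in> V}"
  have "f a \<in> V" by (rule C'.closed_subspace_conv[OF V cont[OF s(1)]]) (use s(2) in blast)
  then show "a \<in> {x \<in> carrier C. f x \<in> V}" using C.conv_carrier(2)[OF s(1)] by blast
 qed (use V in \<open>auto simp: f0 C.zero_in_carrier add smult C.add_closed C.smult_closed closed_subspace_def\<close>)
 then have "closed_span C S \<subseteq> {x \<in> carrier C. f x \<in> V}" by (rule C.closed_span_minimal) (use S fS in blast)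
 then show ?thesis using x by blast
qed

context star_bdd
begin

interpretation C: banach_star C by (rule banach_star_completion)

text \<open>The hypotheses test products of generators with elements of \<open>A\<close> only.
  Density of \<open>A\<close> in the completion extends them to an arbitrary factor, and then
  \<open>closed_span_image\<close> to an arbitrary member of \<open>K\<close>.\<close>

lemma closed_star_ideal_closed_span:
 assumes S: "S \<subseteq> carrier A" and K: "K = closed_span C (max_embed A ` S)"
  and left: "\<And>x r. x \<in> carrier A \<Longrightarrow> r \<in> S \<Longrightarrow> max_embed A (x \<otimes> r) \<in> K"
  and right: "\<And>x r. x \<in> carrier A \<Longrightarrow> r \<in> S \<Longrightarrow> max_embed A (r \<otimes> x) \<in> K"
  and star: "\<And>r. r \<in> S \<Longrightarrow> max_embed A (involution A r) \<in> K"
 shows "closed_star_ideal C K"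
proof -
 note e = star_hom_closed[OF star_hom_max_embed]
 have SC: "max_embed A ` S \<subseteq> carrier C" using S e by blast
 have Kc: "closed_subspace C K" unfolding K by (rule C.closed_subspace_closed_span[OF SC])
 have K0: "\<zero>\<^bsub>C\<^esub> \<in> K" using Kc by (simp add: closed_subspace_def)
 have mz: "x \<otimes>\<^bsub>C\<^esub> \<zero>\<^bsub>C\<^esub> = \<zero>\<^bsub>C\<^esub>" "\<zero>\<^bsub>C\<^esub> \<otimes>\<^bsub>C\<^esub> x = \<zero>\<^bsub>C\<^esub>" if "x \<in> carrier C" for x
  using C.smult_mult_right[OF that C.zero_in_carrier, of 0]
   C.smult_mult_left[OF C.zero_in_carrier that, of 0] that
  by (simp_all add: C.smult_0 C.zero_in_carrier C.mult_closed)
 have iz: "involution C \<zero>\<^bsub>C\<^esub> = \<zero>\<^bsub>C\<^esub>"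
  using C.involution_smult[OF C.zero_in_carrier, of 0]
  by (simp add: C.smult_0 C.zero_in_carrier C.involution_closed)
 note img = closed_span_image[OF C.normed_star_axioms C.normed_star_axioms SC Kc, folded K]
 show ?thesis
 proof (unfold_locales, rule Kc)
  fix a x assume a: "a \<in> carrier C" and x: "x \<in> K"
  obtain t where t: "\<And>n. t n \<in> carrier A" "C.conv (\<lambda>n. max_embed A (t n)) a"
   by (rule C.dense_imageE[OF dense_max_embed a]) (rule that)
  have r: "a \<otimes>\<^bsub>C\<^esub> max_embed A r \<in> K" "max_embed A r \<otimes>\<^bsub>C\<^esub> a \<in> K" if r: "r \<in> S" for r
  proof -
   have rA: "r \<in> carrier A" using r S by blast
   note rc = C.conv_const[OF e[OF rA]]
   show "a \<otimes>\<^bsub>C\<^esub> max_embed A r \<in> K"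
    by (rule C.closed_subspace_conv[OF Kc C.conv_mult[OF t(2) rc]])
     (use left[OF t(1) r] in \<open>simp add: star_hom_mult[OF star_hom_max_embed t(1) rA]\<close>)
   show "max_embed A r \<otimes>\<^bsub>C\<^esub> a \<in> K"
    by (rule C.closed_subspace_conv[OF Kc C.conv_mult[OF rc t(2)]])
     (use right[OF t(1) r] in \<open>simp add: star_hom_mult[OF star_hom_max_embed rA t(1)]\<close>)
  qed
  show "a \<otimes>\<^bsub>C\<^esub> x \<in> K"
  proof (rule img[where f = "\<lambda>x. a \<otimes>\<^bsub>C\<^esub> x" and k = "\<lambda>c. c"])
   show "a \<otimes>\<^bsub>C\<^esub> r \<in> K" if "r \<in> max_embed A ` S" for r using that r(1) by blast
  qed (use a x in \<open>auto simp: mz K0 C.distrib_left C.smult_mult_right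
    intro: C.conv_mult C.conv_const\<close>)
  show "x \<otimes>\<^bsub>C\<^esub> a \<in> K"
  proof (rule img[where f = "\<lambda>x. x \<otimes>\<^bsub>C\<^esub> a" and k = "\<lambda>c. c"])
   show "r \<otimes>\<^bsub>C\<^esub> a \<in> K" if "r \<in> max_embed A ` S" for r using that r(2) by blast
  qed (use a x in \<open>auto simp: mz K0 C.distrib_right C.smult_mult_left
    intro: C.conv_mult C.conv_const\<close>)
 next
  fix x assume x: "x \<in> K"
  show "involution C x \<in> K"
  proof (rule img[where f = "involution C" and k = cnj])
   show "involution C r \<in> K" if "r \<in> max_embed A ` S" for r
    using that star S by (auto simp: star_hom_involution[OF star_hom_max_embed, symmetric])
  qed (use x in \<open>auto simp: iz K0 C.involution_add C.involution_smult
    intro: C.conv_involution\<close>)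
 qed
qed

text \<open>The representation extends to the completion as a linear contraction, which vanishes on
  \<open>K\<close> since it does so on generators. Hence x and x - k have the same image for every k
  in \<open>K\<close>, and the infimum over k bounds it.\<close>

lemma rep_le_quotient_norm:
 fixes \<psi> :: "'a \<Rightarrow> 'k::chilbert_space \<Rightarrow> 'k"
 assumes S: "S \<subseteq> carrier A" and K: "K = closed_span C (max_embed A ` S)"
  and ideal: "closed_star_ideal C K"
  and \<psi>: "star_hom A bounded_ops \<psi>" and S0: "\<And>r. r \<in> S \<Longrightarrow> \<psi> r = (\<lambda>_. 0)" and x: "x \<in> carrier A"
 shows "onorm (\<psi> x) \<le> alg_norm (quotient_alg C K) (K +>\<^bsub>C\<^esub> max_embed A x)"
proof -
 interpret ideal: closed_star_ideal C K by fact
 let ?B = "normed_ops {T :: 'k \<Rightarrow> 'k. bounded_clinear T}"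
 note e = star_hom_closed[OF star_hom_max_embed]
 have l: "linear_map A ?B \<psi>" using star_hom_linear[OF \<psi>] by (simp add: linear_map_normed_ops_iff)
 have le: "alg_norm ?B (\<psi> y) \<le> nrm (max_embed A y)" if "y \<in> carrier A" for y
  using rep_le_max_norm[OF \<psi> that] by (simp add: norm_max_embed[OF that])
 obtain \<Psi> where \<Psi>: "linear_map C ?B \<Psi>" "\<And>a. a \<in> carrier C \<Longrightarrow> alg_norm ?B (\<Psi> a) \<le> nrm a"
  "\<And>y. y \<in> carrier A \<Longrightarrow> \<Psi> (max_embed A y) = \<psi> y"
  by (rule extension_by_continuity[OF C.normed_star_axioms all_ops.banach_star_axioms star_space_axioms
     star_hom_linear[OF star_hom_max_embed] l dense_max_embed le], assumption, rule that)
 have z: "closed_subspace ?B {\<lambda>_. 0}"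
 proof (rule all_ops.closed_subspaceI)
  fix s a assume s: "all_ops.conv s a" "\<And>n. s n \<in> {\<lambda>_. 0 :: 'k}"
  then have "s = (\<lambda>_ _. 0)" by auto
  then show "a \<in> {\<lambda>_. 0}"
   using all_ops.conv_unique[OF s(1)] all_ops.conv_const[of "\<lambda>_. 0"] by (simp add: clinear_const_0)
 qed (simp_all add: clinear_const_0)
 have K0: "\<Psi> k \<in> {\<lambda>_. 0}" if k: "k \<in> K" for k
 proof (rule closed_span_image[where k = "\<lambda>c. c", OF C.normed_star_axioms all_ops.normed_star_axioms _ z _ _ _ _ _ k[unfolded K]])
  show "max_embed A ` S \<subseteq> carrier C" using S e by blast
  show "\<Psi> \<zero>\<^bsub>C\<^esub> \<in> {\<lambda>_. 0}"
   using linear_map_zero[OF C.star_space_axioms all_ops.star_space_axioms \<Psi>(1)] by simp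
  show "all_ops.conv (\<lambda>n. \<Psi> (s n)) (\<Psi> a)" if "C.conv s a" for s a
   by (rule contraction_conv[OF C.normed_star_axioms all_ops.normed_star_axioms \<Psi>(1,2) that])
  show "\<Psi> r \<in> {\<lambda>_. 0}" if "r \<in> max_embed A ` S" for r using that S \<Psi>(3) S0 by auto
 qed (use linear_map_add[OF \<Psi>(1)] linear_map_smult[OF \<Psi>(1)] in blast)+
 show ?thesis
 proof (rule ideal.quotient_norm_geI[OF e[OF x]])
  fix k assume k: "k \<in> K"
  have b: "bounded_clinear (\<psi> x)" by (rule rep_facts(1)[OF \<psi> x])
  have "\<Psi> (max_embed A x \<ominus>\<^bsub>C\<^esub> k) = \<psi> x \<ominus>\<^bsub>?B\<^esub> (\<lambda>_. 0)"
   using linear_map_minus[OF C.star_space_axioms all_ops.star_space_axioms \<Psi>(1) e[OF x] ideal.I_sub[OF k]]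
    K0[OF k] \<Psi>(3)[OF x] by simp
  also have "\<dots> = \<psi> x" using b by (simp add: all_ops.minus_ops clinear_const_0)
  finally show "onorm (\<psi> x) \<le> nrm (max_embed A x \<ominus>\<^bsub>C\<^esub> k)"
   using \<Psi>(2)[OF C.diff_closed[OF e[OF x] ideal.I_sub[OF k]]] by simp
 qed
qed

end

section \<open>The maximal norm on algebraic Roe algebras\<close>

lemma onorm_diff_le_limit:
 assumes "bounded_clinear S" "bounded_clinear T" 
 shows "onorm (matrix_entry (\<lambda>f. S f - T f) x y) \<le> onorm (\<lambda>f. S f - T f)"
 by (rule onorm_bound[OF onorm_nonneg norm_matrix_entry_le]) (intro clinear_minus assms)+

section \<open>Matrix units with operator coefficients and rank one operators\<close>

definition single_op :: "'x \<Rightarrow> 'x \<Rightarrow> ('h \<Rightarrow> 'h) \<Rightarrow> ('x, 'h::chilbert_space) ell2 \<Rightarrow> ('x, 'h) ell2" where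
 "single_op x y t f = ell2_single x (t (Rep_ell2 f y))"

lemma clinear_single_op: "bounded_clinear t \<Longrightarrow> bounded_clinear (single_op x y t)"
 unfolding single_op_def[abs_def]
 by (rule bounded_clinear_compose[OF clinear_ell2_single bounded_clinear_compose[OF _ clinear_Rep_ell2]])

lemma matrix_entry_single_op:
 "bounded_clinear t \<Longrightarrow> matrix_entry (single_op x y t) a b = (if a = x \<and> b = y then t else (\<lambda>_. 0))"
 by (auto simp: matrix_entry_def single_op_def Rep_ell2_single clinear_zero)

lemma onorm_single_op_le:
 assumes t: "bounded_clinear t"
 shows "onorm (single_op x y t) \<le> onorm t"
proof (rule onorm_bound[OF onorm_nonneg[OF t]])
 fix f
 have "norm (t (Rep_ell2 f y)) \<le> onorm t * norm (Rep_ell2 f y)" by (rule norm_le_onorm[OF t])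
 also have "\<dots> \<le> onorm t * norm f" by (intro mult_left_mono norm_Rep_ell2_le onorm_nonneg t)
 finally show "norm (single_op x y t f) \<le> onorm t * norm f" by (simp add: single_op_def)
qed

definition finsupp :: "'x set \<Rightarrow> ('x, 'h::chilbert_space) ell2 \<Rightarrow> bool" where
 "finsupp X f \<longleftrightarrow> (\<exists>F\<subseteq>X. finite F \<and> (\<forall>x. x \<notin> F \<longrightarrow> Rep_ell2 f x = 0))"

lemma finsupp_single: "x \<in> X \<Longrightarrow> finsupp X (ell2_single x v)"
 unfolding finsupp_def by (rule exI[of _ "{x}"]) (simp add: Rep_ell2_single)

lemma finsupp_sum:
 assumes "finite F" "\<And>x. x \<notin> F \<Longrightarrow> Rep_ell2 f x = 0"
 shows "f = (\<Sum>x\<in>F. ell2_single x (Rep_ell2 f x))"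
proof (rule ell2_eqI)
 fix y
 have "Rep_ell2 (\<Sum>x\<in>F. ell2_single x (Rep_ell2 f x)) y = (\<Sum>x\<in>F. if x = y then Rep_ell2 f y else 0)"
  unfolding Rep_ell2_sum by (intro sum.cong) (auto simp: Rep_ell2_single)
 then show "Rep_ell2 f y = Rep_ell2 (\<Sum>x\<in>F. ell2_single x (Rep_ell2 f x)) y" using assms by auto
qed

text \<open>General vectors are allowed because composing a \<open>rank_one\<close> with an operator
  of finite propagation spreads its vector over several coordinates.\<close>

definition rank_op :: "('x, 'h::chilbert_space) ell2 \<Rightarrow> ('x, 'h) ell2 \<Rightarrow> ('x, 'h) ell2_op" where
 "rank_op \<xi> \<zeta> = (\<lambda>f. cinner \<zeta> f *\<^sub>C \<xi>)"

lemma rank_one_eq: "rank_one x v y w = rank_op (ell2_single x v) (ell2_single y w)"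
 by (simp add: rank_one_def rank_op_def)

lemma clinear_rank_op: "bounded_clinear (rank_op \<xi> \<zeta>)"
 unfolding rank_op_def by (rule compact_operatorD[OF compact_operator_rank_one])

lemma rank_op_comp_left: "bounded_clinear T \<Longrightarrow> T \<circ> rank_op \<xi> \<zeta> = rank_op (T \<xi>) \<zeta>"
 by (auto simp: rank_op_def clinear_scaleC)

lemma rank_op_comp_right: "bounded_clinear T \<Longrightarrow> rank_op \<xi> \<zeta> \<circ> T = rank_op \<xi> (cadjoint T \<zeta>)"
 by (auto simp: rank_op_def cinner_cadjoint)

lemma cadjoint_rank_op: "cadjoint (rank_op \<xi> \<zeta>) = rank_op \<zeta> \<xi>"
proof (rule cadjoint_eqI)
 fix v w
 have "cinner (rank_op \<zeta> \<xi> v) w = cnj (cinner \<xi> v) * cinner \<zeta> w" by (simp add: rank_op_def cinner_scaleC_left)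
 also have "cnj (cinner \<xi> v) = cinner v \<xi>" by (rule cinner_commute[symmetric])
 finally show "cinner (rank_op \<zeta> \<xi> v) w = cinner v (rank_op \<xi> \<zeta> w)"
  by (simp add: rank_op_def cinner_scaleC_right mult.commute)
qed

lemma rank_op_comp: "rank_op \<xi> \<zeta> \<circ> rank_op \<xi>' \<zeta>' = (\<lambda>f. cinner \<zeta> \<xi>' *\<^sub>C rank_op \<xi> \<zeta>' f)"
 by (auto simp: rank_op_def cinner_scaleC_right scaleC_scaleC mult.commute)

lemma rank_op_diff_right: "(\<lambda>f. rank_op \<xi> \<zeta> f - rank_op \<xi> \<zeta>' f) = rank_op \<xi> (\<zeta> - \<zeta>')"
 by (simp add: rank_op_def cinner_diff_left cvs.scale_left_diff_distrib)

lemma matrix_entry_rank_op: "matrix_entry (rank_op \<xi> \<zeta>) x y = (\<lambda>v. cinner (Rep_ell2 \<zeta> y) v *\<^sub>C Rep_ell2 \<xi> x)"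
proof
 fix v
 have "cinner \<zeta> (ell2_single y v) = cnj (cinner (ell2_single y v) \<zeta>)" by (rule cinner_commute)
 also have "\<dots> = cnj (cinner v (Rep_ell2 \<zeta> y))" by (simp add: cinner_ell2_single)
 also have "\<dots> = cinner (Rep_ell2 \<zeta> y) v" by (rule cinner_commute[symmetric])
 finally show "matrix_entry (rank_op \<xi> \<zeta>) x y v = cinner (Rep_ell2 \<zeta> y) v *\<^sub>C Rep_ell2 \<xi> x"
  by (simp add: matrix_entry_def rank_op_def scaleC_ell2.rep_eq)
qed

locale roe_space = bounded_geometry_space X d for X :: "'x set" and d +
 fixes h :: "'h::chilbert_space itself"
begin

abbreviation A :: "('x, 'h) ell2_op star_alg" where "A \<equiv> roe_alg X d"

lemma operator_algebra_roe: "operator_algebra (carrier A)"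
 by unfold_locales
  (auto intro: roe_bounded roe_zero_closed roe_add_closed roe_scale_closed
   roe_mult_closed roe_cadjoint_closed)

lemma star_ring_space_roe: "star_ring_space A"
 by (rule operator_algebra.star_ring_space_ops[OF operator_algebra_roe]) simp_all

interpretation roe: star_ring_space A by (rule star_ring_space_roe)

lemma roe_minus: "S \<in> carrier A \<Longrightarrow> T \<in> carrier A \<Longrightarrow> S \<ominus>\<^bsub>A\<^esub> T = (\<lambda>f. S f - T f)"
 by (simp add: roe.minus_eq_smult)

text \<open>C[X] is in general not norm closed in the bounded operators, but its block diagonal part
  is. It is thus a Banach star algebra on which \<open>rep_contractive\<close> applies with the
  operator norm.\<close>

definition Diag :: "('x, 'h) ell2_op set" where
 "Diag = {T \<in> carrier A. \<forall>x y. x \<noteq> y \<longrightarrow> matrix_entry T x y = (\<lambda>_. 0)}"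

lemma operator_algebra_Diag: "operator_algebra Diag"
proof unfold_locales
 fix S T :: "('x, 'h) ell2_op" and c
 assume T: "T \<in> Diag"
 then have Tb: "bounded_clinear T" and TA: "T \<in> carrier A" by (auto simp: Diag_def roe_bounded)
 show "bounded_clinear T" by (rule Tb)
 show "(\<lambda>v. c *\<^sub>C T v) \<in> Diag" using T by (auto simp: Diag_def matrix_entry_cmult roe_scale_closed)
 show "cadjoint T \<in> Diag"
  using T by (auto simp: Diag_def matrix_entry_cadjoint[OF Tb] roe_cadjoint_closed cadjoint_zero)
 assume S: "S \<in> Diag"
 show "(\<lambda>v. S v + T v) \<in> Diag" using S T by (auto simp: Diag_def matrix_entry_plus roe_add_closed)
 have Sb: "bounded_clinear S" using S by (auto simp: Diag_def roe_bounded)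
 have "matrix_entry (S \<circ> T) x y = (\<lambda>_. 0)" if "x \<noteq> y" for x y
 proof -
  have "matrix_entry (S \<circ> T) x y = (\<lambda>v. \<Sum>k\<in>{y}. matrix_entry S x k (matrix_entry T k y v))"
   by (rule matrix_entry_comp[OF Sb]) (use T in \<open>auto simp: Diag_def\<close>)
  then show ?thesis using S that by (simp add: Diag_def)
 qed
 then show "S \<circ> T \<in> Diag" using S T by (simp add: Diag_def roe_mult_closed)
next
 show "(\<lambda>_. 0) \<in> Diag" by (simp add: Diag_def roe_zero_closed)
qed

lemma banach_star_Diag: "banach_star (normed_ops Diag)"
proof (rule operator_algebra.banach_star_ops[OF operator_algebra_Diag])
 fix T S assume T: "\<And>n. T n \<in> Diag" and S: "bounded_clinear S"
  and lim: "(\<lambda>n. onorm (\<lambda>v. T n v - S v)) \<longlonglongrightarrow> 0" and pt: "\<And>v. (\<lambda>n. T n v) \<longlonglongrightarrow> S v"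
 have Tb: "bounded_clinear (T n)" for n using T[of n] by (auto simp: Diag_def roe_bounded)
 have z: "matrix_entry S x y = (\<lambda>_. 0)" if "\<And>n. matrix_entry (T n) x y = (\<lambda>_. 0)" for x y
 proof
  fix v
  have "(\<lambda>n. matrix_entry (T n) x y v) \<longlonglongrightarrow> matrix_entry S x y v"
   unfolding matrix_entry_def
   by (rule bounded_linear.tendsto[OF bounded_clinearD[OF clinear_Rep_ell2] pt])
  then show "matrix_entry S x y v = 0" using that LIMSEQ_unique[OF _ tendsto_const] by simp
 qed
 have zd: "matrix_entry S x y = (\<lambda>_. 0)" if "x \<noteq> y \<or> x \<notin> X \<or> y \<notin> X" for x y
  by (rule z) (use T that in \<open>auto simp: Diag_def carrier_roe_alg\<close>)
 have "compact_operator (matrix_entry S x y)" for x y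
 proof (rule compact_operator_limit[OF clinear_matrix_entry[OF S]])
  fix e :: real assume "e > 0"
  then obtain N where N: "norm (onorm (\<lambda>v. T N v - S v) - 0) < e" using LIMSEQ_D[OF lim] by blast
  have "onorm (\<lambda>v. matrix_entry S x y v - matrix_entry (T N) x y v) \<le> onorm (\<lambda>f. S f - T N f)"
   using onorm_diff_le_limit[OF S Tb[of N]] by (simp add: matrix_entry_minus)
  also have "\<dots> < e" using N onorm_nonneg[OF clinear_minus[OF Tb[of N] S]]
   by (simp add: onorm_diff_commute[of S])
  finally show "\<exists>R. compact_operator R \<and> onorm (\<lambda>v. matrix_entry S x y v - R v) < e"
   using T[of N] by (intro exI[of _ "matrix_entry (T N) x y"]) (simp add: Diag_def carrier_roe_alg)
 qed
 \<comment> \<open>Distance zero separates the diagonal from the rest, so any positive number, here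
   1, witnesses finite propagation.\<close>
 moreover have "x \<noteq> y" if "x \<in> X" "y \<in> X" "1 \<le> d x y" for x y using that by auto
 ultimately have "S \<in> carrier A"
  unfolding carrier_roe_alg using S zd by (auto intro!: exI[of _ 1])
 then show "S \<in> Diag" using zd by (simp add: Diag_def)
qed

text \<open>The image of \<open>cadjoint V \<circ> V\<close> is bounded through the block diagonal
  algebra, and the C*-identity for \<open>\<psi> V\<close> takes the square root.\<close>

lemma matching_contractive:
 fixes \<psi> :: "('x, 'h) ell2_op \<Rightarrow> 'k::chilbert_space \<Rightarrow> 'k"
 assumes \<psi>: "star_hom A bounded_ops \<psi>" and V: "V \<in> carrier A" "matching V"
 shows "onorm (\<psi> V) \<le> onorm V"
proof -
 interpret Diag: banach_star "normed_ops Diag" by (rule banach_star_Diag)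
 have Vb: "bounded_clinear V" by (rule roe_bounded[OF V(1)])
 note f = rep_facts[OF \<psi>]
 have VV: "cadjoint V \<circ> V \<in> Diag"
  using V by (simp add: Diag_def roe_mult_closed roe_cadjoint_closed matching_cadjoint_comp_diagonal[OF Vb])
 have "star_hom (normed_ops Diag) bounded_ops \<psi>"
  using \<psi> by (auto simp: star_hom_def Diag_def)
 then have "onorm (\<psi> (cadjoint V \<circ> V)) \<le> onorm (cadjoint V \<circ> V)"
  using Diag.rep_contractive[of \<psi>] VV by simp
 also have "\<dots> \<le> onorm (cadjoint V) * onorm V"
  by (intro onorm_compose bounded_clinearD bounded_clinear_cadjoint Vb)
 also have "\<dots> = (onorm V)\<^sup>2" by (simp add: onorm_cadjoint[OF Vb] power2_eq_square)
 finally have "onorm (\<psi> (cadjoint V \<circ> V)) \<le> (onorm V)\<^sup>2" .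
 moreover have "\<psi> (cadjoint V \<circ> V) = cadjoint (\<psi> V) \<circ> \<psi> V"
  using f(5)[of "cadjoint V" V] f(2)[OF V(1)] V(1) by (simp add: roe_cadjoint_closed)
 ultimately have "(onorm (\<psi> V))\<^sup>2 \<le> (onorm V)\<^sup>2" using onorm_le_sqrt[OF f(1)[OF V(1)]] by simp
 then show ?thesis by (rule power2_le_imp_le) (rule onorm_nonneg[OF Vb])
qed

lemma rep_sum:
 assumes \<psi>: "star_hom A bounded_ops \<psi>" and T: "finite I" "\<And>i. i \<in> I \<Longrightarrow> T i \<in> carrier A"
 shows "\<psi> (\<lambda>v. \<Sum>i\<in>I. T i v) = (\<lambda>v. \<Sum>i\<in>I. \<psi> (T i) v)"
 using T
proof (induction I rule: finite_induct)
 case empty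
 then show ?case
  using linear_map_zero[OF roe.star_space_axioms bounded_ops.star_space_axioms star_hom_linear[OF \<psi>]] by simp
next
 case (insert i I)
 have Ti: "T i \<in> carrier A" and s: "(\<lambda>v. \<Sum>i\<in>I. T i v) \<in> carrier A"
  using insert.prems by (simp_all add: roe_sum_closed)
 have IH: "\<psi> (\<lambda>v. \<Sum>i\<in>I. T i v) = (\<lambda>v. \<Sum>i\<in>I. \<psi> (T i) v)"
  by (rule insert.IH) (use insert.prems in simp)
 show ?case using rep_facts(4)[OF \<psi> Ti s] by (simp only: sum.insert[OF insert.hyps] roe_alg_simps IH)
qed

text \<open>The decomposition into matching operators depends on \<open>T\<close> alone, so the sum
  of their operator norms bounds \<open>T\<close> in all representations simultaneously.\<close>

lemma star_bdd_roe: "star_bdd A"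
proof (rule star_bddI)
 show "star_space A" by (rule roe.star_space_axioms)
 fix T assume T: "T \<in> carrier A"
 obtain I :: "(nat \<times> nat) set" and V where IV: "finite I" "\<And>i. V i \<in> carrier A" "\<And>i. matching (V i)"
  "T = (\<lambda>v. \<Sum>i\<in>I. V i v)" using roe_alg_matching_sum[OF T] by metis
 have "onorm (\<psi> T) \<le> (\<Sum>i\<in>I. onorm (V i))"
  if \<psi>: "star_hom A (bounded_ops :: ((('x, 'h) ell2_op, complex) ell2 \<Rightarrow> _) star_alg) \<psi>" for \<psi>
  unfolding IV(4) rep_sum[OF \<psi> IV(1,2)]
  by (rule onorm_sum_le[OF IV(1)])
   (auto intro!: sum_mono matching_contractive[OF \<psi> IV(2,3)] bounded_clinearD rep_facts(1)[OF \<psi>] IV(2))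
 then show "\<exists>B. \<forall>\<psi>. star_hom A (bounded_ops :: ((('x, 'h) ell2_op, complex) ell2 \<Rightarrow> _) star_alg) \<psi>
   \<longrightarrow> onorm (\<psi> T) \<le> B" by blast
qed

sublocale roe: star_bdd A by (rule star_bdd_roe)

lemma max_norm_matching_le:
 assumes "V \<in> carrier A" "matching V"
 shows "max_norm A V \<le> onorm V"
 by (rule roe.max_norm_leI) (rule matching_contractive[OF _ assms])

lemma finite_entries_in_roe:
 fixes T :: "('x, 'h) ell2_op"
 assumes T: "bounded_clinear T" and F: "finite F" "F \<subseteq> X \<times> X"
  and z: "\<And>x y. (x, y) \<notin> F \<Longrightarrow> matrix_entry T x y = (\<lambda>_. 0)"
  and c: "\<And>x y. compact_operator (matrix_entry T x y)"
 shows "T \<in> carrier A"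
 unfolding carrier_roe_alg
proof (intro conjI allI impI T c)
 show "matrix_entry T x y = (\<lambda>_. 0)" if "x \<notin> X \<or> y \<notin> X" for x y using that F(2) by (intro z) blast
 \<comment> \<open>The sum dominates every distance occurring in \<open>F\<close>; adding 1 makes
   the inequality strict and \<open>R\<close> positive even for empty \<open>F\<close>.\<close>
 define R where "R = (\<Sum>p\<in>F. d (fst p) (snd p)) + 1"
 have "d x y < R" if "(x, y) \<in> F" for x y
  using member_le_sum[OF that, of "\<lambda>p. d (fst p) (snd p)"] F(1) by (simp add: R_def)
 moreover have "R > 0" unfolding R_def by (rule add_nonneg_pos) (auto intro: sum_nonneg)
 ultimately show "\<exists>R>0. \<forall>x\<in>X. \<forall>y\<in>X. R \<le> d x y \<longrightarrow> matrix_entry T x y = (\<lambda>_. 0)"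
  by (intro exI[of _ R]) (meson not_le z)
qed

lemma single_op_in_roe:
 assumes "compact_operator t" "x \<in> X" "y \<in> X"
 shows "single_op x y t \<in> carrier A"
 using compact_operatorD[OF assms(1)] assms
 by (intro finite_entries_in_roe[of _ "{(x, y)}"])
  (auto simp: clinear_single_op matrix_entry_single_op compact_operator_zero)

lemma max_norm_single_op_le:
 assumes "compact_operator t" "x \<in> X" "y \<in> X"
 shows "max_norm A (single_op x y t) \<le> onorm t"
proof -
 have t: "bounded_clinear t" by (rule compact_operatorD[OF assms(1)])
 have "matching (single_op x y t)" by (simp add: matching_def matrix_entry_single_op[OF t])
 from max_norm_matching_le[OF single_op_in_roe[OF assms] this] onorm_single_op_le[OF t, of x y]
 show ?thesis by simp
qed

lemma rank_op_in_roe: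
 assumes "finsupp X \<xi>" "finsupp X \<zeta>"
 shows "rank_op \<xi> \<zeta> \<in> carrier A"
proof -
 obtain F where F: "F \<subseteq> X" "finite F" "\<And>x. x \<notin> F \<Longrightarrow> Rep_ell2 \<xi> x = 0" using assms(1) by (auto simp: finsupp_def)
 obtain E where E: "E \<subseteq> X" "finite E" "\<And>x. x \<notin> E \<Longrightarrow> Rep_ell2 \<zeta> x = 0" using assms(2) by (auto simp: finsupp_def)
 show ?thesis
 proof (rule finite_entries_in_roe[OF clinear_rank_op, of "F \<times> E"])
  fix x y
  show "matrix_entry (rank_op \<xi> \<zeta>) x y = (\<lambda>_. 0)" if "(x, y) \<notin> F \<times> E"
   using that F(3)[of x] E(3)[of y] by (auto simp: matrix_entry_rank_op)
  show "compact_operator (matrix_entry (rank_op \<xi> \<zeta>) x y)"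
   unfolding matrix_entry_rank_op by (rule compact_operator_rank_one)
 qed (use F E in auto)
qed

lemma finsupp_apply:
 fixes T :: "('x, 'h) ell2_op"
 assumes T: "T \<in> carrier A" and \<xi>: "finsupp X \<xi>"
 shows "finsupp X (T \<xi>)"
proof -
 obtain F where F: "F \<subseteq> X" "finite F" "\<And>x. x \<notin> F \<Longrightarrow> Rep_ell2 \<xi> x = 0" using \<xi> by (auto simp: finsupp_def)
 have "\<exists>E. finite E \<and> E \<subseteq> X \<and> (\<forall>y. y \<notin> E \<longrightarrow> matrix_entry T y z = (\<lambda>_. 0))" for z
  by (rule roe_alg_columns[OF T, of z]) blast
 then obtain E where E: "\<And>z. finite (E z)" "\<And>z. E z \<subseteq> X" "\<And>y z. y \<notin> E z \<Longrightarrow> matrix_entry T y z = (\<lambda>_. 0)" by metis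
 have "T \<xi> = T (\<Sum>x\<in>F. ell2_single x (Rep_ell2 \<xi> x))" using finsupp_sum[OF F(2,3)] by simp
 also have "\<dots> = (\<Sum>x\<in>F. T (ell2_single x (Rep_ell2 \<xi> x)))"
  by (rule clinear_sum[OF roe_bounded[OF T]])
 finally have "Rep_ell2 (T \<xi>) y = (\<Sum>x\<in>F. matrix_entry T y x (Rep_ell2 \<xi> x))" for y
  by (simp add: Rep_ell2_sum matrix_entry_def)
 moreover have "matrix_entry T y x (Rep_ell2 \<xi> x) = 0" if "y \<notin> (\<Union>x\<in>F. E x)" "x \<in> F" for x y
  using E(3)[of y x] that by auto
 ultimately show ?thesis
  unfolding finsupp_def using F(2) E by (intro exI[of _ "\<Union>x\<in>F. E x"]) (auto intro!: sum.neutral)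
qed

text \<open>These operators need not be matching. Instead, the norm s of the image of
  \<open>rank_op \<zeta> \<zeta>\<close> satisfies s^2 \<le> (norm \<zeta>)^2 s, which forces s
  \<le> (norm \<zeta>)^2; the general case reduces to this one through
  \<open>onorm_le_sqrt\<close>.\<close>

lemma max_norm_rank_op_le:
 assumes fs: "finsupp X (\<xi> :: ('x, 'h) ell2)" "finsupp X \<zeta>"
 shows "max_norm A (rank_op \<xi> \<zeta>) \<le> norm \<xi> * norm \<zeta>"
proof (rule roe.max_norm_leI)
 fix \<psi> :: "('x, 'h) ell2_op \<Rightarrow> (('x, 'h) ell2_op, complex) ell2 \<Rightarrow> _"
 assume \<psi>: "star_hom A bounded_ops \<psi>"
 note f = rep_facts[OF \<psi>]
 have sq: "(onorm (\<psi> (rank_op \<xi> \<zeta>)))\<^sup>2 \<le> (norm \<xi>)\<^sup>2 * onorm (\<psi> (rank_op \<zeta> \<zeta>))"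
  if fs: "finsupp X \<xi>" "finsupp X \<zeta>" for \<xi> \<zeta> :: "('x, 'h) ell2"
 proof -
  note R = rank_op_in_roe[OF fs] rank_op_in_roe[OF fs(2,1)] rank_op_in_roe[OF fs(2,2)]
  have "cadjoint (\<psi> (rank_op \<xi> \<zeta>)) \<circ> \<psi> (rank_op \<xi> \<zeta>) = \<psi> (rank_op \<zeta> \<xi> \<circ> rank_op \<xi> \<zeta>)"
   using f(2)[OF R(1)] f(5)[OF R(2) R(1)] by (simp add: cadjoint_rank_op)
  also have "rank_op \<zeta> \<xi> \<circ> rank_op \<xi> \<zeta> = (\<lambda>f. complex_of_real ((norm \<xi>)\<^sup>2) *\<^sub>C rank_op \<zeta> \<zeta> f)"
   by (simp add: rank_op_comp cinner_self)
  also have "\<psi> \<dots> = (\<lambda>f. complex_of_real ((norm \<xi>)\<^sup>2) *\<^sub>C \<psi> (rank_op \<zeta> \<zeta>) f)"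
   using f(3)[OF R(3)] by simp
  finally have "onorm (cadjoint (\<psi> (rank_op \<xi> \<zeta>)) \<circ> \<psi> (rank_op \<xi> \<zeta>)) = (norm \<xi>)\<^sup>2 * onorm (\<psi> (rank_op \<zeta> \<zeta>))"
   by (simp only: onorm_scaleC[OF f(1)[OF R(3)]]) (simp add: norm_power)
  then show ?thesis using onorm_le_sqrt[OF f(1)[OF R(1)]] by simp
 qed
 have nn: "0 \<le> onorm (\<psi> (rank_op \<zeta> \<zeta>))" by (rule onorm_nonneg[OF f(1)[OF rank_op_in_roe[OF fs(2,2)]]])
 have "onorm (\<psi> (rank_op \<zeta> \<zeta>)) \<le> (norm \<zeta>)\<^sup>2"
  using sq[OF fs(2,2)] nn by (cases "onorm (\<psi> (rank_op \<zeta> \<zeta>)) = 0") (auto simp: power2_eq_square)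
 then have "(norm \<xi>)\<^sup>2 * onorm (\<psi> (rank_op \<zeta> \<zeta>)) \<le> (norm \<xi> * norm \<zeta>)\<^sup>2"
  by (simp add: power_mult_distrib mult_left_mono)
 then have "(onorm (\<psi> (rank_op \<xi> \<zeta>)))\<^sup>2 \<le> (norm \<xi> * norm \<zeta>)\<^sup>2" using sq[OF fs] by linarith
 then show "onorm (\<psi> (rank_op \<xi> \<zeta>)) \<le> norm \<xi> * norm \<zeta>" by (rule power2_le_imp_le) simp
qed

section \<open>The compact ideal\<close>

definition ranks :: "('x, 'h) ell2_op set" where
 "ranks = {rank_one x v y w | x v y w. x \<in> X \<and> y \<in> X}"

abbreviation K :: "('x, 'h) max_roe set" where "K \<equiv> compact_ideal X d"

lemma K_eq: "K = closed_span roe.C (max_embed A ` ranks)"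
proof -
 have "{max_embed A (rank_one x v y w) | x v y w. x \<in> X \<and> y \<in> X} = max_embed A ` ranks"
  unfolding ranks_def by blast
 then show ?thesis by (simp add: compact_ideal_def max_roe_alg_def)
qed

lemma ranks_in_roe: "ranks \<subseteq> carrier A"
 by (auto simp: ranks_def rank_one_eq intro!: rank_op_in_roe finsupp_single)

lemma closed_subspace_K: "closed_subspace roe.C K"
proof -
 interpret C: banach_star roe.C by (rule roe.banach_star_completion)
 show ?thesis unfolding K_eq
  by (rule C.closed_subspace_closed_span) (use ranks_in_roe star_hom_closed[OF roe.star_hom_max_embed] in blast)
qed

lemma embed_sum_in_K:
 fixes T :: "'i \<Rightarrow> ('x, 'h) ell2_op"
 assumes "finite I" "\<And>i. i \<in> I \<Longrightarrow> T i \<in> carrier A" "\<And>i. i \<in> I \<Longrightarrow> max_embed A (T i) \<in> K"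
 shows "max_embed A (\<lambda>f. \<Sum>i\<in>I. T i f) \<in> K"
 using assms
proof (induction I rule: finite_induct)
 case empty
 have "max_embed A \<zero>\<^bsub>A\<^esub> = \<zero>\<^bsub>roe.C\<^esub>"
  using roe.completion_ops(5)[OF roe.CS_const[OF roe_zero_closed]] by (simp add: roe.max_embed_eq)
 then show ?case using closed_subspace_K by (simp add: closed_subspace_def)
next
 case (insert i I)
 have "max_embed A (T i \<oplus>\<^bsub>A\<^esub> (\<lambda>f. \<Sum>i\<in>I. T i f)) = max_embed A (T i) \<oplus>\<^bsub>roe.C\<^esub> max_embed A (\<lambda>f. \<Sum>i\<in>I. T i f)"
  by (rule linear_map_add[OF star_hom_linear[OF roe.star_hom_max_embed]])
   (use insert in \<open>auto intro!: roe_sum_closed\<close>)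
 then show ?case using insert closed_subspace_K by (simp add: closed_subspace_def)
qed

text \<open>Expanding both vectors over their finite supports gives a finite sum of generators of
  \<open>K\<close>.\<close>

lemma embed_rank_op_in_K:
 assumes fs: "finsupp X (\<xi> :: ('x, 'h) ell2)" "finsupp X \<zeta>"
 shows "max_embed A (rank_op \<xi> \<zeta>) \<in> K"
proof -
 obtain F where F: "F \<subseteq> X" "finite F" "\<And>x. x \<notin> F \<Longrightarrow> Rep_ell2 \<xi> x = 0" using fs(1) by (auto simp: finsupp_def)
 obtain E where E: "E \<subseteq> X" "finite E" "\<And>x. x \<notin> E \<Longrightarrow> Rep_ell2 \<zeta> x = 0" using fs(2) by (auto simp: finsupp_def)
 define T where "T q = rank_one (fst q) (Rep_ell2 \<xi> (fst q)) (snd q) (Rep_ell2 \<zeta> (snd q))" for q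
 have Tr: "T q \<in> ranks" if "q \<in> F \<times> E" for q
 proof -
  have "fst q \<in> X" "snd q \<in> X" using that F(1) E(1) by auto
  then show ?thesis unfolding T_def ranks_def by blast
 qed
 have "rank_op \<xi> \<zeta> = (\<lambda>f. \<Sum>q\<in>F \<times> E. T q f)"
 proof
  fix f
  have "rank_op \<xi> \<zeta> f = cinner (\<Sum>y\<in>E. ell2_single y (Rep_ell2 \<zeta> y)) f *\<^sub>C (\<Sum>x\<in>F. ell2_single x (Rep_ell2 \<xi> x))"
   using finsupp_sum[OF F(2,3)] finsupp_sum[OF E(2,3)] by (simp add: rank_op_def)
  also have "\<dots> = (\<Sum>x\<in>F. \<Sum>y\<in>E. T (x, y) f)"
   by (simp add: cinner_sum_left cvs.scale_sum_right cvs.scale_sum_left T_def rank_one_def)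
  also have "\<dots> = (\<Sum>q\<in>F \<times> E. T q f)" by (simp add: sum.cartesian_product)
  finally show "rank_op \<xi> \<zeta> f = (\<Sum>q\<in>F \<times> E. T q f)" .
 qed
 moreover have "max_embed A (\<lambda>f. \<Sum>q\<in>F \<times> E. T q f) \<in> K"
 proof (rule embed_sum_in_K)
  show "T q \<in> carrier A" if "q \<in> F \<times> E" for q using Tr[OF that] ranks_in_roe by blast
  interpret C: banach_star roe.C by (rule roe.banach_star_completion)
  show "max_embed A (T q) \<in> K" if "q \<in> F \<times> E" for q
   unfolding K_eq by (rule subsetD[OF C.closed_span_superset imageI[OF Tr[OF that]]])
 qed (use F E in simp)
 ultimately show ?thesis by simp
qed

text \<open>Composition with \<open>T\<close> moves one vector of a rank one operator by
  \<open>T\<close> or its adjoint, and finite columns keep that vector finitely supported.\<close>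

lemma closed_star_ideal_K: "closed_star_ideal roe.C K"
proof (rule roe.closed_star_ideal_closed_span[OF ranks_in_roe K_eq])
 fix r assume "r \<in> ranks"
 then obtain \<xi> \<zeta> where r: "r = rank_op \<xi> \<zeta>" and fs: "finsupp X \<xi>" "finsupp X \<zeta>"
  by (auto simp: ranks_def rank_one_eq intro: finsupp_single)
 show "max_embed A (involution A r) \<in> K"
  using embed_rank_op_in_K[OF fs(2,1)] by (simp add: r cadjoint_rank_op)
 fix T assume T: "T \<in> carrier A"
 have Tb: "bounded_clinear T" by (rule roe_bounded[OF T])
 show "max_embed A (T \<otimes>\<^bsub>A\<^esub> r) \<in> K"
  using embed_rank_op_in_K[OF finsupp_apply[OF T fs(1)] fs(2)] by (simp add: r rank_op_comp_left[OF Tb])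
 show "max_embed A (r \<otimes>\<^bsub>A\<^esub> T) \<in> K"
  using embed_rank_op_in_K[OF fs(1) finsupp_apply[OF roe_cadjoint_closed[OF T] fs(2)]]
  by (simp add: r rank_op_comp_right[OF Tb])
qed

sublocale ideal: closed_star_ideal roe.C K by (rule closed_star_ideal_K)

abbreviation Q :: "('x, 'h) max_roe set normed_star_alg" where "Q \<equiv> roe_quotient X d"

lemma Q_eq: "Q = quotient_alg roe.C K"
 by (simp add: roe_quotient_def max_roe_alg_def)

sublocale Q: banach_star Q unfolding Q_eq by (rule ideal.banach_star_quotient)

abbreviation cl :: "('x, 'h) ell2_op \<Rightarrow> ('x, 'h) max_roe set" where "cl \<equiv> roe_class X d"

lemma roe_class_eq: "cl T = K +>\<^bsub>roe.C\<^esub> max_embed A T"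
 by (simp add: roe_class_def max_roe_alg_def)

lemma star_hom_roe_class: "star_hom A Q cl"
 unfolding Q_eq roe_class_eq[abs_def]
 using star_hom_comp[OF roe.star_hom_max_embed ideal.star_hom_cos] by (simp add: o_def)

lemma roe_class_zero: "cl (\<lambda>_. 0) = \<zero>\<^bsub>Q\<^esub>"
 using linear_map_zero[OF roe.star_space_axioms Q.star_space_axioms star_hom_linear[OF star_hom_roe_class]] by simp

lemma dense_roe_class: "Q.dense_image cl (carrier A)"
 using ideal.dense_image_quotient[OF roe.dense_max_embed] by (simp add: Q_eq roe_class_eq[abs_def])

lemma roe_class_eq_0_iff:
 assumes "T \<in> carrier A"
 shows "cl T = \<zero>\<^bsub>Q\<^esub> \<longleftrightarrow> max_embed A T \<in> K"
proof -
 have e: "max_embed A T \<in> carrier roe.C" by (rule star_hom_closed[OF roe.star_hom_max_embed assms])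
 show ?thesis
  unfolding Q_eq roe_class_eq ideal.quotient_zero
  using ideal.cos_eq_iff[OF e ideal.zero_in_carrier] e
  by (simp add: ideal.minus_eq_smult ideal.smult_zero_right ideal.zero_in_carrier)
qed

lemma rep_le_norm_roe_class:
 fixes \<psi> :: "('x, 'h) ell2_op \<Rightarrow> 'k::chilbert_space \<Rightarrow> 'k"
 assumes "star_hom A bounded_ops \<psi>" "\<And>r. r \<in> ranks \<Longrightarrow> \<psi> r = (\<lambda>_. 0)" "T \<in> carrier A"
 shows "onorm (\<psi> T) \<le> alg_norm Q (cl T)"
 unfolding Q_eq roe_class_eq
 by (rule roe.rep_le_quotient_norm[OF ranks_in_roe K_eq closed_star_ideal_K assms])

end

section \<open>Approximate units\<close>

text \<open>Distinct orthonormal vectors are at distance at least 1, so choosing a point of a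
  countable dense set within 1/2 of each is injective.\<close>

lemma countable_orthonormal_basis:
 assumes "separable_space (euclidean :: 'h::chilbert_space topology)"
 obtains B :: "'h::chilbert_space set" where "countable B" "\<And>b. b \<in> B \<Longrightarrow> norm b = 1"
  "\<And>b c. b \<in> B \<Longrightarrow> c \<in> B \<Longrightarrow> b \<noteq> c \<Longrightarrow> cinner b c = 0" "closure (cvs.span B) = UNIV"
proof -
 obtain C :: "'h set" where C: "countable C" "closure C = UNIV"
  using assms by (auto simp: separable_space_def)
 obtain B :: "'h set" where Bn: "\<And>b. b \<in> B \<Longrightarrow> norm b = 1"
  and Bo: "\<And>b c. b \<in> B \<Longrightarrow> c \<in> B \<Longrightarrow> b \<noteq> c \<Longrightarrow> cinner b c = 0" and cl: "UNIV = closure (cvs.span B)"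
  using orthonormal_basis_exists[of "UNIV :: 'h set"] cvs.subspace_UNIV closed_UNIV by metis
 have "\<exists>c\<in>C. dist c b < 1/2" for b
 proof -
  have "b \<in> closure C" using C(2) by simp
  then show ?thesis unfolding closure_approachable by (elim allE[of _ "1/2"]) simp
 qed
 then obtain j where j: "\<And>b. j b \<in> C" "\<And>b. dist (j b) b < 1/2" by metis
 have "inj_on j B"
 proof (rule inj_onI, rule ccontr)
  fix b c assume bc: "b \<in> B" "c \<in> B" "j b = j c" "b \<noteq> c"
  have "dist b c < 1"
   by (rule dist_triangle_half_r[of "j b"]) (use j(2)[of b] j(2)[of c] bc(3) in simp_all)
  then have "(norm (b - c))\<^sup>2 < 1" by (simp add: dist_norm power_less_one_iff)
  then show False using Bn[OF bc(1)] Bn[OF bc(2)] Bo[OF bc(1,2,4)] by (simp add: norm_diff_sq)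
 qed
 moreover have "countable (j ` B)" by (rule countable_subset[OF _ C(1)]) (use j(1) in blast)
 ultimately have "countable B" by (rule countable_image_inj_on[rotated])
 with Bn Bo cl show ?thesis using that by simp
qed

lemma finite_to_nat_on_less:
 assumes "countable S"
 shows "finite {s \<in> S. to_nat_on S s < n}"
proof (rule finite_imageD[of "to_nat_on S"])
 show "finite (to_nat_on S ` {s \<in> S. to_nat_on S s < n})" by (rule finite_subset[of _ "{..<n}"]) auto
 show "inj_on (to_nat_on S) {s \<in> S. to_nat_on S s < n}"
  using inj_on_to_nat_on[OF assms] by (rule inj_on_subset) auto
qed

text \<open>\<open>E n\<close> projects onto the span of the first n vectors of an orthonormal
  basis. The vectors on which convergence holds form a subspace containing the basis, and
  contractivity of 1 - E_n carries convergence from its span to the closure.\<close>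

lemma approximating_projections:
 assumes "separable_space (euclidean :: 'h::chilbert_space topology)"
 obtains E :: "nat \<Rightarrow> 'h::chilbert_space \<Rightarrow> 'h" and B :: "nat \<Rightarrow> 'h set"
 where "\<And>n. finite (B n)" "\<And>n v. E n v = (\<Sum>b\<in>B n. cinner b v *\<^sub>C b)"
  "\<And>n. compact_operator (E n)" "\<And>n. cadjoint (E n) = E n" "\<And>n v. E n (E n v) = E n v"
  "\<And>n v. norm (v - E n v) \<le> norm v" "\<And>v. (\<lambda>n. norm (v - E n v)) \<longlonglongrightarrow> 0"
proof -
 obtain B :: "'h set" where B: "countable B" and Bn: "\<And>b. b \<in> B \<Longrightarrow> norm b = 1"
  and Bo: "\<And>b c. b \<in> B \<Longrightarrow> c \<in> B \<Longrightarrow> b \<noteq> c \<Longrightarrow> cinner b c = 0" and cl: "closure (cvs.span B) = UNIV"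
  using countable_orthonormal_basis[OF assms] by metis
 define F where "F n = {b \<in> B. to_nat_on B b < n}" for n
 have fin: "finite (F n)" for n unfolding F_def by (rule finite_to_nat_on_less[OF B])
 have FB: "b \<in> B" if "b \<in> F n" for b n using that by (simp add: F_def)
 define E where "E n v = (\<Sum>b\<in>F n. cinner b v *\<^sub>C b)" for n v
 have co: "compact_operator (E n)" for n
  unfolding E_def[abs_def] by (intro compact_operator_sum compact_operator_rank_one)
 have bc: "bounded_clinear (E n)" for n by (rule compact_operatorD[OF co])
 have adj: "cadjoint (E n) = E n" for n
 proof (rule cadjoint_eqI)
  fix v w
  have "cinner (E n v) w = (\<Sum>b\<in>F n. cnj (cinner b v) * cinner b w)"
   by (simp add: E_def cinner_sum_left cinner_scaleC_left)
  also have "\<dots> = (\<Sum>b\<in>F n. cinner b w * cinner v b)"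
   by (intro sum.cong refl) (subst cinner_commute[of v], simp add: mult.commute)
  finally show "cinner (E n v) w = cinner v (E n w)" by (simp add: E_def cinner_sum_right cinner_scaleC_right)
 qed
 have Eb: "E n b = (if b \<in> F n then b else 0)" if b: "b \<in> B" for n b
 proof -
  have "E n b = (\<Sum>c\<in>F n. if c = b then b else 0)"
   unfolding E_def using Bo[OF FB b] Bn[OF b] by (intro sum.cong) (auto simp: cinner_self)
  then show ?thesis using fin by simp
 qed
 have id: "E n (E n v) = E n v" for n v
 proof -
  have "E n (E n v) = (\<Sum>b\<in>F n. cinner b v *\<^sub>C E n b)"
   by (subst E_def[of n v]) (simp add: clinear_sum[OF bc] clinear_scaleC[OF bc])
  also have "\<dots> = E n v" unfolding E_def[of n v] using Eb[OF FB] by (intro sum.cong) simp_all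
  finally show ?thesis .
 qed
 have le: "norm (v - E n v) \<le> norm v" for n v
  by (rule norm_projection_complement_le[OF bc adj]) (simp add: fun_eq_iff id)
 define S where "S = {v. (\<lambda>n. norm (v - E n v)) \<longlonglongrightarrow> 0}"
 have sub: "cvs.subspace S"
 proof (rule cvs.subspaceI)
  show "0 \<in> S" by (simp add: S_def clinear_zero[OF bc])
  show "x + y \<in> S" if "x \<in> S" "y \<in> S" for x y
  proof -
   have "(\<lambda>n. norm (x - E n x) + norm (y - E n y)) \<longlonglongrightarrow> 0"
    using tendsto_add[of "\<lambda>n. norm (x - E n x)" 0 sequentially "\<lambda>n. norm (y - E n y)" 0] that by (simp add: S_def)
   moreover have "norm (x + y - E n (x + y)) \<le> norm (x - E n x) + norm (y - E n y)" for n
    using norm_triangle_ineq[of "x - E n x" "y - E n y"] by (simp add: clinear_add[OF bc] algebra_simps)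
   ultimately show ?thesis unfolding S_def mem_Collect_eq
    by (intro tendsto_0_by_estimate[OF norm_ge_zero])
  qed
  show "c *\<^sub>C x \<in> S" if "x \<in> S" for c x
  proof -
   have "c *\<^sub>C x - E n (c *\<^sub>C x) = c *\<^sub>C (x - E n x)" for n
    by (simp add: clinear_scaleC[OF bc] cvs.scale_right_diff_distrib)
   then show ?thesis
    using tendsto_mult_left[of "\<lambda>n. norm (x - E n x)" 0 sequentially "cmod c"] that by (simp add: S_def)
  qed
 qed
 have BS: "B \<subseteq> S"
 proof
  fix b assume b: "b \<in> B"
  have "norm (b - E n b) = 0" if "n > to_nat_on B b" for n using Eb[OF b] b that by (simp add: F_def)
  then have "eventually (\<lambda>n. norm (b - E n b) = 0) sequentially"
   unfolding eventually_sequentially by (intro exI[of _ "Suc (to_nat_on B b)"]) auto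
  then show "b \<in> S" unfolding S_def mem_Collect_eq by (rule tendsto_eventually)
 qed
 have "(\<lambda>n. norm (v - E n v)) \<longlonglongrightarrow> 0" for v
 proof (rule LIMSEQ_I)
  fix r :: real assume r: "r > 0"
  have "v \<in> closure (cvs.span B)" using cl by simp
  then obtain w where w: "w \<in> cvs.span B" "dist w v < r/2" unfolding closure_approachable using r half_gt_zero by blast
  have "w \<in> S" using cvs.span_minimal[OF BS sub] w(1) by blast
  then obtain N where N: "\<And>n. n \<ge> N \<Longrightarrow> norm (norm (w - E n w) - 0) < r/2"
   using LIMSEQ_D[of "\<lambda>n. norm (w - E n w)" 0 "r/2"] r by (auto simp: S_def)
  have "norm (norm (v - E n v) - 0) < r" if "n \<ge> N" for n
  proof -
   have eq: "v - E n v = ((v - w) - E n (v - w)) + (w - E n w)" by (simp add: clinear_diff[OF bc])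
   have "norm (v - E n v) \<le> norm ((v - w) - E n (v - w)) + norm (w - E n w)"
    unfolding eq by (rule norm_triangle_ineq)
   also have "\<dots> \<le> norm (v - w) + norm (w - E n w)" using le by simp
   finally have "norm (v - E n v) \<le> norm (v - w) + norm (w - E n w)" .
   then show ?thesis using N[OF that] w(2) by (simp add: dist_norm norm_minus_commute)
  qed
  then show "\<exists>no. \<forall>n\<ge>no. norm (norm (v - E n v) - 0) < r" by blast
 qed
 then show ?thesis using that[of F E] fin E_def co adj id le by blast
qed

text \<open>Pointwise convergence is uniform on a finite net of the image of the unit ball, and
  contractivity of 1 - E_n carries it to the remaining points. Two thirds of r are spent, which
  leaves room for the strict inequality.\<close>

lemma compact_operator_approximation:
 fixes t :: "'a::chilbert_space \<Rightarrow> 'h::chilbert_space"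
 assumes t: "compact_operator t" and E: "\<And>n. bounded_clinear (E n)"
  and le: "\<And>n v. norm (v - E n v) \<le> norm v" and lim: "\<And>v. (\<lambda>n. norm (v - E n v)) \<longlonglongrightarrow> 0"
 shows "(\<lambda>n. onorm (\<lambda>v. t v - E n (t v))) \<longlonglongrightarrow> 0"
proof (rule LIMSEQ_I)
 fix r :: real assume r: "r > 0"
 have tb: "bounded_clinear t" by (rule compact_operatorD[OF t])
 have Db: "bounded_clinear (\<lambda>v. t v - E n (t v))" for n
  by (rule clinear_minus[OF tb bounded_clinear_compose[OF E tb]])
 have r3: "r/3 > 0" using r by simp
 obtain K where K: "finite K" "K \<subseteq> cball 0 1" "\<And>v. norm v \<le> 1 \<Longrightarrow> \<exists>k\<in>K. norm (t v - t k) < r/3"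
  using compact_operator_net[OF t r3] by metis
 have "eventually (\<lambda>n. \<forall>k\<in>K. norm (t k - E n (t k)) < r/3) sequentially"
  by (rule eventually_ball_finite[OF K(1)]) (use order_tendstoD(2)[OF lim r3] in blast)
 then obtain N where N: "\<And>n k. n \<ge> N \<Longrightarrow> k \<in> K \<Longrightarrow> norm (t k - E n (t k)) < r/3"
  by (auto simp: eventually_sequentially)
 have "norm (onorm (\<lambda>v. t v - E n (t v)) - 0) < r" if n: "n \<ge> N" for n
 proof -
  have ball: "norm (t v - E n (t v)) \<le> 2 * r / 3" if v: "norm v \<le> 1" for v
  proof -
   obtain k where k: "k \<in> K" "norm (t v - t k) < r/3" using K(3)[OF v] by blast
   have eq: "t v - E n (t v) = ((t v - t k) - E n (t v - t k)) + (t k - E n (t k))"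
    by (simp add: clinear_diff[OF E])
   have "norm (t v - E n (t v)) \<le> norm ((t v - t k) - E n (t v - t k)) + norm (t k - E n (t k))"
    unfolding eq by (rule norm_triangle_ineq)
   also have "\<dots> \<le> norm (t v - t k) + norm (t k - E n (t k))" using le by simp
   finally have "norm (t v - E n (t v)) \<le> norm (t v - t k) + norm (t k - E n (t k))" .
   then show ?thesis using k N[OF n k(1)] by simp
  qed
  have "onorm (\<lambda>v. t v - E n (t v)) \<le> 2 * r / 3"
  proof (rule onorm_bound)
   fix v
   show "norm (t v - E n (t v)) \<le> 2 * r / 3 * norm v"
   proof (cases "v = 0")
    case True
    then show ?thesis by (simp add: clinear_zero[OF tb] clinear_zero[OF E])
   next
    case False
    define u where "u = complex_of_real (1 / norm v) *\<^sub>C v"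
    have "norm u \<le> 1" using False by (simp add: u_def norm_divide)
    from ball[OF this] have "norm (complex_of_real (1 / norm v) *\<^sub>C (t v - E n (t v))) \<le> 2 * r / 3"
     by (simp add: u_def clinear_scaleC[OF tb] clinear_scaleC[OF E] cvs.scale_right_diff_distrib)
    then have "norm (t v - E n (t v)) / norm v \<le> 2 * r / 3" by (simp add: norm_divide)
    then show ?thesis using False by (simp add: pos_divide_le_eq)
   qed
  qed (use r in simp)
  then show ?thesis using r onorm_nonneg[OF Db, of n] by simp
 qed
 then show "\<exists>no. \<forall>n\<ge>no. norm (onorm (\<lambda>v. t v - E n (t v)) - 0) < r" by blast
qed

context roe_space
begin

lemma countable_space: "countable X"
proof (cases "X = {}")
 case False
 then obtain x0 where x0: "x0 \<in> X" by blast
 have "X \<subseteq> (\<Union>n::nat. {y \<in> X. d x0 y < real n})" using reals_Archimedean2 by auto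
 moreover have "countable (\<Union>n::nat. {y \<in> X. d x0 y < real n})"
  by (rule countable_UN) (simp_all add: countable_finite[OF finite_ball[OF x0]])
 ultimately show ?thesis by (rule countable_subset)
qed simp

text \<open>Strong convergence is asked for on finitely supported vectors only, since these define
  the operators generating \<open>K\<close>. The last property puts \<open>T \<circ> P n\<close>
  into \<open>K\<close>, so the distance from \<open>T\<close> to it bounds the quotient norm from
  above.\<close>

lemma approximate_unit:
 assumes "separable_space (euclidean :: 'h topology)"
 obtains P :: "nat \<Rightarrow> ('x, 'h) ell2_op"
 where "\<And>n. P n \<in> carrier A" "\<And>n. cadjoint (P n) = P n" "\<And>n. P n \<circ> P n = P n"
  "\<And>\<zeta>. finsupp X \<zeta> \<Longrightarrow> (\<lambda>n. norm (\<zeta> - P n \<zeta>)) \<longlonglongrightarrow> 0"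
  "\<And>T n. T \<in> carrier A \<Longrightarrow> max_embed A (T \<circ> P n) \<in> K"
proof -
 obtain E :: "nat \<Rightarrow> 'h \<Rightarrow> 'h" and B :: "nat \<Rightarrow> 'h set"
  where Bf: "\<And>n. finite (B n)" and EB: "\<And>n v. E n v = (\<Sum>b\<in>B n. cinner b v *\<^sub>C b)"
  and Ec: "\<And>n. compact_operator (E n)" and Ea: "\<And>n. cadjoint (E n) = E n" and Ei: "\<And>n v. E n (E n v) = E n v"
  and El: "\<And>n v. norm (v - E n v) \<le> norm v" and Elim: "\<And>v. (\<lambda>n. norm (v - E n v)) \<longlonglongrightarrow> 0"
  by (rule approximating_projections[OF assms]) (rule that)
 have Eb: "bounded_clinear (E n)" for n by (rule compact_operatorD[OF Ec])
 define F where "F n = {x \<in> X. to_nat_on X x < n}" for n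
 have Ff: "finite (F n)" for n unfolding F_def by (rule finite_to_nat_on_less[OF countable_space])
 have FX: "x \<in> X" if "x \<in> F n" for x n using that by (simp add: F_def)
 \<comment> \<open>\<open>P n\<close> acts as \<open>E n\<close> on the first n points of X and is
   zero elsewhere. Its rank is finite because both the set of points and the basis piece
   \<open>B n\<close> are finite.\<close>
 define P where "P n = (\<lambda>f :: ('x, 'h) ell2. \<Sum>x\<in>F n. single_op x x (E n) f)" for n
 have PA: "P n \<in> carrier A" for n
  unfolding P_def
 proof (rule roe_sum_closed)
  show "single_op x x (E n) \<in> carrier A" if "x \<in> F n" for x
   using FX[OF that] by (intro single_op_in_roe Ec)
 qed
 have RP: "Rep_ell2 (P n f) x = (if x \<in> F n then E n (Rep_ell2 f x) else 0)" for n f x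
 proof -
  have "Rep_ell2 (P n f) x = (\<Sum>y\<in>F n. if y = x then E n (Rep_ell2 f x) else 0)"
   unfolding P_def Rep_ell2_sum by (intro sum.cong) (auto simp: single_op_def Rep_ell2_single)
  then show ?thesis using Ff by simp
 qed
 have Pa: "cadjoint (P n) = P n" for n
 proof (rule cadjoint_eqI)
  fix f g :: "('x, 'h) ell2"
  have c: "cinner (ell2_single x (E n (Rep_ell2 f x))) g = cinner f (ell2_single x (E n (Rep_ell2 g x)))" for x
  proof -
   have "cinner f (ell2_single x (E n (Rep_ell2 g x))) = cnj (cinner (E n (Rep_ell2 g x)) (Rep_ell2 f x))"
    by (subst cinner_commute) (simp add: cinner_ell2_single)
   also have "\<dots> = cinner (Rep_ell2 f x) (E n (Rep_ell2 g x))" by (rule cinner_commute[symmetric])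
   also have "\<dots> = cinner (E n (Rep_ell2 f x)) (Rep_ell2 g x)"
    using cinner_cadjoint[OF Eb, of n "Rep_ell2 f x" "Rep_ell2 g x"] by (simp add: Ea)
   finally show ?thesis by (simp add: cinner_ell2_single)
  qed
  show "cinner (P n f) g = cinner f (P n g)"
   by (simp add: P_def single_op_def cinner_sum_left cinner_sum_right c)
 qed
 have Pi: "P n \<circ> P n = P n" for n
  by (rule ext, rule ell2_eqI) (simp add: RP Ei)
 have Plim: "(\<lambda>n. norm (\<zeta> - P n \<zeta>)) \<longlonglongrightarrow> 0" if fs: "finsupp X \<zeta>" for \<zeta> :: "('x, 'h) ell2"
 proof -
  obtain H where H: "H \<subseteq> X" "finite H" "\<And>x. x \<notin> H \<Longrightarrow> Rep_ell2 \<zeta> x = 0" using fs by (auto simp: finsupp_def)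
  \<comment> \<open>The sum of the indices of the support exceeds none of them from below, so from
    \<open>N\<close> on every point of the support belongs to \<open>F n\<close>.\<close>
  define N where "N = Suc (\<Sum>x\<in>H. to_nat_on X x)"
  have HF: "x \<in> F n" if "x \<in> H" "n \<ge> N" for x n
   using member_le_sum[OF that(1), of "to_nat_on X"] H(1,2) that by (auto simp: F_def N_def)
  have le: "norm (\<zeta> - P n \<zeta>) \<le> (\<Sum>x\<in>H. norm (Rep_ell2 \<zeta> x - E n (Rep_ell2 \<zeta> x)))" if n: "n \<ge> N" for n
  proof -
   have "Rep_ell2 (\<zeta> - P n \<zeta>) x = 0" if "x \<notin> H" for x
    using H(3)[OF that] by (simp add: minus_ell2.rep_eq RP clinear_zero[OF Eb])
   from finsupp_sum[OF H(2) this]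
   have "\<zeta> - P n \<zeta> = (\<Sum>x\<in>H. ell2_single x (Rep_ell2 (\<zeta> - P n \<zeta>) x))" by simp
   then have "norm (\<zeta> - P n \<zeta>) \<le> (\<Sum>x\<in>H. norm (Rep_ell2 (\<zeta> - P n \<zeta>) x))"
    using norm_sum[of "\<lambda>x. ell2_single x (Rep_ell2 (\<zeta> - P n \<zeta>) x)" H] by simp
   also have "\<dots> = (\<Sum>x\<in>H. norm (Rep_ell2 \<zeta> x - E n (Rep_ell2 \<zeta> x)))"
    using HF n by (intro sum.cong) (auto simp: minus_ell2.rep_eq RP)
   finally show ?thesis .
  qed
  have "(\<lambda>n. \<Sum>x\<in>H. norm (Rep_ell2 \<zeta> x - E n (Rep_ell2 \<zeta> x))) \<longlonglongrightarrow> 0"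
   by (rule tendsto_null_sum) (rule Elim)
  then show ?thesis
   by (rule tendsto_sandwich[OF _ _ tendsto_const, rotated 2])
    (use le in \<open>auto simp: eventually_sequentially\<close>)
 qed
 have "max_embed A (T \<circ> P n) \<in> K" if T: "T \<in> carrier A" for T n
 proof -
  have Tb: "bounded_clinear T" by (rule roe_bounded[OF T])
  define R where "R q = rank_op (T (ell2_single (fst q) (snd q))) (ell2_single (fst q) (snd q))" for q :: "'x \<times> 'h"
  have s: "single_op x x (E n) f = (\<Sum>b\<in>B n. cinner (ell2_single x b) f *\<^sub>C ell2_single x b)" for x and f :: "('x, 'h) ell2"
   by (simp add: single_op_def EB clinear_sum[OF clinear_ell2_single]
     clinear_scaleC[OF clinear_ell2_single] cinner_ell2_single)
  have "(T \<circ> P n) f = (\<Sum>q\<in>F n \<times> B n. R q f)" for f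
   by (simp add: P_def s clinear_sum[OF Tb] clinear_scaleC[OF Tb] R_def rank_op_def sum.cartesian_product)
    (simp add: case_prod_unfold clinear_scaleC[OF Tb])
  then have eq: "T \<circ> P n = (\<lambda>f. \<Sum>q\<in>F n \<times> B n. R q f)" by blast
  have fs: "finsupp X (T (ell2_single (fst q) (snd q)))" "finsupp X (ell2_single (fst q) (snd q))"
   if "q \<in> F n \<times> B n" for q
  proof -
   have x: "fst q \<in> X" using that FX[of "fst q" n] by auto
   show "finsupp X (T (ell2_single (fst q) (snd q)))" by (rule finsupp_apply[OF T finsupp_single[OF x]])
   show "finsupp X (ell2_single (fst q) (snd q))" by (rule finsupp_single[OF x])
  qed
  show ?thesis unfolding eq
   by (rule embed_sum_in_K) (use Ff Bf fs in \<open>auto simp: R_def intro: rank_op_in_roe embed_rank_op_in_K\<close>)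
 qed
 then show ?thesis using that[of P] PA Pa Pi Plim by blast
qed

text \<open>Representations killing the rank one operators determine the quotient norm: any number
  below that norm is attained or exceeded by such a representation on an ultrapower, built from the
  approximate unit.\<close>

lemma norm_roe_class_leI:
 assumes sep: "separable_space (euclidean :: 'h topology)" and T: "T \<in> carrier A" and c: "0 \<le> c"
  and le: "\<And>\<psi> :: ('x, 'h) ell2_op \<Rightarrow> (('x, 'h) ell2_op, complex) ell2 upow \<Rightarrow> _.
   star_hom A bounded_ops \<psi> \<Longrightarrow> (\<And>r. r \<in> ranks \<Longrightarrow> \<psi> r = (\<lambda>_. 0)) \<Longrightarrow> onorm (\<psi> T) \<le> c"
 shows "alg_norm Q (cl T) \<le> c"
proof (rule ccontr)
 assume "\<not> ?thesis"
 then obtain c' where c': "c < c'" "c' < alg_norm Q (cl T)" using dense not_le by metis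
 obtain P :: "nat \<Rightarrow> ('x, 'h) ell2_op"
  where P: "\<And>n. P n \<in> carrier A" "\<And>n. cadjoint (P n) = P n" "\<And>n. P n \<circ> P n = P n"
  and Plim: "\<And>\<zeta>. finsupp X \<zeta> \<Longrightarrow> (\<lambda>n. norm (\<zeta> - P n \<zeta>)) \<longlonglongrightarrow> 0"
  and TP: "\<And>T n. T \<in> carrier A \<Longrightarrow> max_embed A (T \<circ> P n) \<in> K"
  by (rule approximate_unit[OF sep]) (rule that)
 have Pb: "bounded_clinear (P n)" for n by (rule roe_bounded[OF P(1)])
 \<comment> \<open>Rank operators with general finitely supported vectors replace the generators,
   because the set must be stable under multiplication from the right.\<close>
 define J where "J = {rank_op \<xi> \<zeta> | \<xi> \<zeta> :: ('x, 'h) ell2. finsupp X \<xi> \<and> finsupp X \<zeta>}"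
 obtain \<psi> :: "('x, 'h) ell2_op \<Rightarrow> (('x, 'h) ell2_op, complex) ell2 upow \<Rightarrow> _"
  where \<psi>: "star_hom A bounded_ops \<psi>" "\<And>j. j \<in> J \<Longrightarrow> \<psi> j = (\<lambda>_. 0)" "c' \<le> onorm (\<psi> T)"
 proof (rule roe.representation_of_quotient[of J P T c'])
  show "J \<subseteq> carrier A" by (auto simp: J_def rank_op_in_roe)
  show "j \<otimes>\<^bsub>A\<^esub> S \<in> J" if j: "j \<in> J" and S: "S \<in> carrier A" for j S
  proof -
   obtain \<xi> \<zeta> where "j = rank_op \<xi> \<zeta>" "finsupp X \<xi>" "finsupp X \<zeta>" using j by (auto simp: J_def)
   then show ?thesis
    using finsupp_apply[OF roe_cadjoint_closed[OF S], of \<zeta>]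
    by (auto simp: J_def rank_op_comp_right[OF roe_bounded[OF S]])
  qed
  show "(\<lambda>n. max_norm A (j \<ominus>\<^bsub>A\<^esub> j \<otimes>\<^bsub>A\<^esub> P n)) \<longlonglongrightarrow> 0" if j: "j \<in> J" for j
  proof -
   obtain \<xi> \<zeta> where jj: "j = rank_op \<xi> \<zeta>" and fs: "finsupp X \<xi>" "finsupp X \<zeta>" using j by (auto simp: J_def)
   have fsP: "finsupp X (P n \<zeta>)" for n by (rule finsupp_apply[OF P(1) fs(2)])
   have fsd: "finsupp X (\<zeta> - P n \<zeta>)" for n
   proof -
    obtain F1 where F1: "F1 \<subseteq> X" "finite F1" "\<And>x. x \<notin> F1 \<Longrightarrow> Rep_ell2 \<zeta> x = 0" using fs(2) by (auto simp: finsupp_def)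
    obtain F2 where F2: "F2 \<subseteq> X" "finite F2" "\<And>x. x \<notin> F2 \<Longrightarrow> Rep_ell2 (P n \<zeta>) x = 0" using fsP[of n] by (auto simp: finsupp_def)
    show ?thesis unfolding finsupp_def
     using F1 F2 by (intro exI[of _ "F1 \<union> F2"]) (auto simp: minus_ell2.rep_eq)
   qed
   have jA: "j \<in> carrier A" unfolding jj by (rule rank_op_in_roe[OF fs])
   have "j \<otimes>\<^bsub>A\<^esub> P n = rank_op \<xi> (P n \<zeta>)" for n
    by (simp add: jj P(2) rank_op_comp_right[OF Pb])
   then have "j \<ominus>\<^bsub>A\<^esub> j \<otimes>\<^bsub>A\<^esub> P n = rank_op \<xi> (\<zeta> - P n \<zeta>)" for n
    using roe_minus[OF jA rank_op_in_roe[OF fs(1) fsP]] by (simp add: jj rank_op_diff_right)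
   then have le: "max_norm A (j \<ominus>\<^bsub>A\<^esub> j \<otimes>\<^bsub>A\<^esub> P n) \<le> norm \<xi> * norm (\<zeta> - P n \<zeta>)" for n
    using max_norm_rank_op_le[OF fs(1) fsd] by simp
   have lim0: "(\<lambda>n. norm \<xi> * norm (\<zeta> - P n \<zeta>)) \<longlonglongrightarrow> 0" using tendsto_mult_left[OF Plim[OF fs(2)], of "norm \<xi>"] by simp
   show ?thesis
   proof (rule tendsto_0_by_estimate[OF _ le lim0])
    show "0 \<le> max_norm A (j \<ominus>\<^bsub>A\<^esub> j \<otimes>\<^bsub>A\<^esub> P n)" for n
     by (intro roe.max_norm_nonneg roe.diff_closed roe.mult_closed jA P(1))
   qed
  qed
  \<comment> \<open>\<open>T \<circ> P n\<close> is in \<open>K\<close>, so its distance from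
    \<open>T\<close> is at least the quotient norm, which is larger than c'.\<close>
  show "c' < max_norm A (T \<ominus>\<^bsub>A\<^esub> T \<otimes>\<^bsub>A\<^esub> P n)" for n
  proof -
   have TPA: "T \<circ> P n \<in> carrier A" by (rule roe_mult_closed[OF T P(1)])
   have "alg_norm Q (cl T) \<le> alg_norm roe.C (max_embed A T \<ominus>\<^bsub>roe.C\<^esub> max_embed A (T \<circ> P n))"
    unfolding Q_eq roe_class_eq
    by (rule ideal.quotient_norm_le_minus[OF star_hom_closed[OF roe.star_hom_max_embed T] TP[OF T]])
   also have "\<dots> = max_norm A (T \<ominus>\<^bsub>A\<^esub> (T \<circ> P n))"
    using roe.norm_max_embed[OF roe.diff_closed[OF T TPA]] roe.max_embed_minus[OF T TPA] by simp
   finally show ?thesis using c'(2) by simp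
  qed
 qed (use P T c c' in auto)
 have "\<psi> r = (\<lambda>_. 0)" if "r \<in> ranks" for r
  using that by (intro \<psi>(2)) (auto simp: ranks_def J_def rank_one_eq intro: finsupp_single)
 then have "onorm (\<psi> T) \<le> c" using le[OF \<psi>(1)] by blast
 then show False using \<psi>(3) c'(1) by simp
qed

text \<open>Such an operator may have infinite rank. Each entry t is the norm limit of
  \<open>E n \<circ> t\<close>, which has finite rank, and on single entries the maximal norm is at
  most the operator norm, so the limit stays in \<open>K\<close>.\<close>

lemma roe_class_finite_entries:
 assumes sep: "separable_space (euclidean :: 'h topology)" and T: "T \<in> carrier A"
  and F: "finite F" and z: "\<And>x y. (x, y) \<notin> F \<Longrightarrow> matrix_entry T x y = (\<lambda>_. 0)"
 shows "cl T = \<zero>\<^bsub>Q\<^esub>"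
proof -
 obtain E :: "nat \<Rightarrow> 'h \<Rightarrow> 'h" and B :: "nat \<Rightarrow> 'h set"
  where Bf: "\<And>n. finite (B n)" and EB: "\<And>n v. E n v = (\<Sum>b\<in>B n. cinner b v *\<^sub>C b)"
  and Ec: "\<And>n. compact_operator (E n)" and Ea: "\<And>n. cadjoint (E n) = E n" and Ei: "\<And>n v. E n (E n v) = E n v"
  and El: "\<And>n v. norm (v - E n v) \<le> norm v" and Elim: "\<And>v. (\<lambda>n. norm (v - E n v)) \<longlonglongrightarrow> 0"
  by (rule approximating_projections[OF sep]) (rule that)
 have Eb: "bounded_clinear (E n)" for n by (rule compact_operatorD[OF Ec])
 have single: "max_embed A (single_op x y t) \<in> K" if t: "compact_operator t" and xy: "x \<in> X" "y \<in> X" for x y t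
 proof -
  have tb: "bounded_clinear t" by (rule compact_operatorD[OF t])
  have Et: "compact_operator (E n \<circ> t)" for n by (rule compact_operator_comp_left[OF Eb t])
  have dt: "compact_operator (\<lambda>v. t v - E n (t v))" for n
   using compact_operator_add[OF t compact_operator_scaleC[OF Et, of "-1"]] by simp
  have inK: "max_embed A (single_op x y (E n \<circ> t)) \<in> K" for n
  proof -
   have "single_op x y (E n \<circ> t) f = (\<Sum>b\<in>B n. rank_op (ell2_single x b) (ell2_single y (cadjoint t b)) f)" for f
    by (simp add: single_op_def EB clinear_sum[OF clinear_ell2_single] rank_op_def
      clinear_scaleC[OF clinear_ell2_single] cinner_ell2_single cinner_cadjoint[OF tb])
   then have eq: "single_op x y (E n \<circ> t) = (\<lambda>f. \<Sum>b\<in>B n. rank_op (ell2_single x b) (ell2_single y (cadjoint t b)) f)"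
    by blast
   show ?thesis unfolding eq
    by (rule embed_sum_in_K) (use Bf xy in \<open>auto intro: rank_op_in_roe embed_rank_op_in_K finsupp_single\<close>)
  qed
  have "ideal.conv (\<lambda>n. max_embed A (single_op x y (E n \<circ> t))) (max_embed A (single_op x y t))"
  proof (rule ideal.convI_le)
   note sA = single_op_in_roe[OF Et xy] single_op_in_roe[OF t xy]
   show "max_embed A (single_op x y (E n \<circ> t)) \<in> carrier roe.C" for n
    by (rule star_hom_closed[OF roe.star_hom_max_embed sA(1)])
   show "max_embed A (single_op x y t) \<in> carrier roe.C"
    by (rule star_hom_closed[OF roe.star_hom_max_embed sA(2)])
   show "alg_norm roe.C (max_embed A (single_op x y (E n \<circ> t)) \<ominus>\<^bsub>roe.C\<^esub> max_embed A (single_op x y t))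
     \<le> onorm (\<lambda>v. t v - E n (t v))" for n
   proof -
    have "single_op x y t \<ominus>\<^bsub>A\<^esub> single_op x y (E n \<circ> t) = single_op x y (\<lambda>v. t v - E n (t v))"
     using roe_minus[OF sA(2) sA(1)]
     by (simp add: single_op_def[abs_def] clinear_diff[OF clinear_ell2_single])
    then have "max_norm A (single_op x y (E n \<circ> t) \<ominus>\<^bsub>A\<^esub> single_op x y t) \<le> onorm (\<lambda>v. t v - E n (t v))"
     using max_norm_single_op_le[OF dt xy] by (simp add: roe.max_norm_minus_commute[OF sA(1) sA(2)])
    then show ?thesis
     using roe.norm_max_embed[OF roe.diff_closed[OF sA(1) sA(2)]] roe.max_embed_minus[OF sA(1) sA(2)] by simp
   qed
   show "(\<lambda>n. onorm (\<lambda>v. t v - E n (t v))) \<longlonglongrightarrow> 0"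
    by (rule compact_operator_approximation[OF t Eb El Elim])
  qed
  then show ?thesis using ideal.closed_subspace_conv[OF closed_subspace_K] inK by blast
 qed
 define F' where "F' = F \<inter> X \<times> X"
 have F': "finite F'" using F by (simp add: F'_def)
 define S where "S q = single_op (fst q) (snd q) (matrix_entry T (fst q) (snd q))" for q
 have Tc: "compact_operator (matrix_entry T x y)" for x y using T by (simp add: carrier_roe_alg)
 have Tb: "bounded_clinear (matrix_entry T x y)" for x y by (rule compact_operatorD[OF Tc])
 have SA: "S q \<in> carrier A" if "q \<in> F'" for q
  using that by (auto simp: S_def F'_def intro!: single_op_in_roe Tc)
 have "T = (\<lambda>f. \<Sum>q\<in>F'. S q f)"
 proof (rule operator_eqI[OF roe_bounded[OF T]])
  show "bounded_clinear (\<lambda>f. \<Sum>q\<in>F'. S q f)"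
   by (rule clinear_setsum) (rule roe_bounded[OF SA])
  fix x y
  have "matrix_entry (\<lambda>f. \<Sum>q\<in>F'. S q f) x y = (\<lambda>v. \<Sum>q\<in>F'. if q = (x, y) then matrix_entry T x y v else 0)"
   unfolding matrix_entry_sum
   by (intro ext sum.cong) (auto simp: S_def matrix_entry_single_op[OF Tb])
  also have "\<dots> = matrix_entry T x y"
  proof (cases "(x, y) \<in> F'")
   case False
   then have "matrix_entry T x y = (\<lambda>_. 0)"
    using z[of x y] T by (cases "x \<in> X \<and> y \<in> X") (auto simp: F'_def carrier_roe_alg)
   then show ?thesis by (auto simp: fun_eq_iff intro!: sum.neutral)
  qed (use F' in simp)
  finally show "matrix_entry T x y = matrix_entry (\<lambda>f. \<Sum>q\<in>F'. S q f) x y" ..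
 qed
 moreover have "max_embed A (\<lambda>f. \<Sum>q\<in>F'. S q f) \<in> K"
  by (rule embed_sum_in_K[OF F' SA]) (auto simp: S_def F'_def intro!: single Tc)
 ultimately show ?thesis using roe_class_eq_0_iff[OF T] by simp
qed

end

section \<open>The large scale structure of an action\<close>

lemma metric_lssD:
 assumes "\<U> \<in> metric_lss X d"
 obtains B where "\<And>U x y. U \<in> \<U> \<Longrightarrow> x \<in> U \<Longrightarrow> y \<in> U \<Longrightarrow> d x y \<le> B"
proof -
 have "(SUP U\<in>\<U>. metric_diam d U) < \<infinity>" using assms by (simp add: metric_lss_def)
 then have "(SUP U\<in>\<U>. metric_diam d U) \<noteq> \<infinity>" by simp
 then have "\<exists>n::nat. (SUP U\<in>\<U>. metric_diam d U) < ereal (real n)"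
  by (simp only: less_PInf_Ex_of_nat)
 then obtain n :: nat where n: "(SUP U\<in>\<U>. metric_diam d U) < ereal (real n)" ..
 have "d x y \<le> real n" if "U \<in> \<U>" "x \<in> U" "y \<in> U" for U x y
 proof -
  have "ereal (d x y) \<le> metric_diam d U"
   unfolding metric_diam_def using that by (intro SUP_upper2[of "(x, y)"]) auto
  also have "\<dots> \<le> (SUP U\<in>\<U>. metric_diam d U)" by (rule SUP_upper[OF that(1)])
  also have "\<dots> < ereal (real n)" by (rule n)
  finally show ?thesis by simp
 qed
 then show ?thesis by (rule that)
qed

lemma metric_lssI:
 assumes "\<U> \<subseteq> Pow X" "\<And>U x y. U \<in> \<U> \<Longrightarrow> x \<in> U \<Longrightarrow> y \<in> U \<Longrightarrow> d x y \<le> B"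
 shows "\<U> \<in> metric_lss X d"
proof -
 have "(SUP U\<in>\<U>. metric_diam d U) \<le> ereal B"
  unfolding metric_diam_def by (intro SUP_least) (use assms(2) in auto)
 then have "(SUP U\<in>\<U>. metric_diam d U) < \<infinity>" by (rule le_less_trans) simp
 then show ?thesis using assms(1) by (simp add: metric_lss_def)
qed

locale coarse_action = group_action G X \<phi> + group G + dX: bounded_geometry_space X d
 for G :: "('g, 'z) monoid_scheme" (structure) and X :: "'x set" and \<phi> d +
 fixes dG :: "'x \<Rightarrow> 'x \<Rightarrow> real"
 assumes coarse: "g \<in> carrier G \<Longrightarrow> R > 0 \<Longrightarrow> \<exists>S>0. \<forall>x\<in>X. \<forall>y\<in>X. d x y \<le> R \<longrightarrow> d (\<phi> g x) (\<phi> g y) \<le> S"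
  and cdisc: "coarsely_discontinuous G X d \<phi>"
  and dG_metric: "Metric_space X dG"
  and lss: "metric_lss X dG = orbit_lss G X d \<phi>"
begin

lemma act_closed: "g \<in> carrier G \<Longrightarrow> x \<in> X \<Longrightarrow> \<phi> g x \<in> X"
 using element_image by blast

lemma act_one: "x \<in> X \<Longrightarrow> \<phi> \<one> x = x"
 using fun_cong[OF id_eq_one, of x] by simp

lemma act_mult: "g \<in> carrier G \<Longrightarrow> h \<in> carrier G \<Longrightarrow> x \<in> X \<Longrightarrow> \<phi> (g \<otimes> h) x = \<phi> g (\<phi> h x)"
 by (rule composition_rule)

lemma act_inv: "g \<in> carrier G \<Longrightarrow> x \<in> X \<Longrightarrow> \<phi> (inv g) (\<phi> g x) = x"
 using act_mult[of "inv g" g x] by (simp add: act_one)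

lemma act_inv': "g \<in> carrier G \<Longrightarrow> x \<in> X \<Longrightarrow> \<phi> g (\<phi> (inv g) x) = x"
 using act_mult[of g "inv g" x] by (simp add: act_one)

lemma coarse_bound:
 assumes "g \<in> carrier G"
 obtains S where "S > 0" "\<And>x y. x \<in> X \<Longrightarrow> y \<in> X \<Longrightarrow> d x y \<le> R \<Longrightarrow> d (\<phi> g x) (\<phi> g y) \<le> S"
proof -
 obtain S where S: "S > 0" "\<forall>x\<in>X. \<forall>y\<in>X. d x y \<le> max R 1 \<longrightarrow> d (\<phi> g x) (\<phi> g y) \<le> S"
 proof -
  have "max R 1 > 0" by simp
  from coarse[OF assms this] show ?thesis using that by blast
 qed
 show ?thesis by (rule that[OF S(1)]) (use S(2) in auto)
qed

lemma finite_coarse_bound: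
 assumes "finite S" "S \<subseteq> carrier G"
 shows "\<exists>B. \<forall>g\<in>S. \<forall>x\<in>X. \<forall>y\<in>X. d x y \<le> R \<longrightarrow> d (\<phi> g x) (\<phi> g y) \<le> B"
 using assms
proof (induction S rule: finite_induct)
 case (insert g S)
 then obtain B where B: "\<forall>g\<in>S. \<forall>x\<in>X. \<forall>y\<in>X. d x y \<le> R \<longrightarrow> d (\<phi> g x) (\<phi> g y) \<le> B" by auto
 obtain C where C: "\<And>x y. x \<in> X \<Longrightarrow> y \<in> X \<Longrightarrow> d x y \<le> R \<Longrightarrow> d (\<phi> g x) (\<phi> g y) \<le> C"
  using coarse_bound[of g R] insert.prems by (metis insert_subset)
 show ?case using B C by (intro exI[of _ "max B C"]) (auto simp: le_max_iff_disj)
qed simp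

section \<open>The orbit structure in terms of finite sets of group elements\<close>

definition entourage :: "'g set \<Rightarrow> real \<Rightarrow> 'x \<Rightarrow> 'x \<Rightarrow> bool" where
 "entourage S R x y \<longleftrightarrow> (\<exists>g\<in>S. d x (\<phi> g y) \<le> R)"

text \<open>If x is near g y and y is near h z, then g moves the second relation to one between g y
  and g h z. The distance there is bounded uniformly over the finitely many g, and the products g h
  form the new finite set.\<close>

lemma entourage_comp:
 assumes S: "finite S" "S \<subseteq> carrier G" and S': "finite S'" "S' \<subseteq> carrier G"
 shows "\<exists>T Q. finite T \<and> T \<subseteq> carrier G \<and>
  (\<forall>x\<in>X. \<forall>y\<in>X. \<forall>z\<in>X. entourage S R x y \<longrightarrow> entourage S' R' y z \<longrightarrow> entourage T Q x z)"
proof -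
 obtain B where B: "\<And>g x y. g \<in> S \<Longrightarrow> x \<in> X \<Longrightarrow> y \<in> X \<Longrightarrow> d x y \<le> R' \<Longrightarrow> d (\<phi> g x) (\<phi> g y) \<le> B"
  using finite_coarse_bound[OF S, of R'] by blast
 define T where "T = (\<lambda>(g, h). g \<otimes> h) ` (S \<times> S')"
 have "finite T" using S S' by (simp add: T_def)
 moreover have "T \<subseteq> carrier G" using S(2) S'(2) by (auto simp: T_def)
 moreover have "entourage T (R + B) x z"
  if x: "x \<in> X" and y: "y \<in> X" and z: "z \<in> X" and xy: "entourage S R x y" and yz: "entourage S' R' y z" for x y z
 proof -
  obtain g where g: "g \<in> S" "d x (\<phi> g y) \<le> R" using xy by (auto simp: entourage_def)
  obtain h where h: "h \<in> S'" "d y (\<phi> h z) \<le> R'" using yz by (auto simp: entourage_def)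
  have gG: "g \<in> carrier G" and hG: "h \<in> carrier G" using g h S S' by auto
  have "d (\<phi> g y) (\<phi> g (\<phi> h z)) \<le> B" by (rule B[OF g(1) y act_closed[OF hG z] h(2)])
  moreover have "d x (\<phi> g (\<phi> h z)) \<le> d x (\<phi> g y) + d (\<phi> g y) (\<phi> g (\<phi> h z))"
   by (rule dX.triangle[OF x act_closed[OF gG y] act_closed[OF gG act_closed[OF hG z]]])
  ultimately have "d x (\<phi> (g \<otimes> h) z) \<le> R + B" using g(2) by (simp add: act_mult gG hG z)
  moreover have "g \<otimes> h \<in> T" using g(1) h(1) by (auto simp: T_def)
  ultimately show ?thesis by (auto simp: entourage_def)
 qed
 ultimately show ?thesis by blast
qed

text \<open>An explicit structure containing all generators of the orbit structure, hence the
  smallest one. This turns closeness in X_G into information about finitely many group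
  elements.\<close>

definition controlled :: "'x set set set" where
 "controlled = {\<U>. \<U> \<subseteq> Pow X \<and> (\<exists>S R. finite S \<and> S \<subseteq> carrier G \<and>
   (\<forall>U\<in>\<U>. \<forall>x\<in>U. \<forall>y\<in>U. entourage S R x y))}"

lemma controlledE:
 assumes "\<U> \<in> controlled"
 obtains S R where "finite S" "S \<subseteq> carrier G" "\<And>U x y. U \<in> \<U> \<Longrightarrow> x \<in> U \<Longrightarrow> y \<in> U \<Longrightarrow> entourage S R x y"
proof -
 obtain S R where S: "finite S" "S \<subseteq> carrier G" "\<forall>U\<in>\<U>. \<forall>x\<in>U. \<forall>y\<in>U. entourage S R x y"
  using assms unfolding controlled_def by (elim CollectE conjE exE)
 show ?thesis
 proof (rule that[OF S(1,2)])
  fix U x y assume "U \<in> \<U>" "x \<in> U" "y \<in> U"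
  then show "entourage S R x y" using S(3) by blast
 qed
qed

lemma large_scale_structure_controlled: "large_scale_structure X controlled"
 unfolding large_scale_structure_def
proof (intro conjI ballI allI impI)
 have "{} \<in> controlled" unfolding controlled_def by auto
 then show "controlled \<noteq> {}" by blast
 show "controlled \<subseteq> Pow (Pow X)" by (auto simp: controlled_def)
 fix \<B>1 assume B1: "\<B>1 \<in> controlled"
 then have B1X: "\<B>1 \<subseteq> Pow X" by (simp add: controlled_def)
 obtain S R where S: "finite S" "S \<subseteq> carrier G" and SR: "\<And>U x y. U \<in> \<B>1 \<Longrightarrow> x \<in> U \<Longrightarrow> y \<in> U \<Longrightarrow> entourage S R x y"
  by (rule controlledE[OF B1]) (rule that)
 show "\<B>2 \<in> controlled" if B2: "\<B>2 \<subseteq> Pow X"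
  and sub: "\<forall>B\<in>\<B>2. (\<exists>x\<in>B. \<exists>y\<in>B. x \<noteq> y) \<longrightarrow> (\<exists>B'\<in>\<B>1. B \<subseteq> B')" for \<B>2
 proof -
  \<comment> \<open>The identity and a nonnegative radius take care of one-point sets, which need
    not be contained in a member of the first family.\<close>
  have "entourage (insert \<one> S) (max R 0) x y" if xy: "B \<in> \<B>2" "x \<in> B" "y \<in> B" for B x y
  proof (cases "x = y")
   case True
   have "x \<in> X" using xy B2 by blast
   then show ?thesis using True by (auto simp: entourage_def act_one)
  next
   case False
   then obtain B' where "B' \<in> \<B>1" "B \<subseteq> B'" using sub xy by blast
   then have "entourage S R x y" using SR xy by blast
   then show ?thesis by (auto simp: entourage_def le_max_iff_disj)
  qed
  then show ?thesis unfolding controlled_def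
   using S B2 by (intro CollectI conjI exI[of _ "insert \<one> S"] exI[of _ "max R 0"]) auto
 qed
 fix \<B>2 assume B2: "\<B>2 \<in> controlled"
 then have B2X: "\<B>2 \<subseteq> Pow X" by (simp add: controlled_def)
 obtain S' R' where S': "finite S'" "S' \<subseteq> carrier G" and SR': "\<And>U x y. U \<in> \<B>2 \<Longrightarrow> x \<in> U \<Longrightarrow> y \<in> U \<Longrightarrow> entourage S' R' x y"
  by (rule controlledE[OF B2]) (rule that)
 \<comment> \<open>Two points of a star are joined through three links: from x to a point b of B
   inside one set, from b to c within B, and from c to y inside another set. The first composition
   covers two links and the second adds the last one.\<close>
 obtain T Q where T: "finite T" "T \<subseteq> carrier G"
  and TQ: "\<And>x y z. x \<in> X \<Longrightarrow> y \<in> X \<Longrightarrow> z \<in> X \<Longrightarrow> entourage S' R' x y \<Longrightarrow> entourage S R y z \<Longrightarrow> entourage T Q x z"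
  using entourage_comp[OF S' S, of R' R] by blast
 obtain T' Q' where T': "finite T'" "T' \<subseteq> carrier G"
  and TQ': "\<And>x y z. x \<in> X \<Longrightarrow> y \<in> X \<Longrightarrow> z \<in> X \<Longrightarrow> entourage T Q x y \<Longrightarrow> entourage S' R' y z \<Longrightarrow> entourage T' Q' x z"
  using entourage_comp[OF T S', of Q R'] by blast
 have "entourage T' Q' x y" if B: "B \<in> \<B>1" and x: "x \<in> st B \<B>2" and y: "y \<in> st B \<B>2" for B x y
 proof -
  obtain U b where U: "U \<in> \<B>2" "x \<in> U" "b \<in> U" "b \<in> B" using x by (auto simp: st_def)
  obtain V c where V: "V \<in> \<B>2" "y \<in> V" "c \<in> V" "c \<in> B" using y by (auto simp: st_def)
  have X: "x \<in> X" "b \<in> X" "c \<in> X" "y \<in> X" using U V B2X by auto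
  have "entourage T Q x c" by (rule TQ[OF X(1-3) SR'[OF U(1-3)] SR[OF B U(4) V(4)]])
  then show ?thesis by (rule TQ'[OF X(1,3,4) _ SR'[OF V(1,3,2)]])
 qed
 moreover have "st_family \<B>1 \<B>2 \<subseteq> Pow X" using B2X by (auto simp: st_family_def st_def)
 ultimately show "st_family \<B>1 \<B>2 \<in> controlled"
  unfolding controlled_def using T'
  by (intro CollectI conjI exI[of _ T'] exI[of _ Q']) (auto simp: st_family_def)
qed

lemma orbit_lss_controlled: "orbit_lss G X d \<phi> \<subseteq> controlled"
proof -
 have "metric_lss X d \<subseteq> controlled"
 proof
  fix \<U> assume U: "\<U> \<in> metric_lss X d"
  then have UX: "\<U> \<subseteq> Pow X" by (simp add: metric_lss_def)
  obtain B where B: "\<And>U x y. U \<in> \<U> \<Longrightarrow> x \<in> U \<Longrightarrow> y \<in> U \<Longrightarrow> d x y \<le> B" using metric_lssD[OF U] by blast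
  have "entourage {\<one>} B x y" if "V \<in> \<U>" "x \<in> V" "y \<in> V" for V x y
  proof -
   have "y \<in> X" using that UX by blast
   then show ?thesis using B[OF that] by (simp add: entourage_def act_one)
  qed
  then show "\<U> \<in> controlled"
   unfolding controlled_def using UX by (intro CollectI conjI exI[of _ "{\<one>}"] exI[of _ B]) auto
 qed
 moreover have "(\<lambda>x. {x, \<phi> g x}) ` X \<in> controlled" if g: "g \<in> carrier G" for g
 proof -
  \<comment> \<open>The four ordered pairs from x and g x are matched exactly by the identity, by g
    and by its inverse, so radius 0 works.\<close>
  have "entourage {\<one>, g, inv g} 0 y z" if x: "x \<in> X" and yz: "y \<in> {x, \<phi> g x}" "z \<in> {x, \<phi> g x}" for x y z
   using yz act_closed[OF g x] x g by (auto simp: entourage_def act_one act_inv)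
  then show ?thesis
   unfolding controlled_def using g act_closed[OF g]
   by (intro CollectI conjI exI[of _ "{\<one>, g, inv g}"] exI[of _ 0]) auto
 qed
 ultimately show ?thesis unfolding orbit_lss_def using large_scale_structure_controlled by (intro Inter_lower) blast
qed

text \<open>The family of all pairs at \<open>dG\<close>-distance below R is uniformly bounded, so
  one finite set of group elements serves all of them. This later splits an operator on X_G into
  finitely many terms T_g M_g.\<close>

lemma dG_controlled:
 obtains S Q where "finite S" "S \<subseteq> carrier G" "Q > 0"
  "\<And>x y. x \<in> X \<Longrightarrow> y \<in> X \<Longrightarrow> dG x y < R \<Longrightarrow> \<exists>g\<in>S. d x (\<phi> g y) < Q"
proof -
 interpret dG: Metric_space X dG by (rule dG_metric)
 define \<U> where "\<U> = {{x, y} | x y. x \<in> X \<and> y \<in> X \<and> dG x y < R}"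
 have "\<U> \<in> metric_lss X dG"
 proof (rule metric_lssI)
  show "\<U> \<subseteq> Pow X" by (auto simp: \<U>_def)
  show "dG x y \<le> max R 0" if "U \<in> \<U>" "x \<in> U" "y \<in> U" for U x y
   using that dG.commute by (auto simp: \<U>_def le_max_iff_disj)
 qed
 then have "\<U> \<in> controlled" using lss orbit_lss_controlled by blast
 then obtain S Q where S: "finite S" "S \<subseteq> carrier G" "\<And>U x y. U \<in> \<U> \<Longrightarrow> x \<in> U \<Longrightarrow> y \<in> U \<Longrightarrow> entourage S Q x y"
  by (rule controlledE) (rule that)
 show ?thesis
 proof (rule that[OF S(1,2), of "max Q 0 + 1"])
  fix x y assume xy: "x \<in> X" "y \<in> X" "dG x y < R"
  then have "entourage S Q x y" by (intro S(3)[of "{x, y}"]) (auto simp: \<U>_def)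
  then show "\<exists>g\<in>S. d x (\<phi> g y) < max Q 0 + 1" unfolding entourage_def by (auto intro!: bexI simp: max_def)
 qed auto
qed

lemma metric_lss_sub_orbit: "metric_lss X d \<subseteq> orbit_lss G X d \<phi>"
 unfolding orbit_lss_def by blast

lemma dG_bound_d:
 obtains S where "S > 0" "\<And>x y. x \<in> X \<Longrightarrow> y \<in> X \<Longrightarrow> d x y \<le> R \<Longrightarrow> dG x y < S"
proof -
 define \<U> where "\<U> = {{x, y} | x y. x \<in> X \<and> y \<in> X \<and> d x y \<le> R}"
 have "\<U> \<in> metric_lss X d"
 proof (rule metric_lssI)
  show "\<U> \<subseteq> Pow X" by (auto simp: \<U>_def)
  show "d x y \<le> max R 0" if "U \<in> \<U>" "x \<in> U" "y \<in> U" for U x y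
   using that dX.commute by (auto simp: \<U>_def le_max_iff_disj)
 qed
 then have "\<U> \<in> metric_lss X dG" using lss metric_lss_sub_orbit by blast
 then obtain B where B: "\<And>U x y. U \<in> \<U> \<Longrightarrow> x \<in> U \<Longrightarrow> y \<in> U \<Longrightarrow> dG x y \<le> B" using metric_lssD by metis
 show ?thesis
 proof (rule that[of "max B 0 + 1"])
  fix x y assume "x \<in> X" "y \<in> X" "d x y \<le> R"
  then have "dG x y \<le> B" by (intro B[of "{x, y}"]) (auto simp: \<U>_def)
  then show "dG x y < max B 0 + 1" by (simp add: max_def)
 qed simp
qed

lemma dG_bound_act:
 assumes g: "g \<in> carrier G"
 obtains S where "S > 0" "\<And>x. x \<in> X \<Longrightarrow> dG x (\<phi> g x) < S"
proof -
 have "(\<lambda>x. {x, \<phi> g x}) ` X \<in> metric_lss X dG" unfolding lss orbit_lss_def using g by blast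
 then obtain B where B: "\<And>U x y. U \<in> (\<lambda>x. {x, \<phi> g x}) ` X \<Longrightarrow> x \<in> U \<Longrightarrow> y \<in> U \<Longrightarrow> dG x y \<le> B"
  using metric_lssD by metis
 show ?thesis
 proof (rule that[of "max B 0 + 1"])
  fix x assume "x \<in> X"
  then have "dG x (\<phi> g x) \<le> B" by (intro B[of "{x, \<phi> g x}"]) auto
  then show "dG x (\<phi> g x) < max B 0 + 1" by (simp add: max_def)
 qed simp
qed

text \<open>A \<open>dG\<close>-ball is covered by translates of a single \<open>d\<close>-ball
  under the inverses of finitely many group elements, so bounded geometry passes from
  \<open>d\<close> to \<open>dG\<close>.\<close>

lemma bounded_geometry_dG: "bounded_geometry X dG"
 unfolding bounded_geometry_def
proof (intro allI impI)
 fix R :: real assume "R > 0"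
 interpret dG: Metric_space X dG by (rule dG_metric)
 obtain S Q where S: "finite S" "S \<subseteq> carrier G" "Q > 0"
  and SQ: "\<And>x y. x \<in> X \<Longrightarrow> y \<in> X \<Longrightarrow> dG x y < R \<Longrightarrow> \<exists>g\<in>S. d x (\<phi> g y) < Q"
  using dG_controlled[of R] by blast
 obtain N :: nat where N: "\<And>x. x \<in> X \<Longrightarrow> finite {y \<in> X. d x y < Q}" "\<And>x. x \<in> X \<Longrightarrow> card {y \<in> X. d x y < Q} \<le> N"
  using dX.ball_card[OF S(3)] by blast
 have "finite (dG.mball x R) \<and> card (dG.mball x R) \<le> card S * N" if x: "x \<in> X" for x
 proof -
  define W where "W g = \<phi> (inv g) ` {y \<in> X. d x y < Q}" for g
  have sub: "dG.mball x R \<subseteq> (\<Union>g\<in>S. W g)"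
  proof
   fix y assume "y \<in> dG.mball x R"
   then have y: "y \<in> X" "dG x y < R" by auto
   then obtain g where g: "g \<in> S" "d x (\<phi> g y) < Q" using SQ[OF x] by blast
   then have gG: "g \<in> carrier G" using S by blast
   have "y = \<phi> (inv g) (\<phi> g y)" by (simp add: act_inv gG y)
   moreover have "\<phi> g y \<in> {y \<in> X. d x y < Q}" using g act_closed[OF gG y(1)] by simp
   ultimately have "y \<in> W g" unfolding W_def by (rule image_eqI)
   then show "y \<in> (\<Union>g\<in>S. W g)" using g(1) by blast
  qed
  have fin: "finite (W g)" for g unfolding W_def by (rule finite_imageI[OF N(1)[OF x]])
  have "card (\<Union>g\<in>S. W g) \<le> (\<Sum>g\<in>S. card (W g))" by (rule card_UN_le[OF S(1)])
  also have "\<dots> \<le> (\<Sum>g\<in>S. N)"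
   unfolding W_def by (intro sum_mono order_trans[OF card_image_le[OF N(1)[OF x]] N(2)[OF x]])
  finally have "card (\<Union>g\<in>S. W g) \<le> card S * N" by simp
  moreover have "finite (\<Union>g\<in>S. W g)" using S(1) fin by blast
  ultimately show ?thesis using sub by (meson card_mono finite_subset order_trans)
 qed
 then show "\<exists>N. \<forall>x\<in>X. finite (dG.mball x R) \<and> card (dG.mball x R) \<le> N" by blast
qed

text \<open>Coarse discontinuity puts these points into a bounded set, and bounded sets are finite
  by bounded geometry. The radius \<open>max R 1\<close> is used since the definition asks for a
  positive one.\<close>

lemma finite_close_orbit:
 assumes g: "g \<in> carrier G" "g \<noteq> \<one>"
 shows "finite {x \<in> X. d x (\<phi> g x) < R}"
proof -
 have gG: "g \<in> carrier G - {\<one>}" and pos: "max R 1 > 0" using g by auto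
 obtain K where K: "K \<subseteq> X" "dX.mbounded K" "\<forall>x\<in>X - K. d x (\<phi> g x) \<ge> max R 1"
  using cdisc[unfolded coarsely_discontinuous_def, rule_format, OF gG pos] by blast
 have "{x \<in> X. d x (\<phi> g x) < R} \<subseteq> K"
 proof
  fix x assume x: "x \<in> {x \<in> X. d x (\<phi> g x) < R}"
  show "x \<in> K"
  proof (rule ccontr)
   assume "x \<notin> K"
   then have "max R 1 \<le> d x (\<phi> g x)" using K(3) x by blast
   then show False using x by simp
  qed
 qed
 moreover have "finite K"
 proof -
  obtain c B where B: "K \<subseteq> dX.mcball c B" using K(2) by (auto simp: dX.mbounded_def)
  show ?thesis
  proof (cases "K = {}")
   case False
   then have c: "c \<in> X" using B by auto
   have "K \<subseteq> {y \<in> X. d c y < B + 1}" using B by fastforce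
   then show ?thesis using finite_subset dX.finite_ball[OF c] by blast
  qed simp
 qed
 ultimately show ?thesis by (rule finite_subset)
qed

end

section \<open>Algebraic crossed products\<close>

lemma clinear_rep_sum:
 "(\<And>i. i \<in> S \<Longrightarrow> bounded_clinear (T i)) \<Longrightarrow> cadjoint (\<lambda>v. \<Sum>i\<in>S. T i v) = (\<lambda>v. \<Sum>i\<in>S. cadjoint (T i) v)"
 by (rule cadjoint_eqI) (simp add: cinner_sum_left cinner_sum_right cinner_cadjoint)

lemma linear_map_finsum:
 assumes C: "star_space C" and C': "star_space C'" and \<tau>: "linear_map C C' \<tau>"
  and S: "finite S" "\<And>k. k \<in> S \<Longrightarrow> f k \<in> carrier C"
 shows "\<tau> (finsum C f S) = finsum C' (\<lambda>k. \<tau> (f k)) S"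
 using S
proof (induction S rule: finite_induct)
 interpret C: star_space C by fact
 interpret C': star_space C' by fact
 case empty
 then show ?case using linear_map_zero[OF C C' \<tau>] by (simp add: C.finsum_empty C'.finsum_empty)
next
 interpret C: star_space C by fact
 interpret C': star_space C' by fact
 case (insert k S)
 have f: "f \<in> S \<rightarrow> carrier C" "f k \<in> carrier C" using insert by auto
 have f': "(\<lambda>k. \<tau> (f k)) \<in> S \<rightarrow> carrier C'" "\<tau> (f k) \<in> carrier C'"
  using f linear_map_closed[OF \<tau>] by auto
 have "\<tau> (finsum C f (insert k S)) = \<tau> (f k \<oplus>\<^bsub>C\<^esub> finsum C f S)"
  using insert f by (simp add: C.finsum_insert)
 also have "\<dots> = \<tau> (f k) \<oplus>\<^bsub>C'\<^esub> \<tau> (finsum C f S)"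
  by (rule linear_map_add[OF \<tau> f(2) C.finsum_closed[OF f(1)]])
 also have "\<dots> = finsum C' (\<lambda>k. \<tau> (f k)) (insert k S)"
  using insert f' by (simp add: C'.finsum_insert)
 finally show ?case .
qed

lemma linear_map_finsum_ops:
 fixes f :: "'i \<Rightarrow> 'c" and \<tau> :: "'c \<Rightarrow> 'k::chilbert_space \<Rightarrow> 'k"
 assumes C: "star_space C" and \<tau>: "linear_map C bounded_ops \<tau>"
  and S: "finite S" "\<And>k. k \<in> S \<Longrightarrow> f k \<in> carrier C"
 shows "\<tau> (finsum C f S) = (\<lambda>v. \<Sum>k\<in>S. \<tau> (f k) v)"
proof -
 have "finsum bounded_ops g S = (\<lambda>v. \<Sum>k\<in>S. g k v)" if "\<And>k. k \<in> S \<Longrightarrow> bounded_clinear (g k)" for g :: "'i \<Rightarrow> 'k \<Rightarrow> 'k"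
  using S(1) that
  by (induction S rule: finite_induct) (simp_all add: bounded_ops.finsum_empty bounded_ops.finsum_insert Pi_iff)
 then show ?thesis
  using linear_map_finsum[OF C bounded_ops.star_space_axioms \<tau> S] linear_map_closed[OF \<tau> S(2)] by simp
qed

locale crossed_system = G: group G + C: star_ring_space C
 for G :: "('g, 'z) monoid_scheme" (structure) and C :: "('c, 'm) star_alg_scheme" and \<alpha> :: "'g \<Rightarrow> 'c \<Rightarrow> 'c" +
 assumes \<alpha>_hom: "g \<in> carrier G \<Longrightarrow> star_hom C C (\<alpha> g)"
  and \<alpha>_one: "a \<in> carrier C \<Longrightarrow> \<alpha> \<one> a = a"
  and \<alpha>_mult: "g \<in> carrier G \<Longrightarrow> h \<in> carrier G \<Longrightarrow> a \<in> carrier C \<Longrightarrow> \<alpha> g (\<alpha> h a) = \<alpha> (g \<otimes> h) a"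
begin

abbreviation P :: "('g \<Rightarrow> 'c) star_alg" where "P \<equiv> alg_crossed_product G C \<alpha>"

definition supp :: "('g \<Rightarrow> 'c) \<Rightarrow> 'g set" where "supp f = {g. f g \<noteq> \<zero>\<^bsub>C\<^esub>}"

abbreviation twisted :: "('g \<Rightarrow> 'c) \<Rightarrow> ('g \<Rightarrow> 'c) \<Rightarrow> 'g \<Rightarrow> 'g \<Rightarrow> 'c" where
 "twisted f h g k \<equiv> f k \<otimes>\<^bsub>C\<^esub> \<alpha> k (h (inv k \<otimes> g))"

lemma P_simps:
 "f \<in> carrier P \<longleftrightarrow> (\<forall>g. f g \<in> carrier C) \<and> supp f \<subseteq> carrier G \<and> finite (supp f)"
 "f \<otimes>\<^bsub>P\<^esub> h = (\<lambda>g. if g \<in> carrier G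
   then finsum C (twisted f h g) (supp f) else \<zero>\<^bsub>C\<^esub>)"
 "\<zero>\<^bsub>P\<^esub> = (\<lambda>_. \<zero>\<^bsub>C\<^esub>)" "f \<oplus>\<^bsub>P\<^esub> h = (\<lambda>g. f g \<oplus>\<^bsub>C\<^esub> h g)" "c \<odot>\<^bsub>P\<^esub> f = (\<lambda>g. c \<odot>\<^bsub>C\<^esub> f g)"
 "involution P f = (\<lambda>g. if g \<in> carrier G then \<alpha> g (involution C (f (inv g))) else \<zero>\<^bsub>C\<^esub>)"
 by (auto simp: alg_crossed_product_def supp_def)

lemma P_carrierD: "f \<in> carrier P \<Longrightarrow> f g \<in> carrier C" "f \<in> carrier P \<Longrightarrow> finite (supp f)"
 "f \<in> carrier P \<Longrightarrow> supp f \<subseteq> carrier G"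
 by (auto simp: P_simps)

lemma P_carrierI:
 "(\<And>g. f g \<in> carrier C) \<Longrightarrow> finite S \<Longrightarrow> S \<subseteq> carrier G \<Longrightarrow> (\<And>g. g \<notin> S \<Longrightarrow> f g = \<zero>\<^bsub>C\<^esub>) \<Longrightarrow> f \<in> carrier P"
proof -
 assume f: "\<And>g. f g \<in> carrier C" and S: "finite S" "S \<subseteq> carrier G" "\<And>g. g \<notin> S \<Longrightarrow> f g = \<zero>\<^bsub>C\<^esub>"
 have "supp f \<subseteq> S" using S(3) unfolding supp_def by blast
 then show ?thesis using f S finite_subset by (auto simp: P_simps)
qed

lemma zero_off_supp: "g \<notin> supp f \<Longrightarrow> f g = \<zero>\<^bsub>C\<^esub>"
 by (simp add: supp_def)

lemma \<alpha>_closed: "g \<in> carrier G \<Longrightarrow> a \<in> carrier C \<Longrightarrow> \<alpha> g a \<in> carrier C"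
 by (rule star_hom_closed[OF \<alpha>_hom])

lemma \<alpha>_zero: "g \<in> carrier G \<Longrightarrow> \<alpha> g \<zero>\<^bsub>C\<^esub> = \<zero>\<^bsub>C\<^esub>"
 by (rule linear_map_zero[OF C.star_space_axioms C.star_space_axioms star_hom_linear[OF \<alpha>_hom]])

lemma mult_zero: "a \<in> carrier C \<Longrightarrow> a \<otimes>\<^bsub>C\<^esub> \<zero>\<^bsub>C\<^esub> = \<zero>\<^bsub>C\<^esub>" "a \<in> carrier C \<Longrightarrow> \<zero>\<^bsub>C\<^esub> \<otimes>\<^bsub>C\<^esub> a = \<zero>\<^bsub>C\<^esub>"
 using C.smult_mult_right[OF _ C.zero_in_carrier, of a 0] C.smult_mult_left[OF C.zero_in_carrier, of a 0]
 by (simp_all add: C.smult_0 C.zero_in_carrier C.mult_closed)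

lemma involution_zero: "involution C \<zero>\<^bsub>C\<^esub> = \<zero>\<^bsub>C\<^esub>"
 using C.involution_smult[OF C.zero_in_carrier, of 0]
 by (simp add: C.smult_0 C.zero_in_carrier C.involution_closed)

lemma mult_superset:
 assumes f: "f \<in> carrier P" and h: "h \<in> carrier P" and S: "finite S" "supp f \<subseteq> S" "S \<subseteq> carrier G" and g: "g \<in> carrier G"
 shows "(f \<otimes>\<^bsub>P\<^esub> h) g = finsum C (twisted f h g) S"
proof -
 have "finsum C (twisted f h g) (supp f)
   = finsum C (twisted f h g) S"
 proof (rule C.add.finprod_mono_neutral_cong_left[OF S(1,2)])
  fix k assume k: "k \<in> S - supp f"
  then show "twisted f h g k = \<zero>\<^bsub>C\<^esub>"
   using S P_carrierD(1)[OF h] by (simp add: zero_off_supp mult_zero \<alpha>_closed subset_iff)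
 qed (use S P_carrierD(1)[OF f] P_carrierD(1)[OF h] in \<open>auto intro!: C.mult_closed \<alpha>_closed\<close>)
 then show ?thesis using g by (simp add: P_simps)
qed

lemma mult_support:
 assumes f: "f \<in> carrier P" and h: "h \<in> carrier P" and g: "(f \<otimes>\<^bsub>P\<^esub> h) g \<noteq> \<zero>\<^bsub>C\<^esub>"
 shows "g \<in> (\<lambda>(k, l). k \<otimes> l) ` (supp f \<times> supp h)"
proof (rule ccontr)
 assume no: "\<not> ?thesis"
 have gG: "g \<in> carrier G" using g by (auto simp: P_simps split: if_splits)
 have "twisted f h g k = \<zero>\<^bsub>C\<^esub>" if k: "k \<in> supp f" for k
 proof -
  have kG: "k \<in> carrier G" using k P_carrierD(3)[OF f] by blast
  have "g = k \<otimes> (inv k \<otimes> g)" using kG gG by (simp add: G.m_assoc[symmetric])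
  then have "inv k \<otimes> g \<notin> supp h" using no k by force
  then show ?thesis using P_carrierD(1)[OF f] by (simp add: zero_off_supp \<alpha>_zero kG mult_zero)
 qed
 then have "finsum C (twisted f h g) (supp f) = finsum C (\<lambda>k. \<zero>\<^bsub>C\<^esub>) (supp f)"
  by (intro C.finsum_cong') (auto simp: C.zero_in_carrier)
 then show False using g gG by (simp add: P_simps C.finsum_zero)
qed

lemma star_space_P: "star_space P"
proof unfold_locales
 fix f h assume f: "f \<in> carrier P"
 note fc = P_carrierD(1)[OF f]
 show "c \<odot>\<^bsub>P\<^esub> f \<in> carrier P" for c
  by (rule P_carrierI[OF _ P_carrierD(2,3)[OF f]])
   (use fc in \<open>auto simp: P_simps C.smult_closed zero_off_supp C.smult_zero_right\<close>)
 show "involution P f \<in> carrier P"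
 proof (rule P_carrierI[where S = "(\<lambda>g. inv g) ` supp f"])
  show "involution P f g \<in> carrier C" for g
   using fc by (simp add: P_simps \<alpha>_closed C.involution_closed C.zero_in_carrier)
  show "finite ((\<lambda>g. inv g) ` supp f)" using P_carrierD(2)[OF f] by simp
  show "(\<lambda>g. inv g) ` supp f \<subseteq> carrier G" using P_carrierD(3)[OF f] by auto
  fix g assume g: "g \<notin> (\<lambda>g. inv g) ` supp f"
  show "involution P f g = \<zero>\<^bsub>C\<^esub>"
  proof (cases "g \<in> carrier G")
   case True
   then have "g = inv (inv g)" by simp
   then have "inv g \<notin> supp f" using g by blast
   then show ?thesis using True by (simp add: P_simps zero_off_supp involution_zero \<alpha>_zero)
  qed (simp add: P_simps)
 qed
 assume h: "h \<in> carrier P"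
 note hc = P_carrierD(1)[OF h]
 show "f \<oplus>\<^bsub>P\<^esub> h \<in> carrier P"
  by (rule P_carrierI[where S = "supp f \<union> supp h"])
   (use fc hc P_carrierD(2,3)[OF f] P_carrierD(2,3)[OF h] in
    \<open>auto simp: P_simps C.add_closed zero_off_supp C.zero_add C.zero_in_carrier\<close>)
 show "f \<otimes>\<^bsub>P\<^esub> h \<in> carrier P"
 proof (rule P_carrierI[where S = "(\<lambda>(k, l). k \<otimes> l) ` (supp f \<times> supp h)"])
  show "(f \<otimes>\<^bsub>P\<^esub> h) g \<in> carrier C" for g
   using fc hc P_carrierD(3)[OF f]
   by (auto simp: P_simps C.zero_in_carrier intro!: C.finsum_closed C.mult_closed \<alpha>_closed)
  show "(\<lambda>(k, l). k \<otimes> l) ` (supp f \<times> supp h) \<subseteq> carrier G"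
   using P_carrierD(3)[OF f] P_carrierD(3)[OF h] by auto
  show "(f \<otimes>\<^bsub>P\<^esub> h) g = \<zero>\<^bsub>C\<^esub>" if "g \<notin> (\<lambda>(k, l). k \<otimes> l) ` (supp f \<times> supp h)" for g
   using mult_support[OF f h] that by blast
 qed (use P_carrierD(2)[OF f] P_carrierD(2)[OF h] in simp)
next
 show "\<zero>\<^bsub>P\<^esub> \<in> carrier P" by (rule P_carrierI[of _ "{}"]) (auto simp: P_simps C.zero_in_carrier)
qed (auto simp: P_simps C.add_assoc C.zero_add C.smult_add_right C.smult_add_left C.smult_smult C.smult_1 C.smult_0
  intro: C.add_comm)

interpretation P: star_space P by (rule star_space_P)

text \<open>\<open>\<tau> g a\<close> stands for \<pi>(a) u_g in a covariant pair. Keeping it as one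
  datum lets the construction work without unitaries u_g.\<close>

definition integrated :: "('g \<Rightarrow> 'c \<Rightarrow> 'k \<Rightarrow> 'k::chilbert_space) \<Rightarrow> ('g \<Rightarrow> 'c) \<Rightarrow> 'k \<Rightarrow> 'k" where
 "integrated \<tau> f = (\<lambda>v. \<Sum>g\<in>supp f. \<tau> g (f g) v)"

lemma integrated_superset:
 assumes \<tau>: "\<And>g. g \<in> carrier G \<Longrightarrow> linear_map C bounded_ops (\<tau> g)"
  and S: "finite S" "supp f \<subseteq> S" "S \<subseteq> carrier G"
 shows "integrated \<tau> f = (\<lambda>v. \<Sum>g\<in>S. \<tau> g (f g) v)"
proof -
 have "\<tau> g (f g) v = 0" if "g \<in> S - supp f" for g v
  using linear_map_zero[OF C.star_space_axioms bounded_ops.star_space_axioms \<tau>[of g]] S(3) that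
  by (auto simp: zero_off_supp)
 then show ?thesis unfolding integrated_def using S by (intro ext sum.mono_neutral_left) auto
qed

text \<open>The hypotheses are the relations (a u_g)(b u_h) = a \<alpha>_g(b) u_gh and the formula
  for the adjoint of a u_g, stated for \<open>\<tau>\<close>.\<close>

lemma star_hom_integrated:
 fixes \<tau> :: "'g \<Rightarrow> 'c \<Rightarrow> 'k \<Rightarrow> 'k::chilbert_space"
 assumes \<tau>: "\<And>g. g \<in> carrier G \<Longrightarrow> linear_map C bounded_ops (\<tau> g)"
  and mult: "\<And>g h a b. g \<in> carrier G \<Longrightarrow> h \<in> carrier G \<Longrightarrow> a \<in> carrier C \<Longrightarrow> b \<in> carrier C \<Longrightarrow>
   \<tau> g a \<circ> \<tau> h b = \<tau> (g \<otimes> h) (a \<otimes>\<^bsub>C\<^esub> \<alpha> g b)"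
  and star: "\<And>g a. g \<in> carrier G \<Longrightarrow> a \<in> carrier C \<Longrightarrow> cadjoint (\<tau> g a) = \<tau> (inv g) (\<alpha> (inv g) (involution C a))"
 shows "star_hom P bounded_ops (integrated \<tau>)"
 unfolding star_hom_def
proof (intro conjI ballI allI)
 have b: "bounded_clinear (\<tau> g a)" if "g \<in> carrier G" "a \<in> carrier C" for g a
  using linear_map_closed[OF \<tau>[OF that(1)] that(2)] by simp
 have z: "\<tau> g \<zero>\<^bsub>C\<^esub> = (\<lambda>_. 0)" if "g \<in> carrier G" for g
  using linear_map_zero[OF C.star_space_axioms bounded_ops.star_space_axioms \<tau>[OF that]] by simp
 note sup = integrated_superset[of \<tau>, OF \<tau>]
 show "integrated \<tau> \<in> carrier P \<rightarrow> carrier bounded_ops"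
 proof
  fix f assume f: "f \<in> carrier P"
  show "integrated \<tau> f \<in> carrier bounded_ops"
   unfolding integrated_def using P_carrierD[OF f] by (auto intro!: clinear_setsum b)
 qed
 fix f c assume f: "f \<in> carrier P"
 note fD = P_carrierD[OF f]
 have fG: "g \<in> carrier G" if "g \<in> supp f" for g using fD(3) that by blast
 show "integrated \<tau> (c \<odot>\<^bsub>P\<^esub> f) = c \<odot>\<^bsub>bounded_ops\<^esub> integrated \<tau> f"
 proof -
  have "supp (c \<odot>\<^bsub>P\<^esub> f) \<subseteq> supp f" by (auto simp: supp_def P_simps C.smult_zero_right)
  from sup[OF _ fD(2) this fD(3)] have "integrated \<tau> (c \<odot>\<^bsub>P\<^esub> f) = (\<lambda>v. \<Sum>g\<in>supp f. \<tau> g (c \<odot>\<^bsub>C\<^esub> f g) v)"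
   by (simp add: P_simps)
  also have "\<dots> = (\<lambda>v. \<Sum>g\<in>supp f. c *\<^sub>C \<tau> g (f g) v)"
   using linear_map_smult[OF \<tau>[OF fG] fD(1)] by (intro ext sum.cong) simp_all
  finally show ?thesis by (simp add: integrated_def cvs.scale_sum_right)
 qed
 show "integrated \<tau> (involution P f) = involution bounded_ops (integrated \<tau> f)"
 proof -
  define S where "S = (\<lambda>g. inv g) ` supp f"
  have S: "finite S" "S \<subseteq> carrier G" using fD fG by (auto simp: S_def)
  have sub: "supp (involution P f) \<subseteq> S"
  proof
   fix g assume "g \<in> supp (involution P f)"
   then have g: "involution P f g \<noteq> \<zero>\<^bsub>C\<^esub>" unfolding supp_def by (rule CollectD)
   have gG: "g \<in> carrier G"
   proof (rule ccontr)
    assume "g \<notin> carrier G"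
    then have "involution P f g = \<zero>\<^bsub>C\<^esub>" by (simp add: P_simps(6))
    with g show False by (rule notE)
   qed
   have "inv g \<in> supp f"
   proof (rule ccontr)
    assume "inv g \<notin> supp f"
    then have "involution P f g = \<zero>\<^bsub>C\<^esub>"
     using gG by (simp add: P_simps(6) zero_off_supp involution_zero \<alpha>_zero)
    with g show False by (rule notE)
   qed
   then have "inv (inv g) \<in> S" unfolding S_def by (rule imageI)
   then show "g \<in> S" using gG by simp
  qed
  have inj: "inj_on (\<lambda>g. inv g) (supp f)"
  proof (rule inj_onI)
   fix k l assume kl: "k \<in> supp f" "l \<in> supp f" "inv k = inv l"
   then have "inv (inv k) = inv (inv l)" by simp
   then show "k = l" using fG[OF kl(1)] fG[OF kl(2)] by simp
  qed
  have "integrated \<tau> (involution P f) = (\<lambda>v. \<Sum>g\<in>S. \<tau> g (involution P f g) v)" by (rule sup[OF _ S(1) sub S(2)])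
  also have "\<dots> = (\<lambda>v. \<Sum>k\<in>supp f. \<tau> (inv k) (involution P f (inv k)) v)"
   unfolding S_def by (simp add: sum.reindex[OF inj])
  also have "\<dots> = (\<lambda>v. \<Sum>k\<in>supp f. cadjoint (\<tau> k (f k)) v)"
   using fG fD(1) by (intro ext sum.cong) (simp_all add: star P_simps)
  also have "\<dots> = cadjoint (integrated \<tau> f)"
   unfolding integrated_def using fG fD(1) by (intro clinear_rep_sum[symmetric] b) auto
  finally show ?thesis by simp
 qed
 fix h assume h: "h \<in> carrier P"
 note hD = P_carrierD[OF h]
 have hG: "g \<in> carrier G" if "g \<in> supp h" for g using hD(3) that by blast
 show "integrated \<tau> (f \<oplus>\<^bsub>P\<^esub> h) = integrated \<tau> f \<oplus>\<^bsub>bounded_ops\<^esub> integrated \<tau> h"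
 proof -
  define S where "S = supp f \<union> supp h"
  have S: "finite S" "S \<subseteq> carrier G" "supp f \<subseteq> S" "supp h \<subseteq> S" using fD hD by (auto simp: S_def)
  have sub: "supp (f \<oplus>\<^bsub>P\<^esub> h) \<subseteq> S"
  proof
   fix g assume g: "g \<in> supp (f \<oplus>\<^bsub>P\<^esub> h)"
   show "g \<in> S"
   proof (rule ccontr)
    assume "g \<notin> S"
    then have "f g = \<zero>\<^bsub>C\<^esub>" "h g = \<zero>\<^bsub>C\<^esub>" by (auto simp: S_def zero_off_supp)
    then show False using g by (simp add: supp_def P_simps C.zero_add C.zero_in_carrier)
   qed
  qed
  have "integrated \<tau> (f \<oplus>\<^bsub>P\<^esub> h) = (\<lambda>v. \<Sum>g\<in>S. \<tau> g ((f \<oplus>\<^bsub>P\<^esub> h) g) v)"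
   by (rule sup[OF _ S(1) sub S(2)])
  also have "\<dots> = (\<lambda>v. \<Sum>g\<in>S. \<tau> g (f g) v + \<tau> g (h g) v)"
   using S(2) fD(1) hD(1) linear_map_add[OF \<tau>] by (intro ext sum.cong) (auto simp: P_simps subset_iff)
  finally show ?thesis
   using sup[OF _ S(1,3,2)] sup[OF _ S(1,4,2)] by (simp add: sum.distrib)
 qed
 show "integrated \<tau> (f \<otimes>\<^bsub>P\<^esub> h) = integrated \<tau> f \<otimes>\<^bsub>bounded_ops\<^esub> integrated \<tau> h"
 proof
  fix v
  define S where "S = (\<lambda>(k, l). k \<otimes> l) ` (supp f \<times> supp h)"
  have S: "finite S" "S \<subseteq> carrier G" using fD hD fG hG by (auto simp: S_def)
  have sub: "supp (f \<otimes>\<^bsub>P\<^esub> h) \<subseteq> S" using mult_support[OF f h] unfolding S_def supp_def by blast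
  \<comment> \<open>For fixed k the substitution g = k l lets l run through the support of h; for
    all other g in \<open>S\<close> the factor h vanishes.\<close>
  have inner: "(\<Sum>g\<in>S. \<tau> g (twisted f h g k) v) = \<tau> k (f k) (integrated \<tau> h v)"
   if k: "k \<in> supp f" for k
  proof -
   have kG: "k \<in> carrier G" by (rule fG[OF k])
   have t: "\<tau> g (twisted f h g k) v = \<tau> k (f k) (\<tau> (inv k \<otimes> g) (h (inv k \<otimes> g)) v)"
    if g: "g \<in> S" for g
   proof -
    have gG: "g \<in> carrier G" using S g by blast
    have "k \<otimes> (inv k \<otimes> g) = g" using kG gG by (simp add: G.m_assoc[symmetric])
    then show ?thesis
     using fun_cong[OF mult[OF kG, of "inv k \<otimes> g" "f k" "h (inv k \<otimes> g)"], of v] kG gG fD(1) hD(1) by simp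
   qed
   have inj: "inj_on (\<lambda>l. k \<otimes> l) (supp h)" by (rule inj_onI) (simp add: hG kG)
   have kS: "(\<lambda>l. k \<otimes> l) ` supp h \<subseteq> S" using k by (auto simp: S_def)
   have "(\<Sum>g\<in>S. \<tau> g (twisted f h g k) v)
     = (\<Sum>g\<in>S. \<tau> k (f k) (\<tau> (inv k \<otimes> g) (h (inv k \<otimes> g)) v))"
    by (rule sum.cong[OF refl t])
   also have "\<dots> = (\<Sum>g\<in>(\<lambda>l. k \<otimes> l) ` supp h. \<tau> k (f k) (\<tau> (inv k \<otimes> g) (h (inv k \<otimes> g)) v))"
   proof (rule sum.mono_neutral_right[OF S(1) kS], rule ballI)
    fix g assume g: "g \<in> S - (\<lambda>l. k \<otimes> l) ` supp h"
    then have gG: "g \<in> carrier G" using S by blast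
    have "g = k \<otimes> (inv k \<otimes> g)" using kG gG by (simp add: G.m_assoc[symmetric])
    then have "inv k \<otimes> g \<notin> supp h" using g by blast
    then show "\<tau> k (f k) (\<tau> (inv k \<otimes> g) (h (inv k \<otimes> g)) v) = 0"
     using kG gG by (simp add: zero_off_supp z clinear_zero[OF b[OF kG fD(1)]])
   qed
   also have "\<dots> = (\<Sum>l\<in>supp h. \<tau> k (f k) (\<tau> l (h l) v))"
    unfolding sum.reindex[OF inj] using kG hG
    by (intro sum.cong) (simp_all add: G.m_assoc[symmetric])
   also have "\<dots> = \<tau> k (f k) (integrated \<tau> h v)"
    unfolding integrated_def by (rule clinear_sum[OF b[OF kG fD(1)], symmetric])
   finally show ?thesis .
  qed
  have "integrated \<tau> (f \<otimes>\<^bsub>P\<^esub> h) v = (\<Sum>g\<in>S. \<tau> g ((f \<otimes>\<^bsub>P\<^esub> h) g) v)"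
   by (rule fun_cong[OF sup[OF _ S(1) sub S(2)]])
  also have "\<dots> = (\<Sum>g\<in>S. \<Sum>k\<in>supp f. \<tau> g (twisted f h g k) v)"
  proof (rule sum.cong[OF refl])
   fix g assume "g \<in> S"
   then have gG: "g \<in> carrier G" using S by blast
   have "\<tau> g (finsum C (twisted f h g) (supp f))
     = (\<lambda>v. \<Sum>k\<in>supp f. \<tau> g (twisted f h g k) v)"
    by (rule linear_map_finsum_ops[OF C.star_space_axioms \<tau>[OF gG] fD(2)])
     (intro C.mult_closed \<alpha>_closed fD(1) hD(1) fG)
   then show "\<tau> g ((f \<otimes>\<^bsub>P\<^esub> h) g) v = (\<Sum>k\<in>supp f. \<tau> g (twisted f h g k) v)"
    using gG by (simp add: P_simps)
  qed
  also have "\<dots> = (\<Sum>k\<in>supp f. \<Sum>g\<in>S. \<tau> g (twisted f h g k) v)" by (rule sum.swap)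
  also have "\<dots> = (\<Sum>k\<in>supp f. \<tau> k (f k) (integrated \<tau> h v))" by (rule sum.cong[OF refl inner])
  also have "\<dots> = (integrated \<tau> f \<otimes>\<^bsub>bounded_ops\<^esub> integrated \<tau> h) v" by (simp add: integrated_def)
  finally show "integrated \<tau> (f \<otimes>\<^bsub>P\<^esub> h) v = (integrated \<tau> f \<otimes>\<^bsub>bounded_ops\<^esub> integrated \<tau> h) v" .
 qed
qed

section \<open>Calculus of the elements a u_g\<close>

abbreviation single :: "'g \<Rightarrow> 'c \<Rightarrow> 'g \<Rightarrow> 'c" where "single \<equiv> cp_single C"

lemma single_supp: "supp (single g a) \<subseteq> {g}"
 by (auto simp: supp_def cp_single_def)

lemma single_closed: "g \<in> carrier G \<Longrightarrow> a \<in> carrier C \<Longrightarrow> single g a \<in> carrier P"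
 by (rule P_carrierI[where S = "{g}"]) (auto simp: cp_single_def C.zero_in_carrier)

lemma single_add: "a \<in> carrier C \<Longrightarrow> b \<in> carrier C \<Longrightarrow> single g a \<oplus>\<^bsub>P\<^esub> single g b = single g (a \<oplus>\<^bsub>C\<^esub> b)"
 by (auto simp: cp_single_def P_simps C.zero_add C.zero_in_carrier)

lemma single_smult: "c \<odot>\<^bsub>P\<^esub> single g a = single g (c \<odot>\<^bsub>C\<^esub> a)"
 by (auto simp: cp_single_def P_simps C.smult_zero_right)

lemma single_mult:
 assumes g: "g \<in> carrier G" "h \<in> carrier G" and a: "a \<in> carrier C" "b \<in> carrier C"
 shows "single g a \<otimes>\<^bsub>P\<^esub> single h b = single (g \<otimes> h) (a \<otimes>\<^bsub>C\<^esub> \<alpha> g b)"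
proof
 fix k
 show "(single g a \<otimes>\<^bsub>P\<^esub> single h b) k = single (g \<otimes> h) (a \<otimes>\<^bsub>C\<^esub> \<alpha> g b) k"
 proof (cases "k \<in> carrier G")
  case True
  have "(single g a \<otimes>\<^bsub>P\<^esub> single h b) k
    = finsum C (\<lambda>l. single g a l \<otimes>\<^bsub>C\<^esub> \<alpha> l (single h b (inv l \<otimes> k))) {g}"
   by (rule mult_superset[OF single_closed[OF g(1) a(1)] single_closed[OF g(2) a(2)] _ single_supp _ True]) (use g in auto)
  also have "\<dots> = a \<otimes>\<^bsub>C\<^esub> \<alpha> g (single h b (inv g \<otimes> k)) \<oplus>\<^bsub>C\<^esub> finsum C (\<lambda>l. single g a l \<otimes>\<^bsub>C\<^esub> \<alpha> l (single h b (inv l \<otimes> k))) {}"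
   using P_carrierD(1)[OF single_closed[OF g(2) a(2)]] a g
   by (subst C.finsum_insert) (auto simp: cp_single_def intro!: C.mult_closed \<alpha>_closed)
  also have "\<dots> = a \<otimes>\<^bsub>C\<^esub> \<alpha> g (single h b (inv g \<otimes> k))"
   using P_carrierD(1)[OF single_closed[OF g(2) a(2)]] a g
   by (simp add: C.finsum_empty C.mult_closed \<alpha>_closed)
  also have "\<dots> = single (g \<otimes> h) (a \<otimes>\<^bsub>C\<^esub> \<alpha> g b) k"
  proof (cases "k = g \<otimes> h")
   case True
   then show ?thesis using g by (simp add: cp_single_def G.m_assoc[symmetric])
  next
   case False
   have "inv g \<otimes> k \<noteq> h"
   proof
    assume "inv g \<otimes> k = h"
    then have "g \<otimes> h = k" using g True by (auto simp: G.m_assoc[symmetric])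
    then show False using False by simp
   qed
   then show ?thesis using False a g by (simp add: cp_single_def \<alpha>_zero mult_zero)
  qed
  finally show ?thesis .
 next
  case False
  then show ?thesis using g by (auto simp: P_simps cp_single_def)
 qed
qed

lemma single_involution:
 assumes g: "g \<in> carrier G" and a: "a \<in> carrier C"
 shows "involution P (single g a) = single (inv g) (\<alpha> (inv g) (involution C a))"
proof
 fix k
 show "involution P (single g a) k = single (inv g) (\<alpha> (inv g) (involution C a)) k"
 proof (cases "k \<in> carrier G")
  case True
  have "inv k = g \<longleftrightarrow> k = inv g" using True g by auto
  then show ?thesis using True by (auto simp: P_simps cp_single_def involution_zero \<alpha>_zero)
 next
  case False
  then show ?thesis using g by (auto simp: P_simps cp_single_def)
 qed
qed

end

lemma (in crossed_system) star_hom_functorial: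
 assumes C': "crossed_system G C' \<alpha>'" and j: "star_hom C C' j"
  and eq: "\<And>g a. g \<in> carrier G \<Longrightarrow> a \<in> carrier C \<Longrightarrow> j (\<alpha> g a) = \<alpha>' g (j a)"
 shows "star_hom P (alg_crossed_product G C' \<alpha>') (\<lambda>f g. j (f g))"
proof -
 interpret C': crossed_system G C' \<alpha>' by fact
 note jl = star_hom_linear[OF j]
 have j0: "j \<zero>\<^bsub>C\<^esub> = \<zero>\<^bsub>C'\<^esub>" by (rule linear_map_zero[OF C.star_space_axioms C'.C.star_space_axioms jl])
 have sub: "C'.supp (\<lambda>g. j (f g)) \<subseteq> supp f" for f by (auto simp: C'.supp_def supp_def j0)
 have cl: "(\<lambda>g. j (f g)) \<in> carrier C'.P" if f: "f \<in> carrier P" for f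
  by (rule C'.P_carrierI[OF _ P_carrierD(2,3)[OF f]])
   (use star_hom_closed[OF j P_carrierD(1)[OF f]] in \<open>auto simp: zero_off_supp j0\<close>)
 show ?thesis
  unfolding star_hom_def
 proof (intro conjI ballI allI)
  show "(\<lambda>f g. j (f g)) \<in> carrier P \<rightarrow> carrier C'.P" using cl by blast
  fix f c assume f: "f \<in> carrier P"
  note fD = P_carrierD[OF f]
  show "(\<lambda>g. j ((c \<odot>\<^bsub>P\<^esub> f) g)) = c \<odot>\<^bsub>C'.P\<^esub> (\<lambda>g. j (f g))"
   using linear_map_smult[OF jl fD(1)] by (simp add: P_simps C'.P_simps)
  show "(\<lambda>g. j (involution P f g)) = involution C'.P (\<lambda>g. j (f g))"
   using fD(1) by (auto simp: P_simps C'.P_simps j0 eq C.involution_closed star_hom_involution[OF j])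
  fix h assume h: "h \<in> carrier P"
  note hD = P_carrierD[OF h]
  show "(\<lambda>g. j ((f \<oplus>\<^bsub>P\<^esub> h) g)) = (\<lambda>g. j (f g)) \<oplus>\<^bsub>C'.P\<^esub> (\<lambda>g. j (h g))"
   using linear_map_add[OF jl fD(1) hD(1)] by (simp add: P_simps C'.P_simps)
  show "(\<lambda>g. j ((f \<otimes>\<^bsub>P\<^esub> h) g)) = (\<lambda>g. j (f g)) \<otimes>\<^bsub>C'.P\<^esub> (\<lambda>g. j (h g))"
  proof
   fix g
   show "j ((f \<otimes>\<^bsub>P\<^esub> h) g) = ((\<lambda>g. j (f g)) \<otimes>\<^bsub>C'.P\<^esub> (\<lambda>g. j (h g))) g"
   proof (cases "g \<in> carrier G")
    case g: True
    have fG: "k \<in> carrier G" if "k \<in> supp f" for k using fD(3) that by blast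
    have "j ((f \<otimes>\<^bsub>P\<^esub> h) g) = finsum C' (\<lambda>k. j (twisted f h g k)) (supp f)"
     using g linear_map_finsum[OF C.star_space_axioms C'.C.star_space_axioms jl fD(2), of "\<lambda>k. twisted f h g k"]
     by (simp add: P_simps C.mult_closed fD(1) hD(1) \<alpha>_closed fG)
    also have "\<dots> = finsum C' (\<lambda>k. j (f k) \<otimes>\<^bsub>C'\<^esub> \<alpha>' k (j (h (inv k \<otimes> g)))) (supp f)"
    proof (rule C'.C.finsum_cong')
     show "(\<lambda>k. j (f k) \<otimes>\<^bsub>C'\<^esub> \<alpha>' k (j (h (inv k \<otimes> g)))) \<in> supp f \<rightarrow> carrier C'"
      by (auto intro!: C'.C.mult_closed C'.\<alpha>_closed star_hom_closed[OF j] fD(1) hD(1) fG)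
     show "j (twisted f h g k) = j (f k) \<otimes>\<^bsub>C'\<^esub> \<alpha>' k (j (h (inv k \<otimes> g)))"
      if "k \<in> supp f" for k
      by (simp add: star_hom_mult[OF j] fD(1) hD(1) \<alpha>_closed fG[OF that] eq)
    qed simp
    also have "\<dots> = ((\<lambda>g. j (f g)) \<otimes>\<^bsub>C'.P\<^esub> (\<lambda>g. j (h g))) g"
     by (rule C'.mult_superset[OF cl[OF f] cl[OF h] fD(2) sub fD(3) g, symmetric])
    finally show ?thesis .
   qed (simp add: P_simps C'.P_simps j0)
  qed
 qed
qed

text \<open>The representation bound for crossed products of Banach star algebras comes from
 $\|\pi(a u_g)\|^2 = \|\pi(a a^*)\|$.\<close>

locale banach_crossed_system = crossed_system G C \<alpha> + C: banach_star C
 for G :: "('g, 'z) monoid_scheme" (structure) and C :: "('c, 'm) normed_star_alg_scheme" and \<alpha> :: "'g \<Rightarrow> 'c \<Rightarrow> 'c"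
begin

lemma rep_single_le:
 fixes \<pi> :: "('g \<Rightarrow> 'c) \<Rightarrow> 'k \<Rightarrow> 'k::chilbert_space"
 assumes \<pi>: "star_hom P bounded_ops \<pi>" and g: "g \<in> carrier G" and a: "a \<in> carrier C"
 shows "onorm (\<pi> (single g a)) \<le> C.nrm a"
proof -
 note f = rep_facts[OF \<pi>]
 note one = G.one_closed
 have hom: "star_hom C bounded_ops (\<lambda>a. \<pi> (single \<one> a))"
  unfolding star_hom_def
 proof (intro conjI ballI allI)
  show "(\<lambda>a. \<pi> (single \<one> a)) \<in> carrier C \<rightarrow> carrier bounded_ops" using f(1) single_closed[OF one] by simp
  fix a c assume a: "a \<in> carrier C"
  show "\<pi> (single \<one> (c \<odot>\<^bsub>C\<^esub> a)) = c \<odot>\<^bsub>bounded_ops\<^esub> \<pi> (single \<one> a)"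
   using f(3)[OF single_closed[OF one a], of c] by (simp add: single_smult)
  show "\<pi> (single \<one> (involution C a)) = involution bounded_ops (\<pi> (single \<one> a))"
   using f(2)[OF single_closed[OF one a]] a by (simp add: single_involution \<alpha>_one C.involution_closed)
  fix b assume b: "b \<in> carrier C"
  show "\<pi> (single \<one> (a \<oplus>\<^bsub>C\<^esub> b)) = \<pi> (single \<one> a) \<oplus>\<^bsub>bounded_ops\<^esub> \<pi> (single \<one> b)"
   using f(4)[OF single_closed[OF one a] single_closed[OF one b]] a b by (simp add: single_add)
  show "\<pi> (single \<one> (a \<otimes>\<^bsub>C\<^esub> b)) = \<pi> (single \<one> a) \<otimes>\<^bsub>bounded_ops\<^esub> \<pi> (single \<one> b)"
   using f(5)[OF single_closed[OF one a] single_closed[OF one b]] a b by (simp add: single_mult \<alpha>_one)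
 qed
 define T where "T = \<pi> (single g a)"
 have Tb: "bounded_clinear T" unfolding T_def by (rule f(1)[OF single_closed[OF g a]])
 have aa: "involution C a \<in> carrier C" by (rule C.involution_closed[OF a])
 have si: "single (inv g) (\<alpha> (inv g) (involution C a)) \<in> carrier P"
  using g aa by (intro single_closed \<alpha>_closed) auto
 have "T \<circ> cadjoint T = \<pi> (single g a \<otimes>\<^bsub>P\<^esub> single (inv g) (\<alpha> (inv g) (involution C a)))"
  unfolding T_def using f(2)[OF single_closed[OF g a]] f(5)[OF single_closed[OF g a] si]
  by (simp add: single_involution[OF g a])
 also have "single g a \<otimes>\<^bsub>P\<^esub> single (inv g) (\<alpha> (inv g) (involution C a)) = single \<one> (a \<otimes>\<^bsub>C\<^esub> involution C a)"
  using g a aa by (simp add: single_mult \<alpha>_closed \<alpha>_mult \<alpha>_one)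
 finally have TT: "T \<circ> cadjoint T = \<pi> (single \<one> (a \<otimes>\<^bsub>C\<^esub> involution C a))" .
 have "(onorm (cadjoint T))\<^sup>2 \<le> onorm (cadjoint (cadjoint T) \<circ> cadjoint T)"
  by (rule onorm_le_sqrt[OF bounded_clinear_cadjoint[OF Tb]])
 also have "\<dots> = onorm (\<pi> (single \<one> (a \<otimes>\<^bsub>C\<^esub> involution C a)))" by (simp add: cadjoint_cadjoint[OF Tb] TT)
 also have "\<dots> \<le> C.nrm (a \<otimes>\<^bsub>C\<^esub> involution C a)"
  by (rule C.rep_contractive[OF hom C.mult_closed[OF a aa]])
 also have "\<dots> \<le> (C.nrm a)\<^sup>2"
  using C.norm_mult[OF a aa] a by (simp add: C.norm_involution power2_eq_square)
 finally have "(onorm T)\<^sup>2 \<le> (C.nrm a)\<^sup>2" by (simp add: onorm_cadjoint[OF Tb])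
 then show ?thesis unfolding T_def by (rule power2_le_imp_le) (rule C.norm_nonneg[OF a])
qed

text \<open>The crude bound by the sum of coefficient norms gives finiteness of the maximal norm and
  the density of elements with coefficients in a dense subalgebra.\<close>

lemma rep_le_sum:
 fixes \<pi> :: "('g \<Rightarrow> 'c) \<Rightarrow> 'k \<Rightarrow> 'k::chilbert_space"
 assumes \<pi>: "star_hom P bounded_ops \<pi>" and S: "finite S" "S \<subseteq> carrier G"
  and f: "f \<in> carrier P" "supp f \<subseteq> S"
 shows "onorm (\<pi> f) \<le> (\<Sum>g\<in>S. C.nrm (f g))"
 using S f
proof (induction S arbitrary: f rule: finite_induct)
 case empty
 have "f = \<zero>\<^bsub>P\<^esub>" using empty zero_off_supp[of _ f] by (auto simp: P_simps)
 then have "\<pi> f = (\<lambda>_. 0)"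
  using linear_map_zero[OF star_space_P bounded_ops.star_space_axioms star_hom_linear[OF \<pi>]] by simp
 then show ?case by (simp add: onorm_zero)
next
 case (insert g S)
 have g: "g \<in> carrier G" using insert by simp
 have fg: "f g \<in> carrier C" by (rule P_carrierD(1)[OF insert.prems(2)])
 define f' where "f' = f(g := \<zero>\<^bsub>C\<^esub>)"
 have f'S: "supp f' \<subseteq> S" using insert.prems(3) by (auto simp: f'_def supp_def)
 have f': "f' \<in> carrier P"
  using P_carrierD[OF insert.prems(2)]
  by (intro P_carrierI[of f' "supp f"]) (auto simp: f'_def C.zero_in_carrier zero_off_supp)
 have "f = single g (f g) \<oplus>\<^bsub>P\<^esub> f'"
  using P_carrierD(1)[OF insert.prems(2)] fg
  by (auto simp: P_simps f'_def cp_single_def fun_eq_iff C.zero_add C.zero_in_carrier)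
 then have "\<pi> f = (\<lambda>v. \<pi> (single g (f g)) v + \<pi> f' v)"
  using rep_facts(4)[OF \<pi> single_closed[OF g fg] f'] by simp
 then have "onorm (\<pi> f) \<le> onorm (\<pi> (single g (f g))) + onorm (\<pi> f')"
  using rep_facts(1)[OF \<pi> single_closed[OF g fg]] rep_facts(1)[OF \<pi> f']
  by (simp add: onorm_triangle bounded_clinearD)
 also have "\<dots> \<le> C.nrm (f g) + (\<Sum>k\<in>S. C.nrm (f' k))"
  using insert.prems(1) by (intro add_mono rep_single_le[OF \<pi> g fg] insert.IH f' f'S) simp
 also have "(\<Sum>k\<in>S. C.nrm (f' k)) = (\<Sum>k\<in>S. C.nrm (f k))"
  using insert.hyps(2) by (intro sum.cong) (auto simp: f'_def)
 finally show ?case using insert.hyps by simp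
qed

lemma star_bdd_P: "star_bdd P"
 by (rule star_bddI[OF star_space_P])
  (use rep_le_sum[OF _ P_carrierD(2,3) _ subset_refl] in blast)

sublocale P: star_bdd P by (rule star_bdd_P)

lemma max_norm_le_sum:
 assumes "f \<in> carrier P" "finite S" "S \<subseteq> carrier G" "supp f \<subseteq> S"
 shows "max_norm P f \<le> (\<Sum>g\<in>S. C.nrm (f g))"
 by (rule P.max_norm_leI) (rule rep_le_sum[OF _ assms(2,3,1,4)])

lemma dense_in_P:
 assumes dense: "C.dense_image j D" and j0: "z \<in> D" "j z = \<zero>\<^bsub>C\<^esub>" and f: "f \<in> carrier P" and e: "e > 0"
 obtains t where "\<And>g. t g \<in> D" "\<And>g. g \<notin> supp f \<Longrightarrow> t g = z" "(\<lambda>g. j (t g)) \<in> carrier P"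
  "max_norm P (f \<ominus>\<^bsub>P\<^esub> (\<lambda>g. j (t g))) < e"
proof -
 note fD = P_carrierD[OF f]
 \<comment> \<open>An error below \<open>r\<close> at each point of the support adds up to less than
   e; the summand 1 covers empty support. Outside the support the value \<open>z\<close> keeps the
   approximant finitely supported.\<close>
 define r where "r = e / (real (card (supp f)) + 1)"
 have r: "r > 0" using e by (simp add: r_def add_nonneg_pos)
 have "\<exists>x\<in>D. C.nrm (f g \<ominus>\<^bsub>C\<^esub> j x) < r" for g using dense fD(1) r unfolding C.dense_image_def by blast
 then obtain s where s: "\<And>g. s g \<in> D" "\<And>g. C.nrm (f g \<ominus>\<^bsub>C\<^esub> j (s g)) < r" by metis
 define t where "t g = (if g \<in> supp f then s g else z)" for g
 have tD: "t g \<in> D" for g using s j0 by (simp add: t_def)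
 have jt: "(\<lambda>g. j (t g)) \<in> carrier P"
 proof (rule P_carrierI[OF _ fD(2,3)])
  show "j (t g) \<in> carrier C" for g using dense tD unfolding C.dense_image_def by blast
  show "j (t g) = \<zero>\<^bsub>C\<^esub>" if "g \<notin> supp f" for g using that j0 by (simp add: t_def)
 qed
 have m: "f \<ominus>\<^bsub>P\<^esub> (\<lambda>g. j (t g)) = (\<lambda>g. f g \<ominus>\<^bsub>C\<^esub> j (t g))"
  using P.minus_eq_smult[OF f jt] C.minus_eq_smult[OF fD(1) P_carrierD(1)[OF jt]] by (simp add: P_simps)
 have "max_norm P (f \<ominus>\<^bsub>P\<^esub> (\<lambda>g. j (t g))) \<le> (\<Sum>g\<in>supp f. C.nrm ((f \<ominus>\<^bsub>P\<^esub> (\<lambda>g. j (t g))) g))"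
 proof (rule max_norm_le_sum[OF P.diff_closed[OF f jt] fD(2,3)])
  have "(f \<ominus>\<^bsub>P\<^esub> (\<lambda>g. j (t g))) g = \<zero>\<^bsub>C\<^esub>" if "g \<notin> supp f" for g
   unfolding m using that j0 by (simp add: t_def zero_off_supp C.minus_self C.zero_in_carrier)
  then show "supp (f \<ominus>\<^bsub>P\<^esub> (\<lambda>g. j (t g))) \<subseteq> supp f" unfolding supp_def[of "f \<ominus>\<^bsub>P\<^esub> (\<lambda>g. j (t g))"] by blast
 qed
 also have "\<dots> \<le> (\<Sum>g\<in>supp f. r)"
  unfolding m
 proof (rule sum_mono)
  show "C.nrm (f g \<ominus>\<^bsub>C\<^esub> j (t g)) \<le> r" if "g \<in> supp f" for g
   using s(2)[of g] that by (simp add: t_def)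
 qed
 also have "\<dots> = real (card (supp f)) * r" by simp
 also have "\<dots> < e" using e by (simp add: r_def field_simps)
 finally show ?thesis using that[of t] tD jt by (simp add: t_def)
qed

end

section \<open>Induced endomorphisms\<close>

context star_bdd
begin

context
 fixes f :: "'a \<Rightarrow> 'a"
 assumes f: "star_hom A A f"
begin

text \<open>A representation composed with \<open>f\<close> is again a representation, hence already
  counted in the supremum.\<close>

lemma max_norm_hom_le:
 assumes "x \<in> carrier A"
 shows "p (f x) \<le> p x"
proof (rule max_norm_leI)
 fix \<psi> assume "rep \<psi>"
 then have "rep (\<psi> \<circ> f)" by (rule star_hom_comp[OF f])
 from rep_le_max_norm[OF this assms] show "onorm (\<psi> (f x)) \<le> p x" by simp
qed

lemma max_norm_hom_minus_le: "x \<in> carrier A \<Longrightarrow> y \<in> carrier A \<Longrightarrow> p (f x \<ominus> f y) \<le> p (x \<ominus> y)"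
 using max_norm_hom_le[OF diff_closed]
 by (simp add: linear_map_minus[OF star_space_axioms star_space_axioms star_hom_linear[OF f]])

lemma CS_hom: "s \<in> CS \<Longrightarrow> (\<lambda>n. f (s n)) \<in> CS"
 by (rule CS_by_estimate[of s s _ 1 0])
  (simp_all add: star_hom_closed[OF f] max_norm_hom_minus_le CS_carrier)

lemma max_extend_cls:
 assumes s: "s \<in> CS"
 shows "max_extend A f (cls s) = cls (\<lambda>n. f (s n))"
 unfolding max_extend_def
proof (rule UN_cls[OF s])
 fix t assume t: "t \<in> CS" "cls t = cls s"
 show "cls (\<lambda>n. f (t n)) = cls (\<lambda>n. f (s n))"
  by (rule cls_by_estimate[OF t(1) s t(2) t(1) s t(2) CS_hom[OF t(1)] CS_hom[OF s], of 1 0])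
   (simp add: max_norm_hom_minus_le CS_carrier[OF s] CS_carrier[OF t(1)])
qed

lemma max_extend_max_embed: "x \<in> carrier A \<Longrightarrow> max_extend A f (max_embed A x) = max_embed A (f x)"
 unfolding max_embed_eq by (rule max_extend_cls[OF CS_const])

lemma star_hom_max_extend: "star_hom C C (max_extend A f)"
proof -
 note fl = star_hom_linear[OF f]
 have "star_hom seq_alg seq_alg (\<lambda>s n. f (s n))"
  by (auto simp: star_hom_def CS_hom CS_carrier linear_map_add[OF fl] linear_map_smult[OF fl] star_hom_mult[OF f]
    star_hom_involution[OF f])
 from star_hom_comp[OF this star_hom_cls] show ?thesis
  by (rule star_hom_factor[where f = cls and \<rho> = "cls \<circ> (\<lambda>s n. f (s n))", OF star_space_seq_alg star_hom_cls, rotated])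
   (auto simp: carrier_completion max_extend_cls)
qed

lemma norm_max_extend_le:
 assumes "x \<in> carrier C"
 shows "nrm (max_extend A f x) \<le> nrm x"
proof -
 obtain s where s: "s \<in> CS" "x = cls s" using assms unfolding carrier_completion by blast
 show ?thesis
  unfolding s(2) max_extend_cls[OF s(1)]
  by (rule LIMSEQ_le[OF norm_cls[OF CS_hom[OF s(1)]] norm_cls[OF s(1)]])
   (auto simp: max_norm_hom_le CS_carrier[OF s(1)])
qed

end

end

context closed_star_ideal
begin

context
 fixes F
 assumes F: "star_hom C C F" and FI: "\<And>x. x \<in> I \<Longrightarrow> F x \<in> I"
begin

lemma quotient_extend_coset:
 assumes a: "a \<in> carrier C"
 shows "quotient_extend C I F (coset a) = coset (F a)"
 unfolding quotient_extend_def
proof (rule UN_cos[OF a])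
 fix b assume "b \<in> coset a"
 then have b: "b \<in> carrier C" "b \<ominus> a \<in> I" using mem_cos[OF a] by blast+
 have "F b \<ominus> F a \<in> I"
  using FI[OF b(2)] linear_map_minus[OF star_space_axioms star_space_axioms star_hom_linear[OF F] b(1) a] by simp
 then show "coset (F b) = coset (F a)"
  using star_hom_closed[OF F] a b(1) by (simp add: cos_eq_iff)
qed

lemma star_hom_quotient_extend: "star_hom Q Q (quotient_extend C I F)"
 by (rule star_hom_factor[where f = "\<lambda>a. coset a", OF star_space_axioms star_hom_cos _ star_hom_comp[OF F star_hom_cos]])
  (auto simp: carrier_quotient quotient_extend_coset)

lemma norm_quotient_extend_le:
 assumes le: "\<And>a. a \<in> carrier C \<Longrightarrow> nrm (F a) \<le> nrm a" and x: "x \<in> carrier Q"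
 shows "alg_norm Q (quotient_extend C I F x) \<le> alg_norm Q x"
proof (rule field_le_epsilon)
 fix e :: real assume e: "e > 0"
 obtain a where a: "a \<in> carrier C" "x = coset a" using x unfolding carrier_quotient by blast
 obtain b where b: "b \<in> carrier C" "coset b = coset a" "nrm b < alg_norm Q x + e"
  using quotient_norm_less[OF a(1), of "alg_norm Q x + e"] a(2) e by auto
 have "alg_norm Q (quotient_extend C I F (coset b)) \<le> nrm (F b)"
  unfolding quotient_extend_coset[OF b(1)] by (rule quotient_norm_le_self[OF star_hom_closed[OF F b(1)]])
 then show "alg_norm Q (quotient_extend C I F x) \<le> alg_norm Q x + e"
  using le[OF b(1)] b(2,3) a(2) by simp
qed

end

end

context roe_space
begin

abbreviation induced :: "(('x, 'h) ell2_op \<Rightarrow> ('x, 'h) ell2_op)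
  \<Rightarrow> ('x, 'h) max_roe set \<Rightarrow> ('x, 'h) max_roe set" where
 "induced f \<equiv> quotient_extend (max_roe_alg X d) K (max_extend A f)"

lemma max_extend_K:
 assumes f: "star_hom A A f" and r: "\<And>r. r \<in> ranks \<Longrightarrow> f r \<in> ranks" and x: "x \<in> K"
 shows "max_extend A f x \<in> K"
proof -
 note Fl = star_hom_linear[OF roe.star_hom_max_extend[OF f]]
 show ?thesis
 proof (rule closed_span_image[where k = "\<lambda>c. c",
    OF ideal.normed_star_axioms ideal.normed_star_axioms _ closed_subspace_K _ _ _ _ _ x[unfolded K_eq]])
  show "max_embed A ` ranks \<subseteq> carrier roe.C"
   using ranks_in_roe star_hom_closed[OF roe.star_hom_max_embed] by blast
  show "max_extend A f \<zero>\<^bsub>roe.C\<^esub> \<in> K"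
   by (simp only: linear_map_zero[OF ideal.star_space_axioms ideal.star_space_axioms Fl] ideal.I_zero)
  show "ideal.conv (\<lambda>n. max_extend A f (s n)) (max_extend A f a)" if "ideal.conv s a" for s a
   by (rule contraction_conv[OF ideal.normed_star_axioms ideal.normed_star_axioms Fl roe.norm_max_extend_le[OF f] that])
  show "max_extend A f y \<in> K" if y: "y \<in> max_embed A ` ranks" for y
  proof -
   obtain u where u: "u \<in> ranks" "y = max_embed A u" using y by blast
   show ?thesis
    unfolding u(2) roe.max_extend_max_embed[OF f subsetD[OF ranks_in_roe u(1)]] K_eq
    by (rule subsetD[OF ideal.closed_span_superset imageI[OF r[OF u(1)]]])
  qed
 qed (use linear_map_add[OF Fl] linear_map_smult[OF Fl] in blast)+
qed

context
 fixes f
 assumes f: "star_hom A A f" and fr: "\<And>r. r \<in> ranks \<Longrightarrow> f r \<in> ranks"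
begin

lemma star_hom_induced: "star_hom Q Q (induced f)"
 unfolding Q_eq max_roe_alg_def
 by (rule ideal.star_hom_quotient_extend[OF roe.star_hom_max_extend[OF f] max_extend_K[OF f fr]])

lemma norm_induced_le: "q \<in> carrier Q \<Longrightarrow> alg_norm Q (induced f q) \<le> alg_norm Q q"
 unfolding Q_eq max_roe_alg_def
 by (rule ideal.norm_quotient_extend_le[OF roe.star_hom_max_extend[OF f] max_extend_K[OF f fr] roe.norm_max_extend_le[OF f]])

lemma induced_coset_cls:
 "s \<in> roe.CS \<Longrightarrow> induced f (ideal.coset (roe.cls s)) = ideal.coset (roe.cls (\<lambda>n. f (s n)))"
 unfolding max_roe_alg_def
 using ideal.quotient_extend_coset[OF roe.star_hom_max_extend[OF f] max_extend_K[OF f fr], of "roe.cls s"]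
 by (simp add: roe.carrier_completion roe.max_extend_cls[OF f])

lemma induced_roe_class: "T \<in> carrier A \<Longrightarrow> induced f (cl T) = cl (f T)"
 unfolding roe_class_eq roe.max_embed_eq by (rule induced_coset_cls[OF roe.CS_const])

end

lemma carrier_Q_E:
 assumes "q \<in> carrier Q"
 obtains s where "s \<in> roe.CS" "q = ideal.coset (roe.cls s)"
 using assms unfolding Q_eq ideal.carrier_quotient roe.carrier_completion by blast

end

section \<open>The covariant pair of the orbit space\<close>

locale roe_system = coarse_action G X \<phi> d dG
 for G :: "('g, 'z) monoid_scheme" (structure) and X :: "'x set" and \<phi> d dG +
 fixes h :: "'h::chilbert_space itself"
 assumes sep: "separable_space (euclidean :: 'h topology)"
begin

sublocale rA: roe_space X d h by unfold_locales

lemma bounded_geometry_space_dG: "bounded_geometry_space X dG"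
 using dG_metric bounded_geometry_dG by (simp add: bounded_geometry_space_def bounded_geometry_space_axioms_def)

sublocale rB: roe_space X dG h
 unfolding roe_space_def by (rule bounded_geometry_space_dG)

abbreviation M :: "'g \<Rightarrow> ('x, 'h) ell2_op" where "M \<equiv> translation G X \<phi>"

lemma Rep_M: "g \<in> carrier G \<Longrightarrow> Rep_ell2 (M g f) x = (if x \<in> X then Rep_ell2 f (\<phi> (inv g) x) else 0)"
 by (simp add: Rep_translation[OF group_action_axioms])

section \<open>The translation operators M_g\<close>

lemma clinear_M:
 assumes g: "g \<in> carrier G"
 shows "bounded_clinear (M g)"
proof -
 have "inj_on (\<phi> (inv g)) X" by (rule inj_prop) (simp add: g)
 then have "bounded_clinear (matching_op X (\<phi> (inv g)) (\<lambda>_ v. v :: 'h))"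
  by (rule clinear_matching_op[where C = 1]) (simp_all add: clinear_id)
 then show ?thesis by (simp add: translation_def[abs_def] matching_op_def[abs_def])
qed

lemma M_mult: "g \<in> carrier G \<Longrightarrow> k \<in> carrier G \<Longrightarrow> M g \<circ> M k = M (g \<otimes> k)"
proof
 fix f assume g: "g \<in> carrier G" and k: "k \<in> carrier G"
 show "(M g \<circ> M k) f = M (g \<otimes> k) f"
 proof (rule ell2_eqI)
  fix x
  show "Rep_ell2 ((M g \<circ> M k) f) x = Rep_ell2 (M (g \<otimes> k) f) x"
   using g k act_closed[of "inv g" x] act_mult[of "inv k" "inv g" x]
   by (simp add: Rep_M inv_mult_group)
 qed
qed

lemma M_single:
 assumes g: "g \<in> carrier G"
 shows "M g (ell2_single y v) = (if y \<in> X then ell2_single (\<phi> g y) v else 0)"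
proof (rule ell2_eqI)
 fix x
 have "\<phi> (inv g) x = y \<longleftrightarrow> y \<in> X \<and> x = \<phi> g y" if "x \<in> X"
  using act_inv[OF g, of y] act_inv'[OF g that] act_closed[of "inv g" x] that g by auto
 then show "Rep_ell2 (M g (ell2_single y v)) x = Rep_ell2 (if y \<in> X then ell2_single (\<phi> g y) v else 0) x"
  using act_closed[OF g, of y] by (auto simp: Rep_M[OF g] Rep_ell2_single zero_ell2.rep_eq)
qed

lemma matrix_entry_M_comp:
 "g \<in> carrier G \<Longrightarrow> matrix_entry (M g \<circ> T) x y = (if x \<in> X then matrix_entry T (\<phi> (inv g) x) y else (\<lambda>_. 0))"
 by (auto simp: matrix_entry_def Rep_M)

lemma matrix_entry_comp_M:
 assumes g: "g \<in> carrier G" and T: "bounded_clinear T"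
 shows "matrix_entry (T \<circ> M g) x y = (if y \<in> X then matrix_entry T x (\<phi> g y) else (\<lambda>_. 0))"
 by (auto simp: matrix_entry_def M_single[OF g] clinear_zero[OF T] zero_ell2.rep_eq)

lemma cadjoint_M:
 assumes g: "g \<in> carrier G"
 shows "cadjoint (M g) = M (inv g)"
proof (rule operator_eqI)
 have gi: "inv g \<in> carrier G" using g by simp
 show "bounded_clinear (cadjoint (M g))" by (rule bounded_clinear_cadjoint[OF clinear_M[OF g]])
 show "bounded_clinear (M (inv g))" by (rule clinear_M[OF gi])
 fix x y
 have e: "y \<in> X \<and> x \<in> X \<and> \<phi> g x = y \<longleftrightarrow> x \<in> X \<and> y \<in> X \<and> \<phi> (inv g) y = x"
  using act_inv[OF g, of x] act_inv'[OF g, of y] by auto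
 have i: "cadjoint id = (id :: 'h \<Rightarrow> 'h)" by (rule cadjoint_eqI) simp
 show "matrix_entry (cadjoint (M g)) x y = matrix_entry (M (inv g)) x y"
  unfolding matrix_entry_cadjoint[OF clinear_M[OF g]] matrix_entry_translation[OF group_action_axioms g]
   matrix_entry_translation[OF group_action_axioms gi] e by (simp add: i cadjoint_zero)
qed

text \<open>On the ambient space \<open>M \<one>\<close> is only the projection onto coordinates in
  X. It acts as a unit on operators whose entries are supported in X times X, whatever the
  metric.\<close>

lemma M_one_comp:
 assumes T: "T \<in> carrier (roe_alg X e)"
 shows "M \<one> \<circ> T = T" "T \<circ> M \<one> = T"
proof -
 have Tb: "bounded_clinear T" by (rule roe_bounded[OF T])
 have z: "x \<notin> X \<or> y \<notin> X \<Longrightarrow> matrix_entry T x y = (\<lambda>_. 0)" for x y using T by (simp add: carrier_roe_alg)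
 note b = clinear_M[OF one_closed]
 show "M \<one> \<circ> T = T"
  by (rule operator_eqI[OF clinear_comp[OF b Tb] Tb]) (simp add: matrix_entry_M_comp act_one z)
 show "T \<circ> M \<one> = T"
  by (rule operator_eqI[OF clinear_comp[OF Tb b] Tb]) (simp add: matrix_entry_comp_M[OF _ Tb] act_one z)
qed

section \<open>Conjugation by M_g and the two crossed systems\<close>

definition Ad :: "'g \<Rightarrow> ('x, 'h) ell2_op \<Rightarrow> ('x, 'h) ell2_op" where
 "Ad g = (\<lambda>T. M g \<circ> T \<circ> cadjoint (M g))"

lemma Ad_eq: "g \<in> carrier G \<Longrightarrow> Ad g T = M g \<circ> T \<circ> M (inv g)"
 by (simp add: Ad_def cadjoint_M)

lemma Ad_closed:
 assumes g: "g \<in> carrier G" and T: "T \<in> carrier rA.A"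
 shows "Ad g T \<in> carrier rA.A"
proof -
 have gi: "inv g \<in> carrier G" using g by simp
 have Tb: "bounded_clinear T" by (rule roe_bounded[OF T])
 have MT: "bounded_clinear (M g \<circ> T)" by (rule clinear_comp[OF clinear_M[OF g] Tb])
 have e: "matrix_entry (Ad g T) x y
   = (if x \<in> X \<and> y \<in> X then matrix_entry T (\<phi> (inv g) x) (\<phi> (inv g) y) else (\<lambda>_. 0))" for x y
  unfolding Ad_eq[OF g] matrix_entry_comp_M[OF gi MT] matrix_entry_M_comp[OF g] by simp
 obtain R where R: "R > 0" "\<And>x y. x \<in> X \<Longrightarrow> y \<in> X \<Longrightarrow> R \<le> d x y \<Longrightarrow> matrix_entry T x y = (\<lambda>_. 0)"
  using roe_propagation[OF T] by metis
 obtain S where S: "S > 0" "\<forall>x\<in>X. \<forall>y\<in>X. d x y \<le> R \<longrightarrow> d (\<phi> g x) (\<phi> g y) \<le> S"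
  using coarse[OF g R(1)] by blast
 \<comment> \<open>A nonzero entry at (x, y) comes from an entry of \<open>T\<close> at the points
   moved back by g. Those are closer than R, so x and y are at distance at most S; the summand 1
   turns this into the non-strict form of the propagation condition.\<close>
 have "matrix_entry (Ad g T) x y = (\<lambda>_. 0)" if xy: "x \<in> X" "y \<in> X" "S + 1 \<le> d x y" for x y
 proof -
  note c = act_closed[OF gi xy(1)] act_closed[OF gi xy(2)]
  have "R \<le> d (\<phi> (inv g) x) (\<phi> (inv g) y)"
  proof (rule ccontr)
   assume "\<not> ?thesis"
   then have "d (\<phi> g (\<phi> (inv g) x)) (\<phi> g (\<phi> (inv g) y)) \<le> S" using S(2) c by simp
   then show False using xy by (simp add: act_inv'[OF g])
  qed
  then show ?thesis by (simp add: e R(2)[OF c])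
 qed
 then have "\<exists>R>0. \<forall>x\<in>X. \<forall>y\<in>X. R \<le> d x y \<longrightarrow> matrix_entry (Ad g T) x y = (\<lambda>_. 0)"
  using S(1) by (intro exI[of _ "S + 1"]) simp
 moreover have "bounded_clinear (Ad g T)"
  unfolding Ad_eq[OF g] by (rule clinear_comp[OF MT clinear_M[OF gi]])
 moreover have "compact_operator (matrix_entry (Ad g T) x y)" for x y
  using T by (simp add: e carrier_roe_alg compact_operator_zero)
 ultimately show ?thesis unfolding carrier_roe_alg by (simp add: e)
qed

lemma Ad_mult: "g \<in> carrier G \<Longrightarrow> k \<in> carrier G \<Longrightarrow> Ad g (Ad k T) = Ad (g \<otimes> k) T"
proof -
 assume g: "g \<in> carrier G" and k: "k \<in> carrier G"
 have "Ad g (Ad k T) = (M g \<circ> M k) \<circ> T \<circ> (M (inv k) \<circ> M (inv g))"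
  using g k by (simp add: Ad_eq comp_assoc)
 then show ?thesis using g k by (simp add: M_mult Ad_eq inv_mult_group)
qed

lemma Ad_one: "T \<in> carrier rA.A \<Longrightarrow> Ad \<one> T = T"
 by (simp add: Ad_eq M_one_comp)

lemma star_hom_Ad:
 assumes g: "g \<in> carrier G"
 shows "star_hom rA.A rA.A (Ad g)"
 unfolding star_hom_def
proof (intro conjI ballI allI)
 have gi: "inv g \<in> carrier G" using g by simp
 note Mb = clinear_M[OF g] and Mib = clinear_M[OF gi]
 show "Ad g \<in> carrier rA.A \<rightarrow> carrier rA.A" using Ad_closed[OF g] by blast
 fix T c assume T: "T \<in> carrier rA.A"
 have Tb: "bounded_clinear T" by (rule roe_bounded[OF T])
 show "Ad g (c \<odot>\<^bsub>rA.A\<^esub> T) = c \<odot>\<^bsub>rA.A\<^esub> Ad g T"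
  by (simp add: Ad_eq[OF g] fun_eq_iff clinear_scaleC[OF Mb])
 show "Ad g (involution rA.A T) = involution rA.A (Ad g T)"
  using g by (simp add: Ad_eq cadjoint_comp clinear_comp Mb Mib Tb cadjoint_M comp_assoc)
 fix S assume S: "S \<in> carrier rA.A"
 show "Ad g (T \<oplus>\<^bsub>rA.A\<^esub> S) = Ad g T \<oplus>\<^bsub>rA.A\<^esub> Ad g S"
  by (simp add: Ad_eq[OF g] fun_eq_iff clinear_add[OF Mb])
 have "M g \<circ> T \<circ> M (inv g) \<circ> (M g \<circ> S \<circ> M (inv g)) = M g \<circ> T \<circ> ((M (inv g) \<circ> M g) \<circ> S) \<circ> M (inv g)"
  by (simp only: comp_assoc)
 also have "(M (inv g) \<circ> M g) \<circ> S = S" using g by (simp add: M_mult M_one_comp(1)[OF S])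
 finally show "Ad g (T \<otimes>\<^bsub>rA.A\<^esub> S) = Ad g T \<otimes>\<^bsub>rA.A\<^esub> Ad g S"
  unfolding Ad_eq[OF g] roe_alg_simps comp_assoc by (rule sym)
qed

lemma Ad_ranks:
 assumes g: "g \<in> carrier G" and r: "r \<in> rA.ranks"
 shows "Ad g r \<in> rA.ranks"
proof -
 obtain x v y w where r: "r = rank_one x v y w" and xy: "x \<in> X" "y \<in> X" using r unfolding rA.ranks_def by blast
 note Mb = clinear_M[OF g]
 have "Ad g r = rank_op (M g (ell2_single x v)) (M g (ell2_single y w))"
  by (simp add: Ad_def r rank_one_eq rank_op_comp_left[OF Mb] rank_op_comp_right[OF bounded_clinear_cadjoint[OF Mb]]
    cadjoint_cadjoint[OF Mb])
 also have "\<dots> = rank_one (\<phi> g x) v (\<phi> g y) w" using xy by (simp add: M_single[OF g] rank_one_eq)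
 finally show ?thesis unfolding rA.ranks_def using act_closed[OF g] xy by blast
qed

sublocale D: crossed_system G rA.A Ad
proof -
 interpret star_ring_space rA.A by (rule rA.star_ring_space_roe)
 show "crossed_system G rA.A Ad" by unfold_locales (auto intro: star_hom_Ad Ad_one Ad_mult)
qed

abbreviation \<alpha> :: "'g \<Rightarrow> ('x, 'h) max_roe set \<Rightarrow> ('x, 'h) max_roe set" where "\<alpha> \<equiv> roe_action G X d \<phi>"

lemma \<alpha>_eq: "\<alpha> g = rA.induced (Ad g)"
 by (simp add: roe_action_def Ad_def)

lemma \<alpha>_coset_cls:
 "g \<in> carrier G \<Longrightarrow> s \<in> rA.roe.CS \<Longrightarrow>
  \<alpha> g (rA.ideal.coset (rA.roe.cls s)) = rA.ideal.coset (rA.roe.cls (\<lambda>n. Ad g (s n)))"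
 unfolding \<alpha>_eq by (rule rA.induced_coset_cls[OF star_hom_Ad Ad_ranks])

sublocale P: banach_crossed_system G rA.Q \<alpha>
proof unfold_locales
 fix g assume g: "g \<in> carrier G"
 show "star_hom rA.Q rA.Q (\<alpha> g)" unfolding \<alpha>_eq by (rule rA.star_hom_induced[OF star_hom_Ad[OF g] Ad_ranks[OF g]])
next
 fix q assume "q \<in> carrier rA.Q"
 then obtain s where s: "s \<in> rA.roe.CS" "q = rA.ideal.coset (rA.roe.cls s)" by (rule rA.carrier_Q_E)
 show "\<alpha> \<one> q = q"
  unfolding s(2) \<alpha>_coset_cls[OF one_closed s(1)] by (simp only: Ad_one[OF rA.roe.CS_carrier[OF s(1)]])
 fix g k assume g: "g \<in> carrier G" and k: "k \<in> carrier G"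
 show "\<alpha> g (\<alpha> k q) = \<alpha> (g \<otimes> k) q"
  unfolding s(2) \<alpha>_coset_cls[OF k s(1)] \<alpha>_coset_cls[OF g rA.roe.CS_hom[OF star_hom_Ad[OF k] s(1)]]
   \<alpha>_coset_cls[OF m_closed[OF g k] s(1)] by (simp only: Ad_mult[OF g k])
qed

lemma \<alpha>_roe_class: "g \<in> carrier G \<Longrightarrow> T \<in> carrier rA.A \<Longrightarrow> \<alpha> g (rA.cl T) = rA.cl (Ad g T)"
 unfolding \<alpha>_eq by (rule rA.induced_roe_class[OF star_hom_Ad Ad_ranks])

lemma norm_\<alpha>_le: "g \<in> carrier G \<Longrightarrow> q \<in> carrier rA.Q \<Longrightarrow> alg_norm rA.Q (\<alpha> g q) \<le> alg_norm rA.Q q"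
 unfolding \<alpha>_eq by (rule rA.norm_induced_le[OF star_hom_Ad Ad_ranks])

lemma star_hom_q: "star_hom D.P P.P (\<lambda>t g. rA.cl (t g))"
 by (rule D.star_hom_functorial[OF P.crossed_system_axioms rA.star_hom_roe_class]) (simp add: \<alpha>_roe_class)


section \<open>The operators T M_g and their finite sums in C[X_G]\<close>

lemma comp_M_closed:
 assumes g: "g \<in> carrier G" and T: "T \<in> carrier rA.A"
 shows "T \<circ> M g \<in> carrier rB.A"
proof -
 have Tb: "bounded_clinear T" by (rule roe_bounded[OF T])
 note e = matrix_entry_comp_M[OF g Tb]
 obtain R where R: "R > 0" "\<And>x y. x \<in> X \<Longrightarrow> y \<in> X \<Longrightarrow> R \<le> d x y \<Longrightarrow> matrix_entry T x y = (\<lambda>_. 0)"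
  using roe_propagation[OF T] by metis
 obtain S1 where S1: "S1 > 0" "\<And>x y. x \<in> X \<Longrightarrow> y \<in> X \<Longrightarrow> d x y \<le> R \<Longrightarrow> dG x y < S1"
  by (rule dG_bound_d[of R]) (rule that)
 obtain S2 where S2: "S2 > 0" "\<And>x. x \<in> X \<Longrightarrow> dG x (\<phi> g x) < S2"
  by (rule dG_bound_act[OF g]) (rule that)
 \<comment> \<open>The entry is that of \<open>T\<close> at (x, g y). One link of the triangle is
   controlled because \<open>d\<close>-close points are \<open>dG\<close>-close, the other because g
   moves points by a bounded \<open>dG\<close>-distance.\<close>
 have "matrix_entry (T \<circ> M g) x y = (\<lambda>_. 0)" if xy: "x \<in> X" "y \<in> X" "S1 + S2 \<le> dG x y" for x y
 proof -
  note c = act_closed[OF g xy(2)]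
  have "R \<le> d x (\<phi> g y)"
  proof (rule ccontr)
   assume "\<not> ?thesis"
   then have "dG x (\<phi> g y) < S1" using S1(2)[OF xy(1) c] by simp
   moreover have "dG x y \<le> dG x (\<phi> g y) + dG (\<phi> g y) y" using rB.triangle xy c by blast
   ultimately show False using S2(2)[OF xy(2)] xy(3) rB.commute[of y "\<phi> g y"] by simp
  qed
  then show ?thesis using R(2)[OF xy(1) c] by (simp add: e)
 qed
 then have "\<exists>R>0. \<forall>x\<in>X. \<forall>y\<in>X. R \<le> dG x y \<longrightarrow> matrix_entry (T \<circ> M g) x y = (\<lambda>_. 0)"
  using S1(1) S2(1) by (intro exI[of _ "S1 + S2"]) simp
 moreover have "bounded_clinear (T \<circ> M g)" by (rule clinear_comp[OF Tb clinear_M[OF g]])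
 moreover have "compact_operator (matrix_entry (T \<circ> M g) x y)" for x y
  using T by (simp add: e carrier_roe_alg compact_operator_zero)
 moreover have "matrix_entry (T \<circ> M g) x y = (\<lambda>_. 0)" if "x \<notin> X \<or> y \<notin> X" for x y
 proof -
  have "matrix_entry T x y = (\<lambda>_. 0)" if "x \<notin> X" for y using T that by (simp add: carrier_roe_alg)
  then show ?thesis using that by (auto simp: e)
 qed
 ultimately show ?thesis unfolding carrier_roe_alg by simp
qed

lemma roe_alg_subset: "T \<in> carrier rA.A \<Longrightarrow> T \<in> carrier rB.A"
 using comp_M_closed[OF one_closed] M_one_comp(2) by metis

lemma comp_M_mult:
 assumes g: "g \<in> carrier G" and k: "k \<in> carrier G"
 shows "(S \<circ> M g) \<circ> (T \<circ> M k) = (S \<circ> Ad g T) \<circ> M (g \<otimes> k)"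
proof -
 have "(S \<circ> Ad g T) \<circ> M (g \<otimes> k) = S \<circ> M g \<circ> T \<circ> (M (inv g) \<circ> M (g \<otimes> k))"
  by (simp only: Ad_eq[OF g] comp_assoc)
 also have "M (inv g) \<circ> M (g \<otimes> k) = M k"
  using g k by (simp add: M_mult m_assoc[symmetric])
 finally show ?thesis by (simp only: comp_assoc)
qed

lemma comp_M_cadjoint:
 assumes g: "g \<in> carrier G" and T: "T \<in> carrier rA.A"
 shows "cadjoint (T \<circ> M g) = Ad (inv g) (cadjoint T) \<circ> M (inv g)"
proof -
 have gi: "inv g \<in> carrier G" using g by simp
 have "Ad (inv g) (cadjoint T) \<circ> M (inv g) = M (inv g) \<circ> (cadjoint T \<circ> (M g \<circ> M (inv g)))"
  unfolding Ad_eq[OF gi] inv_inv[OF g] by (simp only: comp_assoc)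
 also have "cadjoint T \<circ> (M g \<circ> M (inv g)) = cadjoint T"
  using g by (simp add: M_mult M_one_comp(2)[OF dX.roe_cadjoint_closed[OF T]])
 finally show ?thesis
  by (simp only: cadjoint_comp[OF roe_bounded[OF T] clinear_M[OF g]] cadjoint_M[OF g])
qed

text \<open>The finite sum of the T_g M_g, written as an integrated form so that it becomes a star
  homomorphism as soon as the covariance relations are checked.\<close>

definition crossed_sum :: "('g \<Rightarrow> ('x, 'h) ell2_op) \<Rightarrow> ('x, 'h) ell2_op" where
 "crossed_sum = D.integrated (\<lambda>g T. T \<circ> M g)"

lemma linear_map_comp_M:
 assumes g: "g \<in> carrier G"
 shows "linear_map rA.A bounded_ops (\<lambda>T. T \<circ> M g)"
 using roe_bounded clinear_comp[OF _ clinear_M[OF g]]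
 by (auto simp: linear_map_def)

lemma crossed_sum_superset:
 "finite S \<Longrightarrow> D.supp t \<subseteq> S \<Longrightarrow> S \<subseteq> carrier G \<Longrightarrow> crossed_sum t = (\<lambda>v. \<Sum>g\<in>S. (t g \<circ> M g) v)"
 unfolding crossed_sum_def by (rule D.integrated_superset[OF linear_map_comp_M])

lemma crossed_sum_closed: "t \<in> carrier D.P \<Longrightarrow> crossed_sum t \<in> carrier rB.A"
proof -
 assume t: "t \<in> carrier D.P"
 note tD = D.P_carrierD[OF t]
 have "t g \<circ> M g \<in> carrier rB.A" if "g \<in> D.supp t" for g
  by (rule comp_M_closed[OF subsetD[OF tD(3) that] tD(1)])
 then have "(\<lambda>v. \<Sum>g\<in>D.supp t. (t g \<circ> M g) v) \<in> carrier rB.A" by (rule rB.roe_sum_closed)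
 then show ?thesis using crossed_sum_superset[OF tD(2) subset_refl tD(3)] by simp
qed

lemma star_hom_crossed_sum: "star_hom D.P rB.A crossed_sum"
proof -
 have "star_hom D.P bounded_ops crossed_sum"
  unfolding crossed_sum_def
 proof (rule D.star_hom_integrated[OF linear_map_comp_M])
  show "S \<circ> M g \<circ> (T \<circ> M k) = S \<otimes>\<^bsub>rA.A\<^esub> Ad g T \<circ> M (g \<otimes> k)"
   if "g \<in> carrier G" "k \<in> carrier G" for g k S T
   using comp_M_mult[OF that] by simp
  show "cadjoint (T \<circ> M g) = Ad (inv g) (involution rA.A T) \<circ> M (inv g)"
   if "g \<in> carrier G" "T \<in> carrier rA.A" for g T
   using comp_M_cadjoint[OF that] by simp
 qed
 then show ?thesis using crossed_sum_closed by (simp add: star_hom_def Pi_iff)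
qed

lemma crossed_sum_single: "g \<in> carrier G \<Longrightarrow> crossed_sum (D.single g T) = T \<circ> M g"
 using crossed_sum_superset[of "{g}" "D.single g T"] D.single_supp[of g T] by (simp add: cp_single_def fun_eq_iff)

text \<open>Every nonzero entry of \<open>T\<close> belongs to a \<open>dG\<close>-close pair and is
  assigned to one group element g of a finite set that makes the pair \<open>d\<close>-close. The
  piece of \<open>T\<close> carried by g stays bounded by \<open>roe_alg_restrict\<close>, and
  multiplying it by M_g inverse on the right gives an operator of finite
  \<open>d\<close>-propagation.\<close>

lemma crossed_sum_surj:
 assumes T: "T \<in> carrier rB.A"
 obtains t where "t \<in> carrier D.P" "crossed_sum t = T"
proof -
 have Tb: "bounded_clinear T" by (rule roe_bounded[OF T])
 obtain R where R: "R > 0" "\<And>x y. x \<in> X \<Longrightarrow> y \<in> X \<Longrightarrow> R \<le> dG x y \<Longrightarrow> matrix_entry T x y = (\<lambda>_. 0)"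
  using roe_propagation[OF T] by metis
 obtain S B where S: "finite S" "S \<subseteq> carrier G" "B > 0"
  "\<And>x y. x \<in> X \<Longrightarrow> y \<in> X \<Longrightarrow> dG x y < R \<Longrightarrow> \<exists>g\<in>S. d x (\<phi> g y) < B"
  by (rule dG_controlled[of R]) (rule that)
 \<comment> \<open>Several group elements may work for the same pair; choosing one makes the pieces
   disjoint, so that they add up to \<open>T\<close>.\<close>
 define \<gamma> where "\<gamma> x y = (SOME g. g \<in> S \<and> d x (\<phi> g y) < B)" for x y
 have \<gamma>: "\<gamma> x y \<in> S \<and> d x (\<phi> (\<gamma> x y) y) < B" if xy: "x \<in> X" "y \<in> X" "dG x y < R" for x y
 proof -
  obtain g where "g \<in> S \<and> d x (\<phi> g y) < B" using S(4)[OF xy] by blast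
  then show ?thesis unfolding \<gamma>_def by (rule someI[of "\<lambda>g. g \<in> S \<and> d x (\<phi> g y) < B"])
 qed
 define E where "E g x y \<longleftrightarrow> x \<in> X \<and> y \<in> X \<and> dG x y < R \<and> \<gamma> x y = g" for g x y
 have "\<exists>V. V \<in> carrier rB.A \<and> (\<forall>x y. matrix_entry V x y = (if E g x y then matrix_entry T x y else (\<lambda>_. 0)))" for g
  by (rule rB.roe_alg_restrict[OF T, of "E g"]) blast
 then obtain V where V: "\<And>g. V g \<in> carrier rB.A"
  "\<And>g x y. matrix_entry (V g) x y = (if E g x y then matrix_entry T x y else (\<lambda>_. 0))" by metis
 define t where "t g = (if g \<in> S then V g \<circ> M (inv g) else (\<lambda>_. 0))" for g
 have Vb: "bounded_clinear (V g)" for g by (rule roe_bounded[OF V(1)])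
 have VA: "V g \<circ> M (inv g) \<in> carrier rA.A" if g: "g \<in> S" for g
 proof -
  have gG: "g \<in> carrier G" using S(2) g by blast
  then have gi: "inv g \<in> carrier G" by simp
  note e = matrix_entry_comp_M[OF gi Vb[of g]]
  have "matrix_entry (V g \<circ> M (inv g)) x y = (\<lambda>_. 0)" if xy: "x \<in> X" "y \<in> X" "B \<le> d x y" for x y
  proof -
   have "\<not> E g x (\<phi> (inv g) y)"
   proof
    assume "E g x (\<phi> (inv g) y)"
    then have "d x (\<phi> g (\<phi> (inv g) y)) < B" using \<gamma>[of x "\<phi> (inv g) y"] by (simp add: E_def)
    then show False using xy by (simp add: act_inv'[OF gG xy(2)])
   qed
   then show ?thesis by (simp add: e V(2))
  qed
  then have "\<exists>R>0. \<forall>x\<in>X. \<forall>y\<in>X. R \<le> d x y \<longrightarrow> matrix_entry (V g \<circ> M (inv g)) x y = (\<lambda>_. 0)"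
   using S(3) by (intro exI[of _ B]) simp
  moreover have "bounded_clinear (V g \<circ> M (inv g))" by (rule clinear_comp[OF Vb clinear_M[OF gi]])
  moreover have "compact_operator (matrix_entry (V g \<circ> M (inv g)) x y)" for x y
   using T by (simp add: e V(2) carrier_roe_alg compact_operator_zero)
  moreover have "matrix_entry (V g \<circ> M (inv g)) x y = (\<lambda>_. 0)" if "x \<notin> X \<or> y \<notin> X" for x y
  proof -
   have "\<not> E g x (\<phi> (inv g) y) \<or> y \<notin> X" using that by (auto simp: E_def)
   then show ?thesis by (auto simp: e V(2))
  qed
  ultimately show ?thesis unfolding carrier_roe_alg by simp
 qed
 have t: "t \<in> carrier D.P"
  by (rule D.P_carrierI[OF _ S(1,2)]) (simp_all add: t_def VA dX.roe_zero_closed)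
 have sup: "D.supp t \<subseteq> S" by (auto simp: D.supp_def t_def)
 have tM: "t g \<circ> M g = V g" if g: "g \<in> S" for g
 proof -
  have gG: "g \<in> carrier G" using S(2) g by blast
  have "t g \<circ> M g = V g \<circ> (M (inv g) \<circ> M g)" using g by (simp add: t_def comp_assoc)
  also have "\<dots> = V g" using gG by (simp add: M_mult M_one_comp(2)[OF V(1)])
  finally show ?thesis .
 qed
 have "crossed_sum t = (\<lambda>v. \<Sum>g\<in>S. V g v)"
  unfolding crossed_sum_superset[OF S(1) sup S(2)] by (intro ext sum.cong refl) (simp only: tM)
 also have "\<dots> = T"
 proof (rule operator_eqI[OF _ Tb])
  show "bounded_clinear (\<lambda>v. \<Sum>g\<in>S. V g v)" by (rule clinear_setsum[OF Vb])
  fix x y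
  show "matrix_entry (\<lambda>v. \<Sum>g\<in>S. V g v) x y = matrix_entry T x y"
  proof (cases "x \<in> X \<and> y \<in> X \<and> dG x y < R")
   case True
   then have "\<gamma> x y \<in> S" and E: "E g x y \<longleftrightarrow> g = \<gamma> x y" for g using \<gamma>[of x y] by (auto simp: E_def)
   then have "(\<Sum>g\<in>S. matrix_entry (V g) x y v) = matrix_entry T x y v" for v
    using S(1) by (simp add: V(2) E if_distrib[of "\<lambda>f. f v"] cong: if_cong)
   then show ?thesis by (simp add: matrix_entry_sum)
  next
   case False
   then have "matrix_entry T x y = (\<lambda>_. 0)" using T R(2)[of x y] by (auto simp: carrier_roe_alg not_less)
   then have "matrix_entry (V g) x y = (\<lambda>_. 0)" for g by (simp add: V(2))
   with \<open>matrix_entry T x y = (\<lambda>_. 0)\<close> show ?thesis by (simp add: matrix_entry_sum)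
  qed
 qed
 finally show ?thesis by (rule that[OF t])
qed

text \<open>If $\sum_g t_g M_g = 0$, a nonzero entry of $t_k$ at $(x,z)$ is cancelled by an entry of some
 $t_g$ with $g \neq k$, so $z$ and $gk^{-1}z$ are uniformly close, which coarse discontinuity allows for
 finitely many $z$ only.\<close>

lemma crossed_sum_eq_0:
 assumes t: "t \<in> carrier D.P" and z: "crossed_sum t = (\<lambda>_. 0)"
 shows "rA.cl (t k) = \<zero>\<^bsub>rA.Q\<^esub>"
proof (cases "k \<in> D.supp t")
 case False
 then have "t k = \<zero>\<^bsub>rA.A\<^esub>" by (rule D.zero_off_supp)
 then show ?thesis by (simp add: rA.roe_class_zero)
next
 case True
 note tD = D.P_carrierD[OF t]
 have kG: "k \<in> carrier G" using tD(3) True by blast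
 have "\<exists>R>0. \<forall>x\<in>X. \<forall>y\<in>X. R \<le> d x y \<longrightarrow> matrix_entry (t g) x y = (\<lambda>_. 0)" for g
  using tD(1)[of g] unfolding carrier_roe_alg by blast
 then obtain r where r: "\<And>g. r g > 0" "\<And>g x y. x \<in> X \<Longrightarrow> y \<in> X \<Longrightarrow> r g \<le> d x y \<Longrightarrow> matrix_entry (t g) x y = (\<lambda>_. 0)"
  by metis
 have off: "matrix_entry (t g) x y = (\<lambda>_. 0)" if "x \<notin> X \<or> y \<notin> X" for g x y
  using tD(1)[of g] that by (simp add: carrier_roe_alg)
 \<comment> \<open>A sum of positive radii, so it bounds the propagation of every coefficient in the
   support.\<close>
 define R where "R = sum r (D.supp t)"
 have rR: "r g \<le> R" if "g \<in> D.supp t" for g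
  unfolding R_def using tD(2) that r(1) by (intro member_le_sum) (auto intro: less_imp_le)
 \<comment> \<open>Both z and its image under g k^{-1} will lie within R of the same row index,
   hence the radius 2 R. Since g k^{-1} is not the identity, each set in the union is
   finite.\<close>
 define Z where "Z = (\<Union>g\<in>D.supp t - {k}. {z \<in> X. d z (\<phi> (g \<otimes> inv k) z) < 2 * R})"
 have Z: "finite Z"
  unfolding Z_def
 proof (rule finite_UN_I)
  show "finite (D.supp t - {k})" using tD(2) by simp
  fix g assume g: "g \<in> D.supp t - {k}"
  then have gG: "g \<in> carrier G" using tD(3) by blast
  have "g \<otimes> inv k \<noteq> \<one>"
  proof
   assume "g \<otimes> inv k = \<one>"
   then have "(g \<otimes> inv k) \<otimes> k = k" using kG by simp
   then show False using g gG kG by (simp add: m_assoc)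
  qed
  then show "finite {z \<in> X. d z (\<phi> (g \<otimes> inv k) z) < 2 * R}"
   using gG kG by (intro finite_close_orbit) simp_all
 qed
 \<comment> \<open>All possible positions of nonzero entries of \<open>t k\<close>: a column in
   \<open>Z\<close> and a row within R of it.\<close>
 define F where "F = (\<lambda>(z, x). (x, z)) ` (SIGMA z:Z. {x \<in> X. d z x < R})"
 have F: "finite F"
  unfolding F_def using Z by (intro finite_imageI finite_SigmaI dX.finite_ball) (auto simp: Z_def)
 show ?thesis
 proof (rule rA.roe_class_finite_entries[OF sep tD(1) F])
  fix x z0 assume nF: "(x, z0) \<notin> F"
  show "matrix_entry (t k) x z0 = (\<lambda>_. 0)"
  proof (rule ccontr)
   assume nz: "matrix_entry (t k) x z0 \<noteq> (\<lambda>_. 0)"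
   then have xX: "x \<in> X" and zX: "z0 \<in> X" using off by blast+
   have "\<not> r k \<le> d x z0" using r(2)[OF xX zX] nz by blast
   then have dxz: "d x z0 < R" using rR[OF True] by simp
   \<comment> \<open>With this column the summand for k contributes exactly the entry of
     \<open>t k\<close> at (x, z0), and the summand for g the entry of \<open>t g\<close> at (x, g
     k^{-1} z0).\<close>
   define y where "y = \<phi> (inv k) z0"
   have yX: "y \<in> X" unfolding y_def using act_closed[OF inv_closed[OF kG] zX] .
   have ent: "matrix_entry (t g \<circ> M g) x y = matrix_entry (t g) x (\<phi> (g \<otimes> inv k) z0)" if g: "g \<in> D.supp t" for g
   proof -
    have gG: "g \<in> carrier G" using tD(3) g by blast
    show ?thesis
     using matrix_entry_comp_M[OF gG roe_bounded[OF tD(1)], of g x y] yX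
     by (simp add: y_def act_mult[OF gG inv_closed[OF kG] zX])
   qed
   have self: "\<phi> (k \<otimes> inv k) z0 = z0" using kG zX by (simp add: act_one)
   have "\<exists>g\<in>D.supp t - {k}. matrix_entry (t g) x (\<phi> (g \<otimes> inv k) z0) \<noteq> (\<lambda>_. 0)"
   proof (rule ccontr)
    assume no: "\<not> ?thesis"
    have "matrix_entry (crossed_sum t) x y v = matrix_entry (t k) x z0 v" for v
    proof -
     have "matrix_entry (crossed_sum t) x y v = (\<Sum>g\<in>D.supp t. matrix_entry (t g \<circ> M g) x y v)"
      unfolding crossed_sum_superset[OF tD(2) subset_refl tD(3)] matrix_entry_sum ..
     also have "\<dots> = matrix_entry (t k \<circ> M k) x y v + (\<Sum>g\<in>D.supp t - {k}. matrix_entry (t g \<circ> M g) x y v)"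
      by (rule sum.remove[OF tD(2) True])
     also have "(\<Sum>g\<in>D.supp t - {k}. matrix_entry (t g \<circ> M g) x y v) = 0"
      using no by (intro sum.neutral ballI) (simp add: ent)
     finally show ?thesis by (simp only: ent[OF True] self add_0_right)
    qed
    then show False using nz by (simp add: z fun_eq_iff)
   qed
   then obtain g where g: "g \<in> D.supp t - {k}"
    and gnz: "matrix_entry (t g) x (\<phi> (g \<otimes> inv k) z0) \<noteq> (\<lambda>_. 0)" by (rule bexE)
   define z1 where "z1 = \<phi> (g \<otimes> inv k) z0"
   have gS: "g \<in> D.supp t" using g by simp
   have z1X: "z1 \<in> X" using gnz off unfolding z1_def by blast
   have "\<not> r g \<le> d x z1" using r(2)[OF xX z1X] gnz unfolding z1_def by blast
   then have dxz1: "d x z1 < R" using rR[OF gS] by simp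
   have "d z0 z1 \<le> d z0 x + d x z1" by (rule dX.triangle[OF zX xX z1X])
   then have "d z0 z1 < 2 * R" using dxz dxz1 dX.commute[of x z0] by simp
   then have "z0 \<in> Z" unfolding Z_def z1_def[symmetric] using g zX by (intro UN_I[of g]) (simp_all add: z1_def)
   then have "(x, z0) \<in> F" unfolding F_def using xX dxz dX.commute[of x z0]
    by (intro image_eqI[of _ _ "(z0, x)"]) simp_all
   then show False using nF by simp
  qed
 qed
qed


section \<open>Comparison of the two norms on the algebraic crossed product of C[X]\<close>

abbreviation q :: "('g \<Rightarrow> ('x, 'h) ell2_op) \<Rightarrow> 'g \<Rightarrow> ('x, 'h) max_roe set" where
 "q t \<equiv> (\<lambda>g. rA.cl (t g))"

lemma q_single: "q (D.single g T) = P.single g (rA.cl T)"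
 by (simp add: cp_single_def fun_eq_iff rA.roe_class_zero)

lemma roe_class_rank:
 assumes r: "r \<in> rA.ranks"
 shows "rA.cl r = \<zero>\<^bsub>rA.Q\<^esub>"
proof -
 have "max_embed rA.A r \<in> rA.K" unfolding rA.K_eq by (rule subsetD[OF rA.ideal.closed_span_superset imageI[OF r]])
 then show ?thesis using rA.roe_class_eq_0_iff[OF subsetD[OF rA.ranks_in_roe r]] by blast
qed

text \<open>The representatives of an operator on X_G may differ, but their difference has vanishing
  crossed sum and therefore vanishing coefficient classes.\<close>

lemma q_eq_if_crossed_sum_eq:
 assumes t: "t \<in> carrier D.P" "t' \<in> carrier D.P" and eq: "crossed_sum t = crossed_sum t'"
 shows "q t = q t'"
proof
 fix g
 interpret DP: star_space D.P by (rule D.star_space_P)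
 note tc = D.P_carrierD(1)[OF t(1), of g] D.P_carrierD(1)[OF t(2), of g]
 note qc = star_hom_closed[OF rA.star_hom_roe_class tc(1)] star_hom_closed[OF rA.star_hom_roe_class tc(2)]
 have "crossed_sum (t \<ominus>\<^bsub>D.P\<^esub> t') = crossed_sum t \<ominus>\<^bsub>rB.A\<^esub> crossed_sum t'"
  by (rule linear_map_minus[OF DP.star_space_axioms rB.roe.star_space_axioms star_hom_linear[OF star_hom_crossed_sum] t])
 also have "\<dots> = (\<lambda>_. 0)" using rB.roe.minus_self[OF crossed_sum_closed[OF t(2)]] eq by simp
 finally have "rA.cl ((t \<ominus>\<^bsub>D.P\<^esub> t') g) = \<zero>\<^bsub>rA.Q\<^esub>"
  by (rule crossed_sum_eq_0[OF DP.diff_closed[OF t]])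
 moreover have "(t \<ominus>\<^bsub>D.P\<^esub> t') g = t g \<ominus>\<^bsub>rA.A\<^esub> t' g"
  unfolding DP.minus_eq_smult[OF t] rA.roe.minus_eq_smult[OF tc] D.P_simps(4,5) ..
 moreover have "rA.cl (t g \<ominus>\<^bsub>rA.A\<^esub> t' g) = rA.cl (t g) \<ominus>\<^bsub>rA.Q\<^esub> rA.cl (t' g)"
  by (rule linear_map_minus[OF rA.roe.star_space_axioms rA.Q.star_space_axioms star_hom_linear[OF rA.star_hom_roe_class] tc])
 ultimately have "rA.cl (t g) \<ominus>\<^bsub>rA.Q\<^esub> rA.cl (t' g) = \<zero>\<^bsub>rA.Q\<^esub>" by simp
 then show "rA.cl (t g) = rA.cl (t' g)" by (rule rA.Q.eq_of_minus_zero[OF qc])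
qed

text \<open>Because \<open>crossed_sum\<close> is injective modulo finite matrices, every representation of the algebraic
 crossed product of the quotient descends to the Roe algebra of the orbit space and kills rank one
 operators there.\<close>

lemma max_norm_q_le:
 assumes t: "t \<in> carrier D.P"
 shows "max_norm P.P (q t) \<le> alg_norm rB.Q (rB.cl (crossed_sum t))"
proof (rule P.P.max_norm_leI)
 fix \<pi> :: "('g \<Rightarrow> ('x, 'h) max_roe set) \<Rightarrow> ('g \<Rightarrow> ('x, 'h) max_roe set, complex) ell2 \<Rightarrow> _"
 assume \<pi>: "star_hom P.P bounded_ops \<pi>"
 \<comment> \<open>An arbitrary decomposition of an operator on X_G; by
   \<open>q_eq_if_crossed_sum_eq\<close> the value of \<open>\<sigma>\<close> is independent of the
   choice.\<close>
 define sel where "sel T = (SOME t. t \<in> carrier D.P \<and> crossed_sum t = T)" for T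
 define \<sigma> where "\<sigma> T = \<pi> (q (sel T))" for T
 have sel: "sel (crossed_sum t) \<in> carrier D.P \<and> crossed_sum (sel (crossed_sum t)) = crossed_sum t"
  if "t \<in> carrier D.P" for t
  unfolding sel_def by (rule someI[of "\<lambda>s. s \<in> carrier D.P \<and> crossed_sum s = crossed_sum t" t]) (simp add: that)
 have \<sigma>s: "\<sigma> (crossed_sum t) = (\<pi> \<circ> q) t" if "t \<in> carrier D.P" for t
  using q_eq_if_crossed_sum_eq[OF conjunct1[OF sel[OF that]] that conjunct2[OF sel[OF that]]]
  by (simp add: \<sigma>_def)
 have \<sigma>: "star_hom rB.A bounded_ops \<sigma>"
 proof (rule star_hom_factor[where f = crossed_sum and \<rho> = "\<pi> \<circ> q",
    OF D.star_space_P star_hom_crossed_sum _ star_hom_comp[OF star_hom_q \<pi>] \<sigma>s])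
  fix b assume "b \<in> carrier rB.A"
  then obtain t where "t \<in> carrier D.P" "crossed_sum t = b" by (rule crossed_sum_surj)
  then show "\<exists>a\<in>carrier D.P. b = crossed_sum a" by blast
 qed
 \<comment> \<open>Rank one operators do not involve the metric, so they are the same for X and X_G.
   Each is its own coefficient at the identity, and that coefficient has class zero.\<close>
 have "\<sigma> r = (\<lambda>_. 0)" if r: "r \<in> rA.ranks" for r
 proof -
  have rc: "r \<in> carrier rA.A" by (rule subsetD[OF rA.ranks_in_roe r])
  have r1: "crossed_sum (D.single \<one> r) = r"
   using crossed_sum_single[OF one_closed, of r] unfolding M_one_comp(2)[OF rc] .
  have "\<sigma> r = \<pi> (q (D.single \<one> r))"
   using \<sigma>s[OF D.single_closed[OF one_closed rc]] unfolding r1 by (simp only: o_apply)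
  also have "q (D.single \<one> r) = \<zero>\<^bsub>P.P\<^esub>"
   unfolding q_single roe_class_rank[OF r] P.P_simps(3) unfolding cp_single_def by (rule ext) (rule if_cancel)
  also have "\<pi> \<zero>\<^bsub>P.P\<^esub> = (\<lambda>_. 0)"
   using linear_map_zero[OF P.star_space_P bounded_ops.star_space_axioms star_hom_linear[OF \<pi>]]
   unfolding bounded_ops_simps .
  finally show ?thesis .
 qed
 from rB.rep_le_norm_roe_class[OF \<sigma> this crossed_sum_closed[OF t]]
 show "onorm (\<pi> (q t)) \<le> alg_norm rB.Q (rB.cl (crossed_sum t))" unfolding \<sigma>s[OF t] o_apply .
qed

text \<open>Conversely, a representation \<open>\<sigma>\<close> of the Roe algebra of the orbit space that kills rank one operators
 comes from a covariant pair; instead of the unitaries, which need not exist when the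
 representation is degenerate, we extend each $T \mapsto \sigma(T M_g)$ to the quotient.\<close>

lemma rep_crossed_sum_le:
 fixes \<sigma> :: "('x, 'h) ell2_op \<Rightarrow> 'k::chilbert_space \<Rightarrow> 'k"
 assumes \<sigma>: "star_hom rB.A bounded_ops \<sigma>" and r0: "\<And>r. r \<in> rA.ranks \<Longrightarrow> \<sigma> r = (\<lambda>_. 0)"
  and t: "t \<in> carrier D.P"
 shows "onorm (\<sigma> (crossed_sum t)) \<le> max_norm P.P (q t)"
proof -
 note f = rep_facts[OF \<sigma>]
 have \<sigma>A: "star_hom rA.A bounded_ops \<sigma>"
  using \<sigma> roe_alg_subset by (auto simp: star_hom_def)
 \<comment> \<open>Multiplying T M_g by its adjoint on the right cancels the translation and leaves
   an element of C[X], where the quotient norm bounds \<open>\<sigma>\<close>.\<close>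
 have le: "onorm (\<sigma> (T \<circ> M g)) \<le> alg_norm rA.Q (rA.cl T)" if g: "g \<in> carrier G" and T: "T \<in> carrier rA.A" for g T
 proof -
  define Y where "Y = \<sigma> (T \<circ> M g)"
  have TM: "T \<circ> M g \<in> carrier rB.A" by (rule comp_M_closed[OF g T])
  have Y: "bounded_clinear Y" unfolding Y_def by (rule f(1)[OF TM])
  have Tc: "cadjoint T \<in> carrier rA.A" by (rule dX.roe_cadjoint_closed[OF T])
  have cl: "rA.cl T \<in> carrier rA.Q" by (rule star_hom_closed[OF rA.star_hom_roe_class T])
  have "(T \<circ> M g) \<circ> cadjoint (T \<circ> M g) = T \<circ> (M g \<circ> M (inv g)) \<circ> cadjoint T"
   by (simp only: cadjoint_comp[OF roe_bounded[OF T] clinear_M[OF g]] cadjoint_M[OF g] comp_assoc)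
  also have "\<dots> = T \<circ> cadjoint T" using g by (simp add: M_mult M_one_comp(2)[OF T])
  finally have YY: "Y \<circ> cadjoint Y = \<sigma> (T \<circ> cadjoint T)"
   unfolding Y_def using f(2)[OF TM] f(5)[OF TM rB.roe_cadjoint_closed[OF TM]] by simp
  have "(onorm (cadjoint Y))\<^sup>2 \<le> onorm (cadjoint (cadjoint Y) \<circ> cadjoint Y)"
   by (rule onorm_le_sqrt[OF bounded_clinear_cadjoint[OF Y]])
  also have "\<dots> = onorm (\<sigma> (T \<circ> cadjoint T))" by (simp only: cadjoint_cadjoint[OF Y] YY)
  also have "\<dots> \<le> alg_norm rA.Q (rA.cl (T \<circ> cadjoint T))"
   by (rule rA.rep_le_norm_roe_class[OF \<sigma>A r0 dX.roe_mult_closed[OF T Tc]])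
  also have "rA.cl (T \<circ> cadjoint T) = rA.cl T \<otimes>\<^bsub>rA.Q\<^esub> involution rA.Q (rA.cl T)"
   using star_hom_mult[OF rA.star_hom_roe_class T Tc] star_hom_involution[OF rA.star_hom_roe_class T] by simp
  also have "alg_norm rA.Q \<dots> \<le> (alg_norm rA.Q (rA.cl T))\<^sup>2"
   using rA.Q.norm_mult[OF cl rA.Q.involution_closed[OF cl]] rA.Q.norm_involution[OF cl] by (simp add: power2_eq_square)
  finally have "(onorm Y)\<^sup>2 \<le> (alg_norm rA.Q (rA.cl T))\<^sup>2" by (simp add: onorm_cadjoint[OF Y])
  then show ?thesis unfolding Y_def by (rule power2_le_imp_le) (rule rA.Q.norm_nonneg[OF cl])
 qed
 have lin: "linear_map rA.A (normed_ops {T. bounded_clinear T}) (\<lambda>T. \<sigma> (T \<circ> M g))" if g: "g \<in> carrier G" for g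
 proof -
  have "linear_map rA.A rB.A (\<lambda>T. T \<circ> M g)"
   using linear_map_comp_M[OF g] comp_M_closed[OF g] by (simp add: linear_map_def Pi_iff)
  from linear_map_comp[OF this star_hom_linear[OF \<sigma>]] show ?thesis
   by (simp add: linear_map_normed_ops_iff o_def)
 qed
 have "\<exists>\<Phi>. g \<in> carrier G \<longrightarrow> linear_map rA.Q (normed_ops {T. bounded_clinear T}) \<Phi> \<and>
   (\<forall>a\<in>carrier rA.Q. onorm (\<Phi> a) \<le> alg_norm rA.Q a) \<and>
   (\<forall>T\<in>carrier rA.A. \<Phi> (rA.cl T) = \<sigma> (T \<circ> M g))" for g
 proof (cases "g \<in> carrier G")
  case True
  obtain \<Phi> where "linear_map rA.Q (normed_ops {T. bounded_clinear T}) \<Phi>"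
   "\<And>a. a \<in> carrier rA.Q \<Longrightarrow> alg_norm (normed_ops {T. bounded_clinear T}) (\<Phi> a) \<le> alg_norm rA.Q a"
   "\<And>T. T \<in> carrier rA.A \<Longrightarrow> \<Phi> (rA.cl T) = \<sigma> (T \<circ> M g)"
   by (rule extension_by_continuity[OF rA.Q.normed_star_axioms all_ops.banach_star_axioms rA.roe.star_space_axioms
      star_hom_linear[OF rA.star_hom_roe_class] lin[OF True] rA.dense_roe_class])
    (use le[OF True] in simp_all)
  then show ?thesis by auto
 qed blast
 then obtain \<tau> where \<tau>: "\<And>g. g \<in> carrier G \<Longrightarrow> linear_map rA.Q (normed_ops {T. bounded_clinear T}) (\<tau> g) \<and>
   (\<forall>a\<in>carrier rA.Q. onorm (\<tau> g a) \<le> alg_norm rA.Q a) \<and>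
   (\<forall>T\<in>carrier rA.A. \<tau> g (rA.cl T) = \<sigma> (T \<circ> M g))" by metis
 have \<tau>l: "linear_map rA.Q bounded_ops (\<tau> g)" if "g \<in> carrier G" for g
  using \<tau>[OF that] by (simp add: linear_map_normed_ops_iff)
 have \<tau>c: "\<tau> g (rA.cl T) = \<sigma> (T \<circ> M g)" if "g \<in> carrier G" "T \<in> carrier rA.A" for g T
  using \<tau>[OF that(1)] that(2) by blast
 have conv: "all_ops.conv (\<lambda>n. \<tau> g (s n)) (\<tau> g a)" if "g \<in> carrier G" "rA.Q.conv s a" for g s a
  by (rule contraction_conv[OF rA.Q.normed_star_axioms all_ops.normed_star_axioms _ _ that(2)])
   (use \<tau>[OF that(1)] in auto)
 have conv\<alpha>: "rA.Q.conv (\<lambda>n. \<alpha> g (s n)) (\<alpha> g a)" if g: "g \<in> carrier G" and s: "rA.Q.conv s a" for g s a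
  by (rule contraction_conv[OF rA.Q.normed_star_axioms rA.Q.normed_star_axioms star_hom_linear[OF P.\<alpha>_hom[OF g]] norm_\<alpha>_le[OF g] s])
 \<comment> \<open>The covariance relations hold on classes of operators in C[X] by the algebra of
   the T M_g. Each side is continuous in the approximating sequences, so uniqueness of limits
   extends the relations to the whole quotient.\<close>
 have hom: "star_hom P.P bounded_ops (P.integrated \<tau>)"
 proof (rule P.star_hom_integrated[OF \<tau>l])
  fix g k a b assume g: "g \<in> carrier G" and k: "k \<in> carrier G" and a: "a \<in> carrier rA.Q" and b: "b \<in> carrier rA.Q"
  obtain S where S: "\<And>n. S n \<in> carrier rA.A" "rA.Q.conv (\<lambda>n. rA.cl (S n)) a"
   by (rule rA.Q.dense_imageE[OF rA.dense_roe_class a]) (rule that)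
  obtain T where T: "\<And>n. T n \<in> carrier rA.A" "rA.Q.conv (\<lambda>n. rA.cl (T n)) b"
   by (rule rA.Q.dense_imageE[OF rA.dense_roe_class b]) (rule that)
  have L: "all_ops.conv (\<lambda>n. \<tau> g (rA.cl (S n)) \<circ> \<tau> k (rA.cl (T n))) (\<tau> g a \<circ> \<tau> k b)"
   using all_ops.conv_mult[OF conv[OF g S(2)] conv[OF k T(2)]] by simp
  have R: "all_ops.conv (\<lambda>n. \<tau> (g \<otimes> k) (rA.cl (S n) \<otimes>\<^bsub>rA.Q\<^esub> \<alpha> g (rA.cl (T n)))) (\<tau> (g \<otimes> k) (a \<otimes>\<^bsub>rA.Q\<^esub> \<alpha> g b))"
   by (rule conv[OF m_closed[OF g k] rA.Q.conv_mult[OF S(2) conv\<alpha>[OF g T(2)]]])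
  have eq: "\<tau> (g \<otimes> k) (rA.cl (S n) \<otimes>\<^bsub>rA.Q\<^esub> \<alpha> g (rA.cl (T n)))
    = \<tau> g (rA.cl (S n)) \<circ> \<tau> k (rA.cl (T n))" for n
  proof -
   have SA: "S n \<circ> Ad g (T n) \<in> carrier rA.A" by (rule dX.roe_mult_closed[OF S(1) Ad_closed[OF g T(1)]])
   have "rA.cl (S n) \<otimes>\<^bsub>rA.Q\<^esub> \<alpha> g (rA.cl (T n)) = rA.cl (S n \<circ> Ad g (T n))"
    using star_hom_mult[OF rA.star_hom_roe_class S(1) Ad_closed[OF g T(1)]] by (simp add: \<alpha>_roe_class[OF g T(1)])
   then have "\<tau> (g \<otimes> k) (rA.cl (S n) \<otimes>\<^bsub>rA.Q\<^esub> \<alpha> g (rA.cl (T n))) = \<sigma> ((S n \<circ> M g) \<circ> (T n \<circ> M k))"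
    by (simp only: \<tau>c[OF m_closed[OF g k] SA] comp_M_mult[OF g k])
   also have "\<dots> = \<sigma> (S n \<circ> M g) \<circ> \<sigma> (T n \<circ> M k)"
    using f(5)[OF comp_M_closed[OF g S(1)] comp_M_closed[OF k T(1)]] by simp
   finally show ?thesis by (simp only: \<tau>c[OF g S(1)] \<tau>c[OF k T(1)])
  qed
  show "\<tau> g a \<circ> \<tau> k b = \<tau> (g \<otimes> k) (a \<otimes>\<^bsub>rA.Q\<^esub> \<alpha> g b)"
   by (rule all_ops.conv_unique[OF L R[unfolded eq]])
 next
  fix g a assume g: "g \<in> carrier G" and a: "a \<in> carrier rA.Q"
  have gi: "inv g \<in> carrier G" using g by simp
  obtain S where S: "\<And>n. S n \<in> carrier rA.A" "rA.Q.conv (\<lambda>n. rA.cl (S n)) a"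
   by (rule rA.Q.dense_imageE[OF rA.dense_roe_class a]) (rule that)
  have L: "all_ops.conv (\<lambda>n. cadjoint (\<tau> g (rA.cl (S n)))) (cadjoint (\<tau> g a))"
   using all_ops.conv_involution[OF conv[OF g S(2)]] by simp
  have R: "all_ops.conv (\<lambda>n. \<tau> (inv g) (\<alpha> (inv g) (involution rA.Q (rA.cl (S n)))))
    (\<tau> (inv g) (\<alpha> (inv g) (involution rA.Q a)))"
   by (rule conv[OF gi conv\<alpha>[OF gi rA.Q.conv_involution[OF S(2)]]])
  have eq: "\<tau> (inv g) (\<alpha> (inv g) (involution rA.Q (rA.cl (S n)))) = cadjoint (\<tau> g (rA.cl (S n)))" for n
  proof -
   have Sc: "cadjoint (S n) \<in> carrier rA.A" by (rule dX.roe_cadjoint_closed[OF S(1)])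
   have "involution rA.Q (rA.cl (S n)) = rA.cl (cadjoint (S n))"
    using star_hom_involution[OF rA.star_hom_roe_class S(1)] by simp
   then have "\<tau> (inv g) (\<alpha> (inv g) (involution rA.Q (rA.cl (S n)))) = \<sigma> (cadjoint (S n \<circ> M g))"
    by (simp only: \<alpha>_roe_class[OF gi Sc] \<tau>c[OF gi Ad_closed[OF gi Sc]] comp_M_cadjoint[OF g S(1)])
   also have "\<dots> = cadjoint (\<sigma> (S n \<circ> M g))" using f(2)[OF comp_M_closed[OF g S(1)]] by simp
   finally show ?thesis by (simp only: \<tau>c[OF g S(1)])
  qed
  show "cadjoint (\<tau> g a) = \<tau> (inv g) (\<alpha> (inv g) (involution rA.Q a))"
   by (rule all_ops.conv_unique[OF L R[unfolded eq]])
 qed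
 note tD = D.P_carrierD[OF t]
 have qt: "q t \<in> carrier P.P" by (rule star_hom_closed[OF star_hom_q t])
 have sub: "P.supp (q t) \<subseteq> D.supp t" by (auto simp: P.supp_def D.supp_def rA.roe_class_zero)
 have "P.integrated \<tau> (q t) = (\<lambda>v. \<Sum>g\<in>D.supp t. \<tau> g (rA.cl (t g)) v)"
  by (rule P.integrated_superset[OF \<tau>l tD(2) sub tD(3)])
 also have "\<dots> = (\<lambda>v. \<Sum>g\<in>D.supp t. \<sigma> (t g \<circ> M g) v)"
  using tD(3) by (intro ext sum.cong refl) (simp only: \<tau>c[OF subsetD[OF tD(3)] tD(1)])
 also have "\<dots> = \<sigma> (crossed_sum t)"
  by (simp only: rB.rep_sum[OF \<sigma> tD(2) comp_M_closed[OF subsetD[OF tD(3)] tD(1)]] crossed_sum_superset[OF tD(2) subset_refl tD(3)])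
 finally show ?thesis using P.P.rep_le_max_norm[OF hom qt] by simp
qed

lemma norm_q_eq:
 assumes t: "t \<in> carrier D.P"
 shows "max_norm P.P (q t) = alg_norm rB.Q (rB.cl (crossed_sum t))"
proof (rule antisym[OF max_norm_q_le[OF t]])
 show "alg_norm rB.Q (rB.cl (crossed_sum t)) \<le> max_norm P.P (q t)"
  by (rule rB.norm_roe_class_leI[OF sep crossed_sum_closed[OF t] P.P.max_norm_nonneg[OF star_hom_closed[OF star_hom_q t]]])
   (rule rep_crossed_sum_le[OF _ _ t])
qed

section \<open>Dense images and the isomorphism\<close>

lemma dense_q: "normed_star.dense_image P.P.C (\<lambda>t. max_embed P.P (q t)) (carrier D.P)"
proof -
 interpret F: banach_star P.P.C by (rule P.P.banach_star_completion)
 note e = star_hom_closed[OF P.P.star_hom_max_embed]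
 show ?thesis
  unfolding F.dense_image_def
 proof (intro conjI ballI allI impI)
  show "(\<lambda>t. max_embed P.P (q t)) ` carrier D.P \<subseteq> carrier P.P.C"
   using e star_hom_closed[OF star_hom_q] by blast
  fix a and r :: real assume a: "a \<in> carrier P.P.C" and r: "r > 0"
  then obtain f where f: "f \<in> carrier P.P" "alg_norm P.P.C (a \<ominus>\<^bsub>P.P.C\<^esub> max_embed P.P f) < r / 2"
   using P.P.dense_max_embed unfolding F.dense_image_def by (metis half_gt_zero)
  \<comment> \<open>The coefficients of \<open>f\<close> lie in the quotient algebra; replacing them
    by classes from C[X] costs the second half of r.\<close>
  obtain t where t: "\<And>g. t g \<in> carrier rA.A" "\<And>g. g \<notin> P.supp f \<Longrightarrow> t g = (\<lambda>_. 0)" "q t \<in> carrier P.P"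
   "max_norm P.P (f \<ominus>\<^bsub>P.P\<^esub> q t) < r / 2"
   by (rule P.dense_in_P[where j = "rA.cl" and z = "\<lambda>_. 0", OF rA.dense_roe_class dX.roe_zero_closed rA.roe_class_zero f(1) half_gt_zero[OF r]]) (rule that)
  have tP: "t \<in> carrier D.P"
   by (rule D.P_carrierI[OF t(1) P.P_carrierD(2,3)[OF f(1)]]) (simp add: t(2))
  have "alg_norm P.P.C (max_embed P.P f \<ominus>\<^bsub>P.P.C\<^esub> max_embed P.P (q t)) < r / 2"
   using t(4) P.P.norm_max_embed[OF P.P.diff_closed[OF f(1) t(3)]] P.P.max_embed_minus[OF f(1) t(3)] by simp
  then have "alg_norm P.P.C (a \<ominus>\<^bsub>P.P.C\<^esub> max_embed P.P (q t)) < r"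
   using F.norm_triangle[OF a e[OF f(1)] e[OF t(3)]] f(2) by simp
  then show "\<exists>t\<in>carrier D.P. alg_norm P.P.C (a \<ominus>\<^bsub>P.P.C\<^esub> max_embed P.P (q t)) < r"
   using tP by blast
 qed
qed

lemma dense_crossed_sum: "rB.Q.dense_image (\<lambda>t. rB.cl (crossed_sum t)) (carrier D.P)"
 unfolding rB.Q.dense_image_def
proof (intro conjI ballI allI impI)
 show "(\<lambda>t. rB.cl (crossed_sum t)) ` carrier D.P \<subseteq> carrier rB.Q"
  using star_hom_closed[OF rB.star_hom_roe_class] crossed_sum_closed by blast
 fix a and r :: real assume "a \<in> carrier rB.Q" "r > 0"
 then obtain T where T: "T \<in> carrier rB.A" "alg_norm rB.Q (a \<ominus>\<^bsub>rB.Q\<^esub> rB.cl T) < r"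
  using rB.dense_roe_class unfolding rB.Q.dense_image_def by blast
 obtain t where "t \<in> carrier D.P" "crossed_sum t = T" using T(1) by (rule crossed_sum_surj)
 then show "\<exists>t\<in>carrier D.P. alg_norm rB.Q (a \<ominus>\<^bsub>rB.Q\<^esub> rB.cl (crossed_sum t)) < r" using T(2) by blast
qed

text \<open>The formula on the elements [T] u_g expresses canonicity: their finite sums are dense,
  so it determines a continuous \<Phi>.\<close>

lemma crossed_product_iso:
 "\<exists>\<Phi>. star_iso P.P.C rB.Q \<Phi> \<and>
   (\<forall>g\<in>carrier G. \<forall>T\<in>carrier rA.A.
    \<Phi> (max_embed P.P (P.single g (rA.cl T))) = rB.cl (T \<circ> M g))"
proof -
 have j1: "star_hom D.P P.P.C (\<lambda>t. max_embed P.P (q t))"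
  using star_hom_comp[OF star_hom_q P.P.star_hom_max_embed] by (simp add: o_def)
 have j2: "star_hom D.P rB.Q (\<lambda>t. rB.cl (crossed_sum t))"
  using star_hom_comp[OF star_hom_crossed_sum rB.star_hom_roe_class] by (simp add: o_def)
 have eq: "alg_norm P.P.C (max_embed P.P (q t)) = alg_norm rB.Q (rB.cl (crossed_sum t))"
  if "t \<in> carrier D.P" for t
  using P.P.norm_max_embed[OF star_hom_closed[OF star_hom_q that]] norm_q_eq[OF that] by simp
 obtain \<Phi> where \<Phi>: "star_iso P.P.C rB.Q \<Phi>"
  "\<And>t. t \<in> carrier D.P \<Longrightarrow> \<Phi> (max_embed P.P (q t)) = rB.cl (crossed_sum t)"
  by (rule star_iso_of_dense_images[where ?j1.0 = "\<lambda>t. max_embed P.P (q t)"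
     and ?j2.0 = "\<lambda>t. rB.cl (crossed_sum t)", OF P.P.banach_star_completion rB.Q.banach_star_axioms D.star_space_P j1 j2
     dense_q dense_crossed_sum eq], assumption, rule that)
 have "\<Phi> (max_embed P.P (P.single g (rA.cl T))) = rB.cl (T \<circ> M g)"
  if "g \<in> carrier G" "T \<in> carrier rA.A" for g T
  using \<Phi>(2)[OF D.single_closed[OF that]] unfolding q_single crossed_sum_single[OF that(1)] .
 then show ?thesis using \<Phi>(1) by blast
qed

end

theorem theorem5p2:
 fixes G :: "('g, 'z) monoid_scheme"
  and X :: "'x set"
  and d dG :: "'x \<Rightarrow> 'x \<Rightarrow> real"
  and \<phi> :: "'g \<Rightarrow> 'x \<Rightarrow> 'x"
 assumes "separable_space (euclidean :: 'h::chilbert_space topology)"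
  and "\<nexists>B :: 'h set. finite B \<and> cvs.span B = UNIV"
  and "group G" and "countable (carrier G)"
  and "discrete_metric_space X d" and "bounded_geometry X d"
  and "acts_by_coarse_equivalences G X d \<phi>"
  and "coarsely_discontinuous G X d \<phi>"
  and "discrete_metric_space X dG" and "metric_lss X dG = orbit_lss G X d \<phi>"
 shows "\<exists>\<Phi>. star_iso
      (full_crossed_product G (roe_quotient X d) (roe_action G X d \<phi>))
      (roe_quotient X dG :: ('x, 'h) max_roe set normed_star_alg) \<Phi> \<and>
     (\<forall>g\<in>carrier G. \<forall>T\<in>carrier (roe_alg X d :: (('x, 'h) ell2 \<Rightarrow> ('x, 'h) ell2) star_alg).
      \<Phi> (max_embed (alg_crossed_product G (roe_quotient X d) (roe_action G X d \<phi>))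
         (cp_single (roe_quotient X d) g (roe_class X d T)))
      = roe_class X dG (T \<circ> translation G X \<phi> g))"
proof -
 have act: "group_action G X \<phi>" using assms(7) by (simp add: acts_by_coarse_equivalences_def)
 have bgs: "bounded_geometry_space X d"
  using assms(5,6)
  by (simp add: bounded_geometry_space_def bounded_geometry_space_axioms_def discrete_metric_space_def)
 have "coarse_action G X \<phi> d dG"
  unfolding coarse_action_def coarse_action_axioms_def
  using act bgs assms(3,7-10) by (auto simp: acts_by_coarse_equivalences_def discrete_metric_space_def)
 then interpret roe_system G X \<phi> d dG "TYPE('h)"
  using assms(1) by (simp add: roe_system_def roe_system_axioms_def)
 show ?thesis unfolding full_crossed_product_def by (rule crossed_product_iso)
qed

end
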